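(* Let $d,d'\in\mathbb{N}$, $\gamma>0$ and $T>0$. For $x,\xi\in\mathbb{R}^d$ define the random variable $v_{T,x,\xi}$ on $\mathcal{W}_T^0$ by $$v_{T,x,\xi}=\int_0^T|(\beta+\ell^{T,x,\xi})(t)|^{2\gamma}\,dt .$$ (i) For all $x,\xi\in\mathbb{R}^d$, $v_{T,x,\xi}^{-1}\in L^{\infty-}(\mu_T^0)$. Moreover the transition density function $p_T$ (at time $T$) of the diffusion process generated by $\frac12\Delta_{(\gamma)}$ exists and is given, for $(x,y),(\xi,\eta)\in\mathbb{R}^d\times\mathbb{R}^{d'}$, by $$p_T((x,y),(\xi,\eta))=\frac{1}{\sqrt{2\pi}^{\,d+d'}}\frac{1}{\sqrt{T}^{\,d}}\exp\Bigl(-\frac{|\xi-x|^2}{2T}\Bigr)\int_{\mathcal{W}_T^0}v_{T,x,\xi}^{-\frac{d'}{2}}\exp\Bigl(-\frac{|\eta-y|^2}{2v_{T,x,\xi}}\Bigr)d\mu_T^0 .$$ (ii) $p_T$ (given by this formula) is continuous on $(\mathbb{R}^d\times\mathbb{R}^{d'})^2$.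
   Context: The Grushin operator with parameter $\gamma$ on $\mathbb{R}^{d+d'}$ is $\Delta_{(\gamma)}=\Delta_x+|x|^{2\gamma}\Delta_y$, where $\Delta_x,\Delta_y$ are the Laplacians in $x\in\mathbb{R}^d$, $y\in\mathbb{R}^{d'}$. The diffusion process $Z^{(x,y)}$ generated by $\frac12\Delta_{(\gamma)}$ starting at $(x,y)$ is realized as $Z^{(x,y)}(t)=(X(t),Y(t))$ with $$X(t)=x+b(t),\qquad Y(t)=y+\int_0^t|x+b(s)|^\gamma\,d\widehat b(s)\ \text{(It\^o integral)},$$ where $b$ and $\widehat b$ are independent standard Brownian motions in $\mathbb{R}^d$ and $\mathbb{R}^{d'}$ starting at $0$. The transition density function $p_T$ is the function satisfying $\mathbf{E}[f(Z^{(x,y)}(T))]=\int_{\mathbb{R}^d\times\mathbb{R}^{d'}}f(\xi,\eta)\,p_T((x,y),(\xi,\eta))\,d\xi\,d\eta$ for every $(x,y)$ and every bounded continuous $f$. $\mathcal{W}_T^0$ is the space of continuous $w:[0,T]\to\mathbb{R}^d$ with $w(0)=w(T)=0$; $\mu_T^0$ is the pinned Wiener measure on it, i.e. the law of the $d$-dimensional Brownian bridge from $0$ to $0$ on $[0,T]$ (centered continuous Gaussian process with covariance $(t\wedge s-\frac{ts}{T})I_d$); $\beta$ is the coordinate process, $\beta(t)(w)=w(t)$. $\ell^{T,x,\xi}(t)=x+\frac tT(\xi-x)$ for $t\in[0,T]$. $L^{\infty-}(\mu)=\bigcap_{p\in(1,\infty)}L^p(\mu)$. *)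

theory Defs
  imports "HOL-Probability.Probability"
begin

section \<open>Brownian motion and the Ito integral\<close>

definition brownian_motion :: "'w measure \<Rightarrow> (real \<Rightarrow> 'w \<Rightarrow> real ^ 'd) \<Rightarrow> bool" where
  "brownian_motion M B \<longleftrightarrow>
     prob_space M \<and>
     (\<forall>t\<ge>0. B t \<in> borel_measurable M) \<and>
     (\<forall>\<omega>\<in>space M. B 0 \<omega> = 0 \<and> continuous_on {0..} (\<lambda>t. B t \<omega>)) \<and>
     (\<forall>s t. 0 \<le> s \<and> s < t \<longrightarrow>
        distributed M lborel (\<lambda>\<omega>. B t \<omega> - B s \<omega>)
          (\<lambda>z. ennreal (\<Prod>i\<in>UNIV. normal_density 0 (sqrt (t - s)) (z $ i)))) \<and>
     (\<forall>\<tau> n. 0 \<le> \<tau> 0 \<and> incseq \<tau> \<longrightarrow>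
        prob_space.indep_vars M (\<lambda>_. borel) (\<lambda>k \<omega>. B (\<tau> (Suc k)) \<omega> - B (\<tau> k) \<omega>) {..<n::nat})"

definition generated_algebra ::
  "'w measure \<Rightarrow> (real \<Rightarrow> 'w \<Rightarrow> 'a::topological_space) \<Rightarrow> real set \<Rightarrow> 'w measure" where
  "generated_algebra M X S =
     sigma (space M) {X s -` A \<inter> space M | s A. s \<in> S \<and> A \<in> sets borel}"

definition indep_processes ::
  "'w measure \<Rightarrow> (real \<Rightarrow> 'w \<Rightarrow> 'a::topological_space) \<Rightarrow> (real \<Rightarrow> 'w \<Rightarrow> 'b::topological_space) \<Rightarrow> bool" where
  "indep_processes M X Y \<longleftrightarrow>
     prob_space.indep_set M (sets (generated_algebra M X {0..})) (sets (generated_algebra M Y {0..}))"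

definition natural_filtration ::
  "'w measure \<Rightarrow> (real \<Rightarrow> 'w \<Rightarrow> 'a::topological_space) \<Rightarrow> real \<Rightarrow> 'w measure" where
  "natural_filtration M X t = generated_algebra M X {0..t}"

text \<open>
  The data \<open>(n, \<tau>, h)\<close> encode the simple adapted process
  \<open>\<Sum>k<n. h\<^sub>k 1\<^bsub>(\<tau>\<^sub>k, \<tau>\<^sub>k\<^sub>+\<^sub>1]\<^esub>\<close> with \<open>h\<^sub>k\<close> bounded and measurable at time \<open>\<tau>\<^sub>k\<close>.
\<close>

definition simple_integrand ::
  "'w measure \<Rightarrow> (real \<Rightarrow> 'w measure) \<Rightarrow> nat \<Rightarrow> (nat \<Rightarrow> real) \<Rightarrow> (nat \<Rightarrow> 'w \<Rightarrow> real) \<Rightarrow> bool" where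
  "simple_integrand M F n \<tau> h \<longleftrightarrow>
     0 \<le> \<tau> 0 \<and>
     (\<forall>k<n. \<tau> k \<le> \<tau> (Suc k) \<and> h k \<in> borel_measurable (F (\<tau> k)) \<and> bounded (h k ` space M))"

definition simple_process ::
  "nat \<Rightarrow> (nat \<Rightarrow> real) \<Rightarrow> (nat \<Rightarrow> 'w \<Rightarrow> real) \<Rightarrow> real \<Rightarrow> 'w \<Rightarrow> real" where
  "simple_process n \<tau> h s \<omega> = (\<Sum>k<n. h k \<omega> * indicator {\<tau> k<..\<tau> (Suc k)} s)"

definition simple_integral ::
  "(real \<Rightarrow> 'w \<Rightarrow> 'b::real_vector) \<Rightarrow> nat \<Rightarrow> (nat \<Rightarrow> real) \<Rightarrow> (nat \<Rightarrow> 'w \<Rightarrow> real) \<Rightarrow> real \<Rightarrow> 'w \<Rightarrow> 'b" where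
  "simple_integral B n \<tau> h t \<omega> =
     (\<Sum>k<n. h k \<omega> *\<^sub>R (B (min t (\<tau> (Suc k))) \<omega> - B (min t (\<tau> k)) \<omega>))"

text \<open>
  \<open>I\<close> is (a version of) the Ito integral of the scalar process \<open>H\<close> over \<open>[0,t]\<close> with respect to
  the vector-valued \<open>F\<close>-Brownian motion \<open>B\<close>: simple adapted processes approximate \<open>H\<close> in
  \<open>L\<^sup>2([0,t] \<times> \<Omega>)\<close>, and their integrals approximate \<open>I\<close> in \<open>L\<^sup>2(\<Omega>)\<close>.
\<close>

definition has_ito_integral ::
  "'w measure \<Rightarrow> (real \<Rightarrow> 'w measure) \<Rightarrow> (real \<Rightarrow> 'w \<Rightarrow> real ^ 'e) \<Rightarrow> (real \<Rightarrow> 'w \<Rightarrow> real) \<Rightarrow>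
     real \<Rightarrow> ('w \<Rightarrow> real ^ 'e) \<Rightarrow> bool" where
  "has_ito_integral M F B H t I \<longleftrightarrow>
     I \<in> borel_measurable M \<and>
     (\<lambda>(s, \<omega>). H s \<omega>) \<in> borel_measurable (restrict_space lborel {0..t} \<Otimes>\<^sub>M M) \<and>
     (\<exists>n \<tau> h.
        (\<forall>m. simple_integrand M F (n m) (\<tau> m) (h m)) \<and>
        (\<lambda>m::nat. \<integral>\<^sup>+(s, \<omega>). ennreal ((H s \<omega> - simple_process (n m) (\<tau> m) (h m) s \<omega>)\<^sup>2)
             \<partial>(restrict_space lborel {0..t} \<Otimes>\<^sub>M M)) \<longlonglongrightarrow> 0 \<and>
        (\<lambda>m::nat. \<integral>\<^sup>+\<omega>. ennreal ((norm (I \<omega> - simple_integral B (n m) (\<tau> m) (h m) t \<omega>))\<^sup>2) \<partial>M)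
          \<longlonglongrightarrow> 0)"

text \<open>The choice is determined only up to almost sure equality.\<close>

definition ito_integral ::
  "'w measure \<Rightarrow> (real \<Rightarrow> 'w measure) \<Rightarrow> (real \<Rightarrow> 'w \<Rightarrow> real ^ 'e) \<Rightarrow> (real \<Rightarrow> 'w \<Rightarrow> real) \<Rightarrow>
     real \<Rightarrow> 'w \<Rightarrow> real ^ 'e" where
  "ito_integral M F B H t = (SOME I. has_ito_integral M F B H t I)"


section \<open>The diffusion generated by half the Grushin operator\<close>

text \<open>
  \<open>Z\<close> is the diffusion started at \<open>(x, y)\<close>, up to modification: the second component is prescribed
  almost surely at each fixed time, since that is all the Ito integral determines. In particular
  the modification with continuous paths is covered.
\<close>

definition grushin_diffusion ::
  "real \<Rightarrow> 'w measure \<Rightarrow> (real \<Rightarrow> 'w \<Rightarrow> real ^ 'd) \<Rightarrow> (real \<Rightarrow> 'w \<Rightarrow> real ^ 'e) \<Rightarrow>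
     real ^ 'd \<Rightarrow> real ^ 'e \<Rightarrow> (real \<Rightarrow> 'w \<Rightarrow> (real ^ 'd) \<times> (real ^ 'e)) \<Rightarrow> bool" where
  "grushin_diffusion \<gamma> M b bh x y Z \<longleftrightarrow>
     (\<forall>t\<ge>0. Z t \<in> borel_measurable M \<and>
        (AE \<omega> in M. Z t \<omega> =
           (x + b t \<omega>,
            y + ito_integral M (natural_filtration M (\<lambda>s \<omega>. (b s \<omega>, bh s \<omega>))) bh
                  (\<lambda>s \<omega>. norm (x + b s \<omega>) powr \<gamma>) t \<omega>)))"

definition transition_density ::
  "'w measure \<Rightarrow> ('a \<Rightarrow> real \<Rightarrow> 'w \<Rightarrow> 'a) \<Rightarrow> real \<Rightarrow> ('a::euclidean_space \<Rightarrow> 'a \<Rightarrow> real) \<Rightarrow> bool" where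
  "transition_density M Z T p \<longleftrightarrow>
     (\<forall>z. integrable lborel (p z)) \<and>
     (\<forall>z f. continuous_on UNIV f \<and> bounded (range f) \<longrightarrow>
        (\<integral>\<omega>. f (Z z T \<omega>) \<partial>M) = (\<integral>\<zeta>. f \<zeta> * p z \<zeta> \<partial>lborel))"


section \<open>Pinned Wiener measure\<close>

text \<open>Paths on \<open>[0,T]\<close> are represented by functions that are \<open>undefined\<close> outside \<open>[0,T]\<close>.\<close>

definition pinned_paths :: "real \<Rightarrow> (real \<Rightarrow> real ^ 'd) set" where
  "pinned_paths T = {w \<in> extensional {0..T}. continuous_on {0..T} w \<and> w 0 = 0 \<and> w T = 0}"

text \<open>Point masses count as Gaussian.\<close>

definition gaussian_rv :: "'w measure \<Rightarrow> ('w \<Rightarrow> real) \<Rightarrow> bool" where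
  "gaussian_rv M X \<longleftrightarrow>
     X \<in> borel_measurable M \<and>
     (\<exists>m. (AE \<omega> in M. X \<omega> = m) \<or>
          (\<exists>\<sigma>>0. distributed M lborel X (\<lambda>z. ennreal (normal_density m \<sigma> z))))"

text \<open>
  The sigma-algebra is the one generated by the coordinates, which is the Borel sigma-algebra of
  the uniform norm. A process is Gaussian if all finite linear combinations of its coordinates are.
\<close>

definition pinned_wiener_measure :: "real \<Rightarrow> (real \<Rightarrow> real ^ 'd) measure \<Rightarrow> bool" where
  "pinned_wiener_measure T \<mu> \<longleftrightarrow>
     prob_space \<mu> \<and>
     sets \<mu> = sets (restrict_space (Pi\<^sub>M {0..T} (\<lambda>_. borel)) (pinned_paths T)) \<and>
     (\<forall>J c. finite J \<and> J \<subseteq> {0..T} \<longrightarrow> gaussian_rv \<mu> (\<lambda>w. \<Sum>t\<in>J. c t \<bullet> w t)) \<and>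
     (\<forall>t\<in>{0..T}. \<forall>i. (\<integral>w. w t $ i \<partial>\<mu>) = 0) \<and>
     (\<forall>s\<in>{0..T}. \<forall>t\<in>{0..T}. \<forall>i j.
        (\<integral>w. w s $ i * w t $ j \<partial>\<mu>) = (if i = j then min t s - t * s / T else 0))"

text \<open>
  Since \<open>inverse 0 = 0\<close> in HOL, membership of \<open>inverse \<circ> v\<close> here does not entail that \<open>v\<close> is
  almost everywhere nonzero.
\<close>

definition L_infty_minus :: "'w measure \<Rightarrow> ('w \<Rightarrow> real) set" where
  "L_infty_minus \<mu> =
     {f \<in> borel_measurable \<mu>. \<forall>p\<in>{1<..}. integrable \<mu> (\<lambda>w. \<bar>f w\<bar> powr p)}"

definition line_path :: "real \<Rightarrow> real ^ 'd \<Rightarrow> real ^ 'd \<Rightarrow> real \<Rightarrow> real ^ 'd" where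
  "line_path T x \<xi> t = x + (t / T) *\<^sub>R (\<xi> - x)"

definition grushin_v :: "real \<Rightarrow> real \<Rightarrow> real ^ 'd \<Rightarrow> real ^ 'd \<Rightarrow> (real \<Rightarrow> real ^ 'd) \<Rightarrow> real" where
  "grushin_v \<gamma> T x \<xi> w = (LBINT t:{0..T}. norm (w t + line_path T x \<xi> t) powr (2 * \<gamma>))"

fun grushin_density ::
  "real \<Rightarrow> real \<Rightarrow> (real \<Rightarrow> real ^ 'd) measure \<Rightarrow>
     (real ^ 'd) \<times> (real ^ 'e) \<Rightarrow> (real ^ 'd) \<times> (real ^ 'e) \<Rightarrow> real" where
  "grushin_density \<gamma> T \<mu> (x, y) (\<xi>, \<eta>) =
     1 / sqrt (2 * pi) ^ (CARD('d) + CARD('e)) * (1 / sqrt T ^ CARD('d)) *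
     exp (- (norm (\<xi> - x))\<^sup>2 / (2 * T)) *
     (\<integral>w. grushin_v \<gamma> T x \<xi> w powr (- real CARD('e) / 2) *
          exp (- (norm (\<eta> - y))\<^sup>2 / (2 * grushin_v \<gamma> T x \<xi> w)) \<partial>\<mu>)"

end

theory Submission
  imports Defs
begin

text \<open>
  Conditionally on \<open>b\<close>, the Ito integral at time \<open>T\<close> is a centred Gaussian vector with covariance
  \<open>V \<cdot> Id\<close>, where \<open>V\<close> is the time integral of \<open>norm (x + b s) powr (2 * \<gamma>)\<close>; this is exact for simple
  integrals and passes to the limit. Splitting \<open>b\<close> into its end point \<open>b T\<close> and an independent Brownian
  bridge turns \<open>V\<close> into \<open>grushin_v\<close> and gives the density; the identification of laws is by
  characteristic functions on finite grids.

  Everything else rests on a bound for \<open>v powr (- p)\<close> in mean that is uniform in \<open>x\<close> and \<open>\<xi>\<close>. For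
  \<open>s = 1 / (4 * \<gamma>)\<close> Jensen bounds \<open>v powr (- s)\<close> by a multiple of the integral of the inverse
  square root of one coordinate of the path over any short interval. Multiplying \<open>n\<close> such bounds
  over separated intervals controls \<open>v powr (- n * s)\<close>, and conditioning successively on the past
  leaves integrals of \<open>\<bar>u\<bar> powr (- 1 / 2)\<close> against normal densities of bounded height.
\<close>

section \<open>Characteristic functions and joint laws\<close>

text \<open>The exponent \<open>1 / (4 * \<gamma>)\<close> makes
  \<open>\<bar>u\<bar> powr (2 * \<gamma>)\<close>, raised to minus it, equal to
  \<open>\<bar>u\<bar> powr (- 1 / 2)\<close>. This is integrable at 0 in one variable, so a single
  coordinate suffices for every dimension and every \<gamma>. The conditional variance of the bridge
  degenerates at \<open>T\<close>; the separated intervals therefore stop a fixed distance before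
  \<open>T\<close>.

  Uniformity in \<open>x\<close> and \<xi> serves continuity: negative powers of \<open>v\<close>
  come with no common majorant as the parameters vary, but cutting \<open>v\<close> off at
  \<open>1 / K\<close> costs at most \<open>2 / K\<close> times a moment of order
  \<open>e / 2 + 1\<close>, with \<open>e\<close> the dimension of the second component.

  Two conventions also shape the proof. The Ito integral is a \<open>SOME\<close> choice, so
  existence has to be proved before anything can be said of it, and the version chosen has to be
  compared with explicit grid sums. And \<open>0 powr a = 0\<close>, so moment bounds are silent
  about \<open>v = 0\<close>; almost sure positivity is a result of its own.\<close>

lemma prob_space_densityI:
  assumes [measurable]: "f \<in> borel_measurable M" and "(\<integral>\<^sup>+x. f x \<partial>M) = 1"
  shows "prob_space (density M f)"
proof (rule prob_spaceI)
  have "(\<integral>\<^sup>+x. f x * indicator (space M) x \<partial>M) = (\<integral>\<^sup>+x. f x \<partial>M)"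
    by (intro nn_integral_cong) auto
  then show "emeasure (density M f) (space (density M f)) = 1"
    using assms by (simp add: emeasure_density)
qed

text \<open>Dividing by the common mass \<open>c\<close> makes the weights probability densities;
  the image laws under \<open>X\<close> and \<open>Y\<close> then have equal characteristic
  functions and Levy's theorem applies. The weights are meant to carry indicators and trigonometric
  factors of other coordinates.\<close>

lemma weighted_Levy_uniqueness:
  fixes X :: "'a \<Rightarrow> real" and Y :: "'b \<Rightarrow> real"
  assumes "prob_space M" "prob_space N"
    and [measurable]: "X \<in> borel_measurable M" "Y \<in> borel_measurable N"
      "W \<in> borel_measurable M" "V \<in> borel_measurable N" "A \<in> sets borel"
    and W: "\<And>x. 0 \<le> W x" "\<And>x. W x \<le> C" and V: "\<And>y. 0 \<le> V y" "\<And>y. V y \<le> C"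
    and eq: "\<And>t. (\<integral>x. W x *\<^sub>R iexp (t * X x) \<partial>M) = (\<integral>y. V y *\<^sub>R iexp (t * Y y) \<partial>N)"
  shows "(\<integral>x. W x * indicator A (X x) \<partial>M) = (\<integral>y. V y * indicator A (Y y) \<partial>N)"
proof -
  interpret M: prob_space M by fact
  interpret N: prob_space N by fact
  have iW: "integrable M W"
    using W by (intro M.integrable_const_bound[where B=C]) auto
  have iV: "integrable N V"
    using V by (intro N.integrable_const_bound[where B=C]) auto
  define c where "c = integral\<^sup>L M W"
  \<comment> \<open>Taking \<open>t = 0\<close> shows that both weights have the same total
    mass.\<close>
  have "complex_of_real (integral\<^sup>L M W) = complex_of_real (integral\<^sup>L N V)"
    using eq[of 0] iW iV by (simp add: scaleR_conv_of_real)
  then have c': "c = integral\<^sup>L N V" by (simp add: c_def)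
  have "c \<ge> 0" unfolding c_def using W by (intro Bochner_Integration.integral_nonneg) auto
  show ?thesis
  proof (cases "c = 0")
    case True
    then have "AE x in M. W x = 0" "AE y in N. V y = 0"
      using integral_nonneg_eq_0_iff_AE[OF iW] integral_nonneg_eq_0_iff_AE[OF iV] W V c_def c' by auto
    then have "(\<integral>x. W x * indicator A (X x) \<partial>M) = (\<integral>x. 0 \<partial>M)"
        "(\<integral>y. V y * indicator A (Y y) \<partial>N) = (\<integral>y. 0 \<partial>N)"
      by (intro integral_cong_AE; auto)+
    then show ?thesis by simp
  next
    case False
    with \<open>c \<ge> 0\<close> have c: "c > 0" by simp
    define M1 where "M1 = distr (density M (\<lambda>x. ennreal (W x / c))) borel X"
    define M2 where "M2 = distr (density N (\<lambda>x. ennreal (V x / c))) borel Y"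
    have "prob_space (density M (\<lambda>x. ennreal (W x / c)))"
    proof (rule prob_space_densityI)
      have "(\<integral>\<^sup>+x. ennreal (W x / c) \<partial>M) = ennreal (\<integral>x. W x / c \<partial>M)"
        using iW W c by (intro nn_integral_eq_integral) auto
      then show "(\<integral>\<^sup>+x. ennreal (W x / c) \<partial>M) = 1"
        using c by (simp add: c_def[symmetric])
    qed simp
    then have M1: "real_distribution M1"
      by (simp add: M1_def real_distribution_def real_distribution_axioms_def prob_space.prob_space_distr)
    have "prob_space (density N (\<lambda>x. ennreal (V x / c)))"
    proof (rule prob_space_densityI)
      have "(\<integral>\<^sup>+x. ennreal (V x / c) \<partial>N) = ennreal (\<integral>x. V x / c \<partial>N)"
        using iV V c by (intro nn_integral_eq_integral) auto
      then show "(\<integral>\<^sup>+x. ennreal (V x / c) \<partial>N) = 1"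
        using c by (simp add: c'[symmetric])
    qed simp
    then have M2: "real_distribution M2"
      by (simp add: M2_def real_distribution_def real_distribution_axioms_def prob_space.prob_space_distr)
    have i1: "(\<integral>x. f x \<partial>M1) = (\<integral>x. (W x / c) *\<^sub>R f (X x) \<partial>M)"
      if [measurable]: "f \<in> borel_measurable borel" for f :: "real \<Rightarrow> 'c::{banach,second_countable_topology}"
      unfolding M1_def using W c by (subst integral_distr) (auto simp: integral_density)
    have i2: "(\<integral>x. f x \<partial>M2) = (\<integral>x. (V x / c) *\<^sub>R f (Y x) \<partial>N)"
      if [measurable]: "f \<in> borel_measurable borel" for f :: "real \<Rightarrow> 'c::{banach,second_countable_topology}"
      unfolding M2_def using V c by (subst integral_distr) (auto simp: integral_density)
    have "char M1 t = char M2 t" for t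
    proof -
      have "char M1 t = (\<integral>x. (1/c) *\<^sub>R (W x *\<^sub>R iexp (t * X x)) \<partial>M)"
        unfolding char_def by (subst i1) (simp_all add: divide_inverse mult.commute)
      also have "\<dots> = (\<integral>y. (1/c) *\<^sub>R (V y *\<^sub>R iexp (t * Y y)) \<partial>N)"
        by (subst (1 2) integral_scaleR_right) (use eq[of t] in simp)
      also have "\<dots> = char M2 t"
        unfolding char_def by (subst i2) (simp_all add: divide_inverse mult.commute)
      finally show ?thesis .
    qed
    then have "M1 = M2" by (intro Levy_uniqueness M1 M2) auto
    then have "(\<integral>x. indicator A x \<partial>M1) = (\<integral>x. indicator A x \<partial>M2 :: real)" by simp
    then have "(\<integral>x. (W x / c) *\<^sub>R (indicator A (X x) :: real) \<partial>M) = (\<integral>x. (V x / c) *\<^sub>R indicator A (Y x) \<partial>N)"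
      by (subst (asm) i1, simp, subst (asm) i2, simp_all)
    then show ?thesis using c by simp
  qed
qed

text \<open>Adding a weight $1 + \cos(S + \vartheta) \ge 0$ keeps measures positive, so one coordinate of a joint
  characteristic function can be inverted at a time by the one-dimensional theorem.\<close>

lemma weighted_char_extend:
  fixes X S :: "'a \<Rightarrow> real" and Y U :: "'b \<Rightarrow> real"
  assumes "prob_space M" "prob_space N"
    and [measurable]: "X \<in> borel_measurable M" "Y \<in> borel_measurable N"
      "S \<in> borel_measurable M" "U \<in> borel_measurable N"
      "P \<in> borel_measurable M" "Q \<in> borel_measurable N" "A \<in> sets borel"
    and P: "\<And>x. 0 \<le> P x" "\<And>x. P x \<le> 1" and Q: "\<And>y. 0 \<le> Q y" "\<And>y. Q y \<le> 1"
    and eq: "\<And>t s. (\<integral>x. P x *\<^sub>R iexp (t * X x + s * S x) \<partial>M) = (\<integral>y. Q y *\<^sub>R iexp (t * Y y + s * U y) \<partial>N)"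
  shows "(\<integral>x. (P x * indicator A (X x)) *\<^sub>R iexp (S x) \<partial>M)
       = (\<integral>y. (Q y * indicator A (Y y)) *\<^sub>R iexp (U y) \<partial>N)"
proof -
  interpret M: prob_space M by fact
  interpret N: prob_space N by fact
  have iP: "integrable M (\<lambda>x. P x *\<^sub>R iexp (f x))" if [measurable]: "f \<in> borel_measurable M" for f
    using P by (intro M.integrable_const_bound[where B=1]) auto
  have iQ: "integrable N (\<lambda>x. Q x *\<^sub>R iexp (f x))" if [measurable]: "f \<in> borel_measurable N" for f
    using Q by (intro N.integrable_const_bound[where B=1]) auto
  \<comment> \<open>Writing the cosine as two exponentials leaves three terms in which
    \<open>s\<close> has coefficient 0, 1 or -1, each covered by \<open>eq\<close>; the phase
    \<theta> enters only through constant factors.\<close>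
  have expand: "(p * (1 + cos (s + \<theta>))) *\<^sub>R iexp v
     = p *\<^sub>R iexp (v + 0 * s) + (iexp \<theta> / 2) * (p *\<^sub>R iexp (v + 1 * s)) + (iexp (-\<theta>) / 2) * (p *\<^sub>R iexp (v + (-1) * s))"
    for p s \<theta> v :: real
  proof -
    have "complex_of_real (cos (s + \<theta>)) = (iexp (s + \<theta>) + iexp (- (s + \<theta>))) / 2"
      by (simp only: cos_of_real[symmetric] cos_exp_eq of_real_minus mult_minus_right)
    then have "(p * (1 + cos (s + \<theta>))) *\<^sub>R iexp v
        = of_real p * (1 + (iexp (s + \<theta>) + iexp (- (s + \<theta>))) / 2) * iexp v"
      by (simp add: scaleR_conv_of_real)
    also have "\<dots> = of_real p * iexp v + of_real p * (iexp (s+\<theta>) * iexp v) / 2 + of_real p * (iexp (- (s+\<theta>)) * iexp v) / 2"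
      by (simp add: algebra_simps add_divide_distrib)
    also have "iexp (s+\<theta>) * iexp v = iexp \<theta> * iexp (v + 1 * s)"
      by (simp add: exp_add[symmetric] algebra_simps)
    also have "iexp (-(s+\<theta>)) * iexp v = iexp (-\<theta>) * iexp (v + (-1) * s)"
      by (simp add: exp_add[symmetric] algebra_simps)
    finally show ?thesis by (simp add: scaleR_conv_of_real mult_ac)
  qed
  have cosI: "(\<integral>x. P x * (1 + cos (S x + \<theta>)) * indicator A (X x) \<partial>M)
            = (\<integral>y. Q y * (1 + cos (U y + \<theta>)) * indicator A (Y y) \<partial>N)" for \<theta>
  proof (rule weighted_Levy_uniqueness[where C=2])
    have b: "0 \<le> p * (1 + cos s)" "p * (1 + cos s) \<le> 2" if "0 \<le> p" "p \<le> 1" for p s :: real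
    proof -
      have "cos s \<le> 1" "-1 \<le> cos s" by auto
      then have "0 \<le> 1 + cos s" "1 + cos s \<le> 2" by linarith+
      then show "0 \<le> p * (1 + cos s)" "p * (1 + cos s) \<le> 2" using that mult_mono[of p 1 "1 + cos s" 2] by auto
    qed
    show "0 \<le> P x * (1 + cos (S x + \<theta>))" "P x * (1 + cos (S x + \<theta>)) \<le> 2" for x using b P by blast+
    show "0 \<le> Q x * (1 + cos (U x + \<theta>))" "Q x * (1 + cos (U x + \<theta>)) \<le> 2" for x using b Q by blast+
    show "(\<integral>x. (P x * (1 + cos (S x + \<theta>))) *\<^sub>R iexp (t * X x) \<partial>M)
        = (\<integral>y. (Q y * (1 + cos (U y + \<theta>))) *\<^sub>R iexp (t * Y y) \<partial>N)" for t
      unfolding expand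
      by (subst Bochner_Integration.integral_add, (intro Bochner_Integration.integrable_add integrable_mult_right iP; measurable),
            (intro integrable_mult_right iP; measurable),
          subst Bochner_Integration.integral_add, (intro iP; measurable), (intro integrable_mult_right iP; measurable),
          subst Bochner_Integration.integral_add, (intro Bochner_Integration.integrable_add integrable_mult_right iQ; measurable),
            (intro integrable_mult_right iQ; measurable),
          subst Bochner_Integration.integral_add, (intro iQ; measurable), (intro integrable_mult_right iQ; measurable))
        (simp_all only: integral_mult_right_zero eq)
  qed (use assms in measurable)
  \<comment> \<open>The summand 1 in the weight secures positivity; its contribution is identified
    separately so that it can be subtracted again.\<close>
  have one: "(\<integral>x. P x * indicator A (X x) \<partial>M) = (\<integral>y. Q y * indicator A (Y y) \<partial>N)"
  proof (rule weighted_Levy_uniqueness[where C=1])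
    show "(\<integral>x. P x *\<^sub>R iexp (t * X x) \<partial>M) = (\<integral>y. Q y *\<^sub>R iexp (t * Y y) \<partial>N)" for t
      using eq[of t 0] by simp
  qed (use assms in auto)
  have iPr: "integrable M (\<lambda>x. P x * f x * indicator A (X x))"
    if [measurable]: "f \<in> borel_measurable M" and b: "\<And>x. \<bar>f x\<bar> \<le> 1" for f
    using P b by (intro M.integrable_const_bound[where B=1])
      (auto simp: abs_mult indicator_def intro!: mult_le_one)
  have iQr: "integrable N (\<lambda>x. Q x * f x * indicator A (Y x))"
    if [measurable]: "f \<in> borel_measurable N" and b: "\<And>x. \<bar>f x\<bar> \<le> 1" for f
    using Q b by (intro N.integrable_const_bound[where B=1])
      (auto simp: abs_mult indicator_def intro!: mult_le_one)
  have spl: "p * (1 + c) * i = p * 1 * i + p * c * i" for p c i :: real by (simp add: algebra_simps)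
  have cosJ: "(\<integral>x. P x * cos (S x + \<theta>) * indicator A (X x) \<partial>M)
            = (\<integral>y. Q y * cos (U y + \<theta>) * indicator A (Y y) \<partial>N)" for \<theta>
  proof -
    have "(\<integral>x. P x * (1 + cos (S x + \<theta>)) * indicator A (X x) \<partial>M)
        = (\<integral>x. P x * 1 * indicator A (X x) \<partial>M) + (\<integral>x. P x * cos (S x + \<theta>) * indicator A (X x) \<partial>M)"
      unfolding spl by (intro Bochner_Integration.integral_add iPr) auto
    moreover have "(\<integral>y. Q y * (1 + cos (U y + \<theta>)) * indicator A (Y y) \<partial>N)
        = (\<integral>y. Q y * 1 * indicator A (Y y) \<partial>N) + (\<integral>y. Q y * cos (U y + \<theta>) * indicator A (Y y) \<partial>N)"
      unfolding spl by (intro Bochner_Integration.integral_add iQr) auto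
    ultimately show ?thesis using cosI[of \<theta>] one by simp
  qed
  have sp: "(p * q) *\<^sub>R iexp s = of_real (p * cos s * q) + \<i> * of_real (p * sin s * q)" for p q s
    by (simp add: exp_Euler scaleR_conv_of_real cos_of_real sin_of_real algebra_simps)
  \<comment> \<open>The phases 0 and \<open>- pi / 2\<close> give the real and the imaginary part of
    \<open>iexp (S x)\<close>.\<close>
  have sincos: "sin s = cos (s + (- pi / 2))" for s :: real
    by (simp add: cos_diff)
  have "(\<integral>x. (P x * indicator A (X x)) *\<^sub>R iexp (S x) \<partial>M)
      = of_real (\<integral>x. P x * cos (S x) * indicator A (X x) \<partial>M) + \<i> * of_real (\<integral>x. P x * sin (S x) * indicator A (X x) \<partial>M)"
    unfolding sp using iPr[of "\<lambda>x. cos (S x)"] iPr[of "\<lambda>x. sin (S x)"]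
    by (subst Bochner_Integration.integral_add) (auto simp del: of_real_mult)
  moreover have "(\<integral>x. (Q x * indicator A (Y x)) *\<^sub>R iexp (U x) \<partial>N)
      = of_real (\<integral>x. Q x * cos (U x) * indicator A (Y x) \<partial>N) + \<i> * of_real (\<integral>x. Q x * sin (U x) * indicator A (Y x) \<partial>N)"
    unfolding sp using iQr[of "\<lambda>x. cos (U x)"] iQr[of "\<lambda>x. sin (U x)"]
    by (subst Bochner_Integration.integral_add) (auto simp del: of_real_mult)
  ultimately show ?thesis
    unfolding sincos using cosJ[of 0] cosJ[of "- pi / 2"] by simp
qed

text \<open>Induction on \<open>K\<close> turns one exponential factor into an indicator at a time.
  The coefficients stay arbitrary because the step uses the hypothesis with frequency
  \<open>t\<close> at the coordinate \<open>k\<close> and all remaining coefficients scaled by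
  \<open>s\<close>.\<close>

lemma char_indicator_prod:
  fixes X :: "'i \<Rightarrow> 'a \<Rightarrow> real" and Y :: "'i \<Rightarrow> 'b \<Rightarrow> real"
  assumes "prob_space M" "prob_space N" "finite J"
    and X[measurable]: "\<And>j. j \<in> J \<Longrightarrow> X j \<in> borel_measurable M"
    and Y[measurable]: "\<And>j. j \<in> J \<Longrightarrow> Y j \<in> borel_measurable N"
    and eq: "\<And>c. (\<integral>x. iexp (\<Sum>j\<in>J. c j * X j x) \<partial>M) = (\<integral>y. iexp (\<Sum>j\<in>J. c j * Y j y) \<partial>N)"
    and A: "\<And>j. A j \<in> sets borel"
    and K: "K \<subseteq> J"
  shows "(\<integral>x. (\<Prod>j\<in>K. indicator (A j) (X j x) :: real) *\<^sub>R iexp (\<Sum>j\<in>J-K. c j * X j x) \<partial>M)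
       = (\<integral>y. (\<Prod>j\<in>K. indicator (A j) (Y j y) :: real) *\<^sub>R iexp (\<Sum>j\<in>J-K. c j * Y j y) \<partial>N)"
proof -
  have "finite K" using K \<open>finite J\<close> finite_subset by blast
  then show ?thesis using K
  proof (induction K arbitrary: c)
    case empty
    then show ?case using eq by simp
  next
    case (insert k K)
    define R where "R = J - insert k K"
    have JK: "J - K = insert k R" "k \<notin> R" "finite R" "R \<subseteq> J" "K \<subseteq> J" "k \<in> J"
      using insert \<open>finite J\<close> by (auto simp: R_def)
    have mP: "(\<lambda>x. \<Prod>j\<in>K. indicator (A j) (X j x) :: real) \<in> borel_measurable M"
      by (intro borel_measurable_prod measurable_compose[OF X borel_measurable_indicator] A) (use JK in auto)
    have mQ: "(\<lambda>x. \<Prod>j\<in>K. indicator (A j) (Y j x) :: real) \<in> borel_measurable N"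
      by (intro borel_measurable_prod measurable_compose[OF Y borel_measurable_indicator] A) (use JK in auto)
    have mS: "(\<lambda>x. \<Sum>j\<in>R. c j * X j x) \<in> borel_measurable M" "(\<lambda>x. \<Sum>j\<in>R. c j * Y j x) \<in> borel_measurable N"
      using JK by (intro borel_measurable_sum borel_measurable_times X Y; auto)+
    have "(\<integral>x. ((\<Prod>j\<in>K. indicator (A j) (X j x)) * indicator (A k) (X k x)) *\<^sub>R iexp (\<Sum>j\<in>R. c j * X j x) \<partial>M)
       = (\<integral>y. ((\<Prod>j\<in>K. indicator (A j) (Y j y)) * indicator (A k) (Y k y)) *\<^sub>R iexp (\<Sum>j\<in>R. c j * Y j y) \<partial>N)"
    proof (rule weighted_char_extend)
      fix t s
      have *: "(\<Sum>j\<in>J-K. (\<lambda>j. if j = k then t else s * c j) j * Z j) = t * Z k + s * (\<Sum>j\<in>R. c j * Z j)" for Z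
      proof -
        have "(\<Sum>j\<in>R. (if j = k then t else s * c j) * Z j) = (\<Sum>j\<in>R. s * (c j * Z j))"
          using JK by (intro sum.cong) auto
        then show ?thesis using JK by (simp add: sum_distrib_left)
      qed
      show "(\<integral>x. (\<Prod>j\<in>K. indicator (A j) (X j x)) *\<^sub>R iexp (t * X k x + s * (\<Sum>j\<in>R. c j * X j x)) \<partial>M)
          = (\<integral>y. (\<Prod>j\<in>K. indicator (A j) (Y j y)) *\<^sub>R iexp (t * Y k y + s * (\<Sum>j\<in>R. c j * Y j y)) \<partial>N)"
        using insert.IH[OF JK(5), of "\<lambda>j. if j = k then t else s * c j"] unfolding * .
    qed (use assms JK mP mQ mS in \<open>auto intro!: prod_nonneg prod_le_1 simp: indicator_def\<close>)
    then show ?case using insert.hyps by (simp add: R_def mult.commute)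
  qed
qed

text \<open>The case \<open>K = J\<close> of the previous lemma compares the two laws on rectangles,
  which are closed under intersection and generate the product sigma-algebra.\<close>

theorem char_determines_joint_law:
  fixes X :: "'i \<Rightarrow> 'a \<Rightarrow> real" and Y :: "'i \<Rightarrow> 'b \<Rightarrow> real"
  assumes M: "prob_space M" and N: "prob_space N" and J: "finite J"
    and X[measurable]: "\<And>j. j \<in> J \<Longrightarrow> X j \<in> borel_measurable M"
    and Y[measurable]: "\<And>j. j \<in> J \<Longrightarrow> Y j \<in> borel_measurable N"
    and eq: "\<And>c. (\<integral>x. iexp (\<Sum>j\<in>J. c j * X j x) \<partial>M) = (\<integral>y. iexp (\<Sum>j\<in>J. c j * Y j y) \<partial>N)"
  shows "distr M (Pi\<^sub>M J (\<lambda>_. borel)) (\<lambda>x. \<lambda>j\<in>J. X j x) = distr N (Pi\<^sub>M J (\<lambda>_. borel)) (\<lambda>y. \<lambda>j\<in>J. Y j y)"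
proof (rule measure_eqI_PiM_finite[where M="\<lambda>_. borel" and I=J])
  interpret M: prob_space M by fact
  interpret N: prob_space N by fact
  have m1: "(\<lambda>x. \<lambda>j\<in>J. X j x) \<in> measurable M (Pi\<^sub>M J (\<lambda>_. borel))" by measurable
  have m2: "(\<lambda>x. \<lambda>j\<in>J. Y j x) \<in> measurable N (Pi\<^sub>M J (\<lambda>_. borel))" by measurable
  fix A :: "'i \<Rightarrow> real set" assume "\<And>j. j \<in> J \<Longrightarrow> A j \<in> sets borel"
  \<comment> \<open>Sets outside \<open>J\<close> are replaced by \<open>{}\<close>, since
    \<open>char_indicator_prod\<close> asks for measurability at every index.\<close>
  define B where "B j = (if j \<in> J then A j else {})" for j
  have B: "B j \<in> sets borel" for j using \<open>\<And>j. j \<in> J \<Longrightarrow> A j \<in> sets borel\<close> by (auto simp: B_def)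
  have AB: "Pi\<^sub>E J A = Pi\<^sub>E J B" by (auto simp: B_def PiE_iff)
  have sB: "Pi\<^sub>E J B \<in> sets (Pi\<^sub>M J (\<lambda>_. borel))" using J B by (intro sets_PiM_I_finite) auto
  have pr: "indicator (Pi\<^sub>E J B) (\<lambda>j\<in>J. z j) = (\<Prod>j\<in>J. indicator (B j) (z j) :: real)" for z
  proof (cases "\<forall>j\<in>J. z j \<in> B j")
    case True
    then show ?thesis by (auto simp: PiE_iff)
  next
    case False
    then obtain j where "j \<in> J" "z j \<notin> B j" by blast
    then show ?thesis using J by (auto simp: PiE_iff indicator_def intro!: prod_zero[symmetric])
  qed
  have "complex_of_real (\<integral>x. (\<Prod>j\<in>J. indicator (B j) (X j x)) \<partial>M) = of_real (\<integral>y. (\<Prod>j\<in>J. indicator (B j) (Y j y)) \<partial>N)"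
    using char_indicator_prod[OF M N J X Y eq, of B J "\<lambda>_. 0"] B
    by (simp add: scaleR_conv_of_real del: of_real_prod)
  then have "(\<integral>x. indicator (Pi\<^sub>E J B) (\<lambda>j\<in>J. X j x) \<partial>M) = (\<integral>y. indicator (Pi\<^sub>E J B) (\<lambda>j\<in>J. Y j y) \<partial>N :: real)"
    by (simp add: pr)
  then have "measure (distr M (Pi\<^sub>M J (\<lambda>_. borel)) (\<lambda>x. \<lambda>j\<in>J. X j x)) (Pi\<^sub>E J B)
           = measure (distr N (Pi\<^sub>M J (\<lambda>_. borel)) (\<lambda>x. \<lambda>j\<in>J. Y j x)) (Pi\<^sub>E J B)"
    using integral_distr[OF m1, of "indicator (Pi\<^sub>E J B) :: _ \<Rightarrow> real"]
      integral_distr[OF m2, of "indicator (Pi\<^sub>E J B) :: _ \<Rightarrow> real"] sB by simp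
  then show "emeasure (distr M (Pi\<^sub>M J (\<lambda>_. borel)) (\<lambda>x. \<lambda>j\<in>J. X j x)) (Pi\<^sub>E J A)
      = emeasure (distr N (Pi\<^sub>M J (\<lambda>_. borel)) (\<lambda>y. \<lambda>j\<in>J. Y j y)) (Pi\<^sub>E J A)"
    using M.prob_space_distr[OF m1] N.prob_space_distr[OF m2] AB
    by (simp add: finite_measure.emeasure_eq_measure prob_space.finite_measure)
next
  interpret M: prob_space M by fact
  show "range (\<lambda>_::nat. Pi\<^sub>E J (\<lambda>_. UNIV :: real set)) \<subseteq> prod_algebra J (\<lambda>_. borel)"
    using J by (auto intro!: prod_algebraI_finite)
  show "emeasure (distr M (Pi\<^sub>M J (\<lambda>_. borel)) (\<lambda>x. \<lambda>j\<in>J. X j x)) (Pi\<^sub>E J (\<lambda>_. UNIV)) \<noteq> \<infinity>" for i :: nat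
  proof -
    have m1: "(\<lambda>x. \<lambda>j\<in>J. X j x) \<in> measurable M (Pi\<^sub>M J (\<lambda>_. borel))" by measurable
    show ?thesis using M.prob_space_distr[OF m1] by (metis finite_measure.emeasure_finite infinity_ennreal_def prob_space.finite_measure)
  qed
qed (use J in \<open>auto simp: space_PiM\<close>)

section \<open>Gaussian variables and vectors\<close>

text \<open>The coordinates along \<open>Basis\<close> form a finite real family. The map
  \<open>h\<close> rebuilds the vector from them and carries the equality of joint laws
  over.\<close>

theorem char_determines_law:
  fixes X :: "'a \<Rightarrow> 'c::euclidean_space" and Y :: "'b \<Rightarrow> 'c"
  assumes M: "prob_space M" and N: "prob_space N"
    and [measurable]: "X \<in> borel_measurable M" "Y \<in> borel_measurable N"
    and eq: "\<And>u. (\<integral>x. iexp (u \<bullet> X x) \<partial>M) = (\<integral>y. iexp (u \<bullet> Y y) \<partial>N)"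
  shows "distr M borel X = distr N borel Y"
proof -
  define h :: "('c \<Rightarrow> real) \<Rightarrow> 'c" where "h f = (\<Sum>b\<in>Basis. f b *\<^sub>R b)" for f
  have [measurable]: "h \<in> borel_measurable (Pi\<^sub>M Basis (\<lambda>_. borel))"
    unfolding h_def by measurable
  have "distr M (Pi\<^sub>M Basis (\<lambda>_. borel)) (\<lambda>x. \<lambda>j\<in>Basis. X x \<bullet> j)
      = distr N (Pi\<^sub>M Basis (\<lambda>_. borel)) (\<lambda>x. \<lambda>j\<in>Basis. Y x \<bullet> j)"
  proof (rule char_determines_joint_law[OF M N])
    fix c :: "'c \<Rightarrow> real"
    have "(\<Sum>j\<in>Basis. c j * (z \<bullet> j)) = h c \<bullet> z" for z
      by (simp add: h_def inner_sum_left) (simp add: inner_commute)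
    then show "(\<integral>x. iexp (\<Sum>j\<in>Basis. c j * (X x \<bullet> j)) \<partial>M) = (\<integral>y. iexp (\<Sum>j\<in>Basis. c j * (Y y \<bullet> j)) \<partial>N)"
      using eq by simp
  qed auto
  then have "distr (distr M (Pi\<^sub>M Basis (\<lambda>_. borel)) (\<lambda>x. \<lambda>j\<in>Basis. X x \<bullet> j)) borel h
     = distr (distr N (Pi\<^sub>M Basis (\<lambda>_. borel)) (\<lambda>x. \<lambda>j\<in>Basis. Y x \<bullet> j)) borel h" by simp
  then show ?thesis
    by (subst (asm) (1 2) distr_distr) (simp_all add: comp_def h_def euclidean_representation)
qed

lemma normal_char:
  assumes "prob_space M" and s: "0 < \<sigma>" and X: "distributed M lborel X (normal_density m \<sigma>)"
  shows "(\<integral>x. iexp (t * X x) \<partial>M) = iexp (t * m) * of_real (exp (- (\<sigma> * t)\<^sup>2 / 2))"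
proof -
  interpret prob_space M by fact
  have D: "distributed M lborel (\<lambda>x. (X x - m) / \<sigma>) std_normal_density"
    using normal_standard_normal_convert[OF s] X by simp
  have [measurable]: "X \<in> borel_measurable M" using distributed_measurable[OF X] by simp
  have "char (distr M lborel (\<lambda>x. (X x - m) / \<sigma>)) (t * \<sigma>) = of_real (exp (- (t * \<sigma>)\<^sup>2 / 2))"
    unfolding distributed_distr_eq_density[OF D] by (simp only: char_std_normal_distribution)
  then have *: "(\<integral>x. iexp (t * \<sigma> * ((X x - m) / \<sigma>)) \<partial>M) = of_real (exp (- (t * \<sigma>)\<^sup>2 / 2))"
    unfolding char_def by (subst (asm) integral_distr) auto
  have "(\<integral>x. iexp (t * X x) \<partial>M) = (\<integral>x. iexp (t * m) * iexp (t * \<sigma> * ((X x - m) / \<sigma>)) \<partial>M)"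
  proof (intro Bochner_Integration.integral_cong refl)
    fix x
    have e: "t * X x = t * m + t * \<sigma> * ((X x - m) / \<sigma>)" using s by (simp add: field_simps)
    show "iexp (t * X x) = iexp (t * m) * iexp (t * \<sigma> * ((X x - m) / \<sigma>))"
      by (subst e) (simp only: of_real_add distrib_left exp_add)
  qed
  also have "\<dots> = iexp (t * m) * of_real (exp (- (t * \<sigma>)\<^sup>2 / 2))"
    unfolding * [symmetric] by (rule integral_mult_right_zero)
  finally show ?thesis by (simp add: mult.commute)
qed

lemma normal_moments:
  assumes "prob_space M" and s: "0 < \<sigma>" and X: "distributed M lborel X (normal_density m \<sigma>)"
  shows "integrable M X" "integrable M (\<lambda>x. (X x)\<^sup>2)" "(\<integral>x. X x \<partial>M) = m" "(\<integral>x. (X x - m)\<^sup>2 \<partial>M) = \<sigma>\<^sup>2"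
proof -
  interpret prob_space M by fact
  show 1: "integrable M X"
    by (rule distributed_integrable_var[OF X normal_density_nonneg integrable_normal_moment_nz_1[OF s]])
  have "integrable M (\<lambda>x. (X x - m)^2)"
    using distributed_integrable[OF X, of "\<lambda>x. (x - m)^2"] integrable_normal_moment[OF s, of m 2] by simp
  then have "integrable M (\<lambda>x. (X x - m)^2 + 2 * m * X x - m^2)"
    using 1 by auto
  then show "integrable M (\<lambda>x. (X x)\<^sup>2)"
    by (simp add: power2_diff algebra_simps)
  show "(\<integral>x. X x \<partial>M) = m" by (rule normal_distributed_expectation[OF s X])
  then show "(\<integral>x. (X x - m)\<^sup>2 \<partial>M) = \<sigma>\<^sup>2"
    using normal_distributed_variance[OF s X] by simp
qed

lemma gaussian_rv_integrable:
  assumes "prob_space M" "gaussian_rv M X"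
  shows "integrable M X" "integrable M (\<lambda>x. (X x)\<^sup>2)"
proof -
  interpret prob_space M by fact
  have [measurable]: "X \<in> borel_measurable M" using assms by (simp add: gaussian_rv_def)
  consider m where "AE x in M. X x = m" | m \<sigma> where "\<sigma> > 0" "distributed M lborel X (normal_density m \<sigma>)"
    using assms unfolding gaussian_rv_def by auto
  then have "integrable M X \<and> integrable M (\<lambda>x. (X x)\<^sup>2)"
  proof cases
    case 1
    have "integrable M X \<longleftrightarrow> integrable M (\<lambda>_. m)" using 1 by (intro integrable_cong_AE) auto
    moreover have "integrable M (\<lambda>x. (X x)\<^sup>2) \<longleftrightarrow> integrable M (\<lambda>_. m\<^sup>2)" using 1 by (intro integrable_cong_AE) auto
    ultimately show ?thesis by simp
  next
    case 2
    then show ?thesis using normal_moments[OF \<open>prob_space M\<close>] by blast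
  qed
  then show "integrable M X" "integrable M (\<lambda>x. (X x)\<^sup>2)" by auto
qed

text \<open>For a centred variable the second moment is the variance, so one formula covers both
  alternatives of \<open>gaussian_rv\<close>: a point mass at 0 has variance 0 and characteristic
  value 1.\<close>

lemma gaussian_rv_char:
  assumes M: "prob_space M" and X: "gaussian_rv M X" and 0: "(\<integral>x. X x \<partial>M) = 0"
  shows "(\<integral>x. iexp (X x) \<partial>M) = of_real (exp (- (\<integral>x. (X x)\<^sup>2 \<partial>M) / 2))"
proof -
  interpret prob_space M by fact
  have [measurable]: "X \<in> borel_measurable M" using assms by (simp add: gaussian_rv_def)
  consider m where "AE x in M. X x = m" | m \<sigma> where "\<sigma> > 0" "distributed M lborel X (normal_density m \<sigma>)"
    using assms unfolding gaussian_rv_def by auto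
  then show ?thesis
  proof cases
    case 1
    have "(\<integral>x. X x \<partial>M) = (\<integral>x. m \<partial>M)" using 1 by (intro integral_cong_AE) auto
    then have "m = 0" using 0 by (simp add: prob_space)
    with 1 have AE0: "AE x in M. X x = 0" by simp
    have "(\<integral>x. (X x)\<^sup>2 \<partial>M) = (\<integral>x. 0 \<partial>M)" using AE0 by (intro integral_cong_AE) auto
    moreover have "(\<integral>x. iexp (X x) \<partial>M) = (\<integral>x. 1 \<partial>M)" using AE0 by (intro integral_cong_AE) auto
    ultimately show ?thesis by (simp add: prob_space)
  next
    case 2
    note nm = normal_moments[OF M 2]
    have "m = 0" using nm(3) 0 by simp
    then show ?thesis using normal_char[OF M 2, of 1] nm(4) by simp
  qed
qed

lemma prod_Basis_vec:
  "(\<Prod>b\<in>(Basis :: (real^'n) set). f b) = (\<Prod>i\<in>UNIV. f (axis i 1))"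
proof -
  have B: "(Basis :: (real^'n) set) = range (\<lambda>i. axis i 1)" by (auto simp: Basis_vec_def)
  have I: "inj (\<lambda>i::'n. axis i (1::real))" by (auto simp: inj_on_def axis_eq_axis)
  show ?thesis unfolding B prod.reindex[OF I] by simp
qed

lemma nn_integral_prod_normal:
  assumes s: "0 < \<sigma>"
  shows "(\<integral>\<^sup>+z. ennreal (\<Prod>i\<in>UNIV. normal_density 0 \<sigma> ((z::real^'n) $ i)) \<partial>lborel) = 1"
proof -
  have "(\<integral>\<^sup>+z. ennreal (\<Prod>i\<in>UNIV. normal_density 0 \<sigma> ((z::real^'n) $ i)) \<partial>lborel)
      = (\<integral>\<^sup>+z. (\<Prod>b\<in>Basis. ennreal (normal_density 0 \<sigma> ((z::real^'n) \<bullet> b))) \<partial>lborel)"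
    by (simp add: prod_Basis_vec prod_ennreal normal_density_nonneg inner_axis)
  also have "\<dots> = 1"
    by (subst nn_integral_lborel_prod)
      (simp_all add: nn_integral_eq_integral[OF integrable_normal_density[OF s]] normal_density_nonneg integral_normal_density[OF s])
  finally show ?thesis .
qed

lemma prod_normal_measurable [measurable]:
  "(\<lambda>z. \<Prod>i\<in>UNIV. normal_density 0 \<sigma> ((z::real^'n) $ i)) \<in> borel_measurable borel"
  by (intro borel_measurable_prod measurable_compose[OF _ borel_measurable_normal_density]
      borel_measurable_continuous_onI continuous_intros)

text \<open>Density and exponential both factor along \<open>Basis\<close>, so the integral is a
  product of one-dimensional ones.\<close>

lemma char_prod_normal:
  assumes s: "0 < \<sigma>"
  shows "(\<integral>z. iexp (u \<bullet> z) \<partial>density lborel (\<lambda>z::real^'n. ennreal (\<Prod>i\<in>UNIV. normal_density 0 \<sigma> (z $ i))))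
     = of_real (exp (- (\<sigma> * norm u)\<^sup>2 / 2))"
proof -
  interpret product_sigma_finite "\<lambda>_::real^'n. lborel :: real measure" ..
  define g where "g b x = normal_density 0 \<sigma> x *\<^sub>R iexp ((u \<bullet> b) * x)" for b :: "real^'n" and x
  have ig: "integrable lborel (g b)" for b
  proof -
    have "integrable (density lborel (normal_density 0 \<sigma>)) (\<lambda>x. iexp ((u \<bullet> b) * x))"
      using prob_space_normal_density[OF s, of 0]
      by (intro prob_space.integrable_iexp) auto
    then show ?thesis unfolding g_def
      by (subst (asm) integrable_density) (auto simp: normal_density_nonneg)
  qed
  have G: "(\<integral>x. g b x \<partial>lborel) = of_real (exp (- (\<sigma> * (u \<bullet> b))\<^sup>2 / 2))" for b
  proof -
    have "distributed (density lborel (normal_density 0 \<sigma>)) lborel (\<lambda>x. x) (normal_density 0 \<sigma>)"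
      by (auto simp: distributed_def intro!: measure_eqI)
         (metis distr_id2 sets_density)
    from normal_char[OF prob_space_normal_density[OF s] s this, of "u \<bullet> b"]
    show ?thesis unfolding g_def
      by (subst (asm) integral_density) (auto simp: normal_density_nonneg)
  qed
  have e: "(\<Prod>i\<in>UNIV. normal_density 0 \<sigma> (z $ i)) *\<^sub>R iexp (u \<bullet> z) = (\<Prod>b\<in>Basis. g b (z \<bullet> b))" for z
  proof -
    have "iexp (u \<bullet> z) = (\<Prod>b\<in>Basis. iexp ((u \<bullet> b) * (z \<bullet> b)))"
      by (subst euclidean_inner) (simp add: exp_sum sum_distrib_left)
    then show ?thesis
      by (simp add: g_def scaleR_conv_of_real prod.distrib prod_Basis_vec inner_axis)
  qed
  have "(\<integral>z. iexp (u \<bullet> z) \<partial>density lborel (\<lambda>z::real^'n. ennreal (\<Prod>i\<in>UNIV. normal_density 0 \<sigma> (z $ i))))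
     = (\<integral>z. (\<Prod>b\<in>Basis. g b (z \<bullet> b)) \<partial>lborel)"
    by (subst integral_density) (auto simp: e[symmetric] prod_nonneg normal_density_nonneg)
  also have "\<dots> = (\<integral>f. (\<Prod>b\<in>Basis. g b (f b)) \<partial>(\<Pi>\<^sub>M b\<in>(Basis::(real^'n) set). lborel))"
  proof -
    have [measurable]: "g b \<in> borel_measurable borel" for b using ig[of b] by auto
    show ?thesis
    by (subst lborel_eq, subst integral_distr) (auto intro!: Bochner_Integration.integral_cong prod.cong)
  qed
  also have "\<dots> = (\<Prod>b\<in>Basis. \<integral>x. g b x \<partial>lborel)"
    by (intro product_integral_prod ig) simp
  also have "\<dots> = of_real (exp (\<Sum>b\<in>Basis. - (\<sigma> * (u \<bullet> b))\<^sup>2 / 2))"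
    by (simp add: G exp_sum)
  also have "(\<Sum>b\<in>Basis. - (\<sigma> * (u \<bullet> b))\<^sup>2 / 2) = - (\<sigma> * norm u)\<^sup>2 / 2"
  proof -
    have "(\<sigma> * norm u)\<^sup>2 = (\<Sum>b\<in>Basis. (\<sigma> * (u \<bullet> b))\<^sup>2)"
      unfolding power_mult_distrib power2_norm_eq_inner euclidean_inner[of u u]
      by (simp add: sum_distrib_left power2_eq_square)
    then show ?thesis by (simp add: sum_divide_distrib[symmetric] sum_negf)
  qed
  finally show ?thesis .
qed

lemma distributed_prod_normal_char:
  fixes D :: "'w \<Rightarrow> real^'n"
  assumes s: "0 < \<sigma>" and D: "distributed M lborel D (\<lambda>z. ennreal (\<Prod>i\<in>UNIV. normal_density 0 \<sigma> (z $ i)))"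
  shows "(\<integral>x. iexp (u \<bullet> D x) \<partial>M) = of_real (exp (- (\<sigma> * norm u)\<^sup>2 / 2))"
proof -
  have [measurable]: "D \<in> borel_measurable M" using distributed_measurable[OF D] by simp
  have "(\<integral>z. iexp (u \<bullet> z) \<partial>distr M lborel D) = of_real (exp (- (\<sigma> * norm u)\<^sup>2 / 2))"
    unfolding distributed_distr_eq_density[OF D] using char_prod_normal[OF s] .
  then show ?thesis by (subst (asm) integral_distr) auto
qed

text \<open>The marginal is read off from the characteristic function at multiples of
  \<open>axis i 1\<close>; no coordinate has to be integrated out.\<close>

lemma distributed_prod_normal_component:
  fixes D :: "'w \<Rightarrow> real^'n"
  assumes M: "prob_space M"
    and s: "0 < \<sigma>" and D: "distributed M lborel D (\<lambda>z. ennreal (\<Prod>i\<in>UNIV. normal_density 0 \<sigma> (z $ i)))"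
  shows "distributed M lborel (\<lambda>x. D x $ i) (normal_density 0 \<sigma>)"
proof -
  have [measurable]: "D \<in> borel_measurable M" using distributed_measurable[OF D] by simp
  have [measurable]: "(\<lambda>x. D x $ i) \<in> borel_measurable M"
    by (intro measurable_compose[of D M borel "\<lambda>x. x $ i"] borel_measurable_continuous_onI continuous_intros) auto
  have "distr M borel (\<lambda>x. D x $ i) = distr (density lborel (normal_density 0 \<sigma>)) borel (\<lambda>x. x)"
  proof (rule char_determines_law[OF M prob_space_normal_density[OF s]])
    fix u :: real
    have "distributed (density lborel (normal_density 0 \<sigma>)) lborel (\<lambda>x. x) (normal_density 0 \<sigma>)"
      by (auto simp: distributed_def intro!: measure_eqI)
         (metis distr_id2 sets_density)
    from normal_char[OF prob_space_normal_density[OF s] s this, of u]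
    have "(\<integral>y. iexp (u \<bullet> y) \<partial>density lborel (normal_density 0 \<sigma>)) = of_real (exp (- (\<sigma> * u)\<^sup>2 / 2))" by simp
    moreover have "(\<integral>x. iexp (u \<bullet> D x $ i) \<partial>M) = of_real (exp (- (\<sigma> * u)\<^sup>2 / 2))"
      using distributed_prod_normal_char[OF s D, of "u *\<^sub>R axis i 1"]
      by (simp add: inner_axis' power_mult_distrib)
    ultimately show "(\<integral>x. iexp (u \<bullet> D x $ i) \<partial>M) = (\<integral>y. iexp (u \<bullet> y) \<partial>density lborel (normal_density 0 \<sigma>))" by simp
  qed auto
  moreover have "distr (density lborel (normal_density 0 \<sigma>)) borel (\<lambda>x. x) = density lborel (normal_density 0 \<sigma>)"
    by (intro distr_id2) simp
  ultimately show ?thesis by (simp add: distributed_def cong: distr_cong)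
qed

definition std_gauss :: "(real^'n) measure" where
  "std_gauss = density lborel (\<lambda>z. ennreal (\<Prod>i\<in>UNIV. std_normal_density (z $ i)))"

lemma sets_std_gauss [simp, measurable_cong]: "sets std_gauss = sets borel"
  and space_std_gauss [simp]: "space std_gauss = UNIV"
  by (auto simp: std_gauss_def)

lemma prob_space_std_gauss: "prob_space (std_gauss :: (real^'n) measure)"
  unfolding std_gauss_def by (rule prob_space_densityI) (use nn_integral_prod_normal[of 1] in auto)

lemma std_gauss_char: "(\<integral>z. iexp (u \<bullet> z) \<partial>std_gauss) = of_real (exp (- (norm u)\<^sup>2 / 2))"
  unfolding std_gauss_def using char_prod_normal[of 1 u] by simp

section \<open>Independence of Brownian increments\<close>

lemma space_generated_algebra [simp]: "space (generated_algebra M X S) = space M"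
  unfolding generated_algebra_def by (intro space_measure_of) auto

lemma sets_generated_algebra:
  "sets (generated_algebra M X S) = sigma_sets (space M) {X s -` A \<inter> space M | s A. s \<in> S \<and> A \<in> sets borel}"
  unfolding generated_algebra_def by (intro sets_measure_of) auto

lemma measurable_generated_algebra:
  "s \<in> S \<Longrightarrow> X s \<in> borel_measurable (generated_algebra M X S)"
  by (intro measurableI) (auto simp: sets_generated_algebra)

lemma generated_algebra_subset:
  assumes "space N = space M" "\<And>s. s \<in> S \<Longrightarrow> X s \<in> borel_measurable N"
  shows "sets (generated_algebra M X S) \<subseteq> sets N"
  unfolding sets_generated_algebra
proof (rule sets.sigma_sets_subset'[where M=N])
  show "space M \<in> sets N" unfolding assms(1)[symmetric] by (rule sets.top)
  show "{X s -` A \<inter> space M |s A. s \<in> S \<and> A \<in> sets borel} \<subseteq> sets N"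
    using measurable_sets[OF assms(2)] assms(1) by auto
qed

lemma (in prob_space) indep_set_mono:
  assumes "indep_set A B" "A' \<subseteq> A" "B' \<subseteq> B"
  shows "indep_set A' B'"
  using assms unfolding indep_set_def
  by (elim indep_sets_mono_sets) (auto split: bool.split)

lemma (in prob_space) indep_var_of_indep_set:
  assumes ind: "indep_set A B" and X: "X \<in> measurable M S" and Y: "Y \<in> measurable M T"
    and A: "\<And>E. E \<in> sets S \<Longrightarrow> X -` E \<inter> space M \<in> A" and B: "\<And>E. E \<in> sets T \<Longrightarrow> Y -` E \<inter> space M \<in> B"
  shows "indep_var S X T Y"
proof -
  have sub: "sigma_sets (space M) {Z -` E \<inter> space M |E. E \<in> sets U} = {Z -` E \<inter> space M |E. E \<in> sets U}"
    if "Z \<in> measurable M U" for Z :: "'a \<Rightarrow> 'z" and U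
    using sigma_sets_vimage_commute[of Z "space M" "space U" "sets U"] that measurable_space[OF that]
    by (auto simp: sets.sigma_sets_eq)
  show ?thesis
    unfolding indep_var_eq sub[OF X] sub[OF Y]
    using X Y A B by (auto intro!: indep_set_mono[OF ind])
qed

text \<open>Used with \<open>X\<close> the identity into a sub-sigma-algebra of \<open>M\<close>.
  Fubini on the product law then integrates over a fresh copy of \<open>Y\<close> with the other
  argument frozen, which does the work of conditional expectation.\<close>

lemma (in prob_space) indep_set_pair_distr:
  assumes ind: "indep_set A B" and X: "X \<in> measurable M S" and Y: "Y \<in> measurable M T"
    and A: "\<And>E. E \<in> sets S \<Longrightarrow> X -` E \<inter> space M \<in> A" and B: "\<And>E. E \<in> sets T \<Longrightarrow> Y -` E \<inter> space M \<in> B"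
  shows "distr M (S \<Otimes>\<^sub>M T) (\<lambda>\<omega>. (X \<omega>, Y \<omega>)) = distr M S X \<Otimes>\<^sub>M distr M T Y"
proof (rule pair_measure_eqI[symmetric])
  show "sigma_finite_measure (distr M S X)" "sigma_finite_measure (distr M T Y)"
    using prob_space_distr[OF X] prob_space_distr[OF Y] prob_space_imp_sigma_finite by auto
  fix E F assume "E \<in> sets (distr M S X)" "F \<in> sets (distr M T Y)"
  then have E: "E \<in> sets S" and F: "F \<in> sets T" by auto
  have "(\<lambda>\<omega>. (X \<omega>, Y \<omega>)) -` (E \<times> F) \<inter> space M = (X -` E \<inter> space M) \<inter> (Y -` F \<inter> space M)" by auto
  then show "emeasure (distr M S X) E * emeasure (distr M T Y) F
      = emeasure (distr M (S \<Otimes>\<^sub>M T) (\<lambda>\<omega>. (X \<omega>, Y \<omega>))) (E \<times> F)"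
    using indep_setD[OF ind A[OF E] B[OF F]] X Y E F
    by (simp add: emeasure_distr emeasure_eq_measure ennreal_mult')
qed auto

text \<open>Events fixed by finitely many times are closed under intersection and generate the
  algebra, so independence extends from them.\<close>

lemma (in prob_space) indep_set_generated_algebra:
  fixes X :: "real \<Rightarrow> 'a \<Rightarrow> 'b::topological_space" and D :: "'a \<Rightarrow> 'c::topological_space"
  assumes X: "\<And>s. s \<in> S \<Longrightarrow> X s \<in> borel_measurable M" and D[measurable]: "D \<in> borel_measurable M"
    and rect: "\<And>J A C. finite J \<Longrightarrow> J \<subseteq> S \<Longrightarrow> (\<And>j. A j \<in> sets borel) \<Longrightarrow> C \<in> sets borel \<Longrightarrow>
      prob ({\<omega>\<in>space M. \<forall>j\<in>J. X j \<omega> \<in> A j} \<inter> (D -` C \<inter> space M))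
      = prob {\<omega>\<in>space M. \<forall>j\<in>J. X j \<omega> \<in> A j} * prob (D -` C \<inter> space M)"
  shows "indep_set (sets (generated_algebra M X S)) {D -` C \<inter> space M | C. C \<in> sets borel}"
    (is "indep_set _ ?D")
proof -
  define P where "P = {{\<omega>\<in>space M. \<forall>j\<in>J. X j \<omega> \<in> A j} | J A. finite J \<and> J \<subseteq> S \<and> (\<forall>j. A j \<in> sets borel)}"
  have Pev: "P \<subseteq> events"
  proof
    fix E assume "E \<in> P"
    then obtain J A where E: "E = {\<omega>\<in>space M. \<forall>j\<in>J. X j \<omega> \<in> A j}" "finite J" "J \<subseteq> S" "\<forall>j. A j \<in> sets borel"
      by (auto simp: P_def)
    then have "Measurable.pred M (\<lambda>\<omega>. \<forall>j\<in>J. X j \<omega> \<in> A j)"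
      by (intro pred_intros_finite pred_sets2[OF _ X]) auto
    then show "E \<in> events" unfolding E(1) by (simp add: pred_def)
  qed
  have "indep_set P ?D"
  proof (rule indep_setI)
    show "P \<subseteq> events" by fact
    show "?D \<subseteq> events" by (auto intro!: measurable_sets)
    fix a b assume "a \<in> P" "b \<in> ?D"
    then show "prob (a \<inter> b) = prob a * prob b"
      using rect unfolding P_def by blast
  qed
  moreover have "Int_stable P"
  proof (rule Int_stableI)
    fix a b assume "a \<in> P" "b \<in> P"
    then obtain J A J' A' where a: "a = {\<omega>\<in>space M. \<forall>j\<in>J. X j \<omega> \<in> A j}" "finite J" "J \<subseteq> S" "\<And>j. A j \<in> sets borel"
      and b: "b = {\<omega>\<in>space M. \<forall>j\<in>J'. X j \<omega> \<in> A' j}" "finite J'" "J' \<subseteq> S" "\<And>j. A' j \<in> sets borel"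
      unfolding P_def by blast
    \<comment> \<open>Padding each family with \<open>UNIV\<close> off its own index set makes the
      intersection an event over \<open>J \<union> J'\<close>.\<close>
    define A'' where "A'' j = (if j \<in> J then A j else UNIV) \<inter> (if j \<in> J' then A' j else UNIV)" for j
    have "a \<inter> b = {\<omega>\<in>space M. \<forall>j\<in>J \<union> J'. X j \<omega> \<in> A'' j}"
      unfolding a(1) b(1) A''_def by (auto split: if_splits)
    moreover have "\<forall>j. A'' j \<in> sets borel" using a b by (auto simp: A''_def)
    ultimately show "a \<inter> b \<in> P" unfolding P_def using a b by (intro CollectI exI[of _ "J \<union> J'"] exI[of _ A'']) auto
  qed
  moreover have "Int_stable ?D"
  proof (rule Int_stableI)
    fix a b assume "a \<in> ?D" "b \<in> ?D"
    then obtain C C' where "a = D -` C \<inter> space M" "b = D -` C' \<inter> space M"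
      "C \<in> sets borel" "C' \<in> sets borel" by blast
    then have "a \<inter> b = D -` (C \<inter> C') \<inter> space M" "C \<inter> C' \<in> sets borel" by auto
    then show "a \<inter> b \<in> ?D" by blast
  qed
  ultimately have "indep_set (sigma_sets (space M) P) (sigma_sets (space M) ?D)" by (rule indep_set_sigma_sets)
  then show ?thesis
  proof (rule indep_set_mono)
    show "sets (generated_algebra M X S) \<subseteq> sigma_sets (space M) P"
      unfolding sets_generated_algebra
    proof (rule sigma_sets_mono, safe)
      fix u A assume "u \<in> S" "A \<in> sets (borel :: 'b measure)"
      then have "X u -` A \<inter> space M \<in> P" unfolding P_def
        by (intro CollectI exI[of _ "{u}"] exI[of _ "\<lambda>_. A"]) auto
      then show "X u -` A \<inter> space M \<in> sigma_sets (space M) P" by blast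
    qed
  qed auto
qed

section \<open>Increments of one Brownian motion against its own past\<close>

context
  fixes M :: "'w measure" and B :: "real \<Rightarrow> 'w \<Rightarrow> real ^ 'n"
  assumes bm: "brownian_motion M B"
begin

lemma bm_prob_space: "prob_space M"
  and bm_measurable: "0 \<le> t \<Longrightarrow> B t \<in> borel_measurable M"
  and bm_0: "\<omega> \<in> space M \<Longrightarrow> B 0 \<omega> = 0"
  and bm_cont: "\<omega> \<in> space M \<Longrightarrow> continuous_on {0..} (\<lambda>t. B t \<omega>)"
  and bm_incr: "0 \<le> s \<Longrightarrow> s < t \<Longrightarrow> distributed M lborel (\<lambda>\<omega>. B t \<omega> - B s \<omega>)
          (\<lambda>z. ennreal (\<Prod>i\<in>UNIV. normal_density 0 (sqrt (t - s)) (z $ i)))"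
  and bm_indep: "0 \<le> \<tau> 0 \<Longrightarrow> incseq \<tau> \<Longrightarrow>
      prob_space.indep_vars M (\<lambda>_. borel) (\<lambda>k \<omega>. B (\<tau> (Suc k)) \<omega> - B (\<tau> k) \<omega>) {..<n::nat}"
  using bm unfolding brownian_motion_def by auto

interpretation prob_space M by (rule bm_prob_space)

text \<open>Values of \<open>B\<close> up to time \<open>s\<close> are sums of increments over the
  sorted times, so the event depends on finitely many increments, and \<open>B t - B s\<close> is
  the increment that follows them.\<close>

lemma bm_past_rectangle:
  assumes J: "finite J" "J \<subseteq> {0..s}" and A: "\<And>j. A j \<in> sets borel" and C: "C \<in> sets borel"
    and st: "0 \<le> s" "s \<le> t"
  shows "prob ({\<omega>\<in>space M. \<forall>j\<in>J. B j \<omega> \<in> A j} \<inter> ((\<lambda>\<omega>. B t \<omega> - B s \<omega>) -` C \<inter> space M))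
    = prob {\<omega>\<in>space M. \<forall>j\<in>J. B j \<omega> \<in> A j} * prob ((\<lambda>\<omega>. B t \<omega> - B s \<omega>) -` C \<inter> space M)"
proof -
  \<comment> \<open>The point 0 is added so that every value is a sum of increments from the start,
    and \<open>s\<close> so that the last point of the list is \<open>s\<close>.\<close>
  define xs where "xs = sorted_list_of_set (insert 0 (insert s J))"
  have xs: "sorted xs" "set xs = insert 0 (insert s J)" "xs \<noteq> []"
    using J sorted_sorted_list_of_set[of "insert 0 (insert s J)"] set_sorted_list_of_set[of "insert 0 (insert s J)"]
    by (auto simp: xs_def sorted_list_of_set_eq_Nil_iff simp del: sorted_list_of_set_insert_remove set_sorted_list_of_set
      sorted_list_of_set.sorted_sorted_key_list_of_set)
  define n where "n = length xs - 1"
  have n: "length xs = Suc n" using xs by (cases xs) (auto simp: n_def)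
  \<comment> \<open>Staying at \<open>t\<close> after index \<open>n\<close> keeps the sequence
    increasing and makes increment number \<open>n\<close> equal to
    \<open>B t - B s\<close>.\<close>
  define \<tau> where "\<tau> k = (if k \<le> n then xs ! k else t)" for k
  have le: "x \<le> s" "0 \<le> x" if "x \<in> set xs" for x using that xs J st by auto
  have x0: "xs ! 0 = 0"
  proof -
    obtain k where k: "k \<le> n" "xs ! k = 0" using xs(2) n by (metis in_set_conv_nth insertI1 less_Suc_eq_le)
    then have "xs ! 0 \<le> xs ! k" using xs(1) n by (intro sorted_nth_mono) auto
    moreover have "0 \<le> xs ! 0" using n by (intro le nth_mem) auto
    ultimately show ?thesis using k by simp
  qed
  have xn: "xs ! n = s"
  proof -
    obtain k where k: "k \<le> n" "xs ! k = s" using xs(2) n by (metis in_set_conv_nth insertI1 insertI2 less_Suc_eq_le)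
    then have "xs ! k \<le> xs ! n" using xs(1) n by (intro sorted_nth_mono) auto
    moreover have "xs ! n \<le> s" using n by (intro le nth_mem) auto
    ultimately show ?thesis using k by simp
  qed
  have inc: "incseq \<tau>"
  proof (rule incseq_SucI)
    fix k show "\<tau> k \<le> \<tau> (Suc k)"
      using xs(1) n st le[of "xs ! k"] by (auto simp: \<tau>_def intro!: sorted_nth_mono order_trans[OF _ st(2)])
  qed
  have \<tau>0: "\<tau> 0 = 0" by (simp add: \<tau>_def x0)
  define D where "D k \<omega> = B (\<tau> (Suc k)) \<omega> - B (\<tau> k) \<omega>" for k \<omega>
  have "indep_vars (\<lambda>_. borel) D {..<Suc n}"
    unfolding D_def using \<tau>0 by (intro bm_indep inc) simp
  then have iv: "indep_var (PiM {..<n} (\<lambda>_. borel)) (\<lambda>\<omega>. restrict (\<lambda>i. D i \<omega>) {..<n})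
      (PiM {n} (\<lambda>_. borel)) (\<lambda>\<omega>. restrict (\<lambda>i. D i \<omega>) {n})"
    by (intro indep_var_restrict[where I="{..<Suc n}"]) auto
  \<comment> \<open>The event of the past as a predicate on the first \<open>n\<close>
    increments.\<close>
  define Q where "Q f = (\<forall>k\<in>{..n}. xs ! k \<in> J \<longrightarrow> (\<Sum>i<k. f i) \<in> A (xs ! k))" for f :: "nat \<Rightarrow> real^'n"
  have [measurable]: "Measurable.pred (PiM {..<n} (\<lambda>_. borel)) Q"
    unfolding Q_def
  proof (intro pred_intros_finite finite_atMost)
    fix k assume k: "k \<in> {..n}"
    have "(\<lambda>f. \<Sum>i<k. f i) \<in> borel_measurable (PiM {..<n} (\<lambda>_. borel :: (real^'n) measure))"
      using k by (intro borel_measurable_sum measurable_component_singleton) auto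
    then show "Measurable.pred (PiM {..<n} (\<lambda>_. borel)) (\<lambda>f. xs ! k \<in> J \<longrightarrow> (\<Sum>i<k. f i) \<in> A (xs ! k))"
      using A by measurable
  qed
  have Bx: "B (xs ! k) \<omega> = (\<Sum>i<k. D i \<omega>)" if "\<omega> \<in> space M" "k \<le> n" for k \<omega>
    using that(2)
  proof (induction k)
    case 0 then show ?case using bm_0 that x0 by simp
  next
    case (Suc k) then show ?case by (auto simp: D_def \<tau>_def)
  qed
  have Q: "(\<forall>j\<in>J. B j \<omega> \<in> A j) \<longleftrightarrow> Q (restrict (\<lambda>i. D i \<omega>) {..<n})" if w: "\<omega> \<in> space M" for \<omega>
  proof -
    have "(\<forall>j\<in>J. B j \<omega> \<in> A j) \<longleftrightarrow> (\<forall>k\<in>{..n}. xs ! k \<in> J \<longrightarrow> B (xs ! k) \<omega> \<in> A (xs ! k))"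
    proof (intro iffI ballI)
      fix j assume *: "\<forall>k\<in>{..n}. xs ! k \<in> J \<longrightarrow> B (xs ! k) \<omega> \<in> A (xs ! k)" and j: "j \<in> J"
      then obtain k where "k \<le> n" "xs ! k = j" using xs(2) n by (metis in_set_conv_nth insertCI less_Suc_eq_le)
      then show "B j \<omega> \<in> A j" using * j by auto
    qed auto
    also have "\<dots> \<longleftrightarrow> (\<forall>k\<in>{..n}. xs ! k \<in> J \<longrightarrow> (\<Sum>i<k. restrict (\<lambda>i. D i \<omega>) {..<n} i) \<in> A (xs ! k))"
      using Bx[OF w] by (intro ball_cong refl imp_cong) auto
    finally show ?thesis by (simp add: Q_def)
  qed
  have D: "B t \<omega> - B s \<omega> = D n \<omega>" for \<omega>
    by (simp add: D_def \<tau>_def xn)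
  let ?E = "{f\<in>space (PiM {..<n} (\<lambda>_. borel)). Q f}"
  let ?F = "{f\<in>space (PiM {n} (\<lambda>_. borel)). f n \<in> C}"
  have F: "?F \<in> sets (PiM {n} (\<lambda>_. borel))" using C by measurable
  have 1: "{\<omega>\<in>space M. \<forall>j\<in>J. B j \<omega> \<in> A j} = (\<lambda>\<omega>. restrict (\<lambda>i. D i \<omega>) {..<n}) -` ?E \<inter> space M"
    using Q by (auto simp: space_PiM)
  have 2: "(\<lambda>\<omega>. B t \<omega> - B s \<omega>) -` C \<inter> space M = (\<lambda>\<omega>. restrict (\<lambda>i. D i \<omega>) {n}) -` ?F \<inter> space M"
    unfolding D by (auto simp: space_PiM)
  show ?thesis unfolding 1 2
  proof -
    have E: "?E \<in> sets (PiM {..<n} (\<lambda>_. borel))" by measurable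
    have *: "(X -` G \<inter> S) \<inter> (Y -` H \<inter> S) = (\<lambda>x. (X x, Y x)) -` (G \<times> H) \<inter> S"
      for X :: "'w \<Rightarrow> nat \<Rightarrow> real^'n" and Y :: "'w \<Rightarrow> nat \<Rightarrow> real^'n" and G H S by auto
    show "prob (((\<lambda>\<omega>. restrict (\<lambda>i. D i \<omega>) {..<n}) -` ?E \<inter> space M) \<inter> ((\<lambda>\<omega>. restrict (\<lambda>i. D i \<omega>) {n}) -` ?F \<inter> space M))
      = prob ((\<lambda>\<omega>. restrict (\<lambda>i. D i \<omega>) {..<n}) -` ?E \<inter> space M) * prob ((\<lambda>\<omega>. restrict (\<lambda>i. D i \<omega>) {n}) -` ?F \<inter> space M)"
      unfolding * by (rule indep_varD[OF iv E F])
  qed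
qed

lemma bm_indep_past:
  assumes st: "0 \<le> s" "s \<le> t"
  shows "indep_set (sets (generated_algebra M B {0..s})) {(\<lambda>\<omega>. B t \<omega> - B s \<omega>) -` C \<inter> space M | C. C \<in> sets borel}"
proof (rule indep_set_generated_algebra)
  show "(\<lambda>\<omega>. B t \<omega> - B s \<omega>) \<in> borel_measurable M"
    by (intro borel_measurable_diff bm_measurable) (use st in auto)
qed (use bm_past_rectangle[OF _ _ _ _ st] bm_measurable in auto)

end

section \<open>The joint filtration of the two Brownian motions\<close>

abbreviation joint_filt :: "'w measure \<Rightarrow> (real \<Rightarrow> 'w \<Rightarrow> 'a::topological_space) \<Rightarrow> (real \<Rightarrow> 'w \<Rightarrow> 'b::topological_space) \<Rightarrow> real \<Rightarrow> 'w measure" where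
  "joint_filt M b bh \<equiv> natural_filtration M (\<lambda>s \<omega>. (b s \<omega>, bh s \<omega>))"

context
  fixes M :: "'w measure" and b :: "real \<Rightarrow> 'w \<Rightarrow> real ^ 'd" and bh :: "real \<Rightarrow> 'w \<Rightarrow> real ^ 'e"
  assumes b: "brownian_motion M b" and bh: "brownian_motion M bh" and ind: "indep_processes M b bh"
begin

interpretation prob_space M by (rule bm_prob_space[OF b])

lemma space_filt: "space (joint_filt M b bh s) = space M"
  by (simp add: natural_filtration_def)

lemma filt_subset:
  "sets (joint_filt M b bh s) \<subseteq> sets M"
  unfolding natural_filtration_def
  by (intro generated_algebra_subset) (auto intro!: borel_measurable_Pair bm_measurable[OF b] bm_measurable[OF bh])

lemma filt_mono: "s \<le> t \<Longrightarrow> sets (joint_filt M b bh s) \<subseteq> sets (joint_filt M b bh t)"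
  unfolding natural_filtration_def
  by (intro generated_algebra_subset) (auto intro!: measurable_generated_algebra)

lemma measurable_filt_mono:
  assumes "f \<in> measurable (joint_filt M b bh s) N" "s \<le> t" shows "f \<in> measurable (joint_filt M b bh t) N"
proof -
  have "subalgebra (joint_filt M b bh t) (joint_filt M b bh s)" using filt_mono[OF assms(2)] by (simp add: subalgebra_def space_filt)
  then show ?thesis using assms(1) by (rule measurable_from_subalg)
qed

lemma measurable_filt:
  assumes "f \<in> measurable (joint_filt M b bh s) N" shows "f \<in> measurable M N"
proof -
  have "subalgebra M (joint_filt M b bh s)" using filt_subset[of s] by (simp add: subalgebra_def space_filt)
  then show ?thesis using assms(1) by (rule measurable_from_subalg)
qed

lemma measurable_filt_b: "0 \<le> u \<Longrightarrow> u \<le> s \<Longrightarrow> b u \<in> borel_measurable (joint_filt M b bh s)"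
  and measurable_filt_bh: "0 \<le> u \<Longrightarrow> u \<le> s \<Longrightarrow> bh u \<in> borel_measurable (joint_filt M b bh s)"
proof -
  assume u: "0 \<le> u" "u \<le> s"
  then have *: "(\<lambda>\<omega>. (b u \<omega>, bh u \<omega>)) \<in> borel_measurable (joint_filt M b bh s)"
    unfolding natural_filtration_def by (intro measurable_generated_algebra) auto
  show "b u \<in> borel_measurable (joint_filt M b bh s)"
    using measurable_compose[OF * borel_measurable_continuous_onI[OF continuous_on_fst[OF continuous_on_id]]] by simp
  show "bh u \<in> borel_measurable (joint_filt M b bh s)"
    using measurable_compose[OF * borel_measurable_continuous_onI[OF continuous_on_snd[OF continuous_on_id]]] by simp
qed

text \<open>The joint past is generated by intersections of a past event of \<open>b\<close> with a
  past event of \<open>bh\<close>. Independence of the processes splits off the event of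
  \<open>b\<close>, because the past and the next increment of \<open>bh\<close> both lie in the
  algebra of \<open>bh\<close>; inside that algebra the increment is independent of the
  past.\<close>

lemma filt_indep_future:
  assumes st: "0 \<le> s" "s \<le> t"
  shows "indep_set (sets (joint_filt M b bh s)) {(\<lambda>\<omega>. bh t \<omega> - bh s \<omega>) -` C \<inter> space M | C. C \<in> sets borel}"
    (is "indep_set _ ?D")
proof -
  define F1 where "F1 = generated_algebra M b {0..s}"
  define F2 where "F2 = generated_algebra M bh {0..s}"
  have sF: "space F1 = space M" "space F2 = space M" by (auto simp: F1_def F2_def)
  have F: "sets F1 \<subseteq> sets M" "sets F2 \<subseteq> sets M"
    unfolding F1_def F2_def
    by (intro generated_algebra_subset bm_measurable[OF b] bm_measurable[OF bh]; simp)+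
  have F1': "sets F1 \<subseteq> sets (generated_algebra M b {0..})"
    unfolding F1_def by (intro generated_algebra_subset measurable_generated_algebra) auto
  have F2': "sets F2 \<subseteq> sets (generated_algebra M bh {0..})"
    unfolding F2_def by (intro generated_algebra_subset measurable_generated_algebra) auto
  define P where "P = {E \<inter> E' | E E'. E \<in> sets F1 \<and> E' \<in> sets F2}"
  have [measurable]: "(\<lambda>\<omega>. bh t \<omega> - bh s \<omega>) \<in> borel_measurable M"
    by (intro borel_measurable_diff bm_measurable[OF bh]) (use st in auto)
  have D': "?D \<subseteq> sets (generated_algebra M bh {0..})"
  proof -
    have "(\<lambda>\<omega>. bh t \<omega> - bh s \<omega>) \<in> borel_measurable (generated_algebra M bh {0..})"
      by (intro borel_measurable_diff measurable_generated_algebra) (use st in auto)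
    from measurable_sets[OF this] show ?thesis by auto
  qed
  note ind' = ind[unfolded indep_processes_def]
  have "indep_set P ?D"
  proof (rule indep_setI)
    show "P \<subseteq> events" unfolding P_def using F by auto
    show "?D \<subseteq> events" by (auto intro!: measurable_sets)
    fix x y assume "x \<in> P" and y: "y \<in> ?D"
    then obtain E E' where x: "x = E \<inter> E'" "E \<in> sets F1" "E' \<in> sets F2" by (auto simp: P_def)
    have "prob (x \<inter> y) = prob (E \<inter> (E' \<inter> y))" by (simp add: x Int_assoc)
    also have "\<dots> = prob E * prob (E' \<inter> y)"
      using x y F1' F2' D' by (intro indep_setD[OF ind'] sets.Int) auto
    also have "prob (E' \<inter> y) = prob E' * prob y"
      using x y by (intro indep_setD[OF bm_indep_past[OF bh st]]) (auto simp: F2_def)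
    also have "prob E * (prob E' * prob y) = prob (E \<inter> E') * prob y"
      using indep_setD[OF ind' subsetD[OF F1' x(2)] subsetD[OF F2' x(3)]] by simp
    finally show "prob (x \<inter> y) = prob x * prob y" by (simp add: x)
  qed
  moreover have "Int_stable P"
  proof (rule Int_stableI)
    fix x y assume "x \<in> P" "y \<in> P"
    then obtain E E' G G' where "x = E \<inter> E'" "y = G \<inter> G'" "E \<in> sets F1" "E' \<in> sets F2" "G \<in> sets F1" "G' \<in> sets F2"
      unfolding P_def by blast
    then show "x \<inter> y \<in> P" unfolding P_def by (intro CollectI exI[of _ "E \<inter> G"] exI[of _ "E' \<inter> G'"]) auto
  qed
  moreover have "Int_stable ?D"
  proof (rule Int_stableI)
    fix x y assume "x \<in> ?D" "y \<in> ?D"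
    then obtain C C' where "x = (\<lambda>\<omega>. bh t \<omega> - bh s \<omega>) -` C \<inter> space M" "y = (\<lambda>\<omega>. bh t \<omega> - bh s \<omega>) -` C' \<inter> space M"
      "C \<in> sets borel" "C' \<in> sets borel" by blast
    then have "x \<inter> y = (\<lambda>\<omega>. bh t \<omega> - bh s \<omega>) -` (C \<inter> C') \<inter> space M" "C \<inter> C' \<in> sets borel" by auto
    then show "x \<inter> y \<in> ?D" by blast
  qed
  ultimately have "indep_set (sigma_sets (space M) P) (sigma_sets (space M) ?D)" by (rule indep_set_sigma_sets)
  then show ?thesis
  proof (rule indep_set_mono)
    have PP: "P \<subseteq> Pow (space M)" unfolding P_def using sets.sets_into_space sF by fastforce
    define S where "S = sigma (space M) P"
    have S: "space S = space M" "sets S = sigma_sets (space M) P" using PP by (auto simp: S_def)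
    have F1S: "subalgebra S F1" unfolding subalgebra_def
    proof (intro conjI subsetI)
      fix E assume E: "E \<in> sets F1"
      \<comment> \<open>Intersecting with the whole space puts the events of either single process
        into \<open>P\<close>.\<close>
      then have "E = E \<inter> space F2" using sets.sets_into_space[OF E] sF by auto
      then have "E \<in> P" using E unfolding P_def by blast
      then show "E \<in> sets S" using S by auto
    qed (auto simp: S sF)
    have F2S: "subalgebra S F2" unfolding subalgebra_def
    proof (intro conjI subsetI)
      fix E assume E: "E \<in> sets F2"
      then have "E = space F1 \<inter> E" using sets.sets_into_space[OF E] sF by auto
      then have "E \<in> P" using E unfolding P_def by blast
      then show "E \<in> sets S" using S by auto
    qed (auto simp: S sF)
    have "sets (joint_filt M b bh s) \<subseteq> sets S"
      unfolding natural_filtration_def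
    proof (rule generated_algebra_subset)
      fix u assume u: "u \<in> {0..s}"
      have "b u \<in> borel_measurable S" "bh u \<in> borel_measurable S"
        using u unfolding F1_def F2_def
        by (auto intro: measurable_from_subalg[OF F1S[unfolded F1_def] measurable_generated_algebra]
            measurable_from_subalg[OF F2S[unfolded F2_def] measurable_generated_algebra])
      then show "(\<lambda>\<omega>. (b u \<omega>, bh u \<omega>)) \<in> borel_measurable S" by (rule borel_measurable_Pair)
    qed (rule S)
    then show "sets (joint_filt M b bh s) \<subseteq> sigma_sets (space M) P" by (simp add: S)
  qed auto
qed

end

section \<open>The Ito isometry\<close>

abbreviation lborel_on :: "real \<Rightarrow> real measure" where
  "lborel_on t \<equiv> restrict_space lborel {0..t}"

lemma component_measurable: "f \<in> borel_measurable N \<Longrightarrow> (\<lambda>x. (f x :: real^'m) $ i) \<in> borel_measurable N"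
  using measurable_compose[of f N borel "\<lambda>x. x $ i" borel]
  by (simp add: borel_measurable_continuous_onI continuous_intros)

lemma bounded_mult_image:
  assumes "bounded (h ` S)" "bounded (h' ` S)" shows "bounded ((\<lambda>x. h x * h' x :: real) ` S)"
proof -
  obtain C C' where "\<And>x. x \<in> S \<Longrightarrow> \<bar>h x\<bar> \<le> C" "\<And>x. x \<in> S \<Longrightarrow> \<bar>h' x\<bar> \<le> C'"
    using assms by (auto simp: bounded_iff)
  then have "\<bar>h x * h' x\<bar> \<le> C * C'" if "x \<in> S" for x
    unfolding abs_mult using that by (intro mult_mono) (auto intro: order_trans[OF abs_ge_zero])
  then show ?thesis unfolding bounded_iff by auto
qed

text \<open>The deterministic counterpart of \<open>ito_isometry_pair\<close>: both produce the
  length of the overlap of two intervals, which is the whole content of the isometry.\<close>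

lemma overlap_integral:
  fixes a b' c d t :: real
  assumes "0 \<le> a" "0 \<le> c" "a \<le> b'" "c \<le> d" "b' \<le> t" "d \<le> t"
  shows "integrable (lborel_on t) (\<lambda>s. indicator {a<..b'} s * indicator {c<..d} s :: real)"
   and "(\<integral>s. indicator {a<..b'} s * indicator {c<..d} s \<partial>lborel_on t) = max 0 (min b' d - max a c)"
proof -
  have e: "indicator {0..t} s *\<^sub>R (indicator {a<..b'} s * indicator {c<..d} s) = (indicator {max a c<..min b' d} s :: real)" for s
    using assms by (auto simp: indicator_def less_max_iff_disj min_le_iff_disj max_less_iff_conj)
  have S: "{0..t} \<inter> space lborel \<in> sets lborel" by simp
  show "integrable (lborel_on t) (\<lambda>s. indicator {a<..b'} s * indicator {c<..d} s :: real)"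
    unfolding integrable_restrict_space[OF S] e
    by (cases "max a c \<le> min b' d") auto
  show "(\<integral>s. indicator {a<..b'} s * indicator {c<..d} s \<partial>lborel_on t) = max 0 (min b' d - max a c)"
    unfolding integral_restrict_space[OF S] e
    by (cases "max a c \<le> min b' d") (auto simp: measure_def)
qed

lemma integral_double_sum:
  fixes f :: "'j \<Rightarrow> 'j \<Rightarrow> 'z \<Rightarrow> real"
  assumes i: "\<And>j l. j \<in> J \<Longrightarrow> l \<in> J \<Longrightarrow> integrable N (f j l)"
    and v: "\<And>j l. j \<in> J \<Longrightarrow> l \<in> J \<Longrightarrow> integral\<^sup>L N (f j l) = v j l"
  shows "(\<integral>x. (\<Sum>j\<in>J. \<Sum>l\<in>J. f j l x) \<partial>N) = (\<Sum>j\<in>J. \<Sum>l\<in>J. v j l)"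
proof -
  have "(\<integral>x. (\<Sum>j\<in>J. \<Sum>l\<in>J. f j l x) \<partial>N) = (\<Sum>j\<in>J. \<integral>x. (\<Sum>l\<in>J. f j l x) \<partial>N)"
    by (intro Bochner_Integration.integral_sum Bochner_Integration.integrable_sum i)
  also have "\<dots> = (\<Sum>j\<in>J. \<Sum>l\<in>J. integral\<^sup>L N (f j l))"
    by (intro sum.cong refl Bochner_Integration.integral_sum i)
  finally show ?thesis by (simp add: v)
qed

context
  fixes M :: "'w measure" and b :: "real \<Rightarrow> 'w \<Rightarrow> real ^ 'd" and bh :: "real \<Rightarrow> 'w \<Rightarrow> real ^ 'e"
  assumes b: "brownian_motion M b" and bh: "brownian_motion M bh" and ind: "indep_processes M b bh"
begin

interpretation prob_space M by (rule bm_prob_space[OF b])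

abbreviation (input) "incr i s t \<omega> \<equiv> (bh t \<omega> - bh s \<omega>) $ i"

lemma incr_moments:
  assumes "0 \<le> s" "s \<le> t"
  shows "integrable M (incr i s t)" "integrable M (\<lambda>\<omega>. (incr i s t \<omega>)\<^sup>2)"
    "(\<integral>\<omega>. incr i s t \<omega> \<partial>M) = 0" "(\<integral>\<omega>. (incr i s t \<omega>)\<^sup>2 \<partial>M) = t - s"
proof -
  have "integrable M (incr i s t) \<and> integrable M (\<lambda>\<omega>. (incr i s t \<omega>)\<^sup>2) \<and>
    (\<integral>\<omega>. incr i s t \<omega> \<partial>M) = 0 \<and> (\<integral>\<omega>. (incr i s t \<omega>)\<^sup>2 \<partial>M) = t - s"
  proof (cases "s = t")
    case False
    with assms have "s < t" by simp
    then have "0 < sqrt (t - s)" by simp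
    note nm = normal_moments[OF bm_prob_space[OF b] this
      distributed_prod_normal_component[OF bm_prob_space[OF b] this bm_incr[OF bh assms(1) \<open>s < t\<close>], of i]]
    show ?thesis using nm \<open>s < t\<close> by simp
  qed simp
  then show "integrable M (incr i s t)" "integrable M (\<lambda>\<omega>. (incr i s t \<omega>)\<^sup>2)"
    "(\<integral>\<omega>. incr i s t \<omega> \<partial>M) = 0" "(\<integral>\<omega>. (incr i s t \<omega>)\<^sup>2 \<partial>M) = t - s" by auto
qed

lemma incr_measurable: "0 \<le> s \<Longrightarrow> 0 \<le> t \<Longrightarrow> incr i s t \<in> borel_measurable M"
  by (intro component_measurable borel_measurable_diff bm_measurable[OF bh])

lemma incr_measurable_filt: "0 \<le> s \<Longrightarrow> 0 \<le> t \<Longrightarrow> s \<le> c \<Longrightarrow> t \<le> c \<Longrightarrow> incr i s t \<in> borel_measurable (joint_filt M b bh c)"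
  by (intro component_measurable borel_measurable_diff measurable_filt_bh[OF b bh ind])

lemma incr_indep_filt:
  fixes g :: "real \<Rightarrow> real"
  assumes st: "0 \<le> s" "s \<le> t" and Y: "Y \<in> borel_measurable (joint_filt M b bh s)" and g: "g \<in> borel_measurable borel"
  shows "indep_var borel Y borel (\<lambda>\<omega>. g (incr i s t \<omega>))"
proof (rule indep_var_of_indep_set[OF filt_indep_future[OF b bh ind st]])
  show "Y \<in> borel_measurable M" by (rule measurable_filt[OF b bh ind Y])
  show "(\<lambda>\<omega>. g (incr i s t \<omega>)) \<in> borel_measurable M"
    using st g by (intro measurable_compose[OF incr_measurable g]) auto
  show "Y -` E \<inter> space M \<in> sets (joint_filt M b bh s)" if "E \<in> sets borel" for E
    using measurable_sets[OF Y that] by (simp add: space_filt[OF b bh ind])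
  fix E :: "real set" assume E: "E \<in> sets borel"
  have [measurable]: "(\<lambda>x::real^'e. g (x $ i)) \<in> borel_measurable borel"
    using component_measurable[of "\<lambda>x::real^'e. x" borel i] g by (auto intro: measurable_compose)
  have "(\<lambda>x::real^'e. g (x $ i)) -` E \<in> sets borel"
    using measurable_sets[of "\<lambda>x::real^'e. g (x $ i)" borel borel E] E by simp
  moreover have "(\<lambda>\<omega>. g (incr i s t \<omega>)) -` E \<inter> space M
      = (\<lambda>\<omega>. bh t \<omega> - bh s \<omega>) -` ((\<lambda>x::real^'e. g (x $ i)) -` E) \<inter> space M" by auto
  ultimately show "(\<lambda>\<omega>. g (incr i s t \<omega>)) -` E \<inter> space M
      \<in> {(\<lambda>\<omega>. bh t \<omega> - bh s \<omega>) -` C \<inter> space M |C. C \<in> sets borel}" by blast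
qed

text \<open>The increment is independent of the joint past, centred and of variance
  \<open>t - s\<close>. The factor \<open>Y\<close> is merely integrable because in the isometry it
  contains earlier increments, which are unbounded.\<close>

lemma incr_future:
  fixes Y :: "'w \<Rightarrow> real"
  assumes st: "0 \<le> s" "s \<le> t" and Y: "Y \<in> borel_measurable (joint_filt M b bh s)" and iY: "integrable M Y"
  shows "integrable M (\<lambda>\<omega>. Y \<omega> * incr i s t \<omega>)" "(\<integral>\<omega>. Y \<omega> * incr i s t \<omega> \<partial>M) = 0"
    "integrable M (\<lambda>\<omega>. Y \<omega> * (incr i s t \<omega>)\<^sup>2)" "(\<integral>\<omega>. Y \<omega> * (incr i s t \<omega>)\<^sup>2 \<partial>M) = (t - s) * (\<integral>\<omega>. Y \<omega> \<partial>M)"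
  using indep_var_integrable[OF incr_indep_filt[OF st Y, of "\<lambda>x. x" i] iY]
    indep_var_lebesgue_integral[OF incr_indep_filt[OF st Y, of "\<lambda>x. x" i] iY]
    indep_var_integrable[OF incr_indep_filt[OF st Y, of "\<lambda>x. x\<^sup>2" i] iY]
    indep_var_lebesgue_integral[OF incr_indep_filt[OF st Y, of "\<lambda>x. x\<^sup>2" i] iY]
    incr_moments[OF st, of i] by simp_all

lemma integrable_bounded_measurable:
  assumes h: "h \<in> borel_measurable M" "bounded (h ` space M)" and "integrable M Z"
  shows "integrable M (\<lambda>\<omega>. h \<omega> * Z \<omega> :: real)"
proof -
  obtain C where C: "\<And>\<omega>. \<omega> \<in> space M \<Longrightarrow> \<bar>h \<omega>\<bar> \<le> C" using h(2) by (auto simp: bounded_iff)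
  show ?thesis
  proof (rule Bochner_Integration.integrable_bound)
    show "integrable M (\<lambda>\<omega>. C * Z \<omega>)" using assms by simp
    show "AE \<omega> in M. norm (h \<omega> * Z \<omega>) \<le> norm (C * Z \<omega>)"
      using C by (intro AE_I2) (auto simp: abs_mult intro!: mult_right_mono order_trans[OF C])
  qed (use h assms in auto)
qed

text \<open>Cutting the intervals at \<open>c\<close> and at \<open>m = min b' d\<close> leaves a
  single squared increment, over the overlap. Every other product ends in an increment that is
  centred and independent of what precedes it.\<close>

lemma ito_isometry_pair_ordered:
  assumes ac: "0 \<le> a" "a \<le> c" "a \<le> b'" "c \<le> d"
    and h: "h \<in> borel_measurable (joint_filt M b bh a)" "bounded (h ` space M)"
    and h': "h' \<in> borel_measurable (joint_filt M b bh c)" "bounded (h' ` space M)"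
  shows "integrable M (\<lambda>\<omega>. (h \<omega> * h' \<omega>) * (incr i a b' \<omega> * incr i c d \<omega>))"
   and "(\<integral>\<omega>. (h \<omega> * h' \<omega>) * (incr i a b' \<omega> * incr i c d \<omega>) \<partial>M) = max 0 (min b' d - c) * (\<integral>\<omega>. h \<omega> * h' \<omega> \<partial>M)"
proof -
  define H where "H \<omega> = h \<omega> * h' \<omega>" for \<omega>
  have H: "H \<in> borel_measurable (joint_filt M b bh c)" "bounded (H ` space M)"
    unfolding H_def using h h' ac measurable_filt_mono[OF b bh ind h(1) ac(2)] by (auto intro: bounded_mult_image)
  have HM: "H \<in> borel_measurable M" by (rule measurable_filt[OF b bh ind H(1)])
  have iH: "integrable M H" using integrable_bounded_measurable[OF HM H(2), of "\<lambda>_. 1"] by simp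
  have Hinc: "(\<lambda>\<omega>. H \<omega> * incr i a x \<omega>) \<in> borel_measurable (joint_filt M b bh c)" "integrable M (\<lambda>\<omega>. H \<omega> * incr i a x \<omega>)"
    if "a \<le> x" "x \<le> c" for x
    using that ac by (intro borel_measurable_times H incr_measurable_filt integrable_bounded_measurable HM incr_moments; linarith)+
  have "integrable M (\<lambda>\<omega>. H \<omega> * (incr i a b' \<omega> * incr i c d \<omega>)) \<and>
    (\<integral>\<omega>. H \<omega> * (incr i a b' \<omega> * incr i c d \<omega>) \<partial>M) = max 0 (min b' d - c) * (\<integral>\<omega>. H \<omega> \<partial>M)"
  proof (cases "b' \<le> c")
    case True
    have "integrable M (\<lambda>\<omega>. H \<omega> * incr i a b' \<omega> * incr i c d \<omega>)" "(\<integral>\<omega>. H \<omega> * incr i a b' \<omega> * incr i c d \<omega> \<partial>M) = 0"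
      using incr_future(1,2)[where s=c and t=d and i=i, OF _ _ Hinc(1)[of b'] Hinc(2)[of b']] ac True by auto
    then show ?thesis using True by (simp add: mult.assoc)
  next
    case False
    define m where "m = min b' d"
    have m: "c \<le> m" "m \<le> b'" "m \<le> d" "m = b' \<or> m = d" using False ac by (auto simp: m_def)
    have Hm: "(\<lambda>\<omega>. H \<omega> * incr i c m \<omega>) \<in> borel_measurable (joint_filt M b bh m)" "integrable M (\<lambda>\<omega>. H \<omega> * incr i c m \<omega>)"
      using m ac by (intro borel_measurable_times measurable_filt_mono[OF b bh ind H(1) m(1)] incr_measurable_filt
          integrable_bounded_measurable HM H incr_moments; linarith)+
    \<comment> \<open>At least one of the increments from \<open>m\<close> to \<open>b'\<close> and
      from \<open>m\<close> to \<open>d\<close> vanishes, so their product does not occur.\<close>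
    have e: "H \<omega> * (incr i a b' \<omega> * incr i c d \<omega>) = H \<omega> * incr i a c \<omega> * incr i c d \<omega> + H \<omega> * (incr i c m \<omega>)\<^sup>2
       + H \<omega> * incr i c m \<omega> * incr i m b' \<omega> + H \<omega> * incr i c m \<omega> * incr i m d \<omega>" for \<omega>
      using m(4) by (auto simp: algebra_simps power2_eq_square)
    have 1: "integrable M (\<lambda>\<omega>. H \<omega> * incr i a c \<omega> * incr i c d \<omega>)" "(\<integral>\<omega>. H \<omega> * incr i a c \<omega> * incr i c d \<omega> \<partial>M) = 0"
      using incr_future(1,2)[where s=c and t=d and i=i, OF _ _ Hinc(1)[of c] Hinc(2)[of c]] ac by auto
    have 2: "integrable M (\<lambda>\<omega>. H \<omega> * (incr i c m \<omega>)\<^sup>2)" "(\<integral>\<omega>. H \<omega> * (incr i c m \<omega>)\<^sup>2 \<partial>M) = (m - c) * integral\<^sup>L M H"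
      using incr_future[OF _ m(1) H(1) iH, of i] ac by auto
    have 3: "integrable M (\<lambda>\<omega>. H \<omega> * incr i c m \<omega> * incr i m x \<omega>)" "(\<integral>\<omega>. H \<omega> * incr i c m \<omega> * incr i m x \<omega> \<partial>M) = 0"
      if "m \<le> x" for x
      using incr_future[OF _ that Hm, of i] ac m by auto
    show ?thesis unfolding e using 1 2 3[OF m(2)] 3[OF m(3)] m by (simp add: m_def)
  qed
  then show "integrable M (\<lambda>\<omega>. (h \<omega> * h' \<omega>) * (incr i a b' \<omega> * incr i c d \<omega>))"
    "(\<integral>\<omega>. (h \<omega> * h' \<omega>) * (incr i a b' \<omega> * incr i c d \<omega>) \<partial>M) = max 0 (min b' d - c) * (\<integral>\<omega>. h \<omega> * h' \<omega> \<partial>M)"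
    by (simp_all add: H_def)
qed

lemma ito_isometry_pair:
  assumes ac: "0 \<le> a" "0 \<le> c" "a \<le> b'" "c \<le> d"
    and h: "h \<in> borel_measurable (joint_filt M b bh a)" "bounded (h ` space M)"
    and h': "h' \<in> borel_measurable (joint_filt M b bh c)" "bounded (h' ` space M)"
  shows "integrable M (\<lambda>\<omega>. (h \<omega> * h' \<omega>) * (incr i a b' \<omega> * incr i c d \<omega>))" (is ?A)
   and "(\<integral>\<omega>. (h \<omega> * h' \<omega>) * (incr i a b' \<omega> * incr i c d \<omega>) \<partial>M)
      = max 0 (min b' d - max a c) * (\<integral>\<omega>. h \<omega> * h' \<omega> \<partial>M)" (is ?B)
proof -
  have "?A \<and> ?B"
  proof (cases "a \<le> c")
    case True
    then show ?thesis using ito_isometry_pair_ordered[OF ac(1) True ac(3,4) h h', of i] by simp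
  next
    case False
    then show ?thesis using ito_isometry_pair_ordered[OF ac(2) _ ac(4,3) h' h, of i]
      by (simp add: mult.commute min.commute)
  qed
  then show ?A ?B by auto
qed

text \<open>The intervals may overlap in any way, so the difference of two simple integrals over
  different partitions is covered without a common refinement.\<close>

lemma ito_isometry_sum:
  fixes J :: "'j set"
  assumes J: "finite J"
    and ab: "\<And>j. j \<in> J \<Longrightarrow> 0 \<le> \<alpha> j" "\<And>j. j \<in> J \<Longrightarrow> \<alpha> j \<le> \<beta> j" "\<And>j. j \<in> J \<Longrightarrow> \<beta> j \<le> t"
    and g: "\<And>j. j \<in> J \<Longrightarrow> g j \<in> borel_measurable (joint_filt M b bh (\<alpha> j))" "\<And>j. j \<in> J \<Longrightarrow> bounded (g j ` space M)"
  shows "(\<integral>\<^sup>+\<omega>. ennreal ((norm (\<Sum>j\<in>J. g j \<omega> *\<^sub>R (bh (\<beta> j) \<omega> - bh (\<alpha> j) \<omega>)))\<^sup>2) \<partial>M)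
    = ennreal CARD('e) * (\<integral>\<^sup>+(s, \<omega>). ennreal ((\<Sum>j\<in>J. g j \<omega> * indicator {\<alpha> j<..\<beta> j} s)\<^sup>2)
        \<partial>(lborel_on t \<Otimes>\<^sub>M M))"
proof -
  define \<Lambda> where "\<Lambda> j l = max 0 (min (\<beta> j) (\<beta> l) - max (\<alpha> j) (\<alpha> l))" for j l
  have gM: "g j \<in> borel_measurable M" if "j \<in> J" for j by (rule measurable_filt[OF b bh ind g(1)[OF that]])
  have igg: "integrable M (\<lambda>\<omega>. g j \<omega> * g l \<omega>)" if "j \<in> J" "l \<in> J" for j l
    using integrable_bounded_measurable[OF gM g(2) integrable_bounded_measurable[OF gM g(2), of _ "\<lambda>_. 1"]] that by simp
  define E where "E = (\<Sum>j\<in>J. \<Sum>l\<in>J. \<Lambda> j l * (\<integral>\<omega>. g j \<omega> * g l \<omega> \<partial>M))"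
  have sq: "(\<Sum>j\<in>J. g j \<omega> * f j)\<^sup>2 = (\<Sum>j\<in>J. \<Sum>l\<in>J. (g j \<omega> * g l \<omega>) * (f j * f l))" for \<omega> and f :: "'j \<Rightarrow> real"
    by (simp add: power2_eq_square sum_product mult_ac)
  have nrm: "(norm (\<Sum>j\<in>J. g j \<omega> *\<^sub>R (bh (\<beta> j) \<omega> - bh (\<alpha> j) \<omega>)))\<^sup>2
     = (\<Sum>i\<in>UNIV. \<Sum>j\<in>J. \<Sum>l\<in>J. (g j \<omega> * g l \<omega>) * (incr i (\<alpha> j) (\<beta> j) \<omega> * incr i (\<alpha> l) (\<beta> l) \<omega>))" for \<omega>
  proof -
    have "(norm (\<Sum>j\<in>J. g j \<omega> *\<^sub>R (bh (\<beta> j) \<omega> - bh (\<alpha> j) \<omega>)))\<^sup>2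
      = (\<Sum>i\<in>UNIV. (\<Sum>j\<in>J. g j \<omega> * incr i (\<alpha> j) (\<beta> j) \<omega>)\<^sup>2)"
      by (simp add: power2_norm_eq_inner inner_vec_def sum_component) (simp add: power2_eq_square)
    then show ?thesis unfolding sq .
  qed
  have ip: "integrable M (\<lambda>\<omega>. (g j \<omega> * g l \<omega>) * (incr i (\<alpha> j) (\<beta> j) \<omega> * incr i (\<alpha> l) (\<beta> l) \<omega>))"
    "(\<integral>\<omega>. (g j \<omega> * g l \<omega>) * (incr i (\<alpha> j) (\<beta> j) \<omega> * incr i (\<alpha> l) (\<beta> l) \<omega>) \<partial>M) = \<Lambda> j l * (\<integral>\<omega>. g j \<omega> * g l \<omega> \<partial>M)"
    if "j \<in> J" "l \<in> J" for j l i
    unfolding \<Lambda>_def using that by (intro ito_isometry_pair ab g; simp)+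
  have "(\<integral>\<^sup>+\<omega>. ennreal ((norm (\<Sum>j\<in>J. g j \<omega> *\<^sub>R (bh (\<beta> j) \<omega> - bh (\<alpha> j) \<omega>)))\<^sup>2) \<partial>M)
     = ennreal (\<integral>\<omega>. (norm (\<Sum>j\<in>J. g j \<omega> *\<^sub>R (bh (\<beta> j) \<omega> - bh (\<alpha> j) \<omega>)))\<^sup>2 \<partial>M)"
  proof (rule nn_integral_eq_integral)
    show "integrable M (\<lambda>\<omega>. (norm (\<Sum>j\<in>J. g j \<omega> *\<^sub>R (bh (\<beta> j) \<omega> - bh (\<alpha> j) \<omega>)))\<^sup>2)"
      unfolding nrm by (intro Bochner_Integration.integrable_sum ip)
  qed simp
  \<comment> \<open>Every component of \<open>bh\<close> contributes the same amount
    \<open>E\<close>; this is the origin of the factor \<open>CARD('e)\<close>.\<close>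
  also have "\<dots> = ennreal (\<Sum>i\<in>(UNIV :: 'e set). E)"
    unfolding nrm E_def
    by (simp add: Bochner_Integration.integral_sum Bochner_Integration.integrable_sum ip del: sum_constant vector_minus_component)
  also have "\<dots> = ennreal CARD('e) * ennreal E"
    by (simp add: ennreal_mult')
  finally have L: "(\<integral>\<^sup>+\<omega>. ennreal ((norm (\<Sum>j\<in>J. g j \<omega> *\<^sub>R (bh (\<beta> j) \<omega> - bh (\<alpha> j) \<omega>)))\<^sup>2) \<partial>M) = ennreal CARD('e) * ennreal E" .
  define R where "R = lborel_on t"
  interpret R: sigma_finite_measure R unfolding R_def
    by (intro sigma_finite_measure_restrict_space) (auto simp: lborel.sigma_finite_measure_axioms)
  interpret P: pair_sigma_finite R M ..
  have gJ[measurable]: "(\<lambda>x. g j (snd x)) \<in> borel_measurable (R \<Otimes>\<^sub>M M)" if "j \<in> J" for j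
    using gM[OF that] by measurable
  have indR[measurable]: "(\<lambda>x. indicator {\<alpha> j<..\<beta> j} (fst x) :: real) \<in> borel_measurable (R \<Otimes>\<^sub>M M)" for j
    unfolding R_def by (intro measurable_compose[OF measurable_fst] measurable_restrict_space1) simp
  have [measurable]: "(\<lambda>x. ennreal ((\<Sum>j\<in>J. g j (snd x) * indicator {\<alpha> j<..\<beta> j} (fst x))\<^sup>2)) \<in> borel_measurable (R \<Otimes>\<^sub>M M)"
    by (intro measurable_compose[OF _ measurable_ennreal] borel_measurable_power borel_measurable_sum borel_measurable_times gJ indR)
  have "(\<integral>\<^sup>+(s, \<omega>). ennreal ((\<Sum>j\<in>J. g j \<omega> * indicator {\<alpha> j<..\<beta> j} s)\<^sup>2) \<partial>(R \<Otimes>\<^sub>M M))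
      = (\<integral>\<^sup>+\<omega>. \<integral>\<^sup>+s. ennreal ((\<Sum>j\<in>J. g j \<omega> * indicator {\<alpha> j<..\<beta> j} s)\<^sup>2) \<partial>R \<partial>M)"
    by (subst P.nn_integral_snd[symmetric]) (simp_all add: split_beta')
  also have "\<dots> = (\<integral>\<^sup>+\<omega>. ennreal (\<Sum>j\<in>J. \<Sum>l\<in>J. (g j \<omega> * g l \<omega>) * \<Lambda> j l) \<partial>M)"
  proof (rule nn_integral_cong)
    fix \<omega>
    have i: "integrable R (\<lambda>s. (g j \<omega> * g l \<omega>) * (indicator {\<alpha> j<..\<beta> j} s * indicator {\<alpha> l<..\<beta> l} s))"
      "(\<integral>s. indicator {\<alpha> j<..\<beta> j} s * indicator {\<alpha> l<..\<beta> l} s \<partial>R) = \<Lambda> j l" if "j \<in> J" "l \<in> J" for j l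
      using that overlap_integral[of "\<alpha> j" "\<alpha> l" "\<beta> j" "\<beta> l" t] ab by (auto simp: R_def \<Lambda>_def)
    have "(\<integral>\<^sup>+s. ennreal ((\<Sum>j\<in>J. g j \<omega> * indicator {\<alpha> j<..\<beta> j} s)\<^sup>2) \<partial>R)
        = ennreal (\<integral>s. (\<Sum>j\<in>J. g j \<omega> * indicator {\<alpha> j<..\<beta> j} s)\<^sup>2 \<partial>R)"
      unfolding sq by (intro nn_integral_eq_integral Bochner_Integration.integrable_sum i) (auto simp: sq[symmetric])
    also have "(\<integral>s. (\<Sum>j\<in>J. g j \<omega> * indicator {\<alpha> j<..\<beta> j} s)\<^sup>2 \<partial>R) = (\<Sum>j\<in>J. \<Sum>l\<in>J. (g j \<omega> * g l \<omega>) * \<Lambda> j l)"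
      unfolding sq by (intro integral_double_sum i) (use i in simp_all)
    finally show "(\<integral>\<^sup>+s. ennreal ((\<Sum>j\<in>J. g j \<omega> * indicator {\<alpha> j<..\<beta> j} s)\<^sup>2) \<partial>R)
       = ennreal (\<Sum>j\<in>J. \<Sum>l\<in>J. (g j \<omega> * g l \<omega>) * \<Lambda> j l)" .
  qed
  also have "\<dots> = ennreal (\<integral>\<omega>. (\<Sum>j\<in>J. \<Sum>l\<in>J. (g j \<omega> * g l \<omega>) * \<Lambda> j l) \<partial>M)"
  proof (intro nn_integral_eq_integral Bochner_Integration.integrable_sum integrable_mult_left igg AE_I2)
    fix \<omega>
    have i: "integrable R (\<lambda>s. (g j \<omega> * g l \<omega>) * (indicator {\<alpha> j<..\<beta> j} s * indicator {\<alpha> l<..\<beta> l} s))"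
      "(\<integral>s. indicator {\<alpha> j<..\<beta> j} s * indicator {\<alpha> l<..\<beta> l} s \<partial>R) = \<Lambda> j l" if "j \<in> J" "l \<in> J" for j l
      using that overlap_integral[of "\<alpha> j" "\<alpha> l" "\<beta> j" "\<beta> l" t] ab by (auto simp: R_def \<Lambda>_def)
    \<comment> \<open>The quadratic form in the overlaps is nonnegative because it is the integral
      of a square.\<close>
    have "0 \<le> (\<integral>s. (\<Sum>j\<in>J. g j \<omega> * indicator {\<alpha> j<..\<beta> j} s)\<^sup>2 \<partial>R)" by simp
    also have "(\<integral>s. (\<Sum>j\<in>J. g j \<omega> * indicator {\<alpha> j<..\<beta> j} s)\<^sup>2 \<partial>R) = (\<Sum>j\<in>J. \<Sum>l\<in>J. (g j \<omega> * g l \<omega>) * \<Lambda> j l)"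
      unfolding sq by (intro integral_double_sum i) (use i in simp_all)
    finally show "0 \<le> (\<Sum>j\<in>J. \<Sum>l\<in>J. (g j \<omega> * g l \<omega>) * \<Lambda> j l)" .
  qed
  also have "\<dots> = ennreal E"
    unfolding E_def by (intro arg_cong[where f=ennreal] integral_double_sum integrable_mult_left igg) (auto simp: mult.commute)
  finally show ?thesis unfolding L R_def by simp
qed

end

section \<open>Brownian motion as bridge plus end point\<close>

lemma integrable_product_L2:
  fixes X Y :: "'a \<Rightarrow> real"
  assumes [measurable]: "X \<in> borel_measurable M" "Y \<in> borel_measurable M"
    and "integrable M (\<lambda>x. (X x)\<^sup>2)" "integrable M (\<lambda>x. (Y x)\<^sup>2)"
  shows "integrable M (\<lambda>x. X x * Y x)"
proof (rule Bochner_Integration.integrable_bound)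
  show "integrable M (\<lambda>x. (X x)\<^sup>2 + (Y x)\<^sup>2)" using assms by simp
  show "AE x in M. norm (X x * Y x) \<le> norm ((X x)\<^sup>2 + (Y x)\<^sup>2)"
  proof (intro AE_I2)
    fix x
    have "0 \<le> (\<bar>X x\<bar> - \<bar>Y x\<bar>)\<^sup>2" by simp
    then have "2 * (\<bar>X x\<bar> * \<bar>Y x\<bar>) \<le> (X x)\<^sup>2 + (Y x)\<^sup>2" by (simp add: power2_diff)
    moreover have "0 \<le> \<bar>X x\<bar> * \<bar>Y x\<bar>" by simp
    ultimately have "\<bar>X x\<bar> * \<bar>Y x\<bar> \<le> (X x)\<^sup>2 + (Y x)\<^sup>2" by linarith
    then show "norm (X x * Y x) \<le> norm ((X x)\<^sup>2 + (Y x)\<^sup>2)" by (simp add: abs_mult)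
  qed
qed simp

lemma integrable_iexp_real:
  assumes "prob_space M" "X \<in> borel_measurable M"
  shows "integrable M (\<lambda>x. iexp (X x))"
  using assms by (intro prob_space.integrable_iexp) auto

section \<open>Covariance and characteristic function of the pinned measure\<close>

context
  fixes T :: real and \<mu> :: "(real \<Rightarrow> real ^ 'd) measure"
  assumes T: "T > 0" and pw: "pinned_wiener_measure T \<mu>"
begin

lemma pinned_prob_space: "prob_space \<mu>"
  using pw by (simp add: pinned_wiener_measure_def)

lemma space_pinned: "space \<mu> = pinned_paths T"
proof -
  have "sets \<mu> = sets (restrict_space (Pi\<^sub>M {0..T} (\<lambda>_. borel)) (pinned_paths T))"
    using pw by (simp add: pinned_wiener_measure_def)
  from sets_eq_imp_space_eq[OF this] show ?thesis
    by (auto simp: space_restrict_space space_PiM pinned_paths_def PiE_def)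
qed

lemma pinned_coord_measurable:
  assumes "t \<in> {0..T}" shows "(\<lambda>w. w t) \<in> borel_measurable \<mu>"
proof -
  have "(\<lambda>w. w t) \<in> borel_measurable (restrict_space (Pi\<^sub>M {0..T} (\<lambda>_. borel)) (pinned_paths T))"
    using assms by (intro measurable_restrict_space1 measurable_component_singleton)
  moreover have "sets \<mu> = sets (restrict_space (Pi\<^sub>M {0..T} (\<lambda>_. borel)) (pinned_paths T))"
    using pw by (simp add: pinned_wiener_measure_def)
  ultimately show ?thesis using measurable_cong_sets by blast
qed

lemma pinned_path_cont: "w \<in> space \<mu> \<Longrightarrow> continuous_on {0..T} w"
  and pinned_path_T: "w \<in> space \<mu> \<Longrightarrow> w T = 0"
  by (auto simp: space_pinned pinned_paths_def)

interpretation prob_space \<mu> by (rule pinned_prob_space)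

lemma pinned_gaussian:
  "finite J \<Longrightarrow> J \<subseteq> {0..T} \<Longrightarrow> gaussian_rv \<mu> (\<lambda>w. \<Sum>t\<in>J. c t \<bullet> w t)"
  using pw by (simp add: pinned_wiener_measure_def)

lemma pinned_coord_gaussian: "t \<in> {0..T} \<Longrightarrow> gaussian_rv \<mu> (\<lambda>w. w t $ i)"
  using pinned_gaussian[of "{t}" "\<lambda>_. axis i 1"] by (simp add: inner_axis')

lemma pinned_products:
  assumes "s \<in> {0..T}" "t \<in> {0..T}"
  shows "integrable \<mu> (\<lambda>w. w s $ i * w t $ j)"
    "(\<integral>w. w s $ i * w t $ j \<partial>\<mu>) = (if i = j then min t s - t * s / T else 0)"
proof -
  show "integrable \<mu> (\<lambda>w. w s $ i * w t $ j)"
    using assms gaussian_rv_integrable[OF pinned_prob_space pinned_coord_gaussian]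
    by (intro integrable_product_L2) auto
  show "(\<integral>w. w s $ i * w t $ j \<partial>\<mu>) = (if i = j then min t s - t * s / T else 0)"
    using pw assms by (simp add: pinned_wiener_measure_def)
qed

text \<open>The double sum is the variance of the linear combination. Covariances between different
  components vanish, which collapses the sum over components to inner products.\<close>

lemma bridge_char:
  assumes J: "finite J" "J \<subseteq> {0..T}"
  shows "(\<integral>w. iexp (\<Sum>t\<in>J. c t \<bullet> w t) \<partial>\<mu>)
     = of_real (exp (- (\<Sum>s\<in>J. \<Sum>t\<in>J. (c s \<bullet> c t) * (min s t - s * t / T)) / 2))"
proof -
  let ?X = "\<lambda>w. \<Sum>t\<in>J. c t \<bullet> w t"
  have X: "c t \<bullet> w t = (\<Sum>i\<in>UNIV. c t $ i * w t $ i)" for t w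
    by (simp add: inner_vec_def)
  have X': "?X w = (\<Sum>p\<in>J\<times>UNIV. c (fst p) $ snd p * w (fst p) $ snd p)" for w
    unfolding X by (simp add: sum.cartesian_product split_beta')
  have i1: "integrable \<mu> (\<lambda>w. c t $ i * w t $ i)" "(\<integral>w. c t $ i * w t $ i \<partial>\<mu>) = 0" if "t \<in> J" for t i
  proof -
    have t: "t \<in> {0..T}" using that J by auto
    show "integrable \<mu> (\<lambda>w. c t $ i * w t $ i)"
      using gaussian_rv_integrable(1)[OF pinned_prob_space pinned_coord_gaussian[OF t]] by simp
    show "(\<integral>w. c t $ i * w t $ i \<partial>\<mu>) = 0"
      using pw t by (simp add: pinned_wiener_measure_def)
  qed
  have m: "(\<integral>w. ?X w \<partial>\<mu>) = 0"
  proof -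
    have "(\<integral>w. (\<Sum>p\<in>J\<times>UNIV. c (fst p) $ snd p * w (fst p) $ snd p) \<partial>\<mu>)
        = (\<Sum>p\<in>J\<times>UNIV. \<integral>w. c (fst p) $ snd p * w (fst p) $ snd p \<partial>\<mu>)"
      by (intro Bochner_Integration.integral_sum i1) auto
    also have "\<dots> = 0" by (intro sum.neutral ballI i1) auto
    finally show ?thesis unfolding X' .
  qed
  have "(\<integral>w. (?X w)\<^sup>2 \<partial>\<mu>) = (\<integral>w. (\<Sum>p\<in>J\<times>UNIV. \<Sum>q\<in>J\<times>UNIV. (c (fst p) $ snd p * c (fst q) $ snd q) * (w (fst p) $ snd p * w (fst q) $ snd q)) \<partial>\<mu>)"
    unfolding X' by (simp add: power2_eq_square sum_product mult_ac)
  also have "\<dots> = (\<Sum>p\<in>J\<times>UNIV. \<Sum>q\<in>J\<times>UNIV. (c (fst p) $ snd p * c (fst q) $ snd q) *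
      (if snd p = snd q then min (fst q) (fst p) - fst q * fst p / T else 0))"
  proof (rule integral_double_sum)
    fix p q :: "real \<times> 'd" assume "p \<in> J \<times> UNIV" "q \<in> J \<times> UNIV"
    then have *: "fst p \<in> {0..T}" "fst q \<in> {0..T}" using J by auto
    show "integrable \<mu> (\<lambda>w. (c (fst p) $ snd p * c (fst q) $ snd q) * (w (fst p) $ snd p * w (fst q) $ snd q))"
      using pinned_products(1)[OF *] by simp
    show "(\<integral>w. (c (fst p) $ snd p * c (fst q) $ snd q) * (w (fst p) $ snd p * w (fst q) $ snd q) \<partial>\<mu>)
      = (c (fst p) $ snd p * c (fst q) $ snd q) *
      (if snd p = snd q then min (fst q) (fst p) - fst q * fst p / T else 0)"
      using pinned_products(2)[OF *] by simp
  qed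
  also have "\<dots> = (\<Sum>(s,i)\<in>J\<times>UNIV. \<Sum>(t,j)\<in>J\<times>UNIV. if j = i then (c s $ i * c t $ i) * (min s t - s * t / T) else 0)"
    by (intro sum.cong refl) (auto simp: split_beta' min.commute mult.commute intro!: sum.cong)
  also have "\<dots> = (\<Sum>s\<in>J. \<Sum>i\<in>UNIV. \<Sum>t\<in>J. \<Sum>j\<in>UNIV. if j = i then (c s $ i * c t $ i) * (min s t - s * t / T) else 0)"
    by (simp only: sum.cartesian_product[symmetric])
  also have "\<dots> = (\<Sum>s\<in>J. \<Sum>t\<in>J. \<Sum>i\<in>UNIV. (c s $ i * c t $ i) * (min s t - s * t / T))"
    by (subst sum.swap) simp
  also have "\<dots> = (\<Sum>s\<in>J. \<Sum>t\<in>J. (c s \<bullet> c t) * (min s t - s * t / T))"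
    by (simp add: inner_vec_def sum_distrib_right)
  finally show ?thesis
    using gaussian_rv_char[OF pinned_prob_space pinned_gaussian[OF J, of c] m] by simp
qed

end

section \<open>Brownian motion on a finite grid\<close>

context
  fixes M :: "'w measure" and B :: "real \<Rightarrow> 'w \<Rightarrow> real ^ 'n"
  assumes bm: "brownian_motion M B"
begin

interpretation prob_space M by (rule bm_prob_space[OF bm])

lemma bm_increments_char:
  assumes \<tau>: "0 \<le> \<tau> 0" "incseq \<tau>"
  shows "(\<integral>\<omega>. iexp (\<Sum>k<n. a k \<bullet> (B (\<tau> (Suc k)) \<omega> - B (\<tau> k) \<omega>)) \<partial>M)
    = of_real (exp (- (\<Sum>k<n. (norm (a k))\<^sup>2 * (\<tau> (Suc k) - \<tau> k)) / 2))"
proof -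
  let ?D = "\<lambda>k \<omega>. B (\<tau> (Suc k)) \<omega> - B (\<tau> k) \<omega>"
  have \<tau>0: "0 \<le> \<tau> k" for k using \<tau> by (meson incseq_def le0 order_trans)
  have Dm: "?D k \<in> borel_measurable M" for k by (intro borel_measurable_diff bm_measurable[OF bm] \<tau>0)
  have c: "(\<integral>\<omega>. iexp (a k \<bullet> ?D k \<omega>) \<partial>M) = of_real (exp (- (norm (a k))\<^sup>2 * (\<tau> (Suc k) - \<tau> k) / 2))" for k
  \<comment> \<open>Consecutive times may coincide; the increment is then 0 and contributes the
    factor 1.\<close>
  proof (cases "\<tau> k = \<tau> (Suc k)")
    case False
    with \<tau>(2) have lt: "\<tau> k < \<tau> (Suc k)" by (simp add: incseq_SucD order.not_eq_order_implies_strict)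
    show ?thesis using distributed_prod_normal_char[OF _ bm_incr[OF bm \<tau>0 lt], of "a k"] lt
      by (simp add: power_mult_distrib mult.commute)
  qed (simp add: prob_space)
  have "indep_vars (\<lambda>_. borel) (\<lambda>k \<omega>. (\<lambda>z. iexp (a k \<bullet> z)) (?D k \<omega>)) {..<n}"
  proof (rule indep_vars_compose2[OF bm_indep[OF bm \<tau>]])
    show "(\<lambda>z. iexp (a i \<bullet> z)) \<in> borel_measurable borel" for i by measurable
  qed
  then have "(\<integral>\<omega>. (\<Prod>k<n. iexp (a k \<bullet> ?D k \<omega>)) \<partial>M) = (\<Prod>k<n. \<integral>\<omega>. iexp (a k \<bullet> ?D k \<omega>) \<partial>M)"
    by (intro indep_vars_lebesgue_integral integrable_iexp_real bm_prob_space[OF bm] borel_measurable_inner Dm) auto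
  also have "\<dots> = of_real (exp (\<Sum>k<n. - (norm (a k))\<^sup>2 * (\<tau> (Suc k) - \<tau> k) / 2))"
    unfolding c by (simp add: exp_sum)
  finally show ?thesis
    by (simp add: exp_sum sum_distrib_left sum_negf sum_divide_distrib)
qed

text \<open>Summation by parts turns a combination of values into a combination of independent
  increments. The covariance reappears because \<open>min k l\<close> counts the increments that lie
  below both \<open>k\<close> and \<open>l\<close>, each of length \<open>T / m\<close>.\<close>

lemma bm_grid_char:
  fixes m :: nat and T :: real
  assumes T: "T > 0" and m: "m > 0"
  shows "(\<integral>\<omega>. iexp (\<Sum>k\<le>m. c k \<bullet> B (T * k / m) \<omega>) \<partial>M)
    = of_real (exp (- (\<Sum>k\<le>m. \<Sum>l\<le>m. (c k \<bullet> c l) * min (T * k / m) (T * l / m)) / 2))"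
proof -
  define \<tau> where "\<tau> k = T * real k / m" for k :: nat
  have \<tau>: "0 \<le> \<tau> 0" "incseq \<tau>" using T m by (auto simp: \<tau>_def incseq_def intro!: divide_right_mono mult_left_mono)
  define a where "a j = (\<Sum>k\<le>m. of_bool (j < k) *\<^sub>R c k)" for j
  have Bk: "B (\<tau> k) \<omega> = (\<Sum>j<k. B (\<tau> (Suc j)) \<omega> - B (\<tau> j) \<omega>)" if "\<omega> \<in> space M" for k \<omega>
    using bm_0[OF bm that] by (subst sum_lessThan_telescope) (simp add: \<tau>_def)
  have S: "(\<Sum>k\<le>m. c k \<bullet> B (T * k / m) \<omega>) = (\<Sum>j<m. a j \<bullet> (B (\<tau> (Suc j)) \<omega> - B (\<tau> j) \<omega>))"
    if w: "\<omega> \<in> space M" for \<omega>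
  proof -
    have "(\<Sum>k\<le>m. c k \<bullet> B (T * k / m) \<omega>) = (\<Sum>k\<le>m. \<Sum>j<m. of_bool (j < k) *\<^sub>R c k \<bullet> (B (\<tau> (Suc j)) \<omega> - B (\<tau> j) \<omega>))"
    proof (rule sum.cong[OF refl])
      fix k assume k: "k \<in> {..m}"
      have "B (T * k / m) \<omega> = (\<Sum>j<k. B (\<tau> (Suc j)) \<omega> - B (\<tau> j) \<omega>)" using Bk[OF w, of k] by (simp add: \<tau>_def)
      then have "c k \<bullet> B (T * k / m) \<omega> = (\<Sum>j<k. c k \<bullet> (B (\<tau> (Suc j)) \<omega> - B (\<tau> j) \<omega>))"
        by (simp add: inner_sum_right)
      also have "\<dots> = (\<Sum>j<m. of_bool (j < k) *\<^sub>R c k \<bullet> (B (\<tau> (Suc j)) \<omega> - B (\<tau> j) \<omega>))"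
        using k by (intro sum.mono_neutral_cong_left) auto
      finally show "c k \<bullet> B (T * k / m) \<omega> = (\<Sum>j<m. of_bool (j < k) *\<^sub>R c k \<bullet> (B (\<tau> (Suc j)) \<omega> - B (\<tau> j) \<omega>))" .
    qed
    also have "\<dots> = (\<Sum>j<m. a j \<bullet> (B (\<tau> (Suc j)) \<omega> - B (\<tau> j) \<omega>))"
      unfolding a_def inner_sum_left by (rule sum.swap)
    finally show ?thesis .
  qed
  have "(\<integral>\<omega>. iexp (\<Sum>k\<le>m. c k \<bullet> B (T * k / m) \<omega>) \<partial>M)
     = (\<integral>\<omega>. iexp (\<Sum>j<m. a j \<bullet> (B (\<tau> (Suc j)) \<omega> - B (\<tau> j) \<omega>)) \<partial>M)"
    using S by (intro Bochner_Integration.integral_cong refl) simp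
  also have "\<dots> = of_real (exp (- (\<Sum>j<m. (norm (a j))\<^sup>2 * (\<tau> (Suc j) - \<tau> j)) / 2))"
    by (rule bm_increments_char[OF \<tau>])
  also have "(\<Sum>j<m. (norm (a j))\<^sup>2 * (\<tau> (Suc j) - \<tau> j))
     = (\<Sum>j<m. \<Sum>k\<le>m. \<Sum>l\<le>m. (c k \<bullet> c l) * (of_bool (j < k \<and> j < l) * (T / m)))"
  proof (rule sum.cong[OF refl])
    fix j
    have "\<tau> (Suc j) - \<tau> j = T / m" by (simp add: \<tau>_def distrib_left add_divide_distrib)
    moreover have "(norm (a j))\<^sup>2 = (\<Sum>k\<le>m. \<Sum>l\<le>m. (c k \<bullet> c l) * of_bool (j < k \<and> j < l))"
      unfolding power2_norm_eq_inner a_def inner_sum_left inner_sum_right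
      by (intro sum.cong refl) (auto simp: inner_commute)
    ultimately show "(norm (a j))\<^sup>2 * (\<tau> (Suc j) - \<tau> j) = (\<Sum>k\<le>m. \<Sum>l\<le>m. (c k \<bullet> c l) * (of_bool (j < k \<and> j < l) * (T / m)))"
      by (simp only: sum_distrib_right mult.assoc)
  qed
  also have "\<dots> = (\<Sum>k\<le>m. \<Sum>l\<le>m. \<Sum>j<m. (c k \<bullet> c l) * (of_bool (j < k \<and> j < l) * (T / m)))"
    by (subst sum.swap, rule sum.cong[OF refl], rule sum.swap)
  also have "\<dots> = (\<Sum>k\<le>m. \<Sum>l\<le>m. (c k \<bullet> c l) * min (T * k / m) (T * l / m))"
  proof (intro sum.cong refl)
    fix k l assume k: "k \<in> {..m}" and l: "l \<in> {..m}"
    have "(\<Sum>j<m. of_bool (j < k \<and> j < l) :: real) = card ({..<m} \<inter> {j. j < k \<and> j < l})"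
      by (simp add: sum_of_bool_eq)
    also have "{..<m} \<inter> {j. j < k \<and> j < l} = {..<min k l}" using k l by auto
    finally have "(\<Sum>j<m. of_bool (j < k \<and> j < l) :: real) = min k l" by simp
    moreover have "min (T * k / m) (T * l / m) = min k l * (T / m)"
      using T m by (simp add: min_def divide_right_mono mult_le_cancel_left_pos divide_le_cancel field_simps)
    ultimately show "(\<Sum>j<m. (c k \<bullet> c l) * (of_bool (j < k \<and> j < l) * (T / m))) = (c k \<bullet> c l) * min (T * k / m) (T * l / m)"
      by (simp add: sum_distrib_left[symmetric] sum_distrib_right[symmetric] sum_divide_distrib[symmetric])
  qed
  finally show ?thesis .
qed

end

text \<open>The end point term has covariance \<open>s * t / T\<close>, exactly what the bridge
  covariance \<open>min s t - s * t / T\<close> lacks, and by independence the exponents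
  add.\<close>

lemma bridge_grid_char:
  fixes \<mu> :: "(real \<Rightarrow> real ^ 'd) measure" and m :: nat and T :: real
  assumes T: "T > 0" and pw: "pinned_wiener_measure T \<mu>" and m: "m > 0"
  shows "(\<integral>p. iexp (\<Sum>k\<le>m. c k \<bullet> (snd p (T * k / m) + (k / m) *\<^sub>R sqrt T *\<^sub>R fst p)) \<partial>(std_gauss \<Otimes>\<^sub>M \<mu>))
    = of_real (exp (- (\<Sum>k\<le>m. \<Sum>l\<le>m. (c k \<bullet> c l) * min (T * k / m) (T * l / m)) / 2))"
proof -
  interpret \<mu>: prob_space \<mu> by (rule pinned_prob_space[OF T pw])
  interpret G: prob_space "std_gauss :: (real^'d) measure" by (rule prob_space_std_gauss)
  interpret P: pair_prob_space "std_gauss :: (real^'d) measure" \<mu> ..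
  define \<tau> where "\<tau> k = T * real k / m" for k :: nat
  have inj: "inj_on \<tau> {..m}" using T m by (auto simp: inj_on_def \<tau>_def)
  define J where "J = \<tau> ` {..m}"
  have J: "finite J" "J \<subseteq> {0..T}" using T m by (auto simp: J_def \<tau>_def field_simps)
  have \<tau>J: "\<tau> k \<in> {0..T}" if "k \<le> m" for k using J that by (auto simp: J_def)
  \<comment> \<open>\<open>bridge_char\<close> sums over a set of times, so the coefficients are
    moved from indices to times along the injective map \<open>\<tau>\<close>.\<close>
  define c' where "c' t = c (the_inv_into {..m} \<tau> t)" for t
  have c': "c' (\<tau> k) = c k" if "k \<le> m" for k using inj that by (simp add: c'_def the_inv_into_f_f)
  have reJ: "(\<Sum>t\<in>J. F t) = (\<Sum>k\<le>m. F (\<tau> k))" for F :: "real \<Rightarrow> real"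
    unfolding J_def by (subst sum.reindex[OF inj]) simp
  define C where "C = (\<Sum>k\<le>m. (k / m * sqrt T) *\<^sub>R c k)"
  have W: "(\<lambda>w. \<Sum>k\<le>m. c k \<bullet> w (T * k / m)) \<in> borel_measurable \<mu>"
    using \<tau>J by (intro borel_measurable_sum borel_measurable_inner borel_measurable_const pinned_coord_measurable[OF T pw])
        (auto simp: \<tau>_def)
  have e: "iexp (\<Sum>k\<le>m. c k \<bullet> (w (T * k / m) + (k / m) *\<^sub>R sqrt T *\<^sub>R z)) = iexp (C \<bullet> z) * iexp (\<Sum>k\<le>m. c k \<bullet> w (T * k / m))" for w z
  proof -
    have "(\<Sum>k\<le>m. c k \<bullet> (w (T * k / m) + (k / m) *\<^sub>R sqrt T *\<^sub>R z)) = C \<bullet> z + (\<Sum>k\<le>m. c k \<bullet> w (T * k / m))"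
      by (simp add: C_def inner_add_right sum.distrib inner_sum_left)
    then show ?thesis by (simp only: of_real_add distrib_left exp_add)
  qed
  have mW: "(\<lambda>p. \<Sum>k\<le>m. c k \<bullet> snd p (T * k / m)) \<in> borel_measurable (std_gauss \<Otimes>\<^sub>M \<mu>)"
    using measurable_compose[OF measurable_snd W] .
  have "integrable (std_gauss \<Otimes>\<^sub>M \<mu>) (\<lambda>p. iexp (C \<bullet> fst p) * iexp (\<Sum>k\<le>m. c k \<bullet> snd p (T * k / m)))"
  proof (intro P.P.integrable_const_bound[where B=1] AE_I2)
    have "(\<lambda>p. C \<bullet> fst p) \<in> borel_measurable (std_gauss \<Otimes>\<^sub>M \<mu>)" by measurable
    moreover have "(\<lambda>x. iexp x) \<in> borel_measurable borel" by measurable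
    ultimately show "(\<lambda>p. iexp (C \<bullet> fst p) * iexp (\<Sum>k\<le>m. c k \<bullet> snd p (T * k / m))) \<in> borel_measurable (std_gauss \<Otimes>\<^sub>M \<mu>)"
      by (intro borel_measurable_times measurable_compose[OF _ \<open>(\<lambda>x. iexp x) \<in> borel_measurable borel\<close>] mW)
  qed (simp add: norm_mult del: of_real_sum)
  from P.integral_fst'[OF this, symmetric]
  have "(\<integral>p. iexp (\<Sum>k\<le>m. c k \<bullet> (snd p (T * k / m) + (k / m) *\<^sub>R sqrt T *\<^sub>R fst p)) \<partial>(std_gauss \<Otimes>\<^sub>M \<mu>))
     = (\<integral>z. (\<integral>w. iexp (C \<bullet> z) * iexp (\<Sum>k\<le>m. c k \<bullet> w (T * k / m)) \<partial>\<mu>) \<partial>std_gauss)"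
    unfolding e by (simp only: fst_conv snd_conv)
  also have "\<dots> = (\<integral>z. iexp (C \<bullet> z) \<partial>std_gauss) * (\<integral>w. iexp (\<Sum>k\<le>m. c k \<bullet> w (T * k / m)) \<partial>\<mu>)"
    by simp
  also have "(\<integral>w. iexp (\<Sum>k\<le>m. c k \<bullet> w (T * k / m)) \<partial>\<mu>) = (\<integral>w. iexp (\<Sum>t\<in>J. c' t \<bullet> w t) \<partial>\<mu>)"
    unfolding reJ by (simp add: c' \<tau>_def[symmetric])
  also have "\<dots> = of_real (exp (- (\<Sum>k\<le>m. \<Sum>l\<le>m. (c k \<bullet> c l) * (min (\<tau> k) (\<tau> l) - \<tau> k * \<tau> l / T)) / 2))"
  proof -
    have "(\<Sum>s\<in>J. \<Sum>t\<in>J. (c' s \<bullet> c' t) * (min s t - s * t / T))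
        = (\<Sum>k\<le>m. \<Sum>l\<le>m. (c k \<bullet> c l) * (min (\<tau> k) (\<tau> l) - \<tau> k * \<tau> l / T))"
      unfolding reJ by (intro sum.cong refl) (simp add: c')
    then show ?thesis using bridge_char[OF T pw J, of c'] by (simp only:)
  qed
  also have "(\<integral>z. iexp (C \<bullet> z) \<partial>std_gauss) = of_real (exp (- (norm C)\<^sup>2 / 2))" by (rule std_gauss_char)
  also have "(norm C)\<^sup>2 = (\<Sum>k\<le>m. \<Sum>l\<le>m. (c k \<bullet> c l) * (\<tau> k * \<tau> l / T))"
  proof -
    have *: "(k / m * sqrt T) *\<^sub>R c k \<bullet> (l / m * sqrt T) *\<^sub>R c l = (c k \<bullet> c l) * (\<tau> k * \<tau> l / T)" for k l :: nat
    proof -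
      have "\<tau> k * \<tau> l / T = (k / m * sqrt T) * (l / m * sqrt T)"
        using T by (simp add: \<tau>_def field_simps)
      then show ?thesis by (simp only: inner_scaleR_left inner_scaleR_right mult_ac)
    qed
    show ?thesis
      unfolding power2_norm_eq_inner C_def inner_sum_left unfolding inner_sum_right * ..
  qed
  also have "complex_of_real (exp (- (\<Sum>k\<le>m. \<Sum>l\<le>m. (c k \<bullet> c l) * (\<tau> k * \<tau> l / T)) / 2)) *
      of_real (exp (- (\<Sum>k\<le>m. \<Sum>l\<le>m. (c k \<bullet> c l) * (min (\<tau> k) (\<tau> l) - \<tau> k * \<tau> l / T)) / 2))
      = of_real (exp (- (\<Sum>k\<le>m. \<Sum>l\<le>m. (c k \<bullet> c l) * min (\<tau> k) (\<tau> l)) / 2))"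
    unfolding of_real_mult[symmetric] exp_add[symmetric]
  proof -
    have "(\<Sum>k\<le>m. \<Sum>l\<le>m. (c k \<bullet> c l) * (min (\<tau> k) (\<tau> l) - \<tau> k * \<tau> l / T))
      = (\<Sum>k\<le>m. \<Sum>l\<le>m. (c k \<bullet> c l) * min (\<tau> k) (\<tau> l)) - (\<Sum>k\<le>m. \<Sum>l\<le>m. (c k \<bullet> c l) * (\<tau> k * \<tau> l / T))"
      by (simp only: right_diff_distrib sum_subtractf)
    then have "- (\<Sum>k\<le>m. \<Sum>l\<le>m. (c k \<bullet> c l) * (\<tau> k * \<tau> l / T)) / 2 +
       - (\<Sum>k\<le>m. \<Sum>l\<le>m. (c k \<bullet> c l) * (min (\<tau> k) (\<tau> l) - \<tau> k * \<tau> l / T)) / 2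
      = - (\<Sum>k\<le>m. \<Sum>l\<le>m. (c k \<bullet> c l) * min (\<tau> k) (\<tau> l)) / 2" by linarith
    then show "complex_of_real (exp (- (\<Sum>k\<le>m. \<Sum>l\<le>m. (c k \<bullet> c l) * (\<tau> k * \<tau> l / T)) / 2 +
       - (\<Sum>k\<le>m. \<Sum>l\<le>m. (c k \<bullet> c l) * (min (\<tau> k) (\<tau> l) - \<tau> k * \<tau> l / T)) / 2)) =
      of_real (exp (- (\<Sum>k\<le>m. \<Sum>l\<le>m. (c k \<bullet> c l) * min (\<tau> k) (\<tau> l)) / 2))" by (simp only:)
  qed
  finally show ?thesis unfolding \<tau>_def .
qed

text \<open>The components are listed as reals over pairs of a time index and a coordinate, the form
  in which \<open>char_determines_joint_law\<close> applies. One grid at a time is enough, since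
  each approximation of the diffusion looks at a single grid.\<close>

theorem grid_law:
  fixes \<mu> :: "(real \<Rightarrow> real ^ 'd) measure" and b :: "real \<Rightarrow> 'w \<Rightarrow> real ^ 'd" and m :: nat and T :: real
  assumes T: "T > 0" and pw: "pinned_wiener_measure T \<mu>" and m: "m > 0" and bm: "brownian_motion M b"
  shows "distr M (Pi\<^sub>M ({..m} \<times> UNIV) (\<lambda>_. borel)) (\<lambda>\<omega>. \<lambda>p\<in>{..m}\<times>UNIV. b (T * fst p / m) \<omega> $ snd p)
    = distr (std_gauss \<Otimes>\<^sub>M \<mu>) (Pi\<^sub>M ({..m} \<times> UNIV) (\<lambda>_. borel))
        (\<lambda>q. \<lambda>p\<in>{..m}\<times>UNIV. (snd q (T * fst p / m) + (fst p / m) *\<^sub>R sqrt T *\<^sub>R fst q) $ snd p)"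
proof (rule char_determines_joint_law)
  interpret \<mu>: prob_space \<mu> by (rule pinned_prob_space[OF T pw])
  interpret G: prob_space "std_gauss :: (real^'d) measure" by (rule prob_space_std_gauss)
  interpret P: pair_prob_space "std_gauss :: (real^'d) measure" \<mu> ..
  show "prob_space M" by (rule bm_prob_space[OF bm])
  show "prob_space (std_gauss \<Otimes>\<^sub>M \<mu>)" by (intro prob_space_pair prob_space_std_gauss pinned_prob_space[OF T pw])
  fix j :: "nat \<times> 'd" assume "j \<in> {..m} \<times> UNIV"
  then have t: "T * fst j / m \<in> {0..T}" using T m by (auto simp: field_simps)
  show "(\<lambda>\<omega>. b (T * fst j / m) \<omega> $ snd j) \<in> borel_measurable M"
    using t by (intro component_measurable bm_measurable[OF bm]) auto
  show "(\<lambda>q. (snd q (T * fst j / m) + (fst j / m) *\<^sub>R sqrt T *\<^sub>R fst q) $ snd j) \<in> borel_measurable (std_gauss \<Otimes>\<^sub>M \<mu>)"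
    by (intro component_measurable borel_measurable_add borel_measurable_scaleR borel_measurable_const
        measurable_compose[OF measurable_snd pinned_coord_measurable[OF T pw t]])
      (simp_all add: measurable_fst'' measurable_cong_sets[OF refl sets_std_gauss[symmetric]])
next
  fix c :: "nat \<times> 'd \<Rightarrow> real"
  have e: "(\<Sum>j\<in>{..m}\<times>UNIV. c j * (Z (fst j) $ snd j)) = (\<Sum>k\<le>m. (\<chi> i. c (k, i)) \<bullet> Z k)" for Z :: "nat \<Rightarrow> real^'d"
  proof -
    have "(\<Sum>j\<in>{..m}\<times>UNIV. c j * (Z (fst j) $ snd j)) = (\<Sum>(k, i)\<in>{..m}\<times>UNIV. c (k, i) * (Z k $ i))"
      by (intro sum.cong) auto
    also have "\<dots> = (\<Sum>k\<le>m. \<Sum>i\<in>UNIV. c (k, i) * (Z k $ i))"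
      by (rule sum.cartesian_product[symmetric])
    finally show ?thesis by (simp add: inner_vec_def)
  qed
  show "(\<integral>\<omega>. iexp (\<Sum>j\<in>{..m}\<times>UNIV. c j * (b (T * fst j / m) \<omega> $ snd j)) \<partial>M)
     = (\<integral>q. iexp (\<Sum>j\<in>{..m}\<times>UNIV. c j * ((snd q (T * fst j / m) + (fst j / m) *\<^sub>R sqrt T *\<^sub>R fst q) $ snd j)) \<partial>(std_gauss \<Otimes>\<^sub>M \<mu>))"
    unfolding e[of "\<lambda>k. b (T * k / m) _"] e[of "\<lambda>k. snd _ (T * k / m) + (k / m) *\<^sub>R sqrt T *\<^sub>R fst _"]
      bm_grid_char[OF bm T m] bridge_grid_char[OF T pw m] ..
qed auto

section \<open>Simple integrals\<close>

lemma norm_power2_add_le: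
  fixes u v :: "'a::real_normed_vector"
  shows "(norm (u + v))\<^sup>2 \<le> 2 * (norm u)\<^sup>2 + 2 * (norm v)\<^sup>2"
proof -
  have "(norm (u + v))\<^sup>2 \<le> (norm u + norm v)\<^sup>2" by (intro power_mono norm_triangle_ineq) auto
  moreover have "0 \<le> (norm u - norm v)\<^sup>2" by simp
  ultimately show ?thesis by (simp add: power2_sum power2_diff)
qed

context
  fixes M :: "'w measure" and b :: "real \<Rightarrow> 'w \<Rightarrow> real ^ 'd" and bh :: "real \<Rightarrow> 'w \<Rightarrow> real ^ 'e"
  assumes b: "brownian_motion M b" and bh: "brownian_motion M bh" and ind: "indep_processes M b bh"
begin

interpretation prob_space M by (rule bm_prob_space[OF b])

text \<open>Given the paths of \<open>b\<close>, a simple integral against \<open>bh\<close> is a centred Gaussian vector.\<close>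

lemma simple_integral_char:
  fixes \<tau> :: "nat \<Rightarrow> real"
  defines "A \<equiv> generated_algebra M b {0..}"
  assumes U: "U \<in> borel_measurable A" and h: "\<And>k. k < n \<Longrightarrow> h k \<in> borel_measurable A"
    and \<tau>: "0 \<le> \<tau> 0" "incseq \<tau>"
  shows "(\<integral>\<omega>. iexp (U \<omega> + v \<bullet> (\<Sum>k<n. h k \<omega> *\<^sub>R (bh (\<tau> (Suc k)) \<omega> - bh (\<tau> k) \<omega>))) \<partial>M)
    = (\<integral>\<omega>. iexp (U \<omega>) * of_real (exp (- ((norm v)\<^sup>2 * (\<Sum>k<n. (h k \<omega>)\<^sup>2 * (\<tau> (Suc k) - \<tau> k))) / 2)) \<partial>M)"
proof -
  have \<tau>0: "0 \<le> \<tau> k" for k using \<tau> by (meson incseq_def le0 order_trans)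
  define D where "D k \<omega> = bh (\<tau> (Suc k)) \<omega> - bh (\<tau> k) \<omega>" for k \<omega>
  define Q where "Q = Pi\<^sub>M {..<n} (\<lambda>_. borel :: (real^'e) measure)"
  define DD where "DD \<omega> = restrict (\<lambda>k. D k \<omega>) {..<n}" for \<omega>
  have sA: "space A = space M" by (simp add: A_def)
  have AM: "sets A \<subseteq> sets M" unfolding A_def by (intro generated_algebra_subset bm_measurable[OF b]) auto
  have idA: "(\<lambda>\<omega>. \<omega>) \<in> measurable M A"
    using AM sA by (intro measurableI) auto
  have DB: "D k \<in> borel_measurable (generated_algebra M bh {0..})" for k
    unfolding D_def[abs_def] by (intro borel_measurable_diff measurable_generated_algebra) (use \<tau>0 in auto)
  have DM: "D k \<in> borel_measurable M" for k
    unfolding D_def[abs_def] by (intro borel_measurable_diff bm_measurable[OF bh] \<tau>0)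
  have DDB: "DD \<in> measurable (generated_algebra M bh {0..}) Q"
    unfolding DD_def[abs_def] Q_def by (intro measurable_restrict DB)
  have DDM: "DD \<in> measurable M Q"
    unfolding DD_def[abs_def] Q_def by (intro measurable_restrict DM)
  \<comment> \<open>Taking the identity into \<open>A\<close> freezes the whole path of
    \<open>b\<close>, so the coefficients \<open>h k\<close> are constants in the inner
    integral.\<close>
  have law: "distr M (A \<Otimes>\<^sub>M Q) (\<lambda>\<omega>. (\<omega>, DD \<omega>)) = distr M A (\<lambda>\<omega>. \<omega>) \<Otimes>\<^sub>M distr M Q DD"
  proof (rule indep_set_pair_distr[OF ind[unfolded indep_processes_def] idA DDM])
    show "(\<lambda>\<omega>. \<omega>) -` E \<inter> space M \<in> sets (generated_algebra M b {0..})" if "E \<in> sets A" for E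
    proof -
      have "(\<lambda>\<omega>. \<omega>) -` E \<inter> space M = E" using sets.sets_into_space[OF that] sA by auto
      then show ?thesis using that by (simp add: A_def)
    qed
    show "DD -` F \<inter> space M \<in> sets (generated_algebra M bh {0..})" if "F \<in> sets Q" for F
      using measurable_sets[OF DDB that] by simp
  qed
  define G where "G p = iexp (U (fst p) + v \<bullet> (\<Sum>k<n. h k (fst p) *\<^sub>R snd p k))" for p
  have Gm: "G \<in> borel_measurable (A \<Otimes>\<^sub>M Q)"
  proof -
    have "(\<lambda>p. U (fst p) + v \<bullet> (\<Sum>k<n. h k (fst p) *\<^sub>R snd p k)) \<in> borel_measurable (A \<Otimes>\<^sub>M Q)"
    proof (intro borel_measurable_add borel_measurable_inner borel_measurable_const borel_measurable_sum borel_measurable_scaleR)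
      show "(\<lambda>p. U (fst p)) \<in> borel_measurable (A \<Otimes>\<^sub>M Q)" by (rule measurable_compose[OF measurable_fst U])
      fix k assume k: "k \<in> {..<n}"
      show "(\<lambda>p. h k (fst p)) \<in> borel_measurable (A \<Otimes>\<^sub>M Q)"
        using k by (intro measurable_compose[OF measurable_fst h]) auto
      show "(\<lambda>p. snd p k) \<in> borel_measurable (A \<Otimes>\<^sub>M Q)"
        unfolding Q_def by (rule measurable_compose[OF measurable_snd measurable_component_singleton[OF k]])
    qed
    moreover have "(\<lambda>x. iexp x) \<in> borel_measurable borel" by measurable
    ultimately show ?thesis unfolding G_def[abs_def] by (rule measurable_compose)
  qed
  interpret MA: prob_space "distr M A (\<lambda>\<omega>. \<omega>)" by (rule prob_space_distr[OF idA])
  interpret MQ: prob_space "distr M Q DD" by (rule prob_space_distr[OF DDM])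
  interpret P: pair_prob_space "distr M A (\<lambda>\<omega>. \<omega>)" "distr M Q DD" ..
  have Gm': "G \<in> borel_measurable (distr M A (\<lambda>\<omega>. \<omega>) \<Otimes>\<^sub>M distr M Q DD)"
    using Gm by (simp add: measurable_cong_sets[OF sets_pair_measure_cong[OF sets_distr sets_distr] refl])
  have Gi: "integrable (distr M A (\<lambda>\<omega>. \<omega>) \<Otimes>\<^sub>M distr M Q DD) G"
    by (intro P.P.integrable_const_bound[where B=1] Gm') (simp add: G_def del: of_real_sum of_real_add)
  have Gsnd: "(\<lambda>d. G (\<omega>, d)) \<in> borel_measurable Q" if "\<omega> \<in> space M" for \<omega>
    using Gm that sA by (intro measurable_compose_Pair1[of \<omega> A]) auto
  \<comment> \<open>With \<open>h\<close> frozen the exponent is a combination of independent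
    increments with the vectors \<open>h k \<omega> *\<^sub>R v\<close>.\<close>
  have inner: "(\<integral>d. G (\<omega>, d) \<partial>distr M Q DD)
      = iexp (U \<omega>) * of_real (exp (- ((norm v)\<^sup>2 * (\<Sum>k<n. (h k \<omega>)\<^sup>2 * (\<tau> (Suc k) - \<tau> k))) / 2))"
    if w: "\<omega> \<in> space M" for \<omega>
  proof -
    have "(\<integral>d. G (\<omega>, d) \<partial>distr M Q DD) = (\<integral>\<omega>'. G (\<omega>, DD \<omega>') \<partial>M)"
      by (rule integral_distr[OF DDM Gsnd[OF w]])
    also have "\<dots> = (\<integral>\<omega>'. iexp (U \<omega>) * iexp (\<Sum>k<n. (h k \<omega> *\<^sub>R v) \<bullet> (bh (\<tau> (Suc k)) \<omega>' - bh (\<tau> k) \<omega>')) \<partial>M)"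
    proof (rule Bochner_Integration.integral_cong[OF refl])
      fix \<omega>'
      have "v \<bullet> (\<Sum>k<n. h k \<omega> *\<^sub>R DD \<omega>' k) = (\<Sum>k<n. (h k \<omega> *\<^sub>R v) \<bullet> (bh (\<tau> (Suc k)) \<omega>' - bh (\<tau> k) \<omega>'))"
        unfolding inner_sum_right by (intro sum.cong refl) (simp add: DD_def D_def)
      then show "G (\<omega>, DD \<omega>') = iexp (U \<omega>) * iexp (\<Sum>k<n. (h k \<omega> *\<^sub>R v) \<bullet> (bh (\<tau> (Suc k)) \<omega>' - bh (\<tau> k) \<omega>'))"
        unfolding G_def by (simp only: fst_conv snd_conv of_real_add distrib_left exp_add)
    qed
    also have "\<dots> = iexp (U \<omega>) * (\<integral>\<omega>'. iexp (\<Sum>k<n. (h k \<omega> *\<^sub>R v) \<bullet> (bh (\<tau> (Suc k)) \<omega>' - bh (\<tau> k) \<omega>')) \<partial>M)"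
      by (rule integral_mult_right_zero)
    also have "\<dots> = iexp (U \<omega>) * of_real (exp (- (\<Sum>k<n. (norm (h k \<omega> *\<^sub>R v))\<^sup>2 * (\<tau> (Suc k) - \<tau> k)) / 2))"
      unfolding bm_increments_char[OF bh \<tau>] ..
    also have "(\<Sum>k<n. (norm (h k \<omega> *\<^sub>R v))\<^sup>2 * (\<tau> (Suc k) - \<tau> k)) = (norm v)\<^sup>2 * (\<Sum>k<n. (h k \<omega>)\<^sup>2 * (\<tau> (Suc k) - \<tau> k))"
      by (simp add: power_mult_distrib sum_distrib_left mult_ac)
    finally show ?thesis .
  qed
  have e: "iexp (U \<omega> + v \<bullet> (\<Sum>k<n. h k \<omega> *\<^sub>R (bh (\<tau> (Suc k)) \<omega> - bh (\<tau> k) \<omega>))) = G (\<omega>, DD \<omega>)" for \<omega>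
  proof -
    have "(\<Sum>k<n. h k \<omega> *\<^sub>R (bh (\<tau> (Suc k)) \<omega> - bh (\<tau> k) \<omega>)) = (\<Sum>k<n. h k \<omega> *\<^sub>R DD \<omega> k)"
      by (intro sum.cong refl) (simp add: DD_def D_def)
    then show ?thesis by (simp only: G_def fst_conv snd_conv)
  qed
  have pairm: "(\<lambda>\<omega>. (\<omega>, DD \<omega>)) \<in> measurable M (A \<Otimes>\<^sub>M Q)" by (rule measurable_Pair[OF idA DDM])
  have "(\<integral>\<omega>. G (\<omega>, DD \<omega>) \<partial>M) = (\<integral>p. G p \<partial>distr M (A \<Otimes>\<^sub>M Q) (\<lambda>\<omega>. (\<omega>, DD \<omega>)))"
    by (rule integral_distr[OF pairm Gm, symmetric])
  also have "\<dots> = (\<integral>\<omega>. \<integral>d. G (\<omega>, d) \<partial>distr M Q DD \<partial>distr M A (\<lambda>\<omega>. \<omega>))"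
    unfolding law by (rule P.integral_fst'[OF Gi, symmetric])
  also have "\<dots> = (\<integral>\<omega>. \<integral>d. G (\<omega>, d) \<partial>distr M Q DD \<partial>M)"
  proof (rule integral_distr[OF idA])
    have "(\<lambda>\<omega>. \<integral>d. G (\<omega>, d) \<partial>distr M Q DD) \<in> borel_measurable (distr M A (\<lambda>\<omega>. \<omega>))"
      using Gm' by (intro MQ.borel_measurable_lebesgue_integral) simp
    then show "(\<lambda>\<omega>. \<integral>d. G (\<omega>, d) \<partial>distr M Q DD) \<in> borel_measurable A" by simp
  qed
  also have "\<dots> = (\<integral>\<omega>. iexp (U \<omega>) * of_real (exp (- ((norm v)\<^sup>2 * (\<Sum>k<n. (h k \<omega>)\<^sup>2 * (\<tau> (Suc k) - \<tau> k))) / 2)) \<partial>M)"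
    by (rule Bochner_Integration.integral_cong[OF refl inner])
  finally show ?thesis unfolding e .
qed

text \<open>Both integrals are merged into one sum over the disjoint union of their index sets, the
  second with a minus sign, to which \<open>ito_isometry_sum\<close> applies.\<close>

lemma simple_difference_isometry:
  assumes s: "simple_integrand M (joint_filt M b bh) n \<tau> h"
    and s': "simple_integrand M (joint_filt M b bh) n' \<tau>' h'"
    and t: "0 \<le> t"
  shows "(\<integral>\<^sup>+\<omega>. ennreal ((norm (simple_integral bh n \<tau> h t \<omega> - simple_integral bh n' \<tau>' h' t \<omega>))\<^sup>2) \<partial>M)
    = ennreal CARD('e) * (\<integral>\<^sup>+(s, \<omega>). ennreal ((simple_process n \<tau> h s \<omega> - simple_process n' \<tau>' h' s \<omega>)\<^sup>2)
        \<partial>(lborel_on t \<Otimes>\<^sub>M M))"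
proof -
  let ?F = "joint_filt M b bh"
  define J where "J = {..<n} <+> {..<n'}"
  define \<alpha> where "\<alpha> j = (case j of Inl k \<Rightarrow> min t (\<tau> k) | Inr k \<Rightarrow> min t (\<tau>' k))" for j
  define \<beta> where "\<beta> j = (case j of Inl k \<Rightarrow> min t (\<tau> (Suc k)) | Inr k \<Rightarrow> min t (\<tau>' (Suc k)))" for j
  \<comment> \<open>A coefficient that starts after \<open>t\<close> is set to 0: its cut interval
    is empty, and the coefficient need not be measurable at the cut time \<open>t\<close>.\<close>
  define g where "g j \<omega> = (case j of Inl k \<Rightarrow> (if \<tau> k \<le> t then h k \<omega> else 0) | Inr k \<Rightarrow> (if \<tau>' k \<le> t then - h' k \<omega> else 0))" for j \<omega>
  have pos: "0 \<le> \<tau>'' k" if "simple_integrand M ?F n'' \<tau>'' h''" "k \<le> n''" for n'' \<tau>'' h'' k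
    using that(2)
  proof (induction k)
    case (Suc k)
    then have "0 \<le> \<tau>'' k" by simp
    also have "\<tau>'' k \<le> \<tau>'' (Suc k)" using that(1) Suc by (simp add: simple_integrand_def)
    finally show ?case .
  qed (use that in \<open>simp add: simple_integrand_def\<close>)
  have mono: "\<tau> k \<le> \<tau> (Suc k)" "h k \<in> borel_measurable (?F (\<tau> k))" "bounded (h k ` space M)" if "k < n" for k
    using s that by (auto simp: simple_integrand_def)
  have mono': "\<tau>' k \<le> \<tau>' (Suc k)" "h' k \<in> borel_measurable (?F (\<tau>' k))" "bounded (h' k ` space M)" if "k < n'" for k
    using s' that by (auto simp: simple_integrand_def)
  have 1: "simple_integral bh n \<tau> h t \<omega> - simple_integral bh n' \<tau>' h' t \<omega> = (\<Sum>j\<in>J. g j \<omega> *\<^sub>R (bh (\<beta> j) \<omega> - bh (\<alpha> j) \<omega>))" for \<omega>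
  proof -
    have "(\<Sum>k<n. h k \<omega> *\<^sub>R (bh (min t (\<tau> (Suc k))) \<omega> - bh (min t (\<tau> k)) \<omega>))
      = (\<Sum>k<n. (if \<tau> k \<le> t then h k \<omega> else 0) *\<^sub>R (bh (min t (\<tau> (Suc k))) \<omega> - bh (min t (\<tau> k)) \<omega>))"
    proof (intro sum.cong refl)
      fix k assume "k \<in> {..<n}"
      then show "h k \<omega> *\<^sub>R (bh (min t (\<tau> (Suc k))) \<omega> - bh (min t (\<tau> k)) \<omega>)
         = (if \<tau> k \<le> t then h k \<omega> else 0) *\<^sub>R (bh (min t (\<tau> (Suc k))) \<omega> - bh (min t (\<tau> k)) \<omega>)"
        using mono(1)[of k] by (auto simp: min_def)
    qed
    moreover have "(\<Sum>k<n'. h' k \<omega> *\<^sub>R (bh (min t (\<tau>' (Suc k))) \<omega> - bh (min t (\<tau>' k)) \<omega>))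
      = - (\<Sum>k<n'. (if \<tau>' k \<le> t then - h' k \<omega> else 0) *\<^sub>R (bh (min t (\<tau>' (Suc k))) \<omega> - bh (min t (\<tau>' k)) \<omega>))"
      unfolding sum_negf[symmetric]
    proof (intro sum.cong refl)
      fix k assume "k \<in> {..<n'}"
      then show "h' k \<omega> *\<^sub>R (bh (min t (\<tau>' (Suc k))) \<omega> - bh (min t (\<tau>' k)) \<omega>)
         = - ((if \<tau>' k \<le> t then - h' k \<omega> else 0) *\<^sub>R (bh (min t (\<tau>' (Suc k))) \<omega> - bh (min t (\<tau>' k)) \<omega>))"
        using mono'(1)[of k] by (auto simp: min_def)
    qed
    ultimately show ?thesis
      by (simp add: simple_integral_def J_def sum.Plus g_def \<alpha>_def \<beta>_def)
  qed
  have ind_eq: "indicator {min t x<..min t y} s = (indicator {x<..y} s :: real)" if "s \<le> t" for x y s :: real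
    using that by (auto simp: indicator_def)
  have 2: "simple_process n \<tau> h s \<omega> - simple_process n' \<tau>' h' s \<omega> = (\<Sum>j\<in>J. g j \<omega> * indicator {\<alpha> j<..\<beta> j} s)" if "s \<le> t" for s \<omega>
  proof -
    have "(\<Sum>k<n. h k \<omega> * indicator {\<tau> k<..\<tau> (Suc k)} s)
      = (\<Sum>k<n. (if \<tau> k \<le> t then h k \<omega> else 0) * indicator {min t (\<tau> k)<..min t (\<tau> (Suc k))} s)"
      using that by (intro sum.cong refl) (auto simp: ind_eq)
    moreover have "(\<Sum>k<n'. h' k \<omega> * indicator {\<tau>' k<..\<tau>' (Suc k)} s)
      = - (\<Sum>k<n'. (if \<tau>' k \<le> t then - h' k \<omega> else 0) * indicator {min t (\<tau>' k)<..min t (\<tau>' (Suc k))} s)"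
      unfolding sum_negf[symmetric] using that by (intro sum.cong refl) (auto simp: ind_eq)
    ultimately show ?thesis
      by (simp only: simple_process_def J_def sum.Plus[OF finite_lessThan finite_lessThan] g_def \<alpha>_def \<beta>_def sum.case) simp
  qed
  have "(\<integral>\<^sup>+\<omega>. ennreal ((norm (simple_integral bh n \<tau> h t \<omega> - simple_integral bh n' \<tau>' h' t \<omega>))\<^sup>2) \<partial>M)
      = ennreal CARD('e) * (\<integral>\<^sup>+(s, \<omega>). ennreal ((\<Sum>j\<in>J. g j \<omega> * indicator {\<alpha> j<..\<beta> j} s)\<^sup>2)
        \<partial>(lborel_on t \<Otimes>\<^sub>M M))"
    unfolding 1
  proof (rule ito_isometry_sum[OF b bh ind])
    show "finite J" by (simp add: J_def)
    fix j assume "j \<in> J"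
    then consider k where "k < n" "j = Inl k" | k where "k < n'" "j = Inr k" by (auto simp: J_def)
    then have "0 \<le> \<alpha> j \<and> \<alpha> j \<le> \<beta> j \<and> \<beta> j \<le> t \<and> g j \<in> borel_measurable (?F (\<alpha> j)) \<and> bounded (g j ` space M)"
    proof cases
      case 1
      have "0 \<le> \<tau> k" using pos[OF s, of k] 1 by simp
      then show ?thesis using mono[OF 1(1)] t
        by (cases "\<tau> k \<le> t") (auto simp: 1 \<alpha>_def \<beta>_def g_def[abs_def] min_def bounded_iff image_iff)
    next
      case 2
      have "0 \<le> \<tau>' k" using pos[OF s', of k] 2 by simp
      then show ?thesis using mono'[OF 2(1)] t
        by (cases "\<tau>' k \<le> t") (auto simp: 2 \<alpha>_def \<beta>_def g_def[abs_def] min_def bounded_iff image_iff)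
    qed
    then show "0 \<le> \<alpha> j" "\<alpha> j \<le> \<beta> j" "\<beta> j \<le> t" "g j \<in> borel_measurable (?F (\<alpha> j))" "bounded (g j ` space M)" by auto
  qed
  also have "(\<integral>\<^sup>+(s, \<omega>). ennreal ((\<Sum>j\<in>J. g j \<omega> * indicator {\<alpha> j<..\<beta> j} s)\<^sup>2) \<partial>(lborel_on t \<Otimes>\<^sub>M M))
     = (\<integral>\<^sup>+(s, \<omega>). ennreal ((simple_process n \<tau> h s \<omega> - simple_process n' \<tau>' h' s \<omega>)\<^sup>2)
        \<partial>(lborel_on t \<Otimes>\<^sub>M M))"
    by (intro nn_integral_cong) (auto simp: 2 space_pair_measure space_restrict_space)
  finally show ?thesis .
qed

end

section \<open>Discretisation on uniform grids\<close>

text \<open>Rounding the time to a grid leaves countably many time values, each with a measurable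
  map; these roundings converge by continuity of the paths.\<close>

lemma joint_measurable_continuous:
  fixes f :: "real \<Rightarrow> 'w \<Rightarrow> 'a::metric_space"
  assumes T: "0 \<le> T" and m: "\<And>t. t \<in> {0..T} \<Longrightarrow> f t \<in> borel_measurable M"
    and c: "\<And>\<omega>. \<omega> \<in> space M \<Longrightarrow> continuous_on {0..T} (\<lambda>t. f t \<omega>)"
  shows "(\<lambda>(s, \<omega>). f s \<omega>) \<in> borel_measurable (lborel_on T \<Otimes>\<^sub>M M)"
proof -
  let ?L = "lborel_on T"
  \<comment> \<open>The rounded time is clamped to \<open>[0, T]\<close>, where measurability and
    continuity are available.\<close>
  define q where "q n s = max 0 (min T (real_of_int \<lfloor>s * real (Suc n)\<rfloor> / real (Suc n)))" for n s
  have A: "(\<lambda>(s, \<omega>). f (q n s) \<omega>) \<in> borel_measurable (?L \<Otimes>\<^sub>M M)" for n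
  proof -
    have "(\<lambda>p. (\<lambda>i p. f (max 0 (min T (real_of_int i / real (Suc n)))) (snd p)) \<lfloor>fst p * real (Suc n)\<rfloor> p) \<in> borel_measurable (?L \<Otimes>\<^sub>M M)"
    proof (rule measurable_compose_countable[where f="\<lambda>i p. f (max 0 (min T (real_of_int i / real (Suc n)))) (snd p)"])
      show "(\<lambda>p. f (max 0 (min T (real_of_int i / real (Suc n)))) (snd p)) \<in> borel_measurable (?L \<Otimes>\<^sub>M M)" for i :: int
        using T by (intro measurable_compose[OF measurable_snd m]) auto
      have "(\<lambda>s. \<lfloor>s * real (Suc n)\<rfloor>) \<in> measurable ?L (count_space UNIV)"
        by (intro measurable_restrict_space1) simp
      then show "(\<lambda>p. \<lfloor>fst p * real (Suc n)\<rfloor>) \<in> measurable (?L \<Otimes>\<^sub>M M) (count_space UNIV)"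
        by (rule measurable_compose[OF measurable_fst])
    qed
    then show ?thesis by (simp add: q_def split_beta')
  qed
  have B: "(\<lambda>n. case p of (s, \<omega>) \<Rightarrow> f (q n s) \<omega>) \<longlonglongrightarrow> (case p of (s, \<omega>) \<Rightarrow> f s \<omega>)"
    if p: "p \<in> space (?L \<Otimes>\<^sub>M M)" for p
  proof -
    from p obtain s \<omega> where s: "p = (s, \<omega>)" "s \<in> {0..T}" "\<omega> \<in> space M" by (auto simp: space_pair_measure space_restrict_space)
    have q: "\<bar>q n s - s\<bar> \<le> 1 / real (Suc n)" for n
    proof -
      have "real_of_int \<lfloor>s * real (Suc n)\<rfloor> / real (Suc n) \<le> s"
        by (subst pos_divide_le_eq) (simp_all add: mult.commute del: of_nat_Suc)
      moreover have "s - 1 / real (Suc n) \<le> real_of_int \<lfloor>s * real (Suc n)\<rfloor> / real (Suc n)"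
      proof -
        have "s * real (Suc n) - 1 \<le> real_of_int \<lfloor>s * real (Suc n)\<rfloor>" by linarith
        then have "(s * real (Suc n) - 1) / real (Suc n) \<le> real_of_int \<lfloor>s * real (Suc n)\<rfloor> / real (Suc n)"
          by (intro divide_right_mono) auto
        then show ?thesis by (simp add: diff_divide_distrib del: of_nat_Suc)
      qed
      ultimately show ?thesis using s unfolding q_def by auto
    qed
    have "(\<lambda>n. q n s - s) \<longlonglongrightarrow> 0"
      by (rule Lim_null_comparison[OF _ LIMSEQ_inverse_real_of_nat]) (use q in \<open>auto simp: inverse_eq_divide\<close>)
    then have "(\<lambda>n. q n s) \<longlonglongrightarrow> s" by (simp add: LIM_zero_iff)
    then have "(\<lambda>n. f (q n s) \<omega>) \<longlonglongrightarrow> f s \<omega>"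
      by (rule continuous_on_tendsto_compose[OF c[OF s(3)] _ s(2)]) (use T in \<open>auto simp: q_def\<close>)
    then show ?thesis by (simp add: s)
  qed
  show ?thesis by (rule borel_measurable_LIMSEQ_metric[OF A B])
qed

definition grid_step :: "real \<Rightarrow> (real \<Rightarrow> real) \<Rightarrow> nat \<Rightarrow> real \<Rightarrow> real" where
  "grid_step T g m s = (\<Sum>k<m. g (T * real k / real m) * indicator {T * real k / real m<..T * real (Suc k) / real m} s)"

text \<open>The left end of the grid interval containing \<open>s\<close>. The intervals are open on
  the left and closed on the right, hence the ceiling minus 1.\<close>

definition grid_point :: "real \<Rightarrow> nat \<Rightarrow> real \<Rightarrow> real" where
  "grid_point T m s = T * real (nat (\<lceil>s * real m / T\<rceil> - 1)) / real m"

text \<open>Time 0 is excluded because it lies in none of the half-open intervals, so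
  \<open>grid_step\<close> is 0 there. Later limits therefore hold for almost every time.\<close>

lemma grid_step_eq:
  assumes T: "T > 0" and m: "m > 0" and s: "0 < s" "s \<le> T"
  shows "grid_step T g m s = g (grid_point T m s)"
    and "grid_point T m s \<in> {0..T}" "\<bar>grid_point T m s - s\<bar> \<le> T / real m"
proof -
  define y where "y = s * real m / T"
  define k0 where "k0 = nat (\<lceil>y\<rceil> - 1)"
  have y: "0 < y" "y \<le> real m" using T m s by (auto simp: y_def field_simps)
  have k0: "real k0 < y" "y \<le> real (Suc k0)"
  proof -
    have "1 \<le> \<lceil>y\<rceil>" using y by (simp add: one_le_ceiling)
    then have "real k0 = real_of_int (\<lceil>y\<rceil> - 1)" by (simp add: k0_def)
    then show "real k0 < y" "y \<le> real (Suc k0)" using ceiling_correct[of y] by auto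
  qed
  have k0m: "k0 < m" using k0 y by linarith
  have sy: "s = T * y / real m" using T m by (simp add: y_def)
  have iff: "s \<in> {T * real k / real m<..T * real (Suc k) / real m} \<longleftrightarrow> k = k0" for k
  proof -
    have "s \<in> {T * real k / real m<..T * real (Suc k) / real m} \<longleftrightarrow> real k < y \<and> y \<le> real (Suc k)"
      unfolding sy using T m by (auto simp: divide_less_cancel divide_le_cancel mult_less_cancel_left_pos mult_le_cancel_left_pos simp del: of_nat_Suc)
    also have "\<dots> \<longleftrightarrow> k = k0" using k0 by auto
    finally show ?thesis .
  qed
  have "grid_step T g m s = (\<Sum>k<m. if k = k0 then g (T * real k / real m) else 0)"
    unfolding grid_step_def by (intro sum.cong refl) (use iff in \<open>auto simp: indicator_def\<close>)
  also have "\<dots> = g (T * real k0 / real m)" using k0m by simp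
  also have gp: "T * real k0 / real m = grid_point T m s" by (simp add: grid_point_def k0_def y_def)
  finally show "grid_step T g m s = g (grid_point T m s)" .
  show "grid_point T m s \<in> {0..T}" using k0m T m unfolding gp[symmetric] by (auto simp: field_simps)
  have "T * real k0 / real m \<le> s" "s \<le> T * real (Suc k0) / real m" using iff[of k0] by auto
  moreover have "T * real (Suc k0) / real m = T * real k0 / real m + T / real m" by (simp add: distrib_left add_divide_distrib)
  ultimately show "\<bar>grid_point T m s - s\<bar> \<le> T / real m" unfolding gp[symmetric] by linarith
qed

lemma grid_point_tendsto:
  assumes T: "T > 0" and s: "0 < s" "s \<le> T" and m: "filterlim m at_top sequentially" "\<And>i. m i > 0"
  shows "(\<lambda>i. grid_point T (m i) s) \<longlonglongrightarrow> s"
proof -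
  have "(\<lambda>i. T / real (m i)) \<longlonglongrightarrow> 0"
    by (intro tendsto_divide_0[OF tendsto_const] filterlim_at_top_imp_at_infinity filterlim_compose[OF filterlim_real_sequentially m(1)])
  then have "(\<lambda>i. grid_point T (m i) s - s) \<longlonglongrightarrow> 0"
    by (rule Lim_null_comparison[rotated]) (use grid_step_eq(3)[OF T m(2) s] in auto)
  then show ?thesis by (simp add: LIM_zero_iff)
qed

lemma grid_step_tendsto:
  assumes T: "T > 0" and s: "0 < s" "s \<le> T" and m: "filterlim m at_top sequentially" "\<And>i. m i > 0"
    and c: "continuous_on {0..T} g"
  shows "(\<lambda>i. grid_step T g (m i) s) \<longlonglongrightarrow> g s"
  unfolding grid_step_eq(1)[OF T m(2) s]
  by (rule continuous_on_tendsto_compose[OF c grid_point_tendsto[OF T s m]])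
    (use s grid_step_eq(2)[OF T m(2) s] in auto)

lemma continuous_on_bounded_Icc:
  fixes g :: "real \<Rightarrow> real"
  assumes "continuous_on {0..T} g"
  obtains B where "\<And>t. t \<in> {0..T} \<Longrightarrow> \<bar>g t\<bar> \<le> B"
proof -
  have "bounded (g ` {0..T})" by (intro compact_imp_bounded compact_continuous_image assms) simp
  then obtain B where "\<forall>y\<in>g ` {0..T}. norm y \<le> B" unfolding bounded_iff by blast
  then show ?thesis by (intro that[of B]) auto
qed

text \<open>A continuous path is bounded on \<open>[0, T]\<close>, so for each path the truncation
  is eventually inactive.\<close>

lemma grid_step_truncated_tendsto:
  assumes T: "T > 0" and s: "0 < s" "s \<le> T" and m: "filterlim m at_top sequentially" "\<And>i. m i > 0"
    and K: "filterlim K at_top sequentially"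
    and c: "continuous_on {0..T} g"
  shows "(\<lambda>i. grid_step T (\<lambda>t. min (g t) (K i)) (m i) s) \<longlonglongrightarrow> g s"
proof -
  obtain B where B: "\<And>t. t \<in> {0..T} \<Longrightarrow> \<bar>g t\<bar> \<le> B" using continuous_on_bounded_Icc[OF c] by blast
  have "\<forall>\<^sub>F i in sequentially. B \<le> K i" using K by (simp add: filterlim_at_top)
  then have "\<forall>\<^sub>F i in sequentially. grid_step T g (m i) s = grid_step T (\<lambda>t. min (g t) (K i)) (m i) s"
  proof eventually_elim
    case (elim i)
    have "g (grid_point T (m i) s) \<le> K i"
      using B[OF grid_step_eq(2)[OF T m(2) s, of i]] elim by auto
    then show ?case unfolding grid_step_eq(1)[OF T m(2) s] by simp
  qed
  then show ?thesis using grid_step_tendsto[OF T s m c] by (rule Lim_transform_eventually[rotated])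
qed

text \<open>Writes the sum that occurs as a conditional variance as a time integral, so that
  dominated convergence can be applied to it.\<close>

lemma grid_step_square_integral:
  assumes T: "T > 0" and m: "m > 0"
  shows "(LBINT s:{0..T}. (grid_step T g m s)\<^sup>2) = (\<Sum>k<m. (g (T * real k / real m))\<^sup>2 * (T * real (Suc k) / real m - T * real k / real m))"
proof -
  have sq: "indicator {0..T} s *\<^sub>R (grid_step T g m s)\<^sup>2
    = (\<Sum>k<m. (g (T * real k / real m))\<^sup>2 * indicator {T * real k / real m<..T * real (Suc k) / real m} s)" for s
  proof (cases "0 < s \<and> s \<le> T")
    case True
    have "(\<Sum>k<m. (g (T * real k / real m))\<^sup>2 * indicator {T * real k / real m<..T * real (Suc k) / real m} s)
       = grid_step T (\<lambda>t. (g t)\<^sup>2) m s" by (simp add: grid_step_def)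
    also have "\<dots> = (grid_step T g m s)\<^sup>2" using grid_step_eq(1)[OF T m] True by simp
    finally show ?thesis using True by simp
  next
    case False
    have "s \<notin> {T * real k / real m<..T * real (Suc k) / real m}" if k: "k < m" for k
    proof
      assume a: "s \<in> {T * real k / real m<..T * real (Suc k) / real m}"
      have "0 \<le> T * real k / real m" using T by simp
      moreover have "T * real (Suc k) / real m \<le> T"
        using T m k by (simp add: pos_divide_le_eq del: of_nat_Suc)
      ultimately show False using a False by auto
    qed
    then have z: "indicator {T * real k / real m<..T * real (Suc k) / real m} s = (0::real)" if "k < m" for k using that by (simp add: indicator_def)
    have "grid_step T g m s = 0"
      unfolding grid_step_def by (intro sum.neutral ballI) (simp only: z lessThan_iff mult_zero_right)
    moreover have "(\<Sum>k<m. (g (T * real k / real m))\<^sup>2 * indicator {T * real k / real m<..T * real (Suc k) / real m} s) = 0"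
      by (intro sum.neutral ballI) (simp only: z lessThan_iff mult_zero_right)
    ultimately show ?thesis by simp
  qed
  have le: "T * real k / real m \<le> T * real (Suc k) / real m" for k
    using T by (intro divide_right_mono mult_left_mono) auto
  show ?thesis unfolding set_lebesgue_integral_def sq
    by (subst Bochner_Integration.integral_sum) (use le in \<open>auto simp: measure_def simp del: of_nat_Suc\<close>)
qed

text \<open>Applied to one bridge path around its line, this identifies the limit of the conditional
  variances as \<open>grushin_v\<close>.\<close>

lemma grid_square_sum_tendsto:
  assumes T: "T > 0" and m: "filterlim m at_top sequentially" "\<And>i. m i > 0"
    and K: "filterlim K at_top sequentially" "\<And>i. K i \<ge> 0"
    and c: "continuous_on {0..T} g" and g0: "\<And>t. 0 \<le> g t"
  shows "(\<lambda>i. \<Sum>k<m i. (min (g (T * real k / real (m i))) (K i))\<^sup>2 * (T * real (Suc k) / real (m i) - T * real k / real (m i)))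
     \<longlonglongrightarrow> (LBINT s:{0..T}. (g s)\<^sup>2)"
proof -
  obtain B where B: "\<And>t. t \<in> {0..T} \<Longrightarrow> \<bar>g t\<bar> \<le> B" using continuous_on_bounded_Icc[OF c] by blast
  have meas: "(\<lambda>s. grid_step T (\<lambda>t. min (g t) (K i)) (m i) s) \<in> borel_measurable borel" for i
    unfolding grid_step_def by measurable
  have gm: "(\<lambda>s. indicator {0..T} s *\<^sub>R (g s)\<^sup>2) \<in> borel_measurable lborel"
    using borel_measurable_continuous_on_indicator[of "{0..T}" "\<lambda>s. (g s)\<^sup>2"] c by (auto intro!: continuous_intros)
  have "(\<lambda>i. LBINT s:{0..T}. (grid_step T (\<lambda>t. min (g t) (K i)) (m i) s)\<^sup>2) \<longlonglongrightarrow> (LBINT s:{0..T}. (g s)\<^sup>2)"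
    unfolding set_lebesgue_integral_def
  proof (rule integral_dominated_convergence[where w="\<lambda>s. indicator {0..T} s * B\<^sup>2"])
    show "(\<lambda>s. indicator {0..T} s *\<^sub>R (grid_step T (\<lambda>t. min (g t) (K i)) (m i) s)\<^sup>2) \<in> borel_measurable lborel" for i
      using meas[of i] by measurable
    show "integrable lborel (\<lambda>s. indicator {0..T} s * B\<^sup>2)"
      using T by (intro integrable_mult_left integrable_real_indicator) auto
    have "AE s in lborel. s \<noteq> (0::real)" using AE_lborel_singleton by blast
    then show "AE s in lborel. (\<lambda>i. indicator {0..T} s *\<^sub>R (grid_step T (\<lambda>t. min (g t) (K i)) (m i) s)\<^sup>2) \<longlonglongrightarrow> indicator {0..T} s *\<^sub>R (g s)\<^sup>2"
    proof eventually_elim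
      case (elim s)
      show ?case
      proof (cases "s \<in> {0..T}")
        case True
        then have "(\<lambda>i. grid_step T (\<lambda>t. min (g t) (K i)) (m i) s) \<longlonglongrightarrow> g s"
          using elim by (intro grid_step_truncated_tendsto[OF T _ _ m K(1) c]) auto
        then show ?thesis by (intro tendsto_intros)
      qed simp
    qed
    show "AE s in lborel. norm (indicator {0..T} s *\<^sub>R (grid_step T (\<lambda>t. min (g t) (K i)) (m i) s)\<^sup>2) \<le> indicator {0..T} s * B\<^sup>2" for i
      using \<open>AE s in lborel. s \<noteq> (0::real)\<close>
    proof eventually_elim
      case (elim s)
      show ?case
      proof (cases "s \<in> {0..T}")
        case True
        with elim have s: "0 < s" "s \<le> T" by auto
        have "\<bar>min (g (grid_point T (m i) s)) (K i)\<bar> \<le> \<bar>B\<bar>"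
          using B[OF grid_step_eq(2)[OF T m(2) s, of i]] g0[of "grid_point T (m i) s"] K(2)[of i] by auto
        then show ?thesis using True unfolding grid_step_eq(1)[OF T m(2) s] by (simp add: abs_le_square_iff)
      qed simp
    qed
  qed (use gm in simp)
  then show ?thesis unfolding grid_step_square_integral[OF T m(2)] .
qed

lemma norm_power_le_components:
  fixes z :: "real ^ 'm"
  shows "norm z ^ (2 * n) \<le> real CARD('m) ^ (2 * n) * (\<Sum>i\<in>UNIV. (z $ i) ^ (2 * n))"
proof -
  obtain i0 where i0: "\<And>i. \<bar>z $ i\<bar> \<le> \<bar>z $ i0\<bar>"
    using Max_in[of "range (\<lambda>i. \<bar>z $ i\<bar>)"] Max_ge[of "range (\<lambda>i. \<bar>z $ i\<bar>)"] by fastforce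
  have "norm z \<le> (\<Sum>i\<in>UNIV. \<bar>z $ i\<bar>)" by (rule norm_le_l1_cart)
  also have "\<dots> \<le> (\<Sum>i\<in>(UNIV::'m set). \<bar>z $ i0\<bar>)" by (intro sum_mono i0)
  also have "\<dots> = real CARD('m) * \<bar>z $ i0\<bar>" by simp
  finally have "norm z ^ (2 * n) \<le> (real CARD('m) * \<bar>z $ i0\<bar>) ^ (2 * n)" by (intro power_mono) auto
  also have "\<dots> = real CARD('m) ^ (2 * n) * (z $ i0) ^ (2 * n)" by (simp add: power_mult_distrib power_even_abs)
  also have "(z $ i0) ^ (2 * n) \<le> (\<Sum>i\<in>UNIV. (z $ i) ^ (2 * n))"
    by (rule member_le_sum) auto
  finally show ?thesis by (simp add: mult_left_mono)
qed

section \<open>Moments of Brownian motion\<close>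

context
  fixes M :: "'w measure" and b :: "real \<Rightarrow> 'w \<Rightarrow> real ^ 'd"
  assumes b: "brownian_motion M b"
begin

interpretation prob_space M by (rule bm_prob_space[OF b])

lemma bm_component_moment:
  assumes t: "0 \<le> t" "t \<le> T"
  shows "(\<integral>\<^sup>+\<omega>. ennreal ((b t \<omega> $ i) ^ (2 * n)) \<partial>M) \<le> ennreal (fact (2 * n) / fact n * T ^ n)"
proof (cases "t = 0")
  case True
  have "(\<integral>\<^sup>+\<omega>. ennreal ((b t \<omega> $ i) ^ (2 * n)) \<partial>M) = (\<integral>\<^sup>+\<omega>. ennreal (0 ^ (2 * n)) \<partial>M)"
    using bm_0[OF b] True by (intro nn_integral_cong) simp
  also have "\<dots> \<le> ennreal (fact (2 * n) / fact n * T ^ n)"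
    using emeasure_space_1 t by (cases "n = 0") (auto simp: power_0_left)
  finally show ?thesis .
next
  case False
  with t have t0: "0 < t" "0 < sqrt t" by auto
  have eq: "distributed M lborel (\<lambda>\<omega>. b t \<omega> - b 0 \<omega>) (\<lambda>z. ennreal (\<Prod>i\<in>UNIV. normal_density 0 (sqrt t) (z $ i)))"
    using bm_incr[OF b order.refl t0(1)] by simp
  note D = distributed_prod_normal_component[OF bm_prob_space[OF b] t0(2) eq, of i]
  have int: "integrable M (\<lambda>\<omega>. ((b t \<omega> - b 0 \<omega>) $ i) ^ (2 * n))"
    using distributed_integrable[OF D, of "\<lambda>x. x ^ (2 * n)"] integrable_normal_moment[OF t0(2), of 0 "2 * n"] by simp
  have "(\<integral>\<^sup>+\<omega>. ennreal ((b t \<omega> $ i) ^ (2 * n)) \<partial>M) = (\<integral>\<^sup>+\<omega>. ennreal (((b t \<omega> - b 0 \<omega>) $ i) ^ (2 * n)) \<partial>M)"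
    using bm_0[OF b] by (intro nn_integral_cong) simp
  also have "\<dots> = ennreal (\<integral>\<omega>. ((b t \<omega> - b 0 \<omega>) $ i) ^ (2 * n) \<partial>M)"
    by (rule nn_integral_eq_integral[OF int]) simp
  also have "(\<integral>\<omega>. ((b t \<omega> - b 0 \<omega>) $ i) ^ (2 * n) \<partial>M) = fact (2 * n) / ((2 / t) ^ n * fact n)"
    using distributed_integral[OF D, of "\<lambda>x. x ^ (2 * n)"] integral_normal_moment_even[OF t0(2), of 0 n] t0 by simp
  also have "\<dots> = fact (2 * n) / fact n * (t / 2) ^ n" by (simp add: field_simps)
  also have "ennreal \<dots> \<le> ennreal (fact (2 * n) / fact n * T ^ n)"
    using t by (intro ennreal_leI mult_left_mono power_mono) auto
  finally show ?thesis .
qed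

text \<open>Even moments of the normal components dominate every real power. The bound is uniform in
  \<open>t\<close> so that it can be integrated over \<open>[0, T]\<close>.\<close>

lemma bm_norm_moment:
  assumes p: "0 \<le> p"
  shows "\<exists>C. \<forall>t\<in>{0..T}. (\<integral>\<^sup>+\<omega>. ennreal (norm (x + b t \<omega>) powr p) \<partial>M) \<le> ennreal C"
proof -
  define n where "n = nat \<lceil>p\<rceil>"
  have np: "p \<le> real (2 * n)" unfolding n_def using p le_of_int_ceiling[of p] zero_le_ceiling[of p] by (simp add: of_nat_nat) linarith
  define c where "c = real CARD('d) ^ (2 * n)"
  define C where "C = 1 + 4 ^ n * (norm x ^ (2 * n) + c * (\<Sum>i\<in>(UNIV::'d set). fact (2 * n) / fact n * T ^ n))"
  have bd: "norm (x + z) powr p \<le> (1 + 4 ^ n * norm x ^ (2 * n)) + 4 ^ n * c * (\<Sum>i\<in>UNIV. (z $ i) ^ (2 * n))" for z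
  proof -
    \<comment> \<open>Below norm 1 the power is at most 1; above norm 1 it grows with the
      exponent.\<close>
    have "norm (x + z) powr p \<le> 1 + norm (x + z) ^ (2 * n)"
    proof (cases "norm (x + z) \<le> 1")
      case True
      then have "norm (x + z) powr p \<le> 1" using p by (simp add: powr_le1)
      then show ?thesis by (simp add: add_increasing2)
    next
      case False
      then have "norm (x + z) powr p \<le> norm (x + z) powr (2 * n)"
        using np by (intro powr_mono) auto
      also have "\<dots> = norm (x + z) ^ (2 * n)" using False by (intro powr_realpow) linarith
      finally show ?thesis by simp
    qed
    also have "norm (x + z) ^ (2 * n) \<le> (2 * max (norm x) (norm z)) ^ (2 * n)"
      by (intro power_mono order_trans[OF norm_triangle_ineq]) auto
    also have "\<dots> = 4 ^ n * max (norm x) (norm z) ^ (2 * n)" by (simp add: power_mult_distrib power_mult)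
    also have "max (norm x) (norm z) ^ (2 * n) \<le> norm x ^ (2 * n) + norm z ^ (2 * n)"
      by (auto simp: max_def)
    also have "norm z ^ (2 * n) \<le> c * (\<Sum>i\<in>UNIV. (z $ i) ^ (2 * n))"
      unfolding c_def by (rule norm_power_le_components)
    finally show ?thesis by (simp add: distrib_left mult_ac)
  qed
  have C: "0 \<le> c" by (simp add: c_def)
  have "(\<integral>\<^sup>+\<omega>. ennreal (norm (x + b t \<omega>) powr p) \<partial>M) \<le> ennreal C" if t: "t \<in> {0..T}" for t
  proof -
    have bm[measurable]: "(\<lambda>\<omega>. b t \<omega> $ i) \<in> borel_measurable M" for i
      using t by (intro component_measurable bm_measurable[OF b]) auto
    have T0: "0 \<le> T" using t by auto
    have "(\<integral>\<^sup>+\<omega>. ennreal (norm (x + b t \<omega>) powr p) \<partial>M)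
      \<le> (\<integral>\<^sup>+\<omega>. ennreal (1 + 4 ^ n * norm x ^ (2 * n)) + ennreal (4 ^ n * c) * (\<Sum>i\<in>UNIV. ennreal ((b t \<omega> $ i) ^ (2 * n))) \<partial>M)"
    proof (rule nn_integral_mono)
      fix \<omega>
      have "ennreal (norm (x + b t \<omega>) powr p) \<le> ennreal ((1 + 4 ^ n * norm x ^ (2 * n)) + 4 ^ n * c * (\<Sum>i\<in>UNIV. (b t \<omega> $ i) ^ (2 * n)))"
        by (intro ennreal_leI bd)
      also have "\<dots> = ennreal (1 + 4 ^ n * norm x ^ (2 * n)) + ennreal (4 ^ n * c) * (\<Sum>i\<in>UNIV. ennreal ((b t \<omega> $ i) ^ (2 * n)))"
        using C by (simp add: ennreal_mult sum_nonneg)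
      finally show "ennreal (norm (x + b t \<omega>) powr p) \<le> ennreal (1 + 4 ^ n * norm x ^ (2 * n)) + ennreal (4 ^ n * c) * (\<Sum>i\<in>UNIV. ennreal ((b t \<omega> $ i) ^ (2 * n)))" .
    qed
    also have "\<dots> = ennreal (1 + 4 ^ n * norm x ^ (2 * n)) + ennreal (4 ^ n * c) * (\<Sum>i\<in>UNIV. \<integral>\<^sup>+\<omega>. ennreal ((b t \<omega> $ i) ^ (2 * n)) \<partial>M)"
      by (simp add: nn_integral_add nn_integral_cmult nn_integral_sum emeasure_space_1 del: sum_ennreal)
    also have "\<dots> \<le> ennreal (1 + 4 ^ n * norm x ^ (2 * n)) + ennreal (4 ^ n * c) * (\<Sum>i\<in>(UNIV::'d set). ennreal (fact (2 * n) / fact n * T ^ n))"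
      using t by (intro add_left_mono mult_left_mono sum_mono bm_component_moment) auto
    also have "(\<Sum>i\<in>(UNIV::'d set). ennreal (fact (2 * n) / fact n * T ^ n)) = ennreal (\<Sum>i\<in>(UNIV::'d set). fact (2 * n) / fact n * T ^ n)"
      using T0 by (intro sum_ennreal) simp
    also have "ennreal (1 + 4 ^ n * norm x ^ (2 * n)) + ennreal (4 ^ n * c) * \<dots> = ennreal C"
    proof -
      have e: "C = (1 + 4 ^ n * norm x ^ (2 * n)) + 4 ^ n * c * (\<Sum>i\<in>(UNIV::'d set). fact (2 * n) / fact n * T ^ n)"
        unfolding C_def by (simp only: distrib_left add.assoc mult.assoc)
      have n: "0 \<le> (\<Sum>i\<in>(UNIV::'d set). fact (2 * n) / fact n * T ^ n)" "0 \<le> 4 ^ n * c" "0 \<le> 1 + 4 ^ n * norm x ^ (2 * n)"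
        using T0 C by (auto intro!: sum_nonneg add_nonneg_nonneg simp del: sum_constant)
      show ?thesis unfolding e using n mult_nonneg_nonneg[OF n(2) n(1)] by (simp only: ennreal_mult ennreal_plus)
    qed
    finally show ?thesis .
  qed
  then show ?thesis by blast
qed

end

section \<open>Convergence to the Ito integral\<close>

text \<open>Nonnegative integrals make it possible to compare the norms before any of them is known
  to be finite. The factor 2 is the price for squares in place of norms.\<close>

lemma nn_L2_triangle:
  fixes f g h :: "'z \<Rightarrow> 'a::{real_normed_vector, second_countable_topology}"
  assumes [measurable]: "f \<in> borel_measurable N" "g \<in> borel_measurable N" "h \<in> borel_measurable N"
  shows "(\<integral>\<^sup>+x. ennreal ((norm (f x - g x))\<^sup>2) \<partial>N)
    \<le> 2 * (\<integral>\<^sup>+x. ennreal ((norm (f x - h x))\<^sup>2) \<partial>N) + 2 * (\<integral>\<^sup>+x. ennreal ((norm (h x - g x))\<^sup>2) \<partial>N)"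
proof -
  have "ennreal ((norm (f x - g x))\<^sup>2) \<le> 2 * ennreal ((norm (f x - h x))\<^sup>2) + 2 * ennreal ((norm (h x - g x))\<^sup>2)" for x
  proof -
    have "(norm (f x - g x))\<^sup>2 \<le> 2 * (norm (f x - h x))\<^sup>2 + 2 * (norm (h x - g x))\<^sup>2"
      using norm_power2_add_le[of "f x - h x" "h x - g x"] by simp
    then have "ennreal ((norm (f x - g x))\<^sup>2) \<le> ennreal (2 * (norm (f x - h x))\<^sup>2 + 2 * (norm (h x - g x))\<^sup>2)"
      by (rule ennreal_leI)
    then show ?thesis by (simp add: ennreal_mult')
  qed
  then have "(\<integral>\<^sup>+x. ennreal ((norm (f x - g x))\<^sup>2) \<partial>N)
    \<le> (\<integral>\<^sup>+x. 2 * ennreal ((norm (f x - h x))\<^sup>2) + 2 * ennreal ((norm (h x - g x))\<^sup>2) \<partial>N)"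
    by (intro nn_integral_mono)
  also have "\<dots> = 2 * (\<integral>\<^sup>+x. ennreal ((norm (f x - h x))\<^sup>2) \<partial>N) + 2 * (\<integral>\<^sup>+x. ennreal ((norm (h x - g x))\<^sup>2) \<partial>N)"
    by (subst nn_integral_add) (auto simp: nn_integral_cmult)
  finally show ?thesis .
qed

text \<open>Summable errors in mean give almost sure convergence of the whole sequence, so no
  subsequence has to be extracted.\<close>

lemma AE_summable_of_nn_integral:
  fixes f :: "nat \<Rightarrow> 'z \<Rightarrow> real"
  assumes [measurable]: "\<And>i. f i \<in> borel_measurable N" and f0: "\<And>i x. 0 \<le> f i x"
    and le: "\<And>i. (\<integral>\<^sup>+x. ennreal (f i x) \<partial>N) \<le> ennreal (c i)" and c: "summable c" "\<And>i. 0 \<le> c i"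
  shows "AE x in N. summable (\<lambda>i. f i x)"
proof -
  have "(\<integral>\<^sup>+x. (\<Sum>i. ennreal (f i x)) \<partial>N) = (\<Sum>i. \<integral>\<^sup>+x. ennreal (f i x) \<partial>N)"
    by (intro nn_integral_suminf) simp
  also have "\<dots> \<le> (\<Sum>i. ennreal (c i))" by (intro suminf_le le) auto
  also have "\<dots> = ennreal (\<Sum>i. c i)" by (rule suminf_ennreal2[OF c(2) c(1)])
  finally have "(\<integral>\<^sup>+x. (\<Sum>i. ennreal (f i x)) \<partial>N) \<noteq> \<infinity>" by (auto simp: top_unique)
  then have "AE x in N. (\<Sum>i. ennreal (f i x)) \<noteq> \<infinity>" by (intro nn_integral_PInf_AE) auto
  then show ?thesis
    by eventually_elim (use f0 in \<open>auto intro: summable_suminf_not_top\<close>)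
qed

lemma simple_process_measurable:
  assumes "\<And>k. k < n \<Longrightarrow> h k \<in> borel_measurable M"
  shows "(\<lambda>(s, \<omega>). simple_process n \<tau> h s \<omega>) \<in> borel_measurable (restrict_space lborel S \<Otimes>\<^sub>M M)"
proof -
  have "(\<lambda>p. \<Sum>k<n. h k (snd p) * indicator {\<tau> k<..\<tau> (Suc k)} (fst p)) \<in> borel_measurable (restrict_space lborel S \<Otimes>\<^sub>M M)"
  proof (intro borel_measurable_sum borel_measurable_times)
    fix k assume "k \<in> {..<n}"
    then show "(\<lambda>p. h k (snd p)) \<in> borel_measurable (restrict_space lborel S \<Otimes>\<^sub>M M)"
      by (intro measurable_compose[OF measurable_snd assms]) auto
    show "(\<lambda>p. indicator {\<tau> k<..\<tau> (Suc k)} (fst p) :: real) \<in> borel_measurable (restrict_space lborel S \<Otimes>\<^sub>M M)"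
      by (intro measurable_compose[OF measurable_fst] measurable_restrict_space1) simp
  qed
  then show ?thesis by (simp add: simple_process_def split_beta')
qed

context
  fixes M :: "'w measure" and b :: "real \<Rightarrow> 'w \<Rightarrow> real ^ 'd" and bh :: "real \<Rightarrow> 'w \<Rightarrow> real ^ 'e"
    and \<gamma> T :: real and x :: "real ^ 'd"
  assumes b: "brownian_motion M b" and bh: "brownian_motion M bh" and ind: "indep_processes M b bh"
    and \<gamma>: "\<gamma> > 0" and T: "T > 0"
begin

interpretation prob_space M by (rule bm_prob_space[OF b])


definition coeff where "coeff s \<omega> = norm (x + b s \<omega>) powr \<gamma>"
text \<open>The cap \<open>K\<close> supplies the boundedness that \<open>simple_integrand\<close>
  requires.\<close>

definition trunc_coeff where "trunc_coeff K m k \<omega> = min (coeff (T * real k / real m) \<omega>) K"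
definition grid where "grid m k = T * real k / real m"
definition sq_norm where "sq_norm f = (\<integral>\<^sup>+(s, \<omega>). ennreal ((f s \<omega>)\<^sup>2) \<partial>(lborel_on T \<Otimes>\<^sub>M M))"

lemma coeff_nonneg: "0 \<le> coeff s \<omega>" by (simp add: coeff_def)

lemma coeff_cont: "\<omega> \<in> space M \<Longrightarrow> continuous_on {0..T} (\<lambda>s. coeff s \<omega>)"
  unfolding coeff_def using \<gamma>
  by (intro continuous_on_powr' continuous_intros continuous_on_subset[OF bm_cont[OF b]]) auto

lemma coeff_measurable_general:
  "b s \<in> borel_measurable N \<Longrightarrow> coeff s \<in> borel_measurable N"
proof -
  have "(\<lambda>z. norm (x + z) powr \<gamma>) \<in> borel_measurable borel" by measurable
  then show "b s \<in> borel_measurable N \<Longrightarrow> coeff s \<in> borel_measurable N"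
    unfolding coeff_def[abs_def] by (rule measurable_compose[rotated])
qed

lemma coeff_measurable: "0 \<le> s \<Longrightarrow> coeff s \<in> borel_measurable M"
  by (intro coeff_measurable_general bm_measurable[OF b])

lemma coeff_joint: "(\<lambda>(s, \<omega>). coeff s \<omega>) \<in> borel_measurable (lborel_on T \<Otimes>\<^sub>M M)"
  using T by (intro joint_measurable_continuous coeff_measurable coeff_cont) auto

lemma trunc_coeff_simple:
  assumes "m > 0" "K \<ge> 0"
  shows "simple_integrand M (joint_filt M b bh) m (grid m) (trunc_coeff K m)"
  unfolding simple_integrand_def
proof (intro conjI allI impI)
  fix k assume "k < m"
  show "grid m k \<le> grid m (Suc k)" using T by (auto simp: grid_def intro!: divide_right_mono mult_left_mono)
  show "trunc_coeff K m k \<in> borel_measurable (joint_filt M b bh (grid m k))"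
    unfolding trunc_coeff_def[abs_def] grid_def using T
    by (intro borel_measurable_min coeff_measurable_general measurable_filt_b[OF b bh ind] borel_measurable_const) auto
  show "bounded (trunc_coeff K m k ` space M)"
    unfolding bounded_iff
  proof (intro exI[of _ K] ballI, safe)
    fix \<omega> show "norm (trunc_coeff K m k \<omega>) \<le> K"
      using assms coeff_nonneg[of "T * real k / real m" \<omega>] by (auto simp: trunc_coeff_def)
  qed
qed (simp add: grid_def)

lemma trunc_coeff_process: "simple_process m (grid m) (trunc_coeff K m) s \<omega> = grid_step T (\<lambda>t. min (coeff t \<omega>) K) m s"
  by (simp add: simple_process_def grid_step_def grid_def trunc_coeff_def)

lemma trunc_coeff_measurable: "trunc_coeff K m k \<in> borel_measurable M"
  unfolding trunc_coeff_def[abs_def] using T by (intro borel_measurable_min coeff_measurable) auto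

lemma trunc_coeff_process_measurable:
  "(\<lambda>(s, \<omega>). simple_process m (grid m) (trunc_coeff K m) s \<omega>) \<in> borel_measurable (lborel_on T \<Otimes>\<^sub>M M)"
  by (intro simple_process_measurable trunc_coeff_measurable)

interpretation LL: finite_measure "lborel_on T"
  by (rule finite_measureI) (use T in \<open>simp add: emeasure_restrict_space space_restrict_space\<close>)

interpretation P: pair_sigma_finite "lborel_on T" M ..

lemma finite_P: "finite_measure (lborel_on T \<Otimes>\<^sub>M M)"
proof (rule finite_measureI)
  have "emeasure (lborel_on T \<Otimes>\<^sub>M M) (space (lborel_on T) \<times> space M) = emeasure (lborel_on T) (space (lborel_on T)) * emeasure M (space M)"
    by (rule emeasure_pair_measure_Times[OF sets.top sets.top])
  then show "emeasure (lborel_on T \<Otimes>\<^sub>M M) (space (lborel_on T \<Otimes>\<^sub>M M)) \<noteq> \<infinity>"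
    using LL.emeasure_finite[of "space (lborel_on T)"] by (simp add: space_pair_measure emeasure_space_1)
qed

text \<open>At time 0 the step approximations vanish instead of approximating the integrand; that
  time carries no mass.\<close>

lemma AE_P_pos: "AE p in lborel_on T \<Otimes>\<^sub>M M. 0 < fst p \<and> fst p \<le> T"
proof (rule AE_I')
  have "emeasure (lborel_on T) {0} = 0" using T by (subst emeasure_restrict_space) auto
  moreover have "{0} \<in> sets (lborel_on T)" using T by (subst sets_restrict_space_iff) auto
  ultimately show "{0} \<times> space M \<in> null_sets (lborel_on T \<Otimes>\<^sub>M M)"
    by (intro null_setsI) (auto simp: emeasure_pair_measure_Times)
  show "{p \<in> space (lborel_on T \<Otimes>\<^sub>M M). \<not> (0 < fst p \<and> fst p \<le> T)} \<subseteq> {0} \<times> space M"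
    by (auto simp: space_pair_measure space_restrict_space)
qed

lemma coeff_L2: "sq_norm coeff < \<infinity>"
proof -
  obtain C where C: "\<forall>t\<in>{0..T}. (\<integral>\<^sup>+\<omega>. ennreal (norm (x + b t \<omega>) powr (2 * \<gamma>)) \<partial>M) \<le> ennreal C"
    using bm_norm_moment[OF b, of "2 * \<gamma>" T x] \<gamma> by fastforce
  have sq: "(coeff s \<omega>)\<^sup>2 = norm (x + b s \<omega>) powr (2 * \<gamma>)" for s \<omega>
    unfolding coeff_def power2_eq_square powr_add[symmetric] by simp
  have m: "(\<lambda>p. ennreal ((coeff (fst p) (snd p))\<^sup>2)) \<in> borel_measurable (lborel_on T \<Otimes>\<^sub>M M)"
    using coeff_joint unfolding split_beta' by measurable
  have "sq_norm coeff = (\<integral>\<^sup>+s. \<integral>\<^sup>+\<omega>. ennreal ((coeff s \<omega>)\<^sup>2) \<partial>M \<partial>lborel_on T)"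
    unfolding sq_norm_def split_beta' by (subst nn_integral_fst[symmetric]) (use m in auto)
  also have "\<dots> \<le> (\<integral>\<^sup>+s. ennreal C \<partial>lborel_on T)"
    unfolding sq by (intro nn_integral_mono C[rule_format]) (simp add: space_restrict_space)
  also have "\<dots> < \<infinity>"
    using LL.emeasure_finite[of "space (lborel_on T)"] by (simp add: ennreal_mult_eq_top_iff less_top[symmetric])
  finally show ?thesis .
qed

text \<open>Truncating before discretising replaces a maximal inequality by dominated convergence twice.\<close>

lemma sq_norm_truncate: "(\<lambda>K::nat. sq_norm (\<lambda>s \<omega>. coeff s \<omega> - min (coeff s \<omega>) (real K))) \<longlonglongrightarrow> 0"
proof -
  have Hm[measurable]: "(\<lambda>p. coeff (fst p) (snd p)) \<in> borel_measurable (lborel_on T \<Otimes>\<^sub>M M)"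
    using coeff_joint unfolding split_beta' .
  have "(\<lambda>K::nat. \<integral>\<^sup>+p. ennreal ((coeff (fst p) (snd p) - min (coeff (fst p) (snd p)) (real K))\<^sup>2) \<partial>(lborel_on T \<Otimes>\<^sub>M M)) \<longlonglongrightarrow> (\<integral>\<^sup>+p. 0 \<partial>(lborel_on T \<Otimes>\<^sub>M M))"
  proof (rule nn_integral_dominated_convergence[where w="\<lambda>p. ennreal ((coeff (fst p) (snd p))\<^sup>2)"])
    show "(\<integral>\<^sup>+p. ennreal ((coeff (fst p) (snd p))\<^sup>2) \<partial>(lborel_on T \<Otimes>\<^sub>M M)) < \<infinity>"
      using coeff_L2 by (simp add: sq_norm_def split_beta')
    show "AE p in lborel_on T \<Otimes>\<^sub>M M. ennreal ((coeff (fst p) (snd p) - min (coeff (fst p) (snd p)) (real K))\<^sup>2) \<le> ennreal ((coeff (fst p) (snd p))\<^sup>2)" for K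
      using coeff_nonneg by (intro AE_I2 ennreal_leI power_mono) (auto simp: min_def)
    show "AE p in lborel_on T \<Otimes>\<^sub>M M. (\<lambda>K. ennreal ((coeff (fst p) (snd p) - min (coeff (fst p) (snd p)) (real K))\<^sup>2)) \<longlonglongrightarrow> 0"
    proof (intro AE_I2 tendsto_eventually)
      fix p
      obtain n :: nat where "coeff (fst p) (snd p) \<le> real n" using real_arch_simple by blast
      then show "\<forall>\<^sub>F K in sequentially. ennreal ((coeff (fst p) (snd p) - min (coeff (fst p) (snd p)) (real K))\<^sup>2) = 0"
        by (intro eventually_sequentiallyI[of n]) (auto simp: min_def)
    qed
  qed auto
  then show ?thesis by (simp add: sq_norm_def split_beta')
qed

text \<open>For fixed \<open>K\<close> the error is at most \<open>K\<close> and the measure is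
  finite, so the constant \<open>K\<^sup>2\<close> is an integrable majorant.\<close>

lemma sq_norm_step:
  assumes K: "K \<ge> 0"
  shows "(\<lambda>m. sq_norm (\<lambda>s \<omega>. min (coeff s \<omega>) K - simple_process (Suc m) (grid (Suc m)) (trunc_coeff K (Suc m)) s \<omega>)) \<longlonglongrightarrow> 0"
proof -
  have Hm[measurable]: "(\<lambda>p. coeff (fst p) (snd p)) \<in> borel_measurable (lborel_on T \<Otimes>\<^sub>M M)"
    using coeff_joint unfolding split_beta' .
  have Gm[measurable]: "(\<lambda>p. grid_step T (\<lambda>t. min (coeff t (snd p)) K) m (fst p)) \<in> borel_measurable (lborel_on T \<Otimes>\<^sub>M M)" for m
    using trunc_coeff_process_measurable[of m K] unfolding split_beta' trunc_coeff_process .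
  have "(\<lambda>m. \<integral>\<^sup>+p. ennreal ((min (coeff (fst p) (snd p)) K - grid_step T (\<lambda>t. min (coeff t (snd p)) K) (Suc m) (fst p))\<^sup>2) \<partial>(lborel_on T \<Otimes>\<^sub>M M)) \<longlonglongrightarrow> (\<integral>\<^sup>+p. 0 \<partial>(lborel_on T \<Otimes>\<^sub>M M))"
  proof (rule nn_integral_dominated_convergence[where w="\<lambda>p. ennreal (K\<^sup>2)"])
    show "(\<integral>\<^sup>+p. ennreal (K\<^sup>2) \<partial>(lborel_on T \<Otimes>\<^sub>M M)) < \<infinity>"
      using finite_measure.emeasure_finite[OF finite_P, of "space (lborel_on T \<Otimes>\<^sub>M M)"]
      by (simp add: ennreal_mult_eq_top_iff less_top[symmetric])
    show "AE p in lborel_on T \<Otimes>\<^sub>M M. ennreal ((min (coeff (fst p) (snd p)) K - grid_step T (\<lambda>t. min (coeff t (snd p)) K) (Suc m) (fst p))\<^sup>2) \<le> ennreal (K\<^sup>2)" for m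
      using AE_P_pos
    proof eventually_elim
      case (elim p)
      then have g: "grid_step T (\<lambda>t. min (coeff t (snd p)) K) (Suc m) (fst p) = min (coeff (grid_point T (Suc m) (fst p)) (snd p)) K"
        using grid_step_eq(1)[OF T, of "Suc m" "fst p"] by simp
      have "\<bar>min (coeff (fst p) (snd p)) K - min (coeff (grid_point T (Suc m) (fst p)) (snd p)) K\<bar> \<le> K"
        using coeff_nonneg[of "fst p" "snd p"] coeff_nonneg[of "grid_point T (Suc m) (fst p)" "snd p"] K by auto
      then show ?case unfolding g by (intro ennreal_leI abs_le_square_iff[THEN iffD1]) (use K in simp)
    qed
    show "AE p in lborel_on T \<Otimes>\<^sub>M M. (\<lambda>m. ennreal ((min (coeff (fst p) (snd p)) K - grid_step T (\<lambda>t. min (coeff t (snd p)) K) (Suc m) (fst p))\<^sup>2)) \<longlonglongrightarrow> 0"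
      using AE_P_pos AE_space
    proof eventually_elim
      case (elim p)
      then have w: "snd p \<in> space M" by (auto simp: space_pair_measure)
      have "(\<lambda>m. grid_step T (\<lambda>t. min (coeff t (snd p)) K) (Suc m) (fst p)) \<longlonglongrightarrow> min (coeff (fst p) (snd p)) K"
        using elim by (intro grid_step_tendsto[OF T _ _ filterlim_Suc] continuous_intros coeff_cont[OF w]) auto
      then have "(\<lambda>m. (min (coeff (fst p) (snd p)) K - grid_step T (\<lambda>t. min (coeff t (snd p)) K) (Suc m) (fst p))\<^sup>2) \<longlonglongrightarrow> (min (coeff (fst p) (snd p)) K - min (coeff (fst p) (snd p)) K)\<^sup>2"
        by (intro tendsto_intros)
      then have "(\<lambda>m. ennreal ((min (coeff (fst p) (snd p)) K - grid_step T (\<lambda>t. min (coeff t (snd p)) K) (Suc m) (fst p))\<^sup>2)) \<longlonglongrightarrow> ennreal ((min (coeff (fst p) (snd p)) K - min (coeff (fst p) (snd p)) K)\<^sup>2)"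
        by (rule tendsto_ennrealI)
      then show ?case by simp
    qed
  qed auto
  then show ?thesis by (simp add: sq_norm_def split_beta' trunc_coeff_process)
qed

lemma sq_norm_triangle:
  assumes "(\<lambda>(s, \<omega>). f s \<omega>) \<in> borel_measurable (lborel_on T \<Otimes>\<^sub>M M)" "(\<lambda>(s, \<omega>). g s \<omega>) \<in> borel_measurable (lborel_on T \<Otimes>\<^sub>M M)"
    "(\<lambda>(s, \<omega>). h s \<omega>) \<in> borel_measurable (lborel_on T \<Otimes>\<^sub>M M)"
  shows "sq_norm (\<lambda>s \<omega>. f s \<omega> - g s \<omega>) \<le> 2 * sq_norm (\<lambda>s \<omega>. f s \<omega> - h s \<omega>) + 2 * sq_norm (\<lambda>s \<omega>. h s \<omega> - g s \<omega>)"
  using nn_L2_triangle[OF assms] by (simp add: sq_norm_def split_beta')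

lemma sq_norm_commute: "sq_norm (\<lambda>s \<omega>. f s \<omega> - g s \<omega>) = sq_norm (\<lambda>s \<omega>. g s \<omega> - f s \<omega>)"
  by (simp add: sq_norm_def power2_commute)

text \<open>First \<open>K\<close> and then \<open>m\<close> is chosen, each for half of the error.
  The rate \<open>1 / 4 ^ i\<close> leaves room for a weight \<open>2 ^ i\<close> in summability
  arguments, and the lower bounds on \<open>K i\<close> and \<open>m i\<close> make both tend to
  infinity.\<close>

lemma ito_sequence:
  obtains K :: "nat \<Rightarrow> nat" and m :: "nat \<Rightarrow> nat" where "\<And>i. K i \<ge> i" "\<And>i. m i > i"
    "\<And>i. sq_norm (\<lambda>s \<omega>. coeff s \<omega> - simple_process (m i) (grid (m i)) (trunc_coeff (K i) (m i)) s \<omega>) \<le> ennreal (1 / 4 ^ i)"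
proof -
  have "\<exists>K m. K \<ge> i \<and> m > i \<and> sq_norm (\<lambda>s \<omega>. coeff s \<omega> - simple_process m (grid m) (trunc_coeff (real K) m) s \<omega>) \<le> ennreal (1 / 4 ^ i)" for i :: nat
  proof -
    \<comment> \<open>A quarter of the target: the two errors enter the triangle inequality with
      factor 2 each.\<close>
    define \<epsilon> where "\<epsilon> = (1 / 4 ^ Suc i :: real)"
    have \<epsilon>: "0 < ennreal \<epsilon>" by (simp add: \<epsilon>_def)
    have "\<forall>\<^sub>F K in sequentially. sq_norm (\<lambda>s \<omega>. coeff s \<omega> - min (coeff s \<omega>) (real K)) < ennreal \<epsilon> \<and> i \<le> K"
      by (intro eventually_conj order_tendstoD(2)[OF sq_norm_truncate \<epsilon>] eventually_ge_at_top)
    from eventually_happens'[OF sequentially_bot this]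
    obtain K where K: "sq_norm (\<lambda>s \<omega>. coeff s \<omega> - min (coeff s \<omega>) (real K)) < ennreal \<epsilon>" "i \<le> K" by blast
    have "\<forall>\<^sub>F m in sequentially. sq_norm (\<lambda>s \<omega>. min (coeff s \<omega>) (real K) - simple_process (Suc m) (grid (Suc m)) (trunc_coeff (real K) (Suc m)) s \<omega>) < ennreal \<epsilon> \<and> i \<le> m"
      by (intro eventually_conj order_tendstoD(2)[OF sq_norm_step \<epsilon>] eventually_ge_at_top) simp
    from eventually_happens'[OF sequentially_bot this]
    obtain m where m: "sq_norm (\<lambda>s \<omega>. min (coeff s \<omega>) (real K) - simple_process (Suc m) (grid (Suc m)) (trunc_coeff (real K) (Suc m)) s \<omega>) < ennreal \<epsilon>" "i \<le> m" by blast
    have mm: "(\<lambda>(s, \<omega>). min (coeff s \<omega>) (real K)) \<in> borel_measurable (lborel_on T \<Otimes>\<^sub>M M)"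
      using coeff_joint unfolding split_beta' by measurable
    have "sq_norm (\<lambda>s \<omega>. coeff s \<omega> - simple_process (Suc m) (grid (Suc m)) (trunc_coeff (real K) (Suc m)) s \<omega>)
      \<le> 2 * sq_norm (\<lambda>s \<omega>. coeff s \<omega> - min (coeff s \<omega>) (real K)) + 2 * sq_norm (\<lambda>s \<omega>. min (coeff s \<omega>) (real K) - simple_process (Suc m) (grid (Suc m)) (trunc_coeff (real K) (Suc m)) s \<omega>)"
      by (rule sq_norm_triangle[OF coeff_joint trunc_coeff_process_measurable mm])
    also have "\<dots> \<le> 2 * ennreal \<epsilon> + 2 * ennreal \<epsilon>"
      using K m by (intro add_mono mult_left_mono) auto
    also have "\<dots> = ennreal (1 / 4 ^ i)"
    proof -
      have "2 * ennreal \<epsilon> + 2 * ennreal \<epsilon> = ennreal (2 * \<epsilon> + 2 * \<epsilon>)"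
        using \<open>0 < ennreal \<epsilon>\<close> by (subst ennreal_plus) (simp_all add: ennreal_mult')
      then show ?thesis by (simp add: \<epsilon>_def)
    qed
    finally show ?thesis using K m by (intro exI[of _ K] exI[of _ "Suc m"]) auto
  qed
  then have "\<forall>i. \<exists>q. fst q \<ge> i \<and> snd q > i \<and>
      sq_norm (\<lambda>s \<omega>. coeff s \<omega> - simple_process (snd q) (grid (snd q)) (trunc_coeff (real (fst q)) (snd q)) s \<omega>) \<le> ennreal (1 / 4 ^ i)"
    by fastforce
  from choice[OF this] obtain q where q: "\<And>i. fst (q i) \<ge> i" "\<And>i. snd (q i) > i"
      "\<And>i. sq_norm (\<lambda>s \<omega>. coeff s \<omega> - simple_process (snd (q i)) (grid (snd (q i))) (trunc_coeff (real (fst (q i))) (snd (q i))) s \<omega>) \<le> ennreal (1 / 4 ^ i)"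
    by blast
  show ?thesis by (rule that[OF q])
qed

lemma simple_integral_measurable:
  assumes "simple_integrand M (joint_filt M b bh) n \<tau> h"
  shows "simple_integral bh n \<tau> h T \<in> borel_measurable M"
proof -
  have pos: "0 \<le> \<tau> k" if "k \<le> n" for k
    using that
  proof (induction k)
    case (Suc k)
    then have "0 \<le> \<tau> k" by simp
    also have "\<tau> k \<le> \<tau> (Suc k)" using assms Suc by (simp add: simple_integrand_def)
    finally show ?case .
  qed (use assms in \<open>simp add: simple_integrand_def\<close>)
  have "h k \<in> borel_measurable M" if "k < n" for k
    using assms that measurable_filt[OF b bh ind, of "h k" "\<tau> k"] by (simp add: simple_integrand_def)
  then show ?thesis unfolding simple_integral_def[abs_def] using T pos
    by (intro borel_measurable_sum borel_measurable_scaleR borel_measurable_diff bm_measurable[OF bh]) auto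
qed

lemma simple_process_measurable':
  assumes "simple_integrand M (joint_filt M b bh) n \<tau> h"
  shows "(\<lambda>(s, \<omega>). simple_process n \<tau> h s \<omega>) \<in> borel_measurable (lborel_on T \<Otimes>\<^sub>M M)"
  using assms measurable_filt[OF b bh ind]
  by (intro simple_process_measurable) (auto simp: simple_integrand_def)

lemma simple_difference_sq_norm:
  assumes "simple_integrand M (joint_filt M b bh) n \<tau> h" "simple_integrand M (joint_filt M b bh) n' \<tau>' h'"
  shows "(\<integral>\<^sup>+\<omega>. ennreal ((norm (simple_integral bh n \<tau> h T \<omega> - simple_integral bh n' \<tau>' h' T \<omega>))\<^sup>2) \<partial>M)
    = ennreal CARD('e) * sq_norm (\<lambda>s \<omega>. simple_process n \<tau> h s \<omega> - simple_process n' \<tau>' h' s \<omega>)"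
  unfolding sq_norm_def using simple_difference_isometry[OF b bh ind assms] T by simp

text \<open>Any version \<open>I\<close> is close to any simple integral, not only to those of its
  defining sequence: pass through that sequence and let it converge. In this way the isometry
  reaches the \<open>SOME\<close> choice. The constant 4 comes from two uses of the triangle
  inequality.\<close>

lemma ito_approximation:
  assumes I: "has_ito_integral M (joint_filt M b bh) bh coeff T I" and s: "simple_integrand M (joint_filt M b bh) n \<tau> h"
  shows "(\<integral>\<^sup>+\<omega>. ennreal ((norm (I \<omega> - simple_integral bh n \<tau> h T \<omega>))\<^sup>2) \<partial>M)
    \<le> ennreal (4 * CARD('e)) * sq_norm (\<lambda>s \<omega>. coeff s \<omega> - simple_process n \<tau> h s \<omega>)"
proof -
  obtain n' \<tau>' h' where s': "\<And>m. simple_integrand M (joint_filt M b bh) (n' m) (\<tau>' m) (h' m)"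
    and l1: "(\<lambda>m::nat. sq_norm (\<lambda>s \<omega>. coeff s \<omega> - simple_process (n' m) (\<tau>' m) (h' m) s \<omega>)) \<longlonglongrightarrow> 0"
    and l2: "(\<lambda>m. \<integral>\<^sup>+\<omega>. ennreal ((norm (I \<omega> - simple_integral bh (n' m) (\<tau>' m) (h' m) T \<omega>))\<^sup>2) \<partial>M) \<longlonglongrightarrow> 0"
    and Im: "I \<in> borel_measurable M"
    using I unfolding has_ito_integral_def sq_norm_def by blast
  let ?c = "ennreal CARD('e)"
  let ?e = "sq_norm (\<lambda>s \<omega>. coeff s \<omega> - simple_process n \<tau> h s \<omega>)"
  let ?a = "\<lambda>m. \<integral>\<^sup>+\<omega>. ennreal ((norm (I \<omega> - simple_integral bh (n' m) (\<tau>' m) (h' m) T \<omega>))\<^sup>2) \<partial>M"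
  let ?n = "\<lambda>m. sq_norm (\<lambda>s \<omega>. coeff s \<omega> - simple_process (n' m) (\<tau>' m) (h' m) s \<omega>)"
  have le: "(\<integral>\<^sup>+\<omega>. ennreal ((norm (I \<omega> - simple_integral bh n \<tau> h T \<omega>))\<^sup>2) \<partial>M)
     \<le> 2 * ?a m + 2 * (?c * (2 * ?n m + 2 * ?e))" for m
  proof -
    have "(\<integral>\<^sup>+\<omega>. ennreal ((norm (I \<omega> - simple_integral bh n \<tau> h T \<omega>))\<^sup>2) \<partial>M)
      \<le> 2 * ?a m + 2 * (\<integral>\<^sup>+\<omega>. ennreal ((norm (simple_integral bh (n' m) (\<tau>' m) (h' m) T \<omega> - simple_integral bh n \<tau> h T \<omega>))\<^sup>2) \<partial>M)"
      by (rule nn_L2_triangle[OF Im simple_integral_measurable[OF s] simple_integral_measurable[OF s']])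
    also have "\<dots> = 2 * ?a m + 2 * (?c * sq_norm (\<lambda>s \<omega>. simple_process (n' m) (\<tau>' m) (h' m) s \<omega> - simple_process n \<tau> h s \<omega>))"
      unfolding simple_difference_sq_norm[OF s' s] ..
    also have "\<dots> \<le> 2 * ?a m + 2 * (?c * (2 * ?n m + 2 * ?e))"
      using sq_norm_triangle[OF simple_process_measurable'[OF s'[of m]] simple_process_measurable'[OF s] coeff_joint]
      by (intro add_left_mono mult_left_mono) (auto simp: sq_norm_commute[of "\<lambda>s \<omega>. simple_process (n' m) (\<tau>' m) (h' m) s \<omega>" coeff])
    finally show ?thesis .
  qed
  have "(\<lambda>m. 2 * ?a m + 2 * (?c * (2 * ?n m + 2 * ?e))) \<longlonglongrightarrow> 2 * 0 + 2 * (?c * (2 * 0 + 2 * ?e))"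
    by (intro tendsto_add ennreal_tendsto_cmult l1 l2 tendsto_const) auto
  then have "(\<integral>\<^sup>+\<omega>. ennreal ((norm (I \<omega> - simple_integral bh n \<tau> h T \<omega>))\<^sup>2) \<partial>M) \<le> 2 * 0 + 2 * (?c * (2 * 0 + 2 * ?e))"
    by (rule LIMSEQ_le_const) (use le in auto)
  also have "\<dots> = ennreal (4 * CARD('e)) * ?e"
  proof -
    have "ennreal (4 * CARD('e)) = 4 * ?c" by (simp add: ennreal_mult')
    moreover have "2 * (?c * (2 * ?e)) = (2 * 2) * ?c * ?e" by (simp only: mult_ac)
    moreover have "(2 * 2 :: ennreal) = 4" by simp
    ultimately show ?thesis by simp
  qed
  finally show ?thesis .
qed

text \<open>Completeness of L2 carried out by hand: the integrals along \<open>ito_sequence\<close>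
  converge almost surely and, by Fatou, in mean square. Without existence the \<open>SOME\<close>
  choice would carry no information.\<close>

lemma ito_integral_exists: "\<exists>I. has_ito_integral M (joint_filt M b bh) bh coeff T I"
proof -
  obtain K m where Km: "\<And>i. K i \<ge> (i::nat)" "\<And>i. m i > (i::nat)"
    and err: "\<And>i. sq_norm (\<lambda>s \<omega>. coeff s \<omega> - simple_process (m i) (grid (m i)) (trunc_coeff (K i) (m i)) s \<omega>) \<le> ennreal (1 / 4 ^ i)"
    by (rule ito_sequence) (rule that)
  define P where "P i = simple_process (m i) (grid (m i)) (trunc_coeff (K i) (m i))" for i
  define S where "S i = simple_integral bh (m i) (grid (m i)) (trunc_coeff (K i) (m i)) T" for i
  have si: "simple_integrand M (joint_filt M b bh) (m i) (grid (m i)) (trunc_coeff (K i) (m i))" for i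
    using Km(2)[of i] by (intro trunc_coeff_simple) auto
  have Sm[measurable]: "S i \<in> borel_measurable M" for i unfolding S_def by (rule simple_integral_measurable[OF si])
  have Pm: "(\<lambda>(s, \<omega>). P i s \<omega>) \<in> borel_measurable (lborel_on T \<Otimes>\<^sub>M M)" for i unfolding P_def by (rule simple_process_measurable'[OF si])
  define c where "c = real CARD('e)"
  have diff: "(\<integral>\<^sup>+\<omega>. ennreal ((norm (S k \<omega> - S i \<omega>))\<^sup>2) \<partial>M) \<le> ennreal (4 * c / 4 ^ i)" if "i \<le> k" for i k
  proof -
    have "(\<integral>\<^sup>+\<omega>. ennreal ((norm (S k \<omega> - S i \<omega>))\<^sup>2) \<partial>M) = ennreal c * sq_norm (\<lambda>s \<omega>. P k s \<omega> - P i s \<omega>)"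
      unfolding S_def P_def c_def by (rule simple_difference_sq_norm[OF si si])
    also have "sq_norm (\<lambda>s \<omega>. P k s \<omega> - P i s \<omega>) \<le> 2 * sq_norm (\<lambda>s \<omega>. P k s \<omega> - coeff s \<omega>) + 2 * sq_norm (\<lambda>s \<omega>. coeff s \<omega> - P i s \<omega>)"
      by (rule sq_norm_triangle[OF Pm Pm coeff_joint])
    also have "sq_norm (\<lambda>s \<omega>. P k s \<omega> - coeff s \<omega>) = sq_norm (\<lambda>s \<omega>. coeff s \<omega> - P k s \<omega>)" by (rule sq_norm_commute)
    also have "2 * sq_norm (\<lambda>s \<omega>. coeff s \<omega> - P k s \<omega>) + 2 * sq_norm (\<lambda>s \<omega>. coeff s \<omega> - P i s \<omega>) \<le> 2 * ennreal (1 / 4 ^ i) + 2 * ennreal (1 / 4 ^ i)"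
    proof (intro add_mono mult_left_mono)
      have "(4::real) ^ i \<le> 4 ^ k" using that by (intro power_increasing) auto
      then have "ennreal (1 / 4 ^ k) \<le> ennreal (1 / 4 ^ i)" by (intro ennreal_leI divide_left_mono) auto
      then show "sq_norm (\<lambda>s \<omega>. coeff s \<omega> - P k s \<omega>) \<le> ennreal (1 / 4 ^ i)" using err[of k] unfolding P_def by (rule order_trans[rotated])
      show "sq_norm (\<lambda>s \<omega>. coeff s \<omega> - P i s \<omega>) \<le> ennreal (1 / 4 ^ i)" using err[of i] unfolding P_def .
    qed auto
    also have "2 * ennreal (1 / 4 ^ i) + 2 * ennreal (1 / 4 ^ i) = ennreal (4 * (1 / 4 ^ i))"
    proof -
      have "ennreal (4 * (1 / 4 ^ i)) = ennreal (2 * (1 / 4 ^ i) + 2 * (1 / 4 ^ i))" by (rule arg_cong[where f=ennreal]) simp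
      also have "\<dots> = 2 * ennreal (1 / 4 ^ i) + 2 * ennreal (1 / 4 ^ i)"
        by (subst ennreal_plus) (simp_all add: ennreal_mult' del: times_divide_eq_right)
      finally show ?thesis ..
    qed
    also have "ennreal c * ennreal (4 * (1 / 4 ^ i)) = ennreal (4 * c / 4 ^ i)"
      by (subst ennreal_mult[symmetric]) (auto simp: c_def mult_ac)
    finally show ?thesis by (simp add: mult_left_mono)
  qed
  \<comment> \<open>The weight \<open>2 ^ i\<close> is affordable at rate \<open>1 / 4 ^ i\<close>,
    and it makes the increments themselves summable by way of
    \<open>a \<le> (1 / 2) ^ i + 2 ^ i * a\<^sup>2\<close>.\<close>
  have "AE \<omega> in M. summable (\<lambda>i. 2 ^ i * (norm (S (Suc i) \<omega> - S i \<omega>))\<^sup>2)"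
  proof (rule AE_summable_of_nn_integral)
    show "summable (\<lambda>i. 4 * c * (1 / 2) ^ i)" by (intro summable_mult summable_geometric) simp
    show "(\<integral>\<^sup>+\<omega>. ennreal (2 ^ i * (norm (S (Suc i) \<omega> - S i \<omega>))\<^sup>2) \<partial>M) \<le> ennreal (4 * c * (1 / 2) ^ i)" for i
    proof -
      have "(\<integral>\<^sup>+\<omega>. ennreal (2 ^ i * (norm (S (Suc i) \<omega> - S i \<omega>))\<^sup>2) \<partial>M)
         = ennreal (2 ^ i) * (\<integral>\<^sup>+\<omega>. ennreal ((norm (S (Suc i) \<omega> - S i \<omega>))\<^sup>2) \<partial>M)"
        by (subst nn_integral_cmult[symmetric]) (auto simp: ennreal_mult)
      also have "\<dots> \<le> ennreal (2 ^ i) * ennreal (4 * c / 4 ^ i)" by (intro mult_left_mono diff) auto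
      also have "\<dots> = ennreal (2 ^ i * (4 * c / 4 ^ i))" by (subst ennreal_mult[symmetric]) (auto simp: c_def)
      also have "2 ^ i * (4 * c / 4 ^ i) = 4 * c * (1 / 2) ^ i"
      proof -
        have "(4::real) ^ i = 2 ^ i * 2 ^ i" by (simp add: power_mult_distrib[symmetric])
        then show ?thesis by (simp add: power_divide)
      qed
      finally show ?thesis .
    qed
  qed (auto simp: c_def)
  then have AEconv: "AE \<omega> in M. (\<lambda>i. S i \<omega>) \<longlonglongrightarrow> lim (\<lambda>i. S i \<omega>)"
  proof eventually_elim
    case (elim \<omega>)
    have "summable (\<lambda>i. (1 / 2) ^ i + 2 ^ i * (norm (S (Suc i) \<omega> - S i \<omega>))\<^sup>2)"
      by (intro summable_add elim summable_geometric) simp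
    then have "summable (\<lambda>i. S (Suc i) \<omega> - S i \<omega>)"
    proof (rule summable_comparison_test'[where N=0])
      fix i :: nat
      let ?a = "norm (S (Suc i) \<omega> - S i \<omega>)"
      have "0 \<le> (1 - 2 ^ i * ?a)\<^sup>2" by simp
      then have "2 * (2 ^ i * ?a) \<le> 1 + (2 ^ i * ?a)\<^sup>2" by (simp add: power2_diff)
      moreover have "0 \<le> 2 ^ i * ?a" by simp
      ultimately have "2 ^ i * ?a \<le> 1 + (2 ^ i * ?a)\<^sup>2" by linarith
      then have "(1 / 2) ^ i * (2 ^ i * ?a) \<le> (1 / 2) ^ i * (1 + (2 ^ i * ?a)\<^sup>2)" by (intro mult_left_mono) auto
      moreover have "(1 / 2) ^ i * (2 ^ i * ?a) = ?a" by (simp add: power_divide)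
      moreover have "(1 / 2) ^ i * (1 + (2 ^ i * ?a)\<^sup>2) = (1 / 2) ^ i + 2 ^ i * ?a\<^sup>2"
        by (simp add: power_divide field_simps power2_eq_square)
      ultimately show "?a \<le> (1 / 2) ^ i + 2 ^ i * ?a\<^sup>2" by simp
    qed
    then have "convergent (\<lambda>n. \<Sum>i<n. S (Suc i) \<omega> - S i \<omega>)" by (simp add: summable_iff_convergent)
    then have "convergent (\<lambda>n. S n \<omega> - S 0 \<omega>)" by (simp only: sum_lessThan_telescope[of "\<lambda>i. S i \<omega>"])
    then have "convergent (\<lambda>n. S n \<omega>)" using convergent_add[OF _ convergent_const[of "S 0 \<omega>"], of "\<lambda>n. S n \<omega> - S 0 \<omega>"] by simp
    then show ?case by (simp add: convergent_LIMSEQ_iff)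
  qed
  define I where "I \<omega> = lim (\<lambda>i. S i \<omega>)" for \<omega>
  have Im[measurable]: "I \<in> borel_measurable M" unfolding I_def[abs_def] by (rule borel_measurable_lim_metric[OF Sm])
  have lim0: "(\<lambda>i. ennreal (4 * c / 4 ^ i)) \<longlonglongrightarrow> 0"
  proof -
    have "(\<lambda>i. 4 * c * (1 / 4) ^ i) \<longlonglongrightarrow> 4 * c * 0" by (intro tendsto_intros LIMSEQ_power_zero) simp
    then have "(\<lambda>i. ennreal (4 * c * (1 / 4) ^ i)) \<longlonglongrightarrow> ennreal (4 * c * 0)" by (rule tendsto_ennrealI)
    then show ?thesis by (simp add: power_divide)
  qed
  have Ierr: "(\<integral>\<^sup>+\<omega>. ennreal ((norm (I \<omega> - S i \<omega>))\<^sup>2) \<partial>M) \<le> ennreal (4 * c / 4 ^ i)" for i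
  proof -
    \<comment> \<open>Fatou's lemma applied to the Cauchy estimate \<open>diff\<close> as
      \<open>k\<close> grows.\<close>
    have "(\<integral>\<^sup>+\<omega>. ennreal ((norm (I \<omega> - S i \<omega>))\<^sup>2) \<partial>M) = (\<integral>\<^sup>+\<omega>. liminf (\<lambda>k. ennreal ((norm (S k \<omega> - S i \<omega>))\<^sup>2)) \<partial>M)"
    proof (rule nn_integral_cong_AE)
      show "AE \<omega> in M. ennreal ((norm (I \<omega> - S i \<omega>))\<^sup>2) = liminf (\<lambda>k. ennreal ((norm (S k \<omega> - S i \<omega>))\<^sup>2))"
        using AEconv
      proof eventually_elim
        case (elim \<omega>)
        then have "(\<lambda>k. ennreal ((norm (S k \<omega> - S i \<omega>))\<^sup>2)) \<longlonglongrightarrow> ennreal ((norm (I \<omega> - S i \<omega>))\<^sup>2)"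
          unfolding I_def by (intro tendsto_ennrealI tendsto_intros)
        from lim_imp_Liminf[OF sequentially_bot this] show ?case by simp
      qed
    qed
    also have "\<dots> \<le> liminf (\<lambda>k. \<integral>\<^sup>+\<omega>. ennreal ((norm (S k \<omega> - S i \<omega>))\<^sup>2) \<partial>M)" by (intro nn_integral_liminf) measurable
    also have "\<dots> \<le> limsup (\<lambda>k. \<integral>\<^sup>+\<omega>. ennreal ((norm (S k \<omega> - S i \<omega>))\<^sup>2) \<partial>M)" by (intro Liminf_le_Limsup) simp
    also have "\<dots> \<le> ennreal (4 * c / 4 ^ i)"
      by (intro Limsup_bounded eventually_sequentiallyI[of i] diff)
    finally show ?thesis .
  qed
  have "has_ito_integral M (joint_filt M b bh) bh coeff T I"
    unfolding has_ito_integral_def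
  proof (intro conjI exI[of _ m] exI[of _ "\<lambda>i. grid (m i)"] exI[of _ "\<lambda>i. trunc_coeff (real (K i)) (m i)"] allI)
    show "(\<lambda>i. \<integral>\<^sup>+(s, \<omega>). ennreal ((coeff s \<omega> - simple_process (m i) (grid (m i)) (trunc_coeff (K i) (m i)) s \<omega>)\<^sup>2) \<partial>(lborel_on T \<Otimes>\<^sub>M M)) \<longlonglongrightarrow> 0"
    proof (rule tendsto_sandwich[OF _ _ tendsto_const])
      show "(\<lambda>i. ennreal (1 / 4 ^ i)) \<longlonglongrightarrow> 0"
        using tendsto_ennrealI[OF LIMSEQ_power_zero[of "1 / 4 :: real"]] by (simp add: power_divide)
      show "\<forall>\<^sub>F i in sequentially. (\<integral>\<^sup>+(s, \<omega>). ennreal ((coeff s \<omega> - simple_process (m i) (grid (m i)) (trunc_coeff (K i) (m i)) s \<omega>)\<^sup>2) \<partial>(lborel_on T \<Otimes>\<^sub>M M)) \<le> ennreal (1 / 4 ^ i)"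
        using err unfolding sq_norm_def by simp
    qed simp
    show "(\<lambda>i. \<integral>\<^sup>+\<omega>. ennreal ((norm (I \<omega> - simple_integral bh (m i) (grid (m i)) (trunc_coeff (K i) (m i)) T \<omega>))\<^sup>2) \<partial>M) \<longlonglongrightarrow> 0"
      by (rule tendsto_sandwich[OF _ _ tendsto_const lim0]) (use Ierr in \<open>auto simp: S_def\<close>)
  qed (use Im coeff_joint si in auto)
  then show ?thesis by blast
qed

text \<open>By \<open>ito_approximation\<close> the summable errors of \<open>ito_sequence\<close>
  also bound the distance to the chosen version of the integral, so the convergence is almost sure
  along the whole sequence.\<close>

theorem ito_integral_approximation:
  obtains K m where "\<And>i. K i \<ge> (i::nat)" "\<And>i. m i > (i::nat)"
    "AE \<omega> in M. (\<lambda>i. \<Sum>k<m i. min (norm (x + b (T * real k / real (m i)) \<omega>) powr \<gamma>) (real (K i)) *\<^sub>R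
        (bh (T * real (Suc k) / real (m i)) \<omega> - bh (T * real k / real (m i)) \<omega>))
      \<longlonglongrightarrow> ito_integral M (joint_filt M b bh) bh (\<lambda>s \<omega>. norm (x + b s \<omega>) powr \<gamma>) T \<omega>"
proof -
  obtain K m where Km: "\<And>i. K i \<ge> (i::nat)" "\<And>i. m i > (i::nat)"
    and err: "\<And>i. sq_norm (\<lambda>s \<omega>. coeff s \<omega> - simple_process (m i) (grid (m i)) (trunc_coeff (K i) (m i)) s \<omega>) \<le> ennreal (1 / 4 ^ i)"
    by (rule ito_sequence) (rule that)
  define I where "I = ito_integral M (joint_filt M b bh) bh coeff T"
  have I: "has_ito_integral M (joint_filt M b bh) bh coeff T I"
    unfolding I_def ito_integral_def using ito_integral_exists by (rule someI_ex)
  have Im[measurable]: "I \<in> borel_measurable M" using I by (simp add: has_ito_integral_def)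
  define S where "S i = simple_integral bh (m i) (grid (m i)) (trunc_coeff (K i) (m i)) T" for i
  have si: "simple_integrand M (joint_filt M b bh) (m i) (grid (m i)) (trunc_coeff (K i) (m i))" for i
    using Km(2)[of i] by (intro trunc_coeff_simple) auto
  have Sm[measurable]: "S i \<in> borel_measurable M" for i unfolding S_def by (rule simple_integral_measurable[OF si])
  have "AE \<omega> in M. summable (\<lambda>i. (norm (I \<omega> - S i \<omega>))\<^sup>2)"
  proof (rule AE_summable_of_nn_integral)
    show "summable (\<lambda>i. 4 * real CARD('e) * (1 / 4) ^ i)" by (intro summable_mult summable_geometric) simp
    show "(\<integral>\<^sup>+\<omega>. ennreal ((norm (I \<omega> - S i \<omega>))\<^sup>2) \<partial>M) \<le> ennreal (4 * real CARD('e) * (1 / 4) ^ i)" for i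
    proof -
      have "(\<integral>\<^sup>+\<omega>. ennreal ((norm (I \<omega> - S i \<omega>))\<^sup>2) \<partial>M) \<le> ennreal (4 * CARD('e)) * ennreal (1 / 4 ^ i)"
        unfolding S_def using ito_approximation[OF I si[of i]] mult_left_mono[OF err[of i], of "ennreal (4 * CARD('e))"]
        by (auto intro: order_trans)
      also have "\<dots> = ennreal (4 * real CARD('e) * (1 / 4) ^ i)"
        by (subst ennreal_mult[symmetric]) (auto simp: power_divide)
      finally show ?thesis .
    qed
  qed auto
  then have "AE \<omega> in M. (\<lambda>i. S i \<omega>) \<longlonglongrightarrow> I \<omega>"
  proof eventually_elim
    case (elim \<omega>)
    have "(\<lambda>i. sqrt ((norm (I \<omega> - S i \<omega>))\<^sup>2)) \<longlonglongrightarrow> sqrt 0"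
      by (intro tendsto_real_sqrt summable_LIMSEQ_zero[OF elim])
    then have "(\<lambda>i. I \<omega> - S i \<omega>) \<longlonglongrightarrow> 0" by (simp add: tendsto_norm_zero_iff)
    then have "(\<lambda>i. I \<omega> - (I \<omega> - S i \<omega>)) \<longlonglongrightarrow> I \<omega> - 0" by (intro tendsto_intros)
    then show ?case by simp
  qed
  moreover have "S i \<omega> = (\<Sum>k<m i. min (norm (x + b (T * real k / real (m i)) \<omega>) powr \<gamma>) (real (K i)) *\<^sub>R
        (bh (T * real (Suc k) / real (m i)) \<omega> - bh (T * real k / real (m i)) \<omega>))" for i \<omega>
  proof -
    have m: "m i > 0" using Km(2)[of i] by simp
    have t: "min T (grid (m i) k) = grid (m i) k" if "k \<le> m i" for k
    proof -
      have "T * real k \<le> T * real (m i)" using T that by simp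
      then have "T * real k / real (m i) \<le> T" using m by (simp add: pos_divide_le_eq)
      then show ?thesis by (simp add: grid_def)
    qed
    show ?thesis unfolding S_def simple_integral_def
      by (intro sum.cong refl) (simp add: t trunc_coeff_def coeff_def grid_def[symmetric] del: of_nat_Suc)
  qed
  moreover have "I = ito_integral M (joint_filt M b bh) bh (\<lambda>s \<omega>. norm (x + b s \<omega>) powr \<gamma>) T"
    unfolding I_def coeff_def[abs_def] ..
  ultimately show ?thesis by (intro that[of K m] Km) simp
qed

end

section \<open>Singular functionals of the bridge\<close>

text \<open>The value at \<open>0\<close> matters: \<open>0 powr (- 1 / 2) = 0\<close> would break the lower bounds below.\<close>

definition inv_sqrt_kern :: "real \<Rightarrow> ennreal" where
  "inv_sqrt_kern u = (if u = 0 then \<infinity> else ennreal (\<bar>u\<bar> powr (- 1 / 2)))"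

lemma inv_sqrt_kern_measurable [measurable]: "inv_sqrt_kern \<in> borel_measurable borel"
  unfolding inv_sqrt_kern_def[abs_def] by measurable

lemma nn_integral_powr_minus_half:
  "(\<integral>\<^sup>+u. ennreal (indicator {0..1} u * u powr (- 1 / 2)) \<partial>lborel) = 2"
proof -
  have "((\<lambda>u. u powr (- 1 / 2)) has_integral (1 powr (- 1 / 2 + 1) / (- 1 / 2 + 1))) {0..1::real}"
    by (rule has_integral_powr_from_0) auto
  then have "((\<lambda>u. u powr (- 1 / 2)) has_integral 2) {0..1::real}" by simp
  then have "((\<lambda>u. if u \<in> {0..1} then u powr (- 1 / 2) else 0) has_integral 2) (UNIV :: real set)"
    by (simp only: has_integral_restrict_UNIV)
  moreover have "(\<lambda>u::real. if u \<in> {0..1} then u powr (- 1 / 2) else 0) = (\<lambda>u. indicator {0..1} u * u powr (- 1 / 2))"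
    by (auto simp: indicator_def)
  ultimately have "((\<lambda>u::real. indicator {0..1} u * u powr (- 1 / 2)) has_integral 2) UNIV" by simp
  then show ?thesis
    by (subst nn_integral_has_integral_lborel[where I=2]) auto
qed

text \<open>The normal density has height at most \<open>1 / \<sigma>0\<close>, whatever the shift
  \<open>a\<close>. Near the singularity the kernel integrates to 2 on each side, which gives
  \<open>4 / \<sigma>0\<close>; elsewhere it is at most 1, which gives the summand 1.\<close>

lemma inv_sqrt_kern_normal_bound:
  assumes s: "0 < \<sigma>0" "\<sigma>0 \<le> \<sigma>"
  shows "(\<integral>\<^sup>+z. inv_sqrt_kern (z + a) \<partial>density lborel (normal_density 0 \<sigma>)) \<le> ennreal (1 + 4 / \<sigma>0)"
proof -
  have \<sigma>: "0 < \<sigma>" using s by simp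
  define k where "k = 1 / \<sigma>0"
  have k0: "0 \<le> k" using s by (simp add: k_def)
  have nd: "normal_density 0 \<sigma> z \<le> k" for z
  proof -
    have "\<sigma> \<le> sqrt (2 * pi * \<sigma>\<^sup>2)"
    proof (rule real_le_rsqrt)
      have "1 * \<sigma>\<^sup>2 \<le> 2 * pi * \<sigma>\<^sup>2" using pi_gt3 by (intro mult_right_mono) auto
      then show "\<sigma>\<^sup>2 \<le> 2 * pi * \<sigma>\<^sup>2" by simp
    qed
    with s have "\<sigma>0 \<le> sqrt (2 * pi * \<sigma>\<^sup>2)" by linarith
    then have "1 / sqrt (2 * pi * \<sigma>\<^sup>2) \<le> 1 / \<sigma>0" using s by (intro frac_le) simp_all
    moreover have "exp (- (z - 0)\<^sup>2 / (2 * \<sigma>\<^sup>2)) \<le> 1" by simp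
    ultimately have "1 / sqrt (2 * pi * \<sigma>\<^sup>2) * exp (- (z - 0)\<^sup>2 / (2 * \<sigma>\<^sup>2)) \<le> 1 / \<sigma>0 * 1"
      using s by (intro mult_mono) simp_all
    then show ?thesis unfolding normal_density_def k_def by simp
  qed
  define g where "g u = ennreal (indicator {0..1} u * u powr (- 1 / 2))" for u :: real
  have gm[measurable]: "g \<in> borel_measurable borel" unfolding g_def[abs_def] by measurable
  have kg: "inv_sqrt_kern u \<le> 1 + (g u + g (- u))" if "u \<noteq> 0" for u
  proof (cases "\<bar>u\<bar> \<le> 1")
    case True
    then have "inv_sqrt_kern u \<le> g u + g (- u)"
      using that by (cases "u > 0") (auto simp: inv_sqrt_kern_def g_def indicator_def)
    then show ?thesis by (rule order_trans) simp
  next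
    case False
    then have "\<bar>u\<bar> powr (- 1 / 2) \<le> \<bar>u\<bar> powr 0" by (intro powr_mono) auto
    then have "inv_sqrt_kern u \<le> 1" using that by (simp add: inv_sqrt_kern_def ennreal_le_1)
    then show ?thesis by (rule order_trans) simp
  qed
  have g2: "(\<integral>\<^sup>+z. g (z + a) \<partial>lborel) = 2" "(\<integral>\<^sup>+z. g (- (z + a)) \<partial>lborel) = 2"
  proof -
    have "(\<integral>\<^sup>+z. g z \<partial>lborel) = 2" unfolding g_def by (rule nn_integral_powr_minus_half)
    then show "(\<integral>\<^sup>+z. g (z + a) \<partial>lborel) = 2" "(\<integral>\<^sup>+z. g (- (z + a)) \<partial>lborel) = 2"
      using nn_integral_real_affine[OF gm, of 1 a] nn_integral_real_affine[OF gm, of "-1" "-a"]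
      by (simp_all add: add.commute)
  qed
  have "(\<integral>\<^sup>+z. inv_sqrt_kern (z + a) \<partial>density lborel (normal_density 0 \<sigma>)) = (\<integral>\<^sup>+z. ennreal (normal_density 0 \<sigma> z) * inv_sqrt_kern (z + a) \<partial>lborel)"
    by (subst nn_integral_density) auto
  also have "\<dots> \<le> (\<integral>\<^sup>+z. ennreal (normal_density 0 \<sigma> z) + ennreal k * (g (z + a) + g (- (z + a))) \<partial>lborel)"
  proof (rule nn_integral_mono_AE)
    have "AE z in lborel. z \<noteq> - a" using AE_lborel_singleton by blast
    then show "AE z in lborel. ennreal (normal_density 0 \<sigma> z) * inv_sqrt_kern (z + a) \<le> ennreal (normal_density 0 \<sigma> z) + ennreal k * (g (z + a) + g (- (z + a)))"
    proof eventually_elim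
      case (elim z)
      then have "z + a \<noteq> 0" by auto
      then have "ennreal (normal_density 0 \<sigma> z) * inv_sqrt_kern (z + a) \<le> ennreal (normal_density 0 \<sigma> z) * (1 + (g (z + a) + g (- (z + a))))"
        by (intro mult_left_mono kg) auto
      also have "\<dots> = ennreal (normal_density 0 \<sigma> z) + ennreal (normal_density 0 \<sigma> z) * (g (z + a) + g (- (z + a)))"
        by (simp add: distrib_left)
      also have "\<dots> \<le> ennreal (normal_density 0 \<sigma> z) + ennreal k * (g (z + a) + g (- (z + a)))"
        by (intro add_left_mono mult_right_mono ennreal_leI nd) auto
      finally show ?case .
    qed
  qed
  also have "\<dots> = 1 + ennreal k * (2 + 2)"
  proof -
    have "(\<integral>\<^sup>+z. ennreal (normal_density 0 \<sigma> z) \<partial>lborel) = 1"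
      using nn_integral_eq_integral[OF integrable_normal_density[OF \<sigma>, of 0]] integral_normal_density[OF \<sigma>, of 0]
      by (simp add: normal_density_nonneg)
    then show ?thesis by (simp add: nn_integral_add nn_integral_cmult g2 del: minus_add_distrib)
  qed
  also have "\<dots> = ennreal (1 + 4 / \<sigma>0)"
  proof -
    have "ennreal (1 + 4 / \<sigma>0) = ennreal (1 + k * 4)" by (simp add: k_def)
    also have "\<dots> = 1 + ennreal k * 4" using k0 by (subst ennreal_plus) (auto simp: ennreal_mult)
    finally show ?thesis by simp
  qed
  finally show ?thesis .
qed

text \<open>The tangent line at \<open>c\<close> of the convex function \<open>u powr (- s)\<close>,
  rearranged. It follows from \<open>1 + x \<le> exp x\<close> and \<open>ln r \<le> r - 1\<close>
  for the ratio \<open>r = g / c\<close>.\<close>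

lemma powr_tangent:
  fixes g c s :: real
  assumes "0 < g" "0 < c" "0 < s"
  shows "(1 + s) * c powr (- s) \<le> g powr (- s) + s * c powr (- s - 1) * g"
proof -
  define r where "r = g / c"
  have r: "0 < r" "g = c * r" using assms by (auto simp: r_def)
  have "1 + - s * ln r \<le> exp (- s * ln r)" by (rule exp_ge_add_one_self)
  moreover have "exp (- s * ln r) = r powr (- s)" using r by (simp add: powr_def)
  moreover have "s * ln r \<le> s * (r - 1)" using r assms ln_le_minus_one by (intro mult_left_mono) auto
  ultimately have "1 + s \<le> r powr (- s) + s * r" by (simp add: algebra_simps)
  then have "c powr (- s) * (1 + s) \<le> c powr (- s) * (r powr (- s) + s * r)" by (intro mult_left_mono) auto
  also have "\<dots> = g powr (- s) + s * c powr (- s - 1) * g"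
  proof -
    have "c powr (- s - 1) * c = c powr (- s)" using assms powr_add[of c "- s - 1" 1] by simp
    then show ?thesis using r assms by (simp add: powr_mult distrib_left mult_ac)
  qed
  finally show ?thesis by (simp add: mult.commute)
qed

section \<open>The Markov property of one coordinate of the bridge\<close>

context
  fixes T :: real and \<mu> :: "(real \<Rightarrow> real ^ 'd) measure" and i :: 'd
  assumes T: "T > 0" and pw: "pinned_wiener_measure T \<mu>"
begin

interpretation prob_space \<mu> by (rule pinned_prob_space[OF T pw])

text \<open>The variables that \<open>pinned_wiener_measure\<close> declares Gaussian. Closure under
  sums makes combinations of the past jointly Gaussian with the residual.\<close>

definition "coord_comb f \<longleftrightarrow> (\<exists>J c. finite J \<and> J \<subseteq> {0..T} \<and> f = (\<lambda>w::real \<Rightarrow> real ^ 'd. \<Sum>t\<in>J. c t \<bullet> w t))"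

lemma coord_comb_coord: "t \<in> {0..T} \<Longrightarrow> coord_comb (\<lambda>w. a * w t $ i)"
  unfolding coord_comb_def by (intro exI[of _ "{t}"] exI[of _ "\<lambda>_. a *\<^sub>R axis i 1"]) (auto simp: inner_axis')

lemma coord_comb_add:
  assumes "coord_comb f" "coord_comb g" shows "coord_comb (\<lambda>w. f w + g w)"
proof -
  obtain J c where f: "finite J" "J \<subseteq> {0..T}" "f = (\<lambda>w. \<Sum>t\<in>J. c t \<bullet> w t)" using assms(1) by (auto simp: coord_comb_def)
  obtain J' c' where g: "finite J'" "J' \<subseteq> {0..T}" "g = (\<lambda>w. \<Sum>t\<in>J'. c' t \<bullet> w t)" using assms(2) by (auto simp: coord_comb_def)
  define d where "d t = (if t \<in> J then c t else 0) + (if t \<in> J' then c' t else 0)" for t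
  have "f w + g w = (\<Sum>t\<in>J \<union> J'. d t \<bullet> w t)" for w
  proof -
    have "(\<Sum>t\<in>J. c t \<bullet> w t) = (\<Sum>t\<in>J \<union> J'. (if t \<in> J then c t else 0) \<bullet> w t)"
      using f g by (intro sum.mono_neutral_cong_left) auto
    moreover have "(\<Sum>t\<in>J'. c' t \<bullet> w t) = (\<Sum>t\<in>J \<union> J'. (if t \<in> J' then c' t else 0) \<bullet> w t)"
      using f g by (intro sum.mono_neutral_cong_left) auto
    ultimately show ?thesis by (simp add: f g d_def inner_add_left sum.distrib)
  qed
  then show ?thesis unfolding coord_comb_def using f g by (intro exI[of _ "J \<union> J'"] exI[of _ d]) auto
qed

lemma coord_comb_0: "coord_comb (\<lambda>w. 0)"
  unfolding coord_comb_def by (intro exI[of _ "{}"]) auto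

lemma coord_comb_sum: "finite A \<Longrightarrow> (\<And>a. a \<in> A \<Longrightarrow> coord_comb (f a)) \<Longrightarrow> coord_comb (\<lambda>w. \<Sum>a\<in>A. f a w)"
  by (induction A rule: finite_induct) (auto intro: coord_comb_add coord_comb_0)

lemma coord_comb_gaussian: "coord_comb f \<Longrightarrow> gaussian_rv \<mu> f"
  unfolding coord_comb_def using pinned_gaussian[OF T pw] by auto

lemma coord_moments:
  assumes "s \<in> {0..T}" "t \<in> {0..T}"
  shows "integrable \<mu> (\<lambda>w. w s $ i)" "(\<integral>w. w s $ i \<partial>\<mu>) = 0"
    "integrable \<mu> (\<lambda>w. w s $ i * w t $ i)" "(\<integral>w. w s $ i * w t $ i \<partial>\<mu>) = min s t - s * t / T"
  using gaussian_rv_integrable(1)[OF pinned_prob_space[OF T pw] pinned_coord_gaussian[OF T pw assms(1)], of i]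
    pw assms pinned_products[OF T pw assms, of i i]
  by (auto simp: pinned_wiener_measure_def min.commute mult.commute)

text \<open>The bridge is Markov: this is \<open>w t\<close> minus its conditional mean given the path up to time \<open>s\<close>.\<close>

definition "bridge_residual s t w = w t $ i - (T - t) / (T - s) * w s $ i"

lemma bridge_residual_lin:
  assumes "0 \<le> s" "s < t" "t < T"
  shows "coord_comb (\<lambda>w. a * bridge_residual s t w)"
proof -
  have "coord_comb (\<lambda>w. a * w t $ i + (- (a * ((T - t) / (T - s)))) * w s $ i)"
    using assms by (intro coord_comb_add coord_comb_coord) auto
  then show ?thesis by (simp add: bridge_residual_def algebra_simps)
qed

text \<open>For \<open>u \<le> v\<close> the covariance is \<open>u * (T - v) / T\<close>. Hence for
  every \<open>u \<le> s\<close> the covariance with time \<open>t\<close> is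
  \<open>(T - t) / (T - s)\<close> times the one with time \<open>s\<close>, and a single
  coefficient removes the correlation with the entire past.\<close>

lemma bridge_residual_moments:
  assumes st: "0 \<le> s" "s < t" "t < T"
  shows "integrable \<mu> (bridge_residual s t)" "(\<integral>w. bridge_residual s t w \<partial>\<mu>) = 0"
    "(\<integral>w. (bridge_residual s t w)\<^sup>2 \<partial>\<mu>) = (t - s) * (T - t) / (T - s)"
    "\<And>u. 0 \<le> u \<Longrightarrow> u \<le> s \<Longrightarrow> integrable \<mu> (\<lambda>w. w u $ i * bridge_residual s t w)"
    "\<And>u. 0 \<le> u \<Longrightarrow> u \<le> s \<Longrightarrow> (\<integral>w. w u $ i * bridge_residual s t w \<partial>\<mu>) = 0"
proof -
  have s: "s \<in> {0..T}" and t: "t \<in> {0..T}" using st by auto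
  let ?\<alpha> = "(T - t) / (T - s)"
  show "integrable \<mu> (bridge_residual s t)" "(\<integral>w. bridge_residual s t w \<partial>\<mu>) = 0"
    unfolding bridge_residual_def[abs_def] using coord_moments(1,2)[OF s s] coord_moments(1,2)[OF t t] by simp_all
  show "integrable \<mu> (\<lambda>w. w u $ i * bridge_residual s t w)" "(\<integral>w. w u $ i * bridge_residual s t w \<partial>\<mu>) = 0" if "0 \<le> u" "u \<le> s" for u
  proof -
    have u: "u \<in> {0..T}" using that st by auto
    have e: "w u $ i * bridge_residual s t w = w u $ i * w t $ i - ?\<alpha> * (w u $ i * w s $ i)" for w by (simp add: bridge_residual_def algebra_simps)
    show "integrable \<mu> (\<lambda>w. w u $ i * bridge_residual s t w)"
      unfolding e using coord_moments(3)[OF u t] coord_moments(3)[OF u s] by simp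
    have "(\<integral>w. w u $ i * bridge_residual s t w \<partial>\<mu>) = (u - u * t / T) - ?\<alpha> * (u - u * s / T)"
      unfolding e using coord_moments(3,4)[OF u t] coord_moments(3,4)[OF u s] that st by simp
    also have "\<dots> = 0" using st T by (simp add: field_simps)
    finally show "(\<integral>w. w u $ i * bridge_residual s t w \<partial>\<mu>) = 0" .
  qed
  have e: "(bridge_residual s t w)\<^sup>2 = w t $ i * w t $ i - 2 * ?\<alpha> * (w s $ i * w t $ i) + ?\<alpha>\<^sup>2 * (w s $ i * w s $ i)" for w
    by (simp add: bridge_residual_def power2_eq_square algebra_simps)
  have "(\<integral>w. (bridge_residual s t w)\<^sup>2 \<partial>\<mu>) = (t - t * t / T) - 2 * ?\<alpha> * (s - s * t / T) + ?\<alpha>\<^sup>2 * (s - s * s / T)"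
    unfolding e using coord_moments(3,4)[OF s t] coord_moments(3,4)[OF t t] coord_moments(3,4)[OF s s] st by simp
  also have "\<dots> = (t - s) * (T - t) / (T - s)"
  proof -
    have q: "u - u * v / T = u * (T - v) / T" for u v using T by (simp add: field_simps)
    have aD: "?\<alpha> * (T - s) = T - t" using st by simp
    have "A\<^sup>2 * (s * D / T) = A * s * (A * D) / T" for A D by (simp add: power2_eq_square)
    from this[of ?\<alpha> "T - s"] have a2: "?\<alpha>\<^sup>2 * (s * (T - s) / T) = ?\<alpha> * s * (T - t) / T" by (simp only: aD)
    have gen: "t * X / T - 2 * A * (s * X / T) + A * s * X / T = X * (t - A * s) / T" for X A
      using T by (simp add: field_simps)
    have "(t - t * t / T) - 2 * ?\<alpha> * (s - s * t / T) + ?\<alpha>\<^sup>2 * (s - s * s / T) = (T - t) * (t - ?\<alpha> * s) / T"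
      unfolding q a2 by (rule gen)
    also have "t - ?\<alpha> * s = T * (t - s) / (T - s)" using st by (simp add: field_simps)
    finally show ?thesis using T by (simp add: mult.commute)
  qed
  finally show "(\<integral>w. (bridge_residual s t w)\<^sup>2 \<partial>\<mu>) = (t - s) * (T - t) / (T - s)" .
qed

lemma bridge_residual_measurable: "0 \<le> s \<Longrightarrow> s < t \<Longrightarrow> t < T \<Longrightarrow> bridge_residual s t \<in> borel_measurable \<mu>"
  using bridge_residual_moments(1) by (rule borel_measurable_integrable)

lemma bridge_residual_char:
  assumes st: "0 \<le> s" "s < t" "t < T"
  shows "(\<integral>w. iexp (a * bridge_residual s t w) \<partial>\<mu>) = of_real (exp (- (a\<^sup>2 * ((t - s) * (T - t) / (T - s))) / 2))"
  using gaussian_rv_char[OF pinned_prob_space[OF T pw] coord_comb_gaussian[OF bridge_residual_lin[OF st, of a]]] bridge_residual_moments[OF st]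
  by (simp add: power_mult_distrib)

text \<open>The combination of past values and the residual are jointly Gaussian and uncorrelated,
  so their variances add and the characteristic function factors.\<close>

lemma bridge_residual_past_char:
  assumes st: "0 \<le> s" "s < t" "t < T" and J: "finite J" "J \<subseteq> {0..s}"
  shows "(\<integral>w. iexp ((\<Sum>u\<in>J. c u * w u $ i) + a * bridge_residual s t w) \<partial>\<mu>)
    = (\<integral>w. iexp (\<Sum>u\<in>J. c u * w u $ i) \<partial>\<mu>) * (\<integral>w. iexp (a * bridge_residual s t w) \<partial>\<mu>)"
proof -
  let ?Z = "\<lambda>w::real \<Rightarrow> real ^ 'd. \<Sum>u\<in>J. c u * w u $ i"
  let ?R = "\<lambda>w. a * bridge_residual s t w"
  have JT: "u \<in> {0..T}" "0 \<le> u" "u \<le> s" if "u \<in> J" for u using that J st by auto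
  have lZ: "coord_comb ?Z" by (intro coord_comb_sum J coord_comb_coord JT)
  have lR: "coord_comb ?R" by (rule bridge_residual_lin[OF st])
  note P = pinned_prob_space[OF T pw]
  have iZ: "integrable \<mu> ?Z" "integrable \<mu> (\<lambda>w. (?Z w)\<^sup>2)" using gaussian_rv_integrable[OF P coord_comb_gaussian[OF lZ]] .
  have iR: "integrable \<mu> ?R" "integrable \<mu> (\<lambda>w. (?R w)\<^sup>2)" using gaussian_rv_integrable[OF P coord_comb_gaussian[OF lR]] .
  have EZ: "(\<integral>w. ?Z w \<partial>\<mu>) = 0"
  proof -
    have "(\<integral>w. ?Z w \<partial>\<mu>) = (\<Sum>u\<in>J. \<integral>w. c u * w u $ i \<partial>\<mu>)"
      by (intro Bochner_Integration.integral_sum integrable_mult_right coord_moments(1)[OF JT(1) JT(1)])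
    also have "\<dots> = 0" using coord_moments(2)[OF JT(1) JT(1)] by (intro sum.neutral ballI) auto
    finally show ?thesis .
  qed
  have ER: "(\<integral>w. ?R w \<partial>\<mu>) = 0" using bridge_residual_moments(2)[OF st] by simp
  have e: "?Z w * ?R w = (\<Sum>u\<in>J. (c u * a) * (w u $ i * bridge_residual s t w))" for w
    by (simp add: sum_distrib_left sum_distrib_right mult_ac)
  have ZR: "integrable \<mu> (\<lambda>w. ?Z w * ?R w)" "(\<integral>w. ?Z w * ?R w \<partial>\<mu>) = 0"
  proof -
    show "integrable \<mu> (\<lambda>w. ?Z w * ?R w)" unfolding e
      by (intro Bochner_Integration.integrable_sum integrable_mult_right bridge_residual_moments(4)[OF st] JT)
    have "(\<integral>w. ?Z w * ?R w \<partial>\<mu>) = (\<Sum>u\<in>J. \<integral>w. (c u * a) * (w u $ i * bridge_residual s t w) \<partial>\<mu>)" unfolding e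
      by (intro Bochner_Integration.integral_sum integrable_mult_right bridge_residual_moments(4)[OF st] JT)
    also have "\<dots> = 0" using bridge_residual_moments(5)[OF st JT(2,3)] by (intro sum.neutral ballI) simp
    finally show "(\<integral>w. ?Z w * ?R w \<partial>\<mu>) = 0" .
  qed
  have "(\<integral>w. (?Z w + ?R w)\<^sup>2 \<partial>\<mu>) = (\<integral>w. (?Z w)\<^sup>2 + (?R w)\<^sup>2 + 2 * (?Z w * ?R w) \<partial>\<mu>)"
    by (simp add: power2_sum mult.assoc)
  also have "\<dots> = (\<integral>w. (?Z w)\<^sup>2 \<partial>\<mu>) + (\<integral>w. (?R w)\<^sup>2 \<partial>\<mu>)"
    using iZ iR ZR by (simp del: integral_mult_right_zero integral_mult_left_zero)
  finally have V: "(\<integral>w. (?Z w + ?R w)\<^sup>2 \<partial>\<mu>) = (\<integral>w. (?Z w)\<^sup>2 \<partial>\<mu>) + (\<integral>w. (?R w)\<^sup>2 \<partial>\<mu>)" .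
  have E0: "(\<integral>w. ?Z w + ?R w \<partial>\<mu>) = 0" using iZ iR EZ ER by simp
  show ?thesis
    unfolding gaussian_rv_char[OF P coord_comb_gaussian[OF coord_comb_add[OF lZ lR]] E0] V
      gaussian_rv_char[OF P coord_comb_gaussian[OF lZ] EZ] gaussian_rv_char[OF P coord_comb_gaussian[OF lR] ER]
    by (simp add: exp_add[symmetric] add_divide_distrib diff_divide_distrib of_real_mult[symmetric] del: of_real_mult)
qed

lemma bridge_residual_law:
  assumes st: "0 \<le> s" "s < t" "t < T"
  shows "distr \<mu> borel (bridge_residual s t) = density lborel (normal_density 0 (sqrt ((t - s) * (T - t) / (T - s))))"
proof -
  have v: "0 < (t - s) * (T - t) / (T - s)" using st by simp
  then have \<sigma>: "0 < sqrt ((t - s) * (T - t) / (T - s))" by simp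
  let ?N = "density lborel (normal_density 0 (sqrt ((t - s) * (T - t) / (T - s))))"
  have D: "distributed ?N lborel (\<lambda>x. x) (normal_density 0 (sqrt ((t - s) * (T - t) / (T - s))))"
    by (auto simp: distributed_def intro!: measure_eqI) (metis distr_id2 sets_density)
  have "distr \<mu> borel (bridge_residual s t) = distr ?N borel (\<lambda>x. x)"
  proof (rule char_determines_law[OF pinned_prob_space[OF T pw] prob_space_normal_density[OF \<sigma>] bridge_residual_measurable[OF st]])
    fix u :: real
    have "(\<integral>y. iexp (u * y) \<partial>?N) = of_real (exp (- (u\<^sup>2 * ((t - s) * (T - t) / (T - s))) / 2))"
      using normal_char[OF prob_space_normal_density[OF \<sigma>] \<sigma> D, of u] v
      by (simp add: power_mult_distrib mult.commute)
    then show "(\<integral>x. iexp (u \<bullet> bridge_residual s t x) \<partial>\<mu>) = (\<integral>y. iexp (u \<bullet> y) \<partial>?N)"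
      using bridge_residual_char[OF st, of u] by simp
  qed simp
  also have "\<dots> = ?N" by (intro distr_id2) simp
  finally show ?thesis .
qed

text \<open>The factored characteristic functions say that past and residual have the same joint law
  as the past of one path and the residual of a second, independent path. For the latter pair the
  rectangles factor.\<close>

lemma bridge_residual_indep:
  assumes st: "0 \<le> s" "s < t" "t < T"
  shows "indep_set (sets (generated_algebra \<mu> (\<lambda>t w. w t $ i) {0..s})) {bridge_residual s t -` C \<inter> space \<mu> | C. C \<in> sets borel}"
proof (rule indep_set_generated_algebra)
  have cm: "(\<lambda>w. w u $ i) \<in> borel_measurable \<mu>" if "u \<in> {0..s}" for u
    using that st by (intro component_measurable pinned_coord_measurable[OF T pw]) auto
  then show "(\<lambda>w. w u $ i) \<in> borel_measurable \<mu>" if "u \<in> {0..s}" for u using that .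
  have bm: "bridge_residual s t \<in> borel_measurable \<mu>" by (rule bridge_residual_measurable[OF st])
  then show "bridge_residual s t \<in> borel_measurable \<mu>" .
  fix J :: "real set" and A :: "real \<Rightarrow> real set" and C :: "real set"
  assume J: "finite J" "J \<subseteq> {0..s}" and A: "\<And>j. A j \<in> sets (borel :: real measure)" and C: "C \<in> sets borel"
  interpret PP: pair_prob_space \<mu> \<mu> ..
  \<comment> \<open>\<open>None\<close> indexes the residual and \<open>Some u\<close> the value at
    time \<open>u\<close>, so that both form a single finite real family.\<close>
  define X where "X j w = (case j of None \<Rightarrow> bridge_residual s t w | Some u \<Rightarrow> w u $ i)" for j and w :: "real \<Rightarrow> real ^ 'd"
  define Y where "Y j p = (case j of None \<Rightarrow> bridge_residual s t (snd p) | Some u \<Rightarrow> fst p u $ i)" for j and p :: "(real \<Rightarrow> real ^ 'd) \<times> (real \<Rightarrow> real ^ 'd)"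
  define I where "I = insert None (Some ` J)"
  define Q where "Q = Pi\<^sub>M I (\<lambda>_. borel :: real measure)"
  have I: "finite I" using J by (simp add: I_def)
  have Xm: "X j \<in> borel_measurable \<mu>" if "j \<in> I" for j
    using that J cm bm by (auto simp: I_def X_def[abs_def] subset_iff)
  have Ym: "Y j \<in> borel_measurable (\<mu> \<Otimes>\<^sub>M \<mu>)" if "j \<in> I" for j
  proof (cases j)
    case None
    then show ?thesis using measurable_compose[OF measurable_snd bm] by (simp add: Y_def[abs_def])
  next
    case (Some u)
    then have u: "u \<in> {0..s}" using that J by (auto simp: I_def)
    show ?thesis using measurable_compose[OF measurable_fst cm[OF u]] Some by (simp add: Y_def[abs_def])
  qed
  have sumI: "(\<Sum>j\<in>I. f j) = (\<Sum>u\<in>J. f (Some u)) + f None" for f :: "real option \<Rightarrow> real"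
    using J by (simp add: I_def sum.reindex)
  have law: "distr \<mu> Q (\<lambda>w. \<lambda>j\<in>I. X j w) = distr (\<mu> \<Otimes>\<^sub>M \<mu>) Q (\<lambda>p. \<lambda>j\<in>I. Y j p)"
    unfolding Q_def
  proof (rule char_determines_joint_law[OF pinned_prob_space[OF T pw] PP.P.prob_space_axioms I Xm Ym])
    fix c :: "real option \<Rightarrow> real"
    have Zm: "(\<lambda>w. \<Sum>u\<in>J. c (Some u) * w u $ i) \<in> borel_measurable \<mu>"
      using J cm by (intro borel_measurable_sum borel_measurable_times) auto
    let ?f = "\<lambda>p. iexp (\<Sum>u\<in>J. c (Some u) * fst p u $ i) * iexp (c None * bridge_residual s t (snd p))"
    have ie: "(\<lambda>x. iexp x) \<in> borel_measurable borel" by measurable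
    have fm: "?f \<in> borel_measurable (\<mu> \<Otimes>\<^sub>M \<mu>)"
      using measurable_compose[OF measurable_compose[OF measurable_fst Zm] ie]
        measurable_compose[OF measurable_compose[OF measurable_snd borel_measurable_times[OF borel_measurable_const bm]] ie]
      by (intro borel_measurable_times)
    have fi: "integrable (\<mu> \<Otimes>\<^sub>M \<mu>) ?f"
      by (intro PP.P.integrable_const_bound[where B=1] fm) (simp add: norm_mult del: of_real_sum of_real_mult)
    have "(\<integral>p. iexp (\<Sum>j\<in>I. c j * Y j p) \<partial>(\<mu> \<Otimes>\<^sub>M \<mu>)) = (\<integral>p. ?f p \<partial>(\<mu> \<Otimes>\<^sub>M \<mu>))"
      by (simp add: sumI Y_def exp_add distrib_left del: of_real_sum of_real_mult)
    also have "\<dots> = (\<integral>w. \<integral>w'. ?f (w, w') \<partial>\<mu> \<partial>\<mu>)" by (rule PP.integral_fst'[OF fi, symmetric])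
    also have "\<dots> = (\<integral>w. iexp (\<Sum>u\<in>J. c (Some u) * w u $ i) \<partial>\<mu>) * (\<integral>w. iexp (c None * bridge_residual s t w) \<partial>\<mu>)"
      by (simp del: of_real_sum of_real_mult)
    also have "\<dots> = (\<integral>w. iexp (\<Sum>j\<in>I. c j * X j w) \<partial>\<mu>)"
      using bridge_residual_past_char[OF st J, of "\<lambda>u. c (Some u)" "c None"] by (simp add: sumI X_def)
    finally show "(\<integral>w. iexp (\<Sum>j\<in>I. c j * X j w) \<partial>\<mu>) = (\<integral>p. iexp (\<Sum>j\<in>I. c j * Y j p) \<partial>(\<mu> \<Otimes>\<^sub>M \<mu>))" by simp
  qed
  define E where "E = Pi\<^sub>E I (\<lambda>j. case j of None \<Rightarrow> C | Some u \<Rightarrow> A u)"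
  have EQ: "E \<in> sets Q" unfolding E_def Q_def using I A C by (intro sets_PiM_I_finite) (auto split: option.split)
  have mX: "(\<lambda>w. \<lambda>j\<in>I. X j w) \<in> measurable \<mu> Q" unfolding Q_def by (intro measurable_restrict Xm)
  have mY: "(\<lambda>w. \<lambda>j\<in>I. Y j w) \<in> measurable (\<mu> \<Otimes>\<^sub>M \<mu>) Q" unfolding Q_def by (intro measurable_restrict Ym)
  let ?A = "{w\<in>space \<mu>. \<forall>j\<in>J. w j $ i \<in> A j}" and ?C = "bridge_residual s t -` C \<inter> space \<mu>"
  have 1: "(\<lambda>w. \<lambda>j\<in>I. X j w) -` E \<inter> space \<mu> = ?A \<inter> ?C"
    by (auto simp: E_def I_def X_def PiE_iff)
  have 2: "(\<lambda>p. \<lambda>j\<in>I. Y j p) -` E \<inter> space (\<mu> \<Otimes>\<^sub>M \<mu>) = ?A \<times> ?C"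
    by (auto simp: E_def I_def Y_def PiE_iff space_pair_measure)
  have As: "?A \<in> sets \<mu>"
  proof -
    have "Measurable.pred \<mu> (\<lambda>w. \<forall>j\<in>J. w j $ i \<in> A j)"
      using J A cm by (intro pred_intros_finite pred_sets2[OF _ cm]) auto
    then show ?thesis by (simp add: pred_def)
  qed
  have Cs: "?C \<in> sets \<mu>" using bm C by (rule measurable_sets)
  have "emeasure \<mu> (?A \<inter> ?C) = emeasure (\<mu> \<Otimes>\<^sub>M \<mu>) (?A \<times> ?C)"
    using emeasure_distr[OF mX EQ] emeasure_distr[OF mY EQ] law unfolding 1 2 by simp
  also have "\<dots> = emeasure \<mu> ?A * emeasure \<mu> ?C" by (rule emeasure_pair_measure_Times[OF As Cs])
  finally show "prob (?A \<inter> ?C) = prob ?A * prob ?C"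
    by (simp add: emeasure_eq_measure ennreal_mult[symmetric])
qed

text \<open>\<open>w t $ i\<close> is the residual plus a multiple of \<open>w s $ i\<close>. With
  the past frozen that multiple is a mere shift, and the bound against the normal law of the
  residual is uniform in shifts.\<close>

lemma inv_sqrt_kern_conditional:
  assumes st: "0 \<le> s" "s < t" "t < T" and \<sigma>: "0 < \<sigma>0" "\<sigma>0\<^sup>2 \<le> (t - s) * (T - t) / (T - s)"
    and \<Phi>: "\<Phi> \<in> borel_measurable (generated_algebra \<mu> (\<lambda>t w. w t $ i) {0..s})"
  shows "(\<integral>\<^sup>+w. \<Phi> w * inv_sqrt_kern (w t $ i + a) \<partial>\<mu>) \<le> ennreal (1 + 4 / \<sigma>0) * (\<integral>\<^sup>+w. \<Phi> w \<partial>\<mu>)"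
proof -
  let ?A = "generated_algebra \<mu> (\<lambda>t w. w t $ i) {0..s}"
  let ?\<alpha> = "(T - t) / (T - s)"
  have cm: "(\<lambda>w. w u $ i) \<in> borel_measurable \<mu>" if "u \<in> {0..s}" for u
    using that st by (intro component_measurable pinned_coord_measurable[OF T pw]) auto
  have AM: "sets ?A \<subseteq> sets \<mu>" using cm by (intro generated_algebra_subset) auto
  have idA: "(\<lambda>w. w) \<in> measurable \<mu> ?A" using AM by (intro measurableI) auto
  have bm: "bridge_residual s t \<in> borel_measurable \<mu>" by (rule bridge_residual_measurable[OF st])
  have law: "distr \<mu> (?A \<Otimes>\<^sub>M borel) (\<lambda>w. (w, bridge_residual s t w)) = distr \<mu> ?A (\<lambda>w. w) \<Otimes>\<^sub>M distr \<mu> borel (bridge_residual s t)"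
  proof (rule indep_set_pair_distr[OF bridge_residual_indep[OF st] idA bm])
    show "(\<lambda>w. w) -` E \<inter> space \<mu> \<in> sets ?A" if "E \<in> sets ?A" for E
    proof -
      have "(\<lambda>w. w) -` E \<inter> space \<mu> = E" using sets.sets_into_space[OF that] by auto
      then show ?thesis using that by simp
    qed
  qed auto
  interpret MA: prob_space "distr \<mu> ?A (\<lambda>w. w)" by (rule prob_space_distr[OF idA])
  interpret MR: prob_space "distr \<mu> borel (bridge_residual s t)" by (rule prob_space_distr[OF bm])
  have Xs: "(\<lambda>w. w s $ i) \<in> borel_measurable ?A" using st measurable_generated_algebra[of s "{0..s}" "\<lambda>t w. w t $ i" \<mu>] by simp
  let ?F = "\<lambda>p. \<Phi> (fst p) * inv_sqrt_kern (snd p + (?\<alpha> * fst p s $ i + a))"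
  have Fm: "?F \<in> borel_measurable (?A \<Otimes>\<^sub>M borel)"
    by (intro borel_measurable_times_ennreal measurable_compose[OF measurable_fst \<Phi>] measurable_compose[OF _ inv_sqrt_kern_measurable]
        borel_measurable_add borel_measurable_times borel_measurable_const measurable_compose[OF measurable_fst Xs] measurable_snd)
  have Fm': "?F \<in> borel_measurable (distr \<mu> ?A (\<lambda>w. w) \<Otimes>\<^sub>M distr \<mu> borel (bridge_residual s t))"
    using Fm by (simp add: measurable_cong_sets[OF sets_pair_measure_cong[OF sets_distr sets_distr] refl])
  have pm: "(\<lambda>w. (w, bridge_residual s t w)) \<in> measurable \<mu> (?A \<Otimes>\<^sub>M borel)" by (rule measurable_Pair[OF idA bm])
  have "(\<integral>\<^sup>+w. \<Phi> w * inv_sqrt_kern (w t $ i + a) \<partial>\<mu>) = (\<integral>\<^sup>+w. ?F (w, bridge_residual s t w) \<partial>\<mu>)"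
    by (simp add: bridge_residual_def algebra_simps)
  also have "\<dots> = (\<integral>\<^sup>+p. ?F p \<partial>distr \<mu> (?A \<Otimes>\<^sub>M borel) (\<lambda>w. (w, bridge_residual s t w)))"
    by (rule nn_integral_distr[OF pm, symmetric]) (use Fm in simp)
  also have "\<dots> = (\<integral>\<^sup>+w. \<integral>\<^sup>+r. ?F (w, r) \<partial>distr \<mu> borel (bridge_residual s t) \<partial>distr \<mu> ?A (\<lambda>w. w))"
    unfolding law by (rule MR.nn_integral_fst[OF Fm', symmetric])
  also have "\<dots> \<le> (\<integral>\<^sup>+w. ennreal (1 + 4 / \<sigma>0) * \<Phi> w \<partial>distr \<mu> ?A (\<lambda>w. w))"
  proof (rule nn_integral_mono)
    fix w
    have "(\<integral>\<^sup>+r. ?F (w, r) \<partial>distr \<mu> borel (bridge_residual s t)) = \<Phi> w * (\<integral>\<^sup>+r. inv_sqrt_kern (r + (?\<alpha> * w s $ i + a)) \<partial>distr \<mu> borel (bridge_residual s t))"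
      unfolding fst_conv snd_conv by (rule nn_integral_cmult) measurable
    also have "\<dots> \<le> \<Phi> w * ennreal (1 + 4 / \<sigma>0)"
      unfolding bridge_residual_law[OF st] using \<sigma> by (intro mult_left_mono inv_sqrt_kern_normal_bound real_le_rsqrt) auto
    finally show "(\<integral>\<^sup>+r. ?F (w, r) \<partial>distr \<mu> borel (bridge_residual s t)) \<le> ennreal (1 + 4 / \<sigma>0) * \<Phi> w" by (simp add: mult.commute)
  qed
  also have "\<dots> = (\<integral>\<^sup>+w. ennreal (1 + 4 / \<sigma>0) * \<Phi> w \<partial>\<mu>)"
    using \<Phi> by (intro nn_integral_distr idA) measurable
  also have "\<dots> = ennreal (1 + 4 / \<sigma>0) * (\<integral>\<^sup>+w. \<Phi> w \<partial>\<mu>)"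
    by (rule nn_integral_cmult[OF measurable_compose[OF idA \<Phi>]])
  finally show ?thesis .
qed

end

section \<open>Negative moments\<close>

lemma line_path_measurable [measurable]: "(\<lambda>t. line_path T x \<xi> t $ i) \<in> borel_measurable borel"
  unfolding line_path_def by (intro component_measurable) measurable

lemma prod_mono_ennreal:
  fixes f g :: "'z \<Rightarrow> ennreal"
  shows "(\<And>a. a \<in> A \<Longrightarrow> f a \<le> g a) \<Longrightarrow> (\<Prod>a\<in>A. f a) \<le> (\<Prod>a\<in>A. g a)"
  by (induction A rule: infinite_finite_induct) (auto intro: mult_mono)

lemma sigma_finite_restrict_Icc: "sigma_finite_measure (lborel_on b)"
  by (intro sigma_finite_measure_restrict_space) (auto simp: lborel.sigma_finite_measure_axioms)

lemma grushin_v_nonneg: "0 \<le> grushin_v \<gamma> T x \<xi> w"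
  unfolding grushin_v_def set_lebesgue_integral_def by (intro Bochner_Integration.integral_nonneg) auto

context
  fixes T :: real and \<mu> :: "(real \<Rightarrow> real ^ 'd) measure"
  assumes T: "T > 0" and pw: "pinned_wiener_measure T \<mu>"
begin

interpretation prob_space \<mu> by (rule pinned_prob_space[OF T pw])

abbreviation (input) "past i s \<equiv> generated_algebra \<mu> (\<lambda>t w. w t $ i) {0..s}"

text \<open>The reference measure lives on \<open>{0..b}\<close> because there the integrand is
  jointly measurable with respect to the path up to \<open>b\<close>; the integral is then known at
  time \<open>b\<close>.\<close>

definition sing_integral :: "'d \<Rightarrow> real \<Rightarrow> real \<Rightarrow> (real \<Rightarrow> real) \<Rightarrow> (real \<Rightarrow> real ^ 'd) \<Rightarrow> ennreal" where
  "sing_integral i a b l w = (\<integral>\<^sup>+t. indicator {a..b} t * inv_sqrt_kern (w t $ i + l t) \<partial>lborel_on b)"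

lemma past_subset: "s \<le> T \<Longrightarrow> sets (past i s) \<subseteq> sets \<mu>"
  by (intro generated_algebra_subset component_measurable pinned_coord_measurable[OF T pw]) auto

lemma past_mono: "s \<le> t \<Longrightarrow> sets (past i s) \<subseteq> sets (past i t)"
  by (intro generated_algebra_subset measurable_generated_algebra) auto

lemma measurable_past_mono:
  assumes "s \<le> t" "f \<in> measurable (past i s) N" shows "f \<in> measurable (past i t) N"
  using measurable_from_subalg[of "past i t" "past i s"] past_mono[OF assms(1), of i] assms(2)
  by (auto simp: subalgebra_def)

lemma measurable_past:
  assumes "s \<le> T" "f \<in> measurable (past i s) N" shows "f \<in> measurable \<mu> N"
  using measurable_from_subalg[of \<mu> "past i s"] past_subset[OF assms(1), of i] assms(2)
  by (auto simp: subalgebra_def)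

lemma inv_sqrt_kern_path_joint:
  assumes "0 \<le> b" "b \<le> T" and [measurable]: "l \<in> borel_measurable borel"
  shows "(\<lambda>p. indicator {a..b} (fst p) * inv_sqrt_kern (snd p (fst p) $ i + l (fst p))) \<in> borel_measurable (lborel_on b \<Otimes>\<^sub>M past i b)"
proof -
  have "(\<lambda>(t, w). w t $ i) \<in> borel_measurable (lborel_on b \<Otimes>\<^sub>M past i b)"
  proof (rule joint_measurable_continuous[OF assms(1)])
    show "(\<lambda>w. w t $ i) \<in> borel_measurable (past i b)" if "t \<in> {0..b}" for t
      using measurable_generated_algebra[of t "{0..b}" "\<lambda>t w. w t $ i" \<mu>] that by simp
    show "continuous_on {0..b} (\<lambda>t. w t $ i)" if "w \<in> space (past i b)" for w
    proof -
      have "continuous_on {0..b} w"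
        using pinned_path_cont[OF T pw, of w] that assms by (auto intro: continuous_on_subset)
      then show ?thesis by (intro continuous_intros)
    qed
  qed
  then have 1: "(\<lambda>p. snd p (fst p) $ i) \<in> borel_measurable (lborel_on b \<Otimes>\<^sub>M past i b)"
    by (simp add: split_beta')
  have 2: "(\<lambda>p. l (fst p)) \<in> borel_measurable (lborel_on b \<Otimes>\<^sub>M past i b)"
    by (intro measurable_compose[OF measurable_fst] measurable_restrict_space1) simp
  have 3: "(\<lambda>p. indicator {a..b} (fst p) :: ennreal) \<in> borel_measurable (lborel_on b \<Otimes>\<^sub>M past i b)"
    by (intro measurable_compose[OF measurable_fst] measurable_restrict_space1) simp
  show ?thesis
    by (intro borel_measurable_times_ennreal 3 measurable_compose[OF _ inv_sqrt_kern_measurable] borel_measurable_add 1 2)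
qed

text \<open>Adaptedness at time \<open>b\<close> lets a product of earlier factors serve as the
  weight \<open>\<Phi>\<close> in \<open>sing_integral_step\<close>.\<close>

lemma sing_integral_measurable:
  assumes "0 \<le> b" "b \<le> T" "l \<in> borel_measurable borel"
  shows "sing_integral i a b l \<in> borel_measurable (past i b)"
proof -
  interpret L: sigma_finite_measure "lborel_on b" by (rule sigma_finite_restrict_Icc)
  have "(\<lambda>(w, t). indicator {a..b} t * inv_sqrt_kern (w t $ i + l t)) \<in> borel_measurable (past i b \<Otimes>\<^sub>M lborel_on b)"
    using measurable_pair_swap[OF inv_sqrt_kern_path_joint[OF assms]] by simp
  then show ?thesis unfolding sing_integral_def[abs_def] by (rule L.borel_measurable_nn_integral)
qed

text \<open>Tonelli moves the expectation inside the time integral, where the conditional bound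
  applies at each \<open>t\<close>. The gap between \<open>s\<close> and \<open>a\<close> makes a
  positive \<open>\<sigma>0\<close> possible.\<close>

lemma sing_integral_step:
  assumes st: "0 \<le> s" "s < a" "a \<le> b" "b < T" and l: "l \<in> borel_measurable borel"
    and \<sigma>: "0 < \<sigma>0" "\<And>t. t \<in> {a..b} \<Longrightarrow> \<sigma>0\<^sup>2 \<le> (t - s) * (T - t) / (T - s)"
    and \<Phi>: "\<Phi> \<in> borel_measurable (past i s)"
  shows "(\<integral>\<^sup>+w. \<Phi> w * sing_integral i a b l w \<partial>\<mu>) \<le> ennreal (b - a) * (ennreal (1 + 4 / \<sigma>0) * (\<integral>\<^sup>+w. \<Phi> w \<partial>\<mu>))"
proof -
  let ?L = "lborel_on b"
  interpret L: sigma_finite_measure ?L by (rule sigma_finite_restrict_Icc)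
  interpret P: pair_sigma_finite ?L \<mu> ..
  have \<Phi>m[measurable]: "\<Phi> \<in> borel_measurable \<mu>" by (rule measurable_past[OF _ \<Phi>]) (use st in simp)
  have sub: "(\<lambda>p. p) \<in> measurable (?L \<Otimes>\<^sub>M \<mu>) (?L \<Otimes>\<^sub>M past i b)"
  proof -
    have "(\<lambda>w. w) \<in> measurable \<mu> (past i b)"
      using past_subset[of b i] st by (intro measurableI) auto
    then have "(\<lambda>p. (fst p, snd p)) \<in> measurable (?L \<Otimes>\<^sub>M \<mu>) (?L \<Otimes>\<^sub>M past i b)"
      by (intro measurable_Pair measurable_fst measurable_compose[OF measurable_snd])
    then show ?thesis by simp
  qed
  have k: "(\<lambda>p. indicator {a..b} (fst p) * inv_sqrt_kern (snd p (fst p) $ i + l (fst p))) \<in> borel_measurable (?L \<Otimes>\<^sub>M \<mu>)"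
    using measurable_compose[OF sub inv_sqrt_kern_path_joint[of b l a i]] st l by simp
  have km: "(\<lambda>t. indicator {a..b} t * inv_sqrt_kern (w t $ i + l t)) \<in> borel_measurable ?L" if "w \<in> space \<mu>" for w
    using measurable_compose[OF measurable_Pair2'[OF that] k] by simp
  have "(\<integral>\<^sup>+w. \<Phi> w * sing_integral i a b l w \<partial>\<mu>)
      = (\<integral>\<^sup>+w. \<integral>\<^sup>+t. \<Phi> w * (indicator {a..b} t * inv_sqrt_kern (w t $ i + l t)) \<partial>?L \<partial>\<mu>)"
    unfolding sing_integral_def by (intro nn_integral_cong nn_integral_cmult[symmetric] km)
  also have "\<dots> = (\<integral>\<^sup>+t. \<integral>\<^sup>+w. \<Phi> w * (indicator {a..b} t * inv_sqrt_kern (w t $ i + l t)) \<partial>\<mu> \<partial>?L)"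
  proof (rule P.Fubini')
    have "(\<lambda>p. \<Phi> (snd p) * (indicator {a..b} (fst p) * inv_sqrt_kern (snd p (fst p) $ i + l (fst p)))) \<in> borel_measurable (?L \<Otimes>\<^sub>M \<mu>)"
      by (intro borel_measurable_times_ennreal k measurable_compose[OF measurable_snd \<Phi>m])
    then show "(\<lambda>(t, w). \<Phi> w * (indicator {a..b} t * inv_sqrt_kern (w t $ i + l t))) \<in> borel_measurable (?L \<Otimes>\<^sub>M \<mu>)"
      by (simp add: split_beta')
  qed
  also have "\<dots> \<le> (\<integral>\<^sup>+t. (ennreal (1 + 4 / \<sigma>0) * (\<integral>\<^sup>+w. \<Phi> w \<partial>\<mu>)) * indicator {a..b} t \<partial>?L)"
  proof (rule nn_integral_mono)
    fix t
    show "(\<integral>\<^sup>+w. \<Phi> w * (indicator {a..b} t * inv_sqrt_kern (w t $ i + l t)) \<partial>\<mu>) \<le> (ennreal (1 + 4 / \<sigma>0) * (\<integral>\<^sup>+w. \<Phi> w \<partial>\<mu>)) * indicator {a..b} t"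
    proof (cases "t \<in> {a..b}")
      case True
      then show ?thesis using inv_sqrt_kern_conditional[OF T pw _ _ _ \<sigma>(1) \<sigma>(2) \<Phi>, of t "l t"] st by simp
    qed simp
  qed
  also have "\<dots> = (ennreal (1 + 4 / \<sigma>0) * (\<integral>\<^sup>+w. \<Phi> w \<partial>\<mu>)) * emeasure ?L {a..b}"
    using st by (intro nn_integral_cmult_indicator) (auto simp: sets_restrict_space_iff)
  also have "emeasure ?L {a..b} = ennreal (b - a)"
    using st by (subst emeasure_restrict_space) auto
  finally show ?thesis by (simp add: mult.commute)
qed

text \<open>The gaps of length \<open>h\<close> between consecutive intervals keep the conditional variances bounded
  below, so each factor costs a constant, whatever the shift \<open>l\<close>.\<close>

lemma sing_integral_product:
  fixes n :: nat
  defines "h \<equiv> T / (2 * real n + 2)"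
  assumes l: "l \<in> borel_measurable borel" and j: "j \<le> n"
  shows "(\<integral>\<^sup>+w. (\<Prod>k<j. sing_integral i ((2 * real k + 1) * h) ((2 * real k + 2) * h) l w) \<partial>\<mu>)
    \<le> (ennreal h * ennreal (1 + 4 / (h / sqrt T))) ^ j"
  using j
proof (induction j)
  case 0
  then show ?case using emeasure_space_1 by simp
next
  case (Suc j)
  have h: "0 < h" using T by (simp add: h_def)
  have Th: "T = (2 * real n + 2) * h" by (simp add: h_def)
  let ?Y = "\<lambda>k. sing_integral i ((2 * real k + 1) * h) ((2 * real k + 2) * h) l"
  let ?\<Phi> = "\<lambda>w. \<Prod>k<j. ?Y k w"
  have le: "(2 * real k + 2) * h \<le> 2 * real j * h" if "k < j" for k
    using that h by (intro mult_right_mono) auto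
  \<comment> \<open>Interval \<open>j\<close> ends at \<open>(2 * j + 2) * h\<close>; since
    \<open>j < n\<close>, at least \<open>2 * h\<close> remains before \<open>T\<close>.\<close>
  have jT: "2 * real j * h + 4 * h \<le> T"
  proof -
    have "2 * real j + 4 \<le> 2 * real n + 2" using Suc.prems by simp
    then have "(2 * real j + 4) * h \<le> (2 * real n + 2) * h" using h by (intro mult_right_mono) auto
    then show ?thesis using Th by (simp add: distrib_right)
  qed
  have j0: "0 \<le> 2 * real j * h" using h by simp
  have \<Phi>: "?\<Phi> \<in> borel_measurable (past i (2 * real j * h))"
  proof (intro borel_measurable_prod_ennreal)
    fix k assume "k \<in> {..<j}"
    then have k: "k < j" by simp
    have "?Y k \<in> borel_measurable (past i ((2 * real k + 2) * h))"
      using le[OF k] jT h l by (intro sing_integral_measurable; (linarith | simp))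
    then show "?Y k \<in> borel_measurable (past i (2 * real j * h))" by (rule measurable_past_mono[OF le[OF k]])
  qed
  have "(\<integral>\<^sup>+w. (\<Prod>k<Suc j. ?Y k w) \<partial>\<mu>) = (\<integral>\<^sup>+w. ?\<Phi> w * ?Y j w \<partial>\<mu>)" by simp
  also have "\<dots> \<le> ennreal ((2 * real j + 2) * h - (2 * real j + 1) * h) * (ennreal (1 + 4 / (h / sqrt T)) * (\<integral>\<^sup>+w. ?\<Phi> w \<partial>\<mu>))"
  proof (rule sing_integral_step[where s="2 * real j * h"])
    show "2 * real j * h < (2 * real j + 1) * h" "(2 * real j + 1) * h \<le> (2 * real j + 2) * h" using h by (auto simp: algebra_simps)
    show "(2 * real j + 2) * h < T" using jT h by (simp add: algebra_simps)
    show "0 < h / sqrt T" using h T by simp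
    fix t assume t: "t \<in> {(2 * real j + 1) * h..(2 * real j + 2) * h}"
    then have 1: "h \<le> t - 2 * real j * h" "h \<le> T - t" "0 < T - 2 * real j * h" "T - 2 * real j * h \<le> T"
      using jT h j0 by (auto simp: algebra_simps)
    \<comment> \<open>The origin of \<open>h / sqrt T\<close>: both factors in the numerator of the
      conditional variance are at least \<open>h\<close>, and the denominator is at most
      \<open>T\<close>.\<close>
    have "(h / sqrt T)\<^sup>2 = h * h / T" using T by (simp add: power_divide power2_eq_square)
    also have "\<dots> \<le> (t - 2 * real j * h) * (T - t) / (T - 2 * real j * h)"
      using 1 h T by (intro frac_le mult_mono) auto
    finally show "(h / sqrt T)\<^sup>2 \<le> (t - 2 * real j * h) * (T - t) / (T - 2 * real j * h)" .
  qed (use j0 l \<Phi> in auto)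
  also have "(2 * real j + 2) * h - (2 * real j + 1) * h = h" by (simp add: algebra_simps)
  also have "ennreal h * (ennreal (1 + 4 / (h / sqrt T)) * (\<integral>\<^sup>+w. ?\<Phi> w \<partial>\<mu>))
    \<le> ennreal h * (ennreal (1 + 4 / (h / sqrt T)) * (ennreal h * ennreal (1 + 4 / (h / sqrt T))) ^ j)"
    using Suc by (intro mult_left_mono) auto
  also have "\<dots> = (ennreal h * ennreal (1 + 4 / (h / sqrt T))) ^ Suc j" by (simp add: mult.assoc)
  finally show ?case .
qed

lemma line_path_cont: "continuous_on S (line_path T x \<xi>)"
  unfolding line_path_def by (intro continuous_intros) (use T in auto)

lemma path_integrand_cont:
  assumes \<gamma>: "\<gamma> > 0" and w: "w \<in> space \<mu>"
  shows "continuous_on {0..T} (\<lambda>t. norm (w t + line_path T x \<xi> t) powr (2 * \<gamma>))"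
  using \<gamma> by (intro continuous_on_powr' continuous_intros line_path_cont pinned_path_cont[OF T pw w]) auto

lemma path_integrand_nn:
  assumes \<gamma>: "\<gamma> > 0" and w: "w \<in> space \<mu>"
  shows "(\<integral>\<^sup>+t. ennreal (norm (w t + line_path T x \<xi> t) powr (2 * \<gamma>)) * indicator {0..T} t \<partial>lborel) = ennreal (grushin_v \<gamma> T x \<xi> w)"
proof -
  have "set_integrable lborel {0..T} (\<lambda>t. norm (w t + line_path T x \<xi> t) powr (2 * \<gamma>))"
    by (intro borel_integrable_atLeastAtMost' path_integrand_cont assms)
  then have i: "integrable lborel (\<lambda>t. indicator {0..T} t *\<^sub>R norm (w t + line_path T x \<xi> t) powr (2 * \<gamma>))"
    by (simp add: set_integrable_def)
  have "(\<integral>\<^sup>+t. ennreal (norm (w t + line_path T x \<xi> t) powr (2 * \<gamma>)) * indicator {0..T} t \<partial>lborel)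
      = (\<integral>\<^sup>+t. ennreal (indicator {0..T} t *\<^sub>R norm (w t + line_path T x \<xi> t) powr (2 * \<gamma>)) \<partial>lborel)"
    by (intro nn_integral_cong) (auto simp: indicator_def)
  also have "\<dots> = ennreal (grushin_v \<gamma> T x \<xi> w)"
    unfolding grushin_v_def set_lebesgue_integral_def by (intro nn_integral_eq_integral i) auto
  finally show ?thesis .
qed

text \<open>Jensen's inequality in tangent line form. The scale \<open>c\<close> is free, which covers \<open>v = 0\<close> as well.\<close>

lemma sing_integral_lower_bound:
  assumes \<gamma>: "\<gamma> > 0" and w: "w \<in> space \<mu>" and c: "c > 0" and ab: "0 \<le> a" "a < b" "b \<le> T"
    and v: "grushin_v \<gamma> T x \<xi> w \<le> c * (b - a)"
  shows "ennreal (c powr (- (1 / (4 * \<gamma>))) * (b - a)) \<le> sing_integral i a b (\<lambda>t. line_path T x \<xi> t $ i) w"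
proof -
  let ?L = "lborel_on b"
  define s where "s = 1 / (4 * \<gamma>)"
  have s: "0 < s" using \<gamma> by (simp add: s_def)
  define y where "y t = w t $ i + line_path T x \<xi> t $ i" for t
  define g where "g t = \<bar>y t\<bar> powr (2 * \<gamma>)" for t
  define q where "q = s * c powr (- s - 1)"
  have q: "0 \<le> q" using s by (simp add: q_def)
  \<comment> \<open>The tangent inequality at \<open>c\<close> for \<open>g t\<close>. Where the
    coordinate vanishes the kernel is \<infinity> and the inequality is trivial.\<close>
  have pt: "ennreal ((1 + s) * c powr (- s)) \<le> inv_sqrt_kern (y t) + ennreal q * ennreal (g t)" for t
  proof (cases "y t = 0")
    case False
    then have g0: "0 < g t" by (simp add: g_def)
    \<comment> \<open>Here \<open>s\<close> takes effect: the exponents multiply to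
      \<open>2 * \<gamma> * (- s) = - 1 / 2\<close>.\<close>
    have "g t powr (- s) = \<bar>y t\<bar> powr (- 1 / 2)"
      unfolding g_def powr_powr using \<gamma> by (simp add: s_def)
    then have "inv_sqrt_kern (y t) = ennreal (g t powr (- s))" using False by (simp add: inv_sqrt_kern_def)
    moreover have "(1 + s) * c powr (- s) \<le> g t powr (- s) + q * g t"
      using powr_tangent[OF g0 c s] by (simp add: q_def)
    then have "ennreal ((1 + s) * c powr (- s)) \<le> ennreal (g t powr (- s) + q * g t)" by (rule ennreal_leI)
    moreover have "ennreal (g t powr (- s) + q * g t) = ennreal (g t powr (- s)) + ennreal q * ennreal (g t)"
      using q g0 by (subst ennreal_plus) (auto simp: ennreal_mult)
    ultimately show ?thesis by simp
  qed (simp add: inv_sqrt_kern_def)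
  have yc: "y \<in> borel_measurable ?L"
  proof -
    have "continuous_on {0..b} y" unfolding y_def
      using ab by (intro continuous_intros line_path_cont continuous_on_subset[OF pinned_path_cont[OF T pw w]]) auto
    then have "y \<in> borel_measurable (restrict_space borel {0..b})" by (rule borel_measurable_continuous_on_restrict)
    then show ?thesis by (simp cong: measurable_cong_sets add: measurable_cong_sets[OF sets_restrict_space_cong[OF sets_lborel] refl])
  qed
  have gm: "(\<lambda>t. ennreal (g t)) \<in> borel_measurable ?L" unfolding g_def using yc by measurable
  have im: "(\<lambda>t. indicator {a..b} t :: ennreal) \<in> borel_measurable ?L" by (intro measurable_restrict_space1) simp
  have km: "(\<lambda>t. inv_sqrt_kern (y t)) \<in> borel_measurable ?L" by (rule measurable_compose[OF yc inv_sqrt_kern_measurable])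
  have "ennreal ((1 + s) * c powr (- s)) * ennreal (b - a) = (\<integral>\<^sup>+t. ennreal ((1 + s) * c powr (- s)) * indicator {a..b} t \<partial>?L)"
  proof -
    have "emeasure ?L {a..b} = ennreal (b - a)" using ab by (subst emeasure_restrict_space) auto
    then show ?thesis using ab by (subst nn_integral_cmult_indicator) (auto simp: sets_restrict_space_iff)
  qed
  also have "\<dots> \<le> (\<integral>\<^sup>+t. indicator {a..b} t * inv_sqrt_kern (y t) + ennreal q * (indicator {a..b} t * ennreal (g t)) \<partial>?L)"
    by (intro nn_integral_mono) (use pt in \<open>auto simp: indicator_def\<close>)
  also have "\<dots> = (\<integral>\<^sup>+t. indicator {a..b} t * inv_sqrt_kern (y t) \<partial>?L) + ennreal q * (\<integral>\<^sup>+t. indicator {a..b} t * ennreal (g t) \<partial>?L)"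
    by (subst nn_integral_add) (auto intro!: borel_measurable_times_ennreal im km gm nn_integral_cmult simp: nn_integral_cmult[OF borel_measurable_times_ennreal[OF im gm]])
  also have "(\<integral>\<^sup>+t. indicator {a..b} t * inv_sqrt_kern (y t) \<partial>?L) = sing_integral i a b (\<lambda>t. line_path T x \<xi> t $ i) w"
    by (simp add: sing_integral_def y_def)
  also have "(\<integral>\<^sup>+t. indicator {a..b} t * ennreal (g t) \<partial>?L) \<le> ennreal (c * (b - a))"
  proof -
    have "(\<integral>\<^sup>+t. indicator {a..b} t * ennreal (g t) \<partial>?L) = (\<integral>\<^sup>+t. (indicator {a..b} t * ennreal (g t)) * indicator {0..b} t \<partial>lborel)"
      by (rule nn_integral_restrict_space) simp
    also have "\<dots> \<le> (\<integral>\<^sup>+t. ennreal (norm (w t + line_path T x \<xi> t) powr (2 * \<gamma>)) * indicator {0..T} t \<partial>lborel)"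
    proof (rule nn_integral_mono)
      fix t
      have "g t \<le> norm (w t + line_path T x \<xi> t) powr (2 * \<gamma>)"
        unfolding g_def y_def using component_le_norm_cart[of "w t + line_path T x \<xi> t" i] \<gamma>
        by (intro powr_mono2) auto
      then show "(indicator {a..b} t * ennreal (g t)) * indicator {0..b} t \<le> ennreal (norm (w t + line_path T x \<xi> t) powr (2 * \<gamma>)) * indicator {0..T} t"
        using ab by (auto simp: indicator_def intro: ennreal_leI)
    qed
    also have "\<dots> = ennreal (grushin_v \<gamma> T x \<xi> w)" by (rule path_integrand_nn[OF \<gamma> w])
    also have "\<dots> \<le> ennreal (c * (b - a))" using v by (rule ennreal_leI)
    finally show ?thesis .
  qed
  finally have main: "ennreal ((1 + s) * c powr (- s)) * ennreal (b - a)
      \<le> sing_integral i a b (\<lambda>t. line_path T x \<xi> t $ i) w + ennreal q * ennreal (c * (b - a))"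
    by (simp add: mult_left_mono add_left_mono)
  \<comment> \<open>The surplus \<open>s * c powr (- s) * (b - a)\<close> on the left equals the
    bound for the \<open>g\<close> term on the right, so both cancel; the bound is finite, as
    cancellation in \<open>ennreal\<close> demands.\<close>
  have "c powr (- s - 1) * c = c powr (- s)" using c powr_add[of c "- s - 1" 1] by simp
  then have qc: "q * (c * (b - a)) = s * c powr (- s) * (b - a)" by (simp add: q_def mult.assoc[symmetric])
  have "ennreal ((1 + s) * c powr (- s)) * ennreal (b - a) = ennreal (c powr (- s) * (b - a) + s * c powr (- s) * (b - a))"
    using s ab by (subst ennreal_mult[symmetric]) (auto simp: algebra_simps)
  also have "\<dots> = ennreal (c powr (- s) * (b - a)) + ennreal (q * (c * (b - a)))"
    unfolding qc using s ab by (intro ennreal_plus) auto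
  also have "ennreal (q * (c * (b - a))) = ennreal q * ennreal (c * (b - a))"
    using q c ab by (intro ennreal_mult) auto
  finally have "ennreal (c powr (- s) * (b - a)) + ennreal q * ennreal (c * (b - a))
     \<le> sing_integral i a b (\<lambda>t. line_path T x \<xi> t $ i) w + ennreal q * ennreal (c * (b - a))"
    using main by simp
  then have "ennreal q * ennreal (c * (b - a)) + ennreal (c powr (- s) * (b - a))
     \<le> ennreal q * ennreal (c * (b - a)) + sing_integral i a b (\<lambda>t. line_path T x \<xi> t $ i) w"
    by (simp only: add.commute)
  then show ?thesis
    unfolding s_def[symmetric] ennreal_add_left_cancel_le by (simp add: ennreal_mult_eq_top_iff)
qed

lemma grushin_v_measurable:
  assumes \<gamma>: "\<gamma> > 0"
  shows "grushin_v \<gamma> T x \<xi> \<in> borel_measurable \<mu>"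
proof -
  let ?L = "lborel_on T"
  interpret L: sigma_finite_measure ?L by (rule sigma_finite_restrict_Icc)
  have m: "(\<lambda>(t, w). norm (w t + line_path T x \<xi> t) powr (2 * \<gamma>)) \<in> borel_measurable (?L \<Otimes>\<^sub>M \<mu>)"
  proof (rule joint_measurable_continuous)
    show "(\<lambda>w. norm (w t + line_path T x \<xi> t) powr (2 * \<gamma>)) \<in> borel_measurable \<mu>" if "t \<in> {0..T}" for t
      using pinned_coord_measurable[OF T pw that] by measurable
  qed (use T path_integrand_cont[OF \<gamma>] in auto)
  have "(\<lambda>w. \<integral>t. norm (w t + line_path T x \<xi> t) powr (2 * \<gamma>) \<partial>?L) \<in> borel_measurable \<mu>"
    using measurable_pair_swap[OF m] by (intro L.borel_measurable_lebesgue_integral) simp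
  moreover have "(\<integral>t. norm (w t + line_path T x \<xi> t) powr (2 * \<gamma>) \<partial>?L) = grushin_v \<gamma> T x \<xi> w" for w
    unfolding grushin_v_def set_lebesgue_integral_def by (rule integral_restrict_space) simp
  ultimately show ?thesis by simp
qed

text \<open>If \<open>v\<close> were 0, the lower bound would hold for every \<open>c > 0\<close>
  and force a singular integral to be infinite; but its mean is finite.\<close>

lemma grushin_v_pos:
  assumes \<gamma>: "\<gamma> > 0"
  shows "AE w in \<mu>. grushin_v \<gamma> T x \<xi> w > 0"
proof -
  define s where "s = 1 / (4 * \<gamma>)"
  have s: "0 < s" using \<gamma> by (simp add: s_def)
  \<comment> \<open>The case \<open>n = 1\<close>: one interval from \<open>h\<close> to
    \<open>2 * h\<close>, with \<open>T = 4 * h\<close>.\<close>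
  define h where "h = T / (2 * real (1::nat) + 2)"
  have h: "0 < h" using T by (simp add: h_def)
  have Th: "T = 4 * h" by (simp add: h_def)
  define i :: 'd where "i = undefined"
  define l where "l t = line_path T x \<xi> t $ i" for t
  let ?Y = "sing_integral i h (2 * h) l"
  have lm: "l \<in> borel_measurable borel" unfolding l_def[abs_def] by measurable
  have Ym: "?Y \<in> borel_measurable \<mu>"
    using h by (intro measurable_past[of "2 * h" _ i] sing_integral_measurable lm) (auto simp: Th)
  have "(\<integral>\<^sup>+w. ?Y w \<partial>\<mu>) \<le> ennreal h * ennreal (1 + 4 / (h / sqrt T))"
    using sing_integral_product[OF lm, of 1 1 i] unfolding h_def[symmetric] by simp
  also have "\<dots> < \<infinity>" by (simp add: ennreal_mult_less_top)
  finally have "AE w in \<mu>. ?Y w \<noteq> \<infinity>" by (intro nn_integral_PInf_AE Ym) auto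
  then show ?thesis
    using AE_space
  proof eventually_elim
    case (elim w)
    show ?case
    proof (rule ccontr)
      assume "\<not> grushin_v \<gamma> T x \<xi> w > 0"
      then have v0: "grushin_v \<gamma> T x \<xi> w = 0" using grushin_v_nonneg[of \<gamma> T x \<xi> w] by simp
      have le: "ennreal (c powr (- s) * h) \<le> ?Y w" if "0 < c" for c
        using sing_integral_lower_bound[OF \<gamma> elim(2) that, of h "2 * h" x \<xi> i] h that v0
        by (simp add: s_def l_def[abs_def] Th)
      have "ennreal r \<le> ?Y w" for r
      proof (cases "r > 0")
        case True
        \<comment> \<open>Solves \<open>c powr (- s) = r / h\<close>, so that the lower bound
          becomes \<open>r\<close>.\<close>
        define c where "c = (r / h) powr (- (1 / s))"
        have "0 < c" using True h by (simp add: c_def)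
        moreover have "c powr (- s) = r / h" unfolding c_def powr_powr using True h s by simp
        ultimately show ?thesis using le[of c] h by simp
      qed (simp add: ennreal_neg)
      then have "?Y w = \<infinity>"
      proof (cases "?Y w")
        case (real r)
        then have "ennreal (r + 1) \<le> ennreal r" using \<open>\<And>r. ennreal r \<le> ?Y w\<close>[of "r + 1"] by simp
        then show ?thesis using real(1) by (simp add: ennreal_le_iff)
      qed simp
      with elim show False by simp
    qed
  qed
qed

text \<open>With \<open>c = v / h\<close> the lower bound reads
  \<open>v powr (- s) * d \<le> Y\<close> for each of the \<open>n\<close> singular integrals
  \<open>Y\<close>. Multiplying them controls \<open>v powr (- s * n)\<close>, and \<open>n\<close>
  is taken with \<open>p \<le> s * n\<close>. The constant is the same for all \<open>x\<close> and
  \<xi> because the mean of the product is bounded for every shift \<open>l\<close> alike.\<close>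

theorem grushin_v_negative_moment:
  assumes \<gamma>: "\<gamma> > 0" and p: "p > 0"
  shows "\<exists>C. \<forall>x \<xi>. (\<integral>\<^sup>+w. ennreal (grushin_v \<gamma> T x \<xi> w powr (- p)) \<partial>\<mu>) \<le> ennreal C"
proof -
  define s where "s = 1 / (4 * \<gamma>)"
  have s: "0 < s" using \<gamma> by (simp add: s_def)
  define n where "n = nat \<lceil>p / s\<rceil>"
  have n: "p \<le> s * real n"
  proof -
    have "p / s \<le> real n" unfolding n_def using p s by (simp add: real_nat_ceiling_ge)
    then show ?thesis using s by (simp add: pos_divide_le_eq mult.commute)
  qed
  define h where "h = T / (2 * real n + 2)"
  have h: "0 < h" using T by (simp add: h_def)
  have Th: "T = (2 * real n + 2) * h" by (simp add: h_def)
  \<comment> \<open>Collects the powers of \<open>h\<close> in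
    \<open>(v / h) powr (- s) * h\<close>.\<close>
  define d where "d = h powr s * h"
  have d: "0 < d" using h by (simp add: d_def)
  define i :: 'd where "i = undefined"
  define K where "K = h * (1 + 4 / (h / sqrt T))"
  have K: "0 \<le> K" using h T by (simp add: K_def)
  have "(\<integral>\<^sup>+w. ennreal (grushin_v \<gamma> T x \<xi> w powr (- p)) \<partial>\<mu>) \<le> ennreal (1 + (1 / d) ^ n * K ^ n)" for x \<xi>
  proof -
    define l where "l t = line_path T x \<xi> t $ i" for t
    have lm: "l \<in> borel_measurable borel" unfolding l_def[abs_def] by measurable
    let ?Y = "\<lambda>k. sing_integral i ((2 * real k + 1) * h) ((2 * real k + 2) * h) l"
    have kT: "(2 * real k + 2) * h \<le> T" if "k < n" for k
      unfolding Th using that h by (intro mult_right_mono) auto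
    have Ym: "?Y k \<in> borel_measurable \<mu>" if "k < n" for k
      using h kT[OF that] by (intro measurable_past[of "(2 * real k + 2) * h" _ i] sing_integral_measurable lm) auto
    have Pm: "(\<lambda>w. \<Prod>k<n. ?Y k w) \<in> borel_measurable \<mu>" by (intro borel_measurable_prod_ennreal Ym) auto
    have pt: "ennreal (grushin_v \<gamma> T x \<xi> w powr (- p)) \<le> 1 + ennreal ((1 / d) ^ n) * (\<Prod>k<n. ?Y k w)" if w: "w \<in> space \<mu>" for w
    proof -
      let ?v = "grushin_v \<gamma> T x \<xi> w"
      \<comment> \<open>For \<open>v = 0\<close> the left side is \<open>0 powr (- p) = 0\<close>,
        and for \<open>v \<ge> 1\<close> it is at most 1; only small \<open>v\<close> calls for the
        product.\<close>
      consider "?v = 0" | "1 \<le> ?v" | "0 < ?v" "?v < 1" using grushin_v_nonneg[of \<gamma> T x \<xi> w] by linarith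
      then show ?thesis
      proof cases
        case 2
        then have "?v powr (- p) \<le> ?v powr 0" using p by (intro powr_mono) auto
        then have "ennreal (?v powr (- p)) \<le> 1" using 2 by (simp add: ennreal_le_1)
        then show ?thesis by (rule order_trans) simp
      next
        case 3
        have "?v powr (- p) \<le> ?v powr (- (s * real n))" using 3 n by (intro powr_mono') auto
        also have "\<dots> = (?v powr (- s)) ^ n" using 3 by (simp add: powr_realpow[symmetric] powr_powr)
        also have "\<dots> = (1 / d) ^ n * (?v powr (- s) * d) ^ n" using d by (simp add: power_mult_distrib[symmetric])
        finally have "ennreal (?v powr (- p)) \<le> ennreal ((1 / d) ^ n * (?v powr (- s) * d) ^ n)" by (rule ennreal_leI)
        also have "\<dots> = ennreal ((1 / d) ^ n) * (\<Prod>k<n. ennreal (?v powr (- s) * d))"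
          using d by (subst ennreal_mult) (auto simp: ennreal_power)
        also have "\<dots> \<le> ennreal ((1 / d) ^ n) * (\<Prod>k<n. ?Y k w)"
        proof (intro mult_left_mono prod_mono_ennreal)
          fix k assume "k \<in> {..<n}"
          then have k: "k < n" by simp
          have len: "(2 * real k + 2) * h - (2 * real k + 1) * h = h" by (simp add: algebra_simps)
          have "ennreal ((?v / h) powr (- s) * h) \<le> ?Y k w"
            using sing_integral_lower_bound[OF \<gamma> w, of "?v / h" "(2 * real k + 1) * h" "(2 * real k + 2) * h" x \<xi> i] h 3 kT[OF k]
            unfolding len by (simp add: s_def l_def[abs_def])
          moreover have "(?v / h) powr (- s) * h = ?v powr (- s) * d"
            using h 3 by (simp add: powr_divide powr_minus_divide d_def)
          ultimately show "ennreal (?v powr (- s) * d) \<le> ?Y k w" by simp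
        qed auto
        finally show ?thesis by (rule order_trans) simp
      qed simp
    qed
    have "(\<integral>\<^sup>+w. ennreal (grushin_v \<gamma> T x \<xi> w powr (- p)) \<partial>\<mu>) \<le> (\<integral>\<^sup>+w. 1 + ennreal ((1 / d) ^ n) * (\<Prod>k<n. ?Y k w) \<partial>\<mu>)"
      by (rule nn_integral_mono[OF pt])
    also have "\<dots> = 1 + ennreal ((1 / d) ^ n) * (\<integral>\<^sup>+w. (\<Prod>k<n. ?Y k w) \<partial>\<mu>)"
      using Pm by (simp add: nn_integral_add nn_integral_cmult emeasure_space_1)
    also have "\<dots> \<le> 1 + ennreal ((1 / d) ^ n) * (ennreal h * ennreal (1 + 4 / (h / sqrt T))) ^ n"
      using sing_integral_product[OF lm order.refl, of i n] unfolding h_def[symmetric] by (intro add_left_mono mult_left_mono) auto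
    also have "ennreal h * ennreal (1 + 4 / (h / sqrt T)) = ennreal K"
      unfolding K_def using h T by (intro ennreal_mult[symmetric]) auto
    also have "1 + ennreal ((1 / d) ^ n) * ennreal K ^ n = ennreal (1 + (1 / d) ^ n * K ^ n)"
      using K d by (subst ennreal_plus) (auto simp: ennreal_mult ennreal_power)
    finally show ?thesis .
  qed
  then show ?thesis by blast
qed

end

section \<open>Continuity of the density\<close>

lemma prod_std_normal:
  fixes z :: "real ^ 'n"
  shows "(\<Prod>i\<in>UNIV. std_normal_density (z $ i)) = (1 / sqrt (2 * pi) ^ CARD('n)) * exp (- (norm z)\<^sup>2 / 2)"
proof -
  have "(\<Prod>i\<in>UNIV. std_normal_density (z $ i)) = (\<Prod>i\<in>(UNIV::'n set). 1 / sqrt (2 * pi)) * (\<Prod>i\<in>UNIV. exp (- (z $ i)\<^sup>2 / 2))"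
    unfolding std_normal_density_def by (rule prod.distrib)
  also have "(\<Prod>i\<in>UNIV. exp (- (z $ i)\<^sup>2 / 2)) = exp (\<Sum>i\<in>UNIV. - (z $ i)\<^sup>2 / 2)"
    by (simp add: exp_sum)
  also have "(\<Sum>i\<in>UNIV. - (z $ i)\<^sup>2 / 2) = - (norm z)\<^sup>2 / 2"
    unfolding power2_norm_eq_inner inner_vec_def by (simp add: sum_negf sum_divide_distrib power2_eq_square)
  finally show ?thesis by (simp add: power_divide)
qed

lemma nn_integral_std_gauss_affine:
  fixes a :: "real ^ 'n"
  assumes c: "c > 0" and [measurable]: "f \<in> borel_measurable borel"
  shows "(\<integral>\<^sup>+u. f (a + c *\<^sub>R u) \<partial>std_gauss)
    = (\<integral>\<^sup>+\<eta>. f \<eta> * ennreal (1 / sqrt (2 * pi) ^ CARD('n) * (1 / c ^ CARD('n)) * exp (- (norm (\<eta> - a))\<^sup>2 / (2 * c\<^sup>2))) \<partial>lborel)"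
proof -
  define k where "k \<eta> = 1 / sqrt (2 * pi) ^ CARD('n) * (1 / c ^ CARD('n)) * exp (- (norm (\<eta> - a))\<^sup>2 / (2 * c\<^sup>2))" for \<eta> :: "real ^ 'n"
  have km[measurable]: "k \<in> borel_measurable borel" unfolding k_def by measurable
  have k: "c ^ CARD('n) * k (a + c *\<^sub>R u) = (\<Prod>i\<in>UNIV. std_normal_density (u $ i))" for u
    using c by (simp add: k_def prod_std_normal power_mult_distrib)
  have k0: "0 \<le> k \<eta>" for \<eta> using c by (simp add: k_def)
  have aff: "lborel = density (distr lborel borel (\<lambda>x. a + c *\<^sub>R x)) (\<lambda>_. \<bar>c\<bar> ^ DIM(real ^ 'n))"
    using lborel_affine[of c a] c by simp
  have "(\<integral>\<^sup>+\<eta>. f \<eta> * ennreal (k \<eta>) \<partial>lborel) = (\<integral>\<^sup>+u. ennreal (c ^ CARD('n)) * (f (a + c *\<^sub>R u) * ennreal (k (a + c *\<^sub>R u))) \<partial>lborel)"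
    by (subst aff) (use c in \<open>simp add: nn_integral_density nn_integral_distr\<close>)
  also have "\<dots> = (\<integral>\<^sup>+u. ennreal (\<Prod>i\<in>UNIV. std_normal_density (u $ i)) * f (a + c *\<^sub>R u) \<partial>lborel)"
  proof (rule nn_integral_cong)
    fix u
    have "ennreal (c ^ CARD('n)) * ennreal (k (a + c *\<^sub>R u)) = ennreal (\<Prod>i\<in>UNIV. std_normal_density (u $ i))"
      using c k0 by (subst ennreal_mult[symmetric]) (auto simp: k)
    then show "ennreal (c ^ CARD('n)) * (f (a + c *\<^sub>R u) * ennreal (k (a + c *\<^sub>R u))) = ennreal (\<Prod>i\<in>UNIV. std_normal_density (u $ i)) * f (a + c *\<^sub>R u)"
      by (metis mult.assoc mult.commute)
  qed
  also have "\<dots> = (\<integral>\<^sup>+u. f (a + c *\<^sub>R u) \<partial>std_gauss)"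
    unfolding std_gauss_def by (subst nn_integral_density) auto
  finally show ?thesis by (simp add: k_def)
qed

text \<open>Up to the factor \<open>1 / sqrt (2 * pi) ^ e\<close>, the density in dimension
  \<open>e\<close> of a centred Gaussian vector with covariance \<open>v * Id\<close> at squared
  distance \<open>r\<close> from the origin, viewed as a function of the variance.\<close>

definition gauss_factor :: "real \<Rightarrow> real \<Rightarrow> real \<Rightarrow> real" where
  "gauss_factor e r v = v powr (- e / 2) * exp (- r / (2 * v))"

lemma gauss_factor_measurable [measurable]: "gauss_factor e r \<in> borel_measurable borel"
  unfolding gauss_factor_def[abs_def] by measurable

lemma gauss_factor_bound:
  assumes "0 \<le> r" "0 \<le> v"
  shows "0 \<le> gauss_factor e r v" "gauss_factor e r v \<le> v powr (- e / 2)"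
proof -
  show "0 \<le> gauss_factor e r v" by (simp add: gauss_factor_def)
  have "exp (- r / (2 * v)) \<le> 1" using assms by simp
  then show "gauss_factor e r v \<le> v powr (- e / 2)"
    unfolding gauss_factor_def by (simp add: mult_left_le)
qed

text \<open>Below the cut-off both values are at most \<open>v powr (- e / 2)\<close>, and one
  factor \<open>v < 1 / K\<close> is traded for an additional negative power of \<open>v\<close>.
  The bound is free of \<open>r\<close>, hence uniform in the second component.\<close>

lemma gauss_factor_truncation:
  assumes e: "0 \<le> e" and r: "0 \<le> r" and v: "0 < v" and K: "0 < K"
  shows "\<bar>gauss_factor e r (max v (1 / K)) - gauss_factor e r v\<bar> \<le> (2 / K) * v powr (- (e / 2 + 1))"
proof (cases "1 / K \<le> v")
  case True
  then show ?thesis using K by (simp add: max_def)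
next
  case False
  then have vK: "v < 1 / K" by simp
  have le: "gauss_factor e r u \<le> v powr (- e / 2)" "0 \<le> gauss_factor e r u" if "v \<le> u" for u
  proof -
    have "u powr (- e / 2) \<le> v powr (- e / 2)" using that v e by (intro powr_mono2') auto
    then show "gauss_factor e r u \<le> v powr (- e / 2)" "0 \<le> gauss_factor e r u" using gauss_factor_bound[OF r, of u e] that v by auto
  qed
  have "\<bar>gauss_factor e r (max v (1 / K)) - gauss_factor e r v\<bar> \<le> v powr (- e / 2)"
    using le[of v] le[of "max v (1 / K)"] by auto
  also have "\<dots> = v powr (- (e / 2 + 1)) * v"
    using v powr_add[of v "- (e / 2 + 1)" 1] by simp
  also have "\<dots> \<le> v powr (- (e / 2 + 1)) * (1 / K)" using vK by (intro mult_left_mono) auto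
  also have "\<dots> \<le> (2 / K) * v powr (- (e / 2 + 1))" using K by (simp add: divide_right_mono)
  finally show ?thesis .
qed

context
  fixes \<gamma> T :: real and \<mu> :: "(real \<Rightarrow> real ^ 'd) measure"
  assumes \<gamma>: "\<gamma> > 0" and T: "T > 0" and pw: "pinned_wiener_measure T \<mu>"
begin

interpretation prob_space \<mu> by (rule pinned_prob_space[OF T pw])

text \<open>Measurability in the end point and the path together is what Fubini needs once the end
  point becomes random.\<close>

lemma grushin_v_joint:
  "(\<lambda>(\<xi>, w). grushin_v \<gamma> T x \<xi> w) \<in> borel_measurable (borel \<Otimes>\<^sub>M \<mu>)"
proof -
  let ?L = "lborel_on T"
  interpret L: sigma_finite_measure ?L by (rule sigma_finite_restrict_Icc)
  have m: "(\<lambda>(t, p). norm (snd p t + line_path T x (fst p) t) powr (2 * \<gamma>)) \<in> borel_measurable (?L \<Otimes>\<^sub>M (borel \<Otimes>\<^sub>M \<mu>))"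
  proof (rule joint_measurable_continuous)
    show "(\<lambda>p. norm (snd p t + line_path T x (fst p) t) powr (2 * \<gamma>)) \<in> borel_measurable (borel \<Otimes>\<^sub>M \<mu>)" if "t \<in> {0..T}" for t
    proof -
      have 1: "(\<lambda>p. snd p t) \<in> borel_measurable (borel \<Otimes>\<^sub>M \<mu>)"
        by (rule measurable_compose[OF measurable_snd pinned_coord_measurable[OF T pw that]])
      have 2: "(\<lambda>p. line_path T x (fst p) t) \<in> borel_measurable (borel \<Otimes>\<^sub>M \<mu>)"
        unfolding line_path_def by measurable
      have "(\<lambda>z::real^'d. norm z powr (2 * \<gamma>)) \<in> borel_measurable borel" by measurable
      then show ?thesis by (rule measurable_compose[OF borel_measurable_add[OF 1 2]])
    qed
  qed (use T path_integrand_cont[OF T pw \<gamma>] in \<open>auto simp: space_pair_measure\<close>)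
  have "(\<lambda>p. \<integral>t. norm (snd p t + line_path T x (fst p) t) powr (2 * \<gamma>) \<partial>?L) \<in> borel_measurable (borel \<Otimes>\<^sub>M \<mu>)"
    using measurable_pair_swap[OF m] by (intro L.borel_measurable_lebesgue_integral) (simp add: split_beta')
  moreover have "(\<integral>t. norm (w t + line_path T x \<xi> t) powr (2 * \<gamma>) \<partial>?L) = grushin_v \<gamma> T x \<xi> w" for w \<xi>
    unfolding grushin_v_def set_lebesgue_integral_def by (rule integral_restrict_space) simp
  ultimately show ?thesis by (simp add: split_beta')
qed

lemma grushin_v_continuous:
  assumes w: "w \<in> space \<mu>"
  shows "continuous_on UNIV (\<lambda>p. grushin_v \<gamma> T (fst p) (snd p) w)"
proof -
  let ?f = "\<lambda>p t. norm (w t + line_path T (fst p) (snd p) t) powr (2 * \<gamma>)"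
  have wc: "continuous_on (UNIV \<times> cbox 0 T) (\<lambda>q. w (snd q))"
    by (rule continuous_on_compose2[OF pinned_path_cont[OF T pw w]]) (auto intro!: continuous_intros)
  have "continuous_on (UNIV \<times> cbox 0 T) (\<lambda>q. ?f (fst q) (snd q))"
    unfolding line_path_def using \<gamma> T
    by (intro continuous_on_powr' continuous_intros wc) auto
  then have "continuous_on UNIV (\<lambda>p. integral (cbox 0 T) (?f p))"
    by (intro integral_continuous_on_param) (simp add: split_beta')
  moreover have "integral (cbox 0 T) (?f p) = grushin_v \<gamma> T (fst p) (snd p) w" for p
    unfolding grushin_v_def cbox_interval
    by (rule set_borel_integral_eq_integral(2)[symmetric])
       (intro borel_integrable_atLeastAtMost' path_integrand_cont[OF T pw \<gamma> w])
  ultimately show ?thesis by simp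
qed

lemma inverse_grushin_v_L_infty_minus:
  "(\<lambda>w. inverse (grushin_v \<gamma> T x \<xi> w)) \<in> L_infty_minus \<mu>"
  unfolding L_infty_minus_def
proof safe
  have [measurable]: "grushin_v \<gamma> T x \<xi> \<in> borel_measurable \<mu>" by (rule grushin_v_measurable[OF T pw \<gamma>])
  show "(\<lambda>w. inverse (grushin_v \<gamma> T x \<xi> w)) \<in> borel_measurable \<mu>" by measurable
  fix p :: real assume "1 < p"
  then have p: "p > 0" by simp
  obtain C where C: "\<forall>x \<xi>. (\<integral>\<^sup>+w. ennreal (grushin_v \<gamma> T x \<xi> w powr (- p)) \<partial>\<mu>) \<le> ennreal C"
    using grushin_v_negative_moment[OF T pw \<gamma> p] by blast
  \<comment> \<open>At \<open>v = 0\<close> both sides are 0 by the conventions for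
    \<open>inverse\<close> and \<open>powr\<close>.\<close>
  have e: "\<bar>inverse (grushin_v \<gamma> T x \<xi> w)\<bar> powr p = grushin_v \<gamma> T x \<xi> w powr (- p)" for w
    using grushin_v_nonneg[of \<gamma> T x \<xi> w] by (cases "grushin_v \<gamma> T x \<xi> w = 0") (auto simp: powr_minus inverse_powr abs_inverse)
  show "integrable \<mu> (\<lambda>w. \<bar>inverse (grushin_v \<gamma> T x \<xi> w)\<bar> powr p)"
    unfolding e
  proof (rule integrableI_bounded)
    have "(\<integral>\<^sup>+w. ennreal (norm (grushin_v \<gamma> T x \<xi> w powr (- p))) \<partial>\<mu>) \<le> ennreal C" using C by simp
    also have "\<dots> < \<infinity>" by simp
    finally show "(\<integral>\<^sup>+w. ennreal (norm (grushin_v \<gamma> T x \<xi> w powr (- p))) \<partial>\<mu>) < \<infinity>" .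
  qed measurable
qed

lemma gauss_factor_integrable:
  assumes "0 < e" "0 \<le> r"
  shows "integrable \<mu> (\<lambda>w. gauss_factor e r (grushin_v \<gamma> T x \<xi> w))"
proof (rule integrableI_bounded)
  have vm[measurable]: "grushin_v \<gamma> T x \<xi> \<in> borel_measurable \<mu>" by (rule grushin_v_measurable[OF T pw \<gamma>])
  show "(\<lambda>w. gauss_factor e r (grushin_v \<gamma> T x \<xi> w)) \<in> borel_measurable \<mu>" by measurable
  obtain C where C: "\<forall>x \<xi>. (\<integral>\<^sup>+w. ennreal (grushin_v \<gamma> T x \<xi> w powr (- (e / 2))) \<partial>\<mu>) \<le> ennreal C"
    using grushin_v_negative_moment[OF T pw \<gamma>, of "e / 2"] assms by auto
  have "(\<integral>\<^sup>+w. ennreal (norm (gauss_factor e r (grushin_v \<gamma> T x \<xi> w))) \<partial>\<mu>) \<le> (\<integral>\<^sup>+w. ennreal (grushin_v \<gamma> T x \<xi> w powr (- (e / 2))) \<partial>\<mu>)"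
    using gauss_factor_bound[OF assms(2) grushin_v_nonneg, of e \<gamma> T x \<xi>]
    by (intro nn_integral_mono ennreal_leI) simp
  also have "\<dots> \<le> ennreal C" using C by simp
  finally show "(\<integral>\<^sup>+w. ennreal (norm (gauss_factor e r (grushin_v \<gamma> T x \<xi> w))) \<partial>\<mu>) < \<infinity>"
    by (simp add: le_less_trans)
qed

text \<open>With \<open>v\<close> cut off from below the integrand is bounded, and dominated
  convergence gives continuity in all parameters. The cut-off error is uniform in the parameters, so
  continuity survives in the limit.\<close>

lemma gauss_factor_integral_continuous:
  assumes e: "0 < e"
  shows "continuous_on UNIV (\<lambda>q :: ((real ^ 'd) \<times> (real ^ 'e)) \<times> (real ^ 'd) \<times> (real ^ 'e).
    \<integral>w. gauss_factor e ((norm (snd (snd q) - snd (fst q)))\<^sup>2) (grushin_v \<gamma> T (fst (fst q)) (fst (snd q)) w) \<partial>\<mu>)"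
proof -
  define r where "r q = (norm (snd (snd q) - snd (fst q)))\<^sup>2" for q :: "((real ^ 'd) \<times> (real ^ 'e)) \<times> (real ^ 'd) \<times> (real ^ 'e)"
  define v where "v q w = grushin_v \<gamma> T (fst (fst q)) (fst (snd q)) w" for q :: "((real ^ 'd) \<times> (real ^ 'e)) \<times> (real ^ 'd) \<times> (real ^ 'e)" and w
  have r0: "0 \<le> r q" for q by (simp add: r_def)
  have vm[measurable]: "v q \<in> borel_measurable \<mu>" for q unfolding v_def[abs_def] by (rule grushin_v_measurable[OF T pw \<gamma>])
  have vpos: "AE w in \<mu>. 0 < v q w" for q unfolding v_def by (rule grushin_v_pos[OF T pw \<gamma>])
  have rc: "continuous_on UNIV r" unfolding r_def by (intro continuous_intros)
  have pc: "continuous_on UNIV (\<lambda>q :: ((real ^ 'd) \<times> (real ^ 'e)) \<times> (real ^ 'd) \<times> (real ^ 'e). (fst (fst q), fst (snd q)))"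
    by (intro continuous_intros)
  have vc: "continuous_on UNIV (\<lambda>q. v q w)" if "w \<in> space \<mu>" for w
    unfolding v_def using continuous_on_compose2[OF grushin_v_continuous[OF that] pc] by simp
  define F where "F K q = (\<integral>w. gauss_factor e (r q) (max (v q w) (1 / real (Suc K))) \<partial>\<mu>)" for K q
  have gb: "\<bar>gauss_factor e (r q) (max u (1 / real (Suc K)))\<bar> \<le> (1 / real (Suc K)) powr (- e / 2)" for K q u
  proof -
    have "0 < max u (1 / real (Suc K))" by (simp add: less_max_iff_disj)
    then have "gauss_factor e (r q) (max u (1 / real (Suc K))) \<le> (max u (1 / real (Suc K))) powr (- e / 2)"
      "0 \<le> gauss_factor e (r q) (max u (1 / real (Suc K)))"
      using gauss_factor_bound[OF r0, of "max u (1 / real (Suc K))" e q] by auto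
    moreover have "(max u (1 / real (Suc K))) powr (- e / 2) \<le> (1 / real (Suc K)) powr (- e / 2)"
      using e by (intro powr_mono2') auto
    ultimately show ?thesis by simp
  qed
  have gm: "(\<lambda>w. gauss_factor e (r q) (max (v q w) (1 / real (Suc K)))) \<in> borel_measurable \<mu>" for K q
    by measurable
  have gi: "integrable \<mu> (\<lambda>w. gauss_factor e (r q) (max (v q w) (1 / real (Suc K))))" for K q
    by (rule integrable_const_bound[where B="(1 / real (Suc K)) powr (- e / 2)", OF _ gm])
      (intro AE_I2, simp only: real_norm_def gb)
  have Fc: "continuous_on UNIV (F K)" for K
    unfolding continuous_on_sequentially
  proof (intro ballI allI impI, elim conjE)
    fix q :: "nat \<Rightarrow> ((real ^ 'd) \<times> (real ^ 'e)) \<times> (real ^ 'd) \<times> (real ^ 'e)" and a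
    assume q: "q \<longlonglongrightarrow> a"
    show "(F K \<circ> q) \<longlonglongrightarrow> F K a"
      unfolding F_def comp_def
    proof (rule integral_dominated_convergence[where w="\<lambda>_. (1 / real (Suc K)) powr (- e / 2)"])
      show "AE w in \<mu>. (\<lambda>n. gauss_factor e (r (q n)) (max (v (q n) w) (1 / real (Suc K)))) \<longlonglongrightarrow> gauss_factor e (r a) (max (v a w) (1 / real (Suc K)))"
      proof (rule AE_I2)
        fix w assume w: "w \<in> space \<mu>"
        have l1: "(\<lambda>n. v (q n) w) \<longlonglongrightarrow> v a w"
          using continuous_on_tendsto_compose[OF vc[OF w] q] by simp
        have l2: "(\<lambda>n. r (q n)) \<longlonglongrightarrow> r a"
          using continuous_on_tendsto_compose[OF rc q] by simp
        \<comment> \<open>The cut-off keeps the limiting variance away from 0, where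
          \<open>gauss_factor\<close> may fail to be continuous.\<close>
        have "max (v a w) (1 / real (Suc K)) > 0" by (simp add: less_max_iff_disj)
        then show "(\<lambda>n. gauss_factor e (r (q n)) (max (v (q n) w) (1 / real (Suc K)))) \<longlonglongrightarrow> gauss_factor e (r a) (max (v a w) (1 / real (Suc K)))"
          unfolding gauss_factor_def by (intro tendsto_intros l1 l2) auto
      qed
    qed (use gm gb in auto)
  qed
  \<comment> \<open>The order \<open>e / 2 + 1\<close> is the one that
    \<open>gauss_factor_truncation\<close> charges for the cut-off.\<close>
  obtain C where C: "\<forall>x \<xi>. (\<integral>\<^sup>+w. ennreal (grushin_v \<gamma> T x \<xi> w powr (- (e / 2 + 1))) \<partial>\<mu>) \<le> ennreal C"
    using grushin_v_negative_moment[OF T pw \<gamma>, of "e / 2 + 1"] e by auto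
  define C' where "C' = max C 0"
  have C': "(\<integral>\<^sup>+w. ennreal (v q w powr (- (e / 2 + 1))) \<partial>\<mu>) \<le> ennreal C'" "0 \<le> C'" for q
    using C by (auto simp: v_def C'_def ennreal_leI intro: order_trans)
  define F0 where "F0 q = (\<integral>w. gauss_factor e (r q) (v q w) \<partial>\<mu>)" for q
  have err: "dist (F K q) (F0 q) \<le> 2 * C' / real (Suc K)" for K q
  proof -
    have i1: "integrable \<mu> (\<lambda>w. gauss_factor e (r q) (v q w))"
      unfolding v_def by (rule gauss_factor_integrable[OF e r0])
    have "ennreal \<bar>F K q - F0 q\<bar> = ennreal (norm (\<integral>w. gauss_factor e (r q) (max (v q w) (1 / real (Suc K))) - gauss_factor e (r q) (v q w) \<partial>\<mu>))"
      unfolding F_def F0_def using gi[of q K] i1 by simp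
    also have "\<dots> \<le> (\<integral>\<^sup>+w. ennreal (norm (gauss_factor e (r q) (max (v q w) (1 / real (Suc K))) - gauss_factor e (r q) (v q w))) \<partial>\<mu>)"
      using gi[of q K] i1 by (intro integral_norm_bound_ennreal Bochner_Integration.integrable_diff)
    also have "\<dots> \<le> (\<integral>\<^sup>+w. ennreal (2 / real (Suc K)) * ennreal (v q w powr (- (e / 2 + 1))) \<partial>\<mu>)"
    proof (rule nn_integral_mono_AE)
      show "AE w in \<mu>. ennreal (norm (gauss_factor e (r q) (max (v q w) (1 / real (Suc K))) - gauss_factor e (r q) (v q w)))
          \<le> ennreal (2 / real (Suc K)) * ennreal (v q w powr (- (e / 2 + 1)))"
        using vpos[of q]
      proof eventually_elim
        case (elim w)
        have "norm (gauss_factor e (r q) (max (v q w) (1 / real (Suc K))) - gauss_factor e (r q) (v q w)) \<le> (2 / real (Suc K)) * v q w powr (- (e / 2 + 1))"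
          using gauss_factor_truncation[of e "r q" "v q w" "real (Suc K)"] e r0 elim by simp
        then have "ennreal (norm (gauss_factor e (r q) (max (v q w) (1 / real (Suc K))) - gauss_factor e (r q) (v q w))) \<le> ennreal ((2 / real (Suc K)) * v q w powr (- (e / 2 + 1)))"
          by (rule ennreal_leI)
        then show ?case by (subst ennreal_mult[symmetric]) auto
      qed
    qed
    also have "\<dots> = ennreal (2 / real (Suc K)) * (\<integral>\<^sup>+w. ennreal (v q w powr (- (e / 2 + 1))) \<partial>\<mu>)"
      by (rule nn_integral_cmult) measurable
    also have "\<dots> \<le> ennreal (2 / real (Suc K)) * ennreal C'" by (intro mult_left_mono C') auto
    also have "\<dots> = ennreal (2 * C' / real (Suc K))" using C' by (subst ennreal_mult[symmetric]) auto
    finally show ?thesis using C'(2) by (simp add: dist_real_def)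
  qed
  have "continuous_on UNIV F0"
  proof (rule uniform_limit_theorem[where F=sequentially and f=F])
    show "uniform_limit UNIV F F0 sequentially"
    proof (rule uniform_limitI)
      fix \<epsilon> :: real assume "0 < \<epsilon>"
      have "(\<lambda>K. 2 * C' * inverse (real (Suc K))) \<longlonglongrightarrow> 2 * C' * 0"
        by (intro tendsto_intros LIMSEQ_inverse_real_of_nat)
      then have "\<forall>\<^sub>F K in sequentially. 2 * C' / real (Suc K) < \<epsilon>"
        using \<open>0 < \<epsilon>\<close> by (auto simp: divide_inverse dest!: order_tendstoD(2))
      then show "\<forall>\<^sub>F K in sequentially. \<forall>q\<in>UNIV. dist (F K q) (F0 q) < \<epsilon>"
        by eventually_elim (use err le_less_trans in blast)
    qed
  qed (use Fc in auto)
  then show ?thesis by (simp add: F0_def[abs_def] r_def v_def)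
qed

lemma grushin_density_eq:
  fixes q :: "((real ^ 'd) \<times> (real ^ 'e)) \<times> (real ^ 'd) \<times> (real ^ 'e)"
  shows "grushin_density \<gamma> T \<mu> (fst q) (snd q) = 1 / sqrt (2 * pi) ^ (CARD('d) + CARD('e)) * (1 / sqrt T ^ CARD('d)) *
     exp (- (norm (fst (snd q) - fst (fst q)))\<^sup>2 / (2 * T)) *
     (\<integral>w. gauss_factor CARD('e) ((norm (snd (snd q) - snd (fst q)))\<^sup>2) (grushin_v \<gamma> T (fst (fst q)) (fst (snd q)) w) \<partial>\<mu>)"
proof -
  obtain x y \<xi> \<eta> where q: "q = ((x, y), (\<xi>, \<eta>))" by (metis surj_pair)
  show ?thesis unfolding q by (simp add: gauss_factor_def)
qed

lemma grushin_density_continuous: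
  "continuous_on UNIV (\<lambda>(z, \<zeta>). grushin_density \<gamma> T \<mu> z (\<zeta> :: (real ^ 'd) \<times> (real ^ 'e)))"
proof -
  have "continuous_on UNIV (\<lambda>q :: ((real ^ 'd) \<times> (real ^ 'e)) \<times> (real ^ 'd) \<times> (real ^ 'e). grushin_density \<gamma> T \<mu> (fst q) (snd q))"
    unfolding grushin_density_eq using T
    by (intro continuous_intros gauss_factor_integral_continuous) auto
  then show ?thesis by (simp add: split_beta')
qed

end

section \<open>The law of the end point\<close>

text \<open>The end point of the diffusion in terms of the end point \<open>x + sqrt T \<cdot> g\<close> of the first component,
  the bridge \<open>w\<close> and a Gaussian vector \<open>u\<close>, all independent.\<close>

definition end_law ::
  "real \<Rightarrow> real \<Rightarrow> real ^ 'd \<Rightarrow> real ^ 'e \<Rightarrow> ((real ^ 'd) \<times> (real \<Rightarrow> real ^ 'd)) \<times> (real ^ 'e) \<Rightarrow> (real ^ 'd) \<times> (real ^ 'e)" where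
  "end_law \<gamma> T x y = (\<lambda>((g, w), u). (x + sqrt T *\<^sub>R g, y + sqrt (grushin_v \<gamma> T x (x + sqrt T *\<^sub>R g) w) *\<^sub>R u))"

context
  fixes \<gamma> T :: real and \<mu> :: "(real \<Rightarrow> real ^ 'd) measure"
  assumes \<gamma>: "\<gamma> > 0" and T: "T > 0" and pw: "pinned_wiener_measure T \<mu>"
begin

interpretation prob_space \<mu> by (rule pinned_prob_space[OF T pw])
interpretation G: prob_space "std_gauss :: (real ^ 'd) measure" by (rule prob_space_std_gauss)
interpretation G\<mu>: pair_prob_space "std_gauss :: (real ^ 'd) measure" \<mu> ..

abbreviation (input) "base \<equiv> (std_gauss :: (real ^ 'd) measure) \<Otimes>\<^sub>M \<mu>"

lemma grushin_v_base_measurable: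
  "(\<lambda>p. grushin_v \<gamma> T x (x + sqrt T *\<^sub>R fst p) (snd p)) \<in> borel_measurable base"
proof -
  have "(\<lambda>p. (x + sqrt T *\<^sub>R fst p, snd p)) \<in> measurable base (borel \<Otimes>\<^sub>M \<mu>)" by measurable
  from measurable_compose[OF this grushin_v_joint[OF \<gamma> T pw, of x]] show ?thesis by (simp add: split_beta')
qed

lemma end_law_measurable:
  "end_law \<gamma> T x y \<in> borel_measurable (base \<Otimes>\<^sub>M (std_gauss :: (real ^ 'e) measure))"
proof -
  have v: "(\<lambda>p. grushin_v \<gamma> T x (x + sqrt T *\<^sub>R fst (fst p)) (snd (fst p))) \<in> borel_measurable (base \<Otimes>\<^sub>M (std_gauss :: (real ^ 'e) measure))"
    using measurable_compose[OF measurable_fst grushin_v_base_measurable] .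
  have g: "(\<lambda>p. fst (fst p)) \<in> borel_measurable (base \<Otimes>\<^sub>M (std_gauss :: (real ^ 'e) measure))" by measurable
  have u: "(\<lambda>p. snd p) \<in> borel_measurable (base \<Otimes>\<^sub>M (std_gauss :: (real ^ 'e) measure))" by measurable
  have "(\<lambda>p. (x + sqrt T *\<^sub>R fst (fst p), y + sqrt (grushin_v \<gamma> T x (x + sqrt T *\<^sub>R fst (fst p)) (snd (fst p))) *\<^sub>R snd p))
    \<in> borel_measurable (base \<Otimes>\<^sub>M (std_gauss :: (real ^ 'e) measure))"
    by (intro borel_measurable_Pair borel_measurable_add borel_measurable_scaleR borel_measurable_const g u
        measurable_compose[OF v borel_measurable_sqrt])
  then show ?thesis by (simp add: end_law_def split_beta')
qed

lemma gauss_factor_normal: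
  fixes \<eta> y :: "real ^ 'e"
  assumes v: "v > 0"
  shows "1 / sqrt (2 * pi) ^ CARD('e) * (1 / sqrt v ^ CARD('e)) * exp (- (norm (\<eta> - y))\<^sup>2 / (2 * (sqrt v)\<^sup>2))
    = 1 / sqrt (2 * pi) ^ CARD('e) * gauss_factor CARD('e) ((norm (\<eta> - y))\<^sup>2) v"
proof -
  have "sqrt v ^ CARD('e) = v powr (CARD('e) / 2)"
    using v by (simp add: powr_half_sqrt[symmetric] powr_realpow[symmetric] powr_powr)
  then have "1 / sqrt v ^ CARD('e) = v powr (- CARD('e) / 2)"
    by (simp add: powr_minus_divide)
  then show ?thesis using v by (simp add: gauss_factor_def)
qed

text \<open>With the end point \<xi> and the bridge fixed, \<open>u\<close> produces a Gaussian
  density of variance \<open>v\<close>. Averaging it over the bridge and then inserting the Gaussian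
  law of \<xi> yields the formula.\<close>

theorem end_law_density:
  "distr (base \<Otimes>\<^sub>M (std_gauss :: (real ^ 'e) measure)) borel (end_law \<gamma> T x y)
    = density lborel (\<lambda>\<zeta>. ennreal (grushin_density \<gamma> T \<mu> (x, y) \<zeta>))"
proof (rule measure_eqI)
  show "sets (distr (base \<Otimes>\<^sub>M (std_gauss :: (real ^ 'e) measure)) borel (end_law \<gamma> T x y)) = sets (density lborel (\<lambda>\<zeta>. ennreal (grushin_density \<gamma> T \<mu> (x, y) \<zeta>)))"
    by simp
  interpret E: prob_space "std_gauss :: (real ^ 'e) measure" by (rule prob_space_std_gauss)
  interpret L\<mu>: pair_sigma_finite \<mu> "lborel :: (real ^ 'e) measure" ..
  fix A assume "A \<in> sets (distr (base \<Otimes>\<^sub>M (std_gauss :: (real ^ 'e) measure)) borel (end_law \<gamma> T x y))"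
  then have A: "A \<in> sets borel" by simp
  define f where "f = (indicator A :: (real ^ 'd) \<times> (real ^ 'e) \<Rightarrow> ennreal)"
  have fm[measurable]: "f \<in> borel_measurable borel" using A by (simp add: f_def)
  define kD where "kD \<xi> = 1 / sqrt (2 * pi) ^ CARD('d) * (1 / sqrt T ^ CARD('d)) * exp (- (norm (\<xi> - x))\<^sup>2 / (2 * (sqrt T)\<^sup>2))" for \<xi>
  define kE where "kE v \<eta> = 1 / sqrt (2 * pi) ^ CARD('e) * gauss_factor CARD('e) ((norm (\<eta> - y))\<^sup>2) v" for v and \<eta> :: "real ^ 'e"
  have kE0: "0 \<le> kE v \<eta>" for v \<eta> by (simp add: kE_def gauss_factor_def)
  have kD0: "0 \<le> kD \<xi>" for \<xi> using T by (simp add: kD_def)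
  have inner: "(\<integral>\<^sup>+u. f (\<xi>, y + sqrt v *\<^sub>R u) \<partial>std_gauss) = (\<integral>\<^sup>+\<eta>. f (\<xi>, \<eta>) * ennreal (kE v \<eta>) \<partial>lborel)" if "v > 0" for v \<xi>
    using nn_integral_std_gauss_affine[of "sqrt v" "\<lambda>\<eta>. f (\<xi>, \<eta>)" y] that
    unfolding gauss_factor_normal[OF that] kE_def by simp
  have vj: "(\<lambda>p. grushin_v \<gamma> T x (fst p) (snd p)) \<in> borel_measurable (borel \<Otimes>\<^sub>M \<mu>)"
    using grushin_v_joint[OF \<gamma> T pw, of x] by (simp add: split_beta')
  define F where "F \<xi> = (\<integral>\<^sup>+w. \<integral>\<^sup>+u. f (\<xi>, y + sqrt (grushin_v \<gamma> T x \<xi> w) *\<^sub>R u) \<partial>std_gauss \<partial>\<mu>)" for \<xi>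
  have Fm: "F \<in> borel_measurable borel"
  proof -
    have "(\<lambda>p. (fst (fst p), y + sqrt (grushin_v \<gamma> T x (fst (fst p)) (snd (fst p))) *\<^sub>R snd p))
      \<in> borel_measurable ((borel \<Otimes>\<^sub>M \<mu>) \<Otimes>\<^sub>M (std_gauss :: (real ^ 'e) measure))"
      by (intro borel_measurable_Pair borel_measurable_add borel_measurable_scaleR borel_measurable_const
        measurable_compose[OF measurable_compose[OF measurable_fst vj] borel_measurable_sqrt]) measurable
    from measurable_compose[OF this fm]
    have 1: "(\<lambda>(p, u). f (fst p, y + sqrt (grushin_v \<gamma> T x (fst p) (snd p)) *\<^sub>R u)) \<in> borel_measurable ((borel \<Otimes>\<^sub>M \<mu>) \<Otimes>\<^sub>M (std_gauss :: (real ^ 'e) measure))"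
      by (simp add: split_beta')
    have "(\<lambda>p. \<integral>\<^sup>+u. f (fst p, y + sqrt (grushin_v \<gamma> T x (fst p) (snd p)) *\<^sub>R u) \<partial>(std_gauss :: (real ^ 'e) measure)) \<in> borel_measurable (borel \<Otimes>\<^sub>M \<mu>)"
      by (rule E.borel_measurable_nn_integral[OF 1])
    then have 2: "(\<lambda>(\<xi>, w). \<integral>\<^sup>+u. f (\<xi>, y + sqrt (grushin_v \<gamma> T x \<xi> w) *\<^sub>R u) \<partial>(std_gauss :: (real ^ 'e) measure)) \<in> borel_measurable (borel \<Otimes>\<^sub>M \<mu>)"
      by (simp add: split_beta')
    show ?thesis unfolding F_def[abs_def] by (rule borel_measurable_nn_integral[OF 2])
  qed
  have F: "F \<xi> * ennreal (kD \<xi>) = (\<integral>\<^sup>+\<eta>. f (\<xi>, \<eta>) * ennreal (grushin_density \<gamma> T \<mu> (x, y) (\<xi>, \<eta>)) \<partial>lborel)" for \<xi>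
  proof -
    have vm[measurable]: "grushin_v \<gamma> T x \<xi> \<in> borel_measurable \<mu>" by (rule grushin_v_measurable[OF T pw \<gamma>])
    \<comment> \<open>The inner Gaussian has a density only for \<open>v > 0\<close>, which holds
      almost surely.\<close>
    have "F \<xi> = (\<integral>\<^sup>+w. \<integral>\<^sup>+\<eta>. f (\<xi>, \<eta>) * ennreal (kE (grushin_v \<gamma> T x \<xi> w) \<eta>) \<partial>lborel \<partial>\<mu>)"
      unfolding F_def
    proof (rule nn_integral_cong_AE)
      show "AE w in \<mu>. (\<integral>\<^sup>+u. f (\<xi>, y + sqrt (grushin_v \<gamma> T x \<xi> w) *\<^sub>R u) \<partial>std_gauss)
         = (\<integral>\<^sup>+\<eta>. f (\<xi>, \<eta>) * ennreal (kE (grushin_v \<gamma> T x \<xi> w) \<eta>) \<partial>lborel)"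
        using grushin_v_pos[OF T pw \<gamma>, of x \<xi>] by eventually_elim (rule inner)
    qed
    also have "\<dots> = (\<integral>\<^sup>+\<eta>. \<integral>\<^sup>+w. f (\<xi>, \<eta>) * ennreal (kE (grushin_v \<gamma> T x \<xi> w) \<eta>) \<partial>\<mu> \<partial>lborel)"
    proof (rule L\<mu>.Fubini'[symmetric])
      have "(\<lambda>p. f (\<xi>, snd p) * ennreal (kE (grushin_v \<gamma> T x \<xi> (fst p)) (snd p))) \<in> borel_measurable (\<mu> \<Otimes>\<^sub>M (lborel :: (real ^ 'e) measure))"
        unfolding kE_def gauss_factor_def by measurable
      then show "(\<lambda>(w, \<eta>). f (\<xi>, \<eta>) * ennreal (kE (grushin_v \<gamma> T x \<xi> w) \<eta>)) \<in> borel_measurable (\<mu> \<Otimes>\<^sub>M (lborel :: (real ^ 'e) measure))"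
        by (simp add: split_beta')
    qed
    also have "\<dots> = (\<integral>\<^sup>+\<eta>. f (\<xi>, \<eta>) * ennreal (\<integral>w. kE (grushin_v \<gamma> T x \<xi> w) \<eta> \<partial>\<mu>) \<partial>lborel)"
    proof (rule nn_integral_cong)
      fix \<eta>
      have i: "integrable \<mu> (\<lambda>w. kE (grushin_v \<gamma> T x \<xi> w) \<eta>)"
        unfolding kE_def by (intro integrable_mult_right gauss_factor_integrable[OF \<gamma> T pw]) auto
      have "(\<lambda>w. ennreal (kE (grushin_v \<gamma> T x \<xi> w) \<eta>)) \<in> borel_measurable \<mu>"
        using i by measurable
      then have "(\<integral>\<^sup>+w. f (\<xi>, \<eta>) * ennreal (kE (grushin_v \<gamma> T x \<xi> w) \<eta>) \<partial>\<mu>) = f (\<xi>, \<eta>) * (\<integral>\<^sup>+w. ennreal (kE (grushin_v \<gamma> T x \<xi> w) \<eta>) \<partial>\<mu>)"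
        by (rule nn_integral_cmult)
      also have "(\<integral>\<^sup>+w. ennreal (kE (grushin_v \<gamma> T x \<xi> w) \<eta>) \<partial>\<mu>) = ennreal (\<integral>w. kE (grushin_v \<gamma> T x \<xi> w) \<eta> \<partial>\<mu>)"
        by (intro nn_integral_eq_integral i) (use kE0 in auto)
      finally show "(\<integral>\<^sup>+w. f (\<xi>, \<eta>) * ennreal (kE (grushin_v \<gamma> T x \<xi> w) \<eta>) \<partial>\<mu>) = f (\<xi>, \<eta>) * ennreal (\<integral>w. kE (grushin_v \<gamma> T x \<xi> w) \<eta> \<partial>\<mu>)" .
    qed
    finally have Fx: "F \<xi> = (\<integral>\<^sup>+\<eta>. f (\<xi>, \<eta>) * ennreal (\<integral>w. kE (grushin_v \<gamma> T x \<xi> w) \<eta> \<partial>\<mu>) \<partial>lborel)" .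
    have p: "grushin_density \<gamma> T \<mu> (x, y) (\<xi>, \<eta>) = (\<integral>w. kE (grushin_v \<gamma> T x \<xi> w) \<eta> \<partial>\<mu>) * kD \<xi>" for \<eta>
    proof -
      have "(\<integral>w. kE (grushin_v \<gamma> T x \<xi> w) \<eta> \<partial>\<mu>) = 1 / sqrt (2 * pi) ^ CARD('e) * (\<integral>w. gauss_factor CARD('e) ((norm (\<eta> - y))\<^sup>2) (grushin_v \<gamma> T x \<xi> w) \<partial>\<mu>)"
        unfolding kE_def by (rule integral_mult_right_zero)
      moreover have "1 / sqrt (2 * pi) ^ (CARD('d) + CARD('e)) = (1 / sqrt (2 * pi) ^ CARD('d)) * (1 / sqrt (2 * pi) ^ CARD('e))"
        by (simp add: power_add)
      moreover have "(sqrt T)\<^sup>2 = T" using T by simp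
      ultimately show ?thesis
        using grushin_density_eq[OF \<gamma> T pw, of "((x, y), (\<xi>, \<eta>))"] by (simp only: fst_conv snd_conv kD_def mult_ac)
    qed
    have dm: "(\<lambda>\<eta>. ennreal (\<integral>w. kE (grushin_v \<gamma> T x \<xi> w) \<eta> \<partial>\<mu>)) \<in> borel_measurable (borel :: (real ^ 'e) measure)"
    proof -
      have "(\<lambda>p. kE (grushin_v \<gamma> T x \<xi> (snd p)) (fst p)) \<in> borel_measurable ((borel :: (real ^ 'e) measure) \<Otimes>\<^sub>M \<mu>)"
        unfolding kE_def gauss_factor_def by measurable
      then have "(\<lambda>(\<eta>, w). kE (grushin_v \<gamma> T x \<xi> w) \<eta>) \<in> borel_measurable ((borel :: (real ^ 'e) measure) \<Otimes>\<^sub>M \<mu>)"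
        by (simp add: split_beta')
      from measurable_compose[OF borel_measurable_lebesgue_integral[OF this] measurable_ennreal] show ?thesis .
    qed
    have "F \<xi> * ennreal (kD \<xi>) = (\<integral>\<^sup>+\<eta>. f (\<xi>, \<eta>) * ennreal (\<integral>w. kE (grushin_v \<gamma> T x \<xi> w) \<eta> \<partial>\<mu>) * ennreal (kD \<xi>) \<partial>lborel)"
      unfolding Fx
    proof (rule nn_integral_multc[symmetric])
      have "(\<lambda>\<eta>. f (\<xi>, \<eta>)) \<in> borel_measurable (borel :: (real ^ 'e) measure)"
        by (rule measurable_compose[OF _ fm]) measurable
      then show "(\<lambda>\<eta>. f (\<xi>, \<eta>) * ennreal (\<integral>w. kE (grushin_v \<gamma> T x \<xi> w) \<eta> \<partial>\<mu>)) \<in> borel_measurable lborel"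
        using dm by (simp add: borel_measurable_times_ennreal)
    qed
    also have "\<dots> = (\<integral>\<^sup>+\<eta>. f (\<xi>, \<eta>) * ennreal (grushin_density \<gamma> T \<mu> (x, y) (\<xi>, \<eta>)) \<partial>lborel)"
    proof (rule nn_integral_cong)
      fix \<eta>
      have "0 \<le> (\<integral>w. kE (grushin_v \<gamma> T x \<xi> w) \<eta> \<partial>\<mu>)" using kE0 by (intro Bochner_Integration.integral_nonneg) auto
      then show "f (\<xi>, \<eta>) * ennreal (\<integral>w. kE (grushin_v \<gamma> T x \<xi> w) \<eta> \<partial>\<mu>) * ennreal (kD \<xi>) = f (\<xi>, \<eta>) * ennreal (grushin_density \<gamma> T \<mu> (x, y) (\<xi>, \<eta>))"
        unfolding p using kD0 by (simp add: ennreal_mult mult.assoc)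
    qed
    finally show ?thesis .
  qed
  have pc: "continuous_on UNIV (\<lambda>\<zeta> :: (real ^ 'd) \<times> (real ^ 'e). grushin_density \<gamma> T \<mu> (x, y) \<zeta>)"
    using continuous_on_compose2[OF grushin_density_continuous[OF \<gamma> T pw], of UNIV "\<lambda>\<zeta>. ((x, y), \<zeta>)"]
    by (simp add: continuous_on_Pair continuous_on_const continuous_on_id)
  have pm[measurable]: "(\<lambda>\<zeta> :: (real ^ 'd) \<times> (real ^ 'e). grushin_density \<gamma> T \<mu> (x, y) \<zeta>) \<in> borel_measurable borel"
    using pc by (rule borel_measurable_continuous_onI)
  have fe: "(\<lambda>p. f (end_law \<gamma> T x y p)) \<in> borel_measurable (base \<Otimes>\<^sub>M (std_gauss :: (real ^ 'e) measure))"
    by (rule measurable_compose[OF end_law_measurable fm])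
  have "emeasure (distr (base \<Otimes>\<^sub>M (std_gauss :: (real ^ 'e) measure)) borel (end_law \<gamma> T x y)) A = (\<integral>\<^sup>+p. f (end_law \<gamma> T x y p) \<partial>(base \<Otimes>\<^sub>M std_gauss))"
    using A unfolding f_def
    by (subst nn_integral_distr[OF end_law_measurable, symmetric]) auto
  also have "\<dots> = (\<integral>\<^sup>+p. \<integral>\<^sup>+u. f (end_law \<gamma> T x y (p, u)) \<partial>std_gauss \<partial>base)"
    by (rule E.nn_integral_fst[OF fe, symmetric])
  also have "\<dots> = (\<integral>\<^sup>+g. \<integral>\<^sup>+w. \<integral>\<^sup>+u. f (end_law \<gamma> T x y ((g, w), u)) \<partial>std_gauss \<partial>\<mu> \<partial>std_gauss)"
    by (rule nn_integral_fst[OF E.borel_measurable_nn_integral_fst[OF fe], symmetric])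
  also have "\<dots> = (\<integral>\<^sup>+g. F (x + sqrt T *\<^sub>R g) \<partial>std_gauss)"
    by (simp add: end_law_def F_def)
  also have "\<dots> = (\<integral>\<^sup>+\<xi>. F \<xi> * ennreal (kD \<xi>) \<partial>lborel)"
    unfolding kD_def using T by (intro nn_integral_std_gauss_affine Fm) simp
  also have "\<dots> = (\<integral>\<^sup>+\<xi>. \<integral>\<^sup>+\<eta>. f (\<xi>, \<eta>) * ennreal (grushin_density \<gamma> T \<mu> (x, y) (\<xi>, \<eta>)) \<partial>lborel \<partial>lborel)"
    by (simp only: F)
  also have "\<dots> = (\<integral>\<^sup>+\<zeta>. f \<zeta> * ennreal (grushin_density \<gamma> T \<mu> (x, y) \<zeta>) \<partial>(lborel \<Otimes>\<^sub>M lborel))"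
    by (rule lborel.nn_integral_fst) (simp add: lborel_prod)
  also have "\<dots> = emeasure (density lborel (\<lambda>\<zeta>. ennreal (grushin_density \<gamma> T \<mu> (x, y) \<zeta>))) A"
    unfolding lborel_prod f_def using A by (subst emeasure_density) (auto simp: mult.commute)
  finally show "emeasure (distr (base \<Otimes>\<^sub>M (std_gauss :: (real ^ 'e) measure)) borel (end_law \<gamma> T x y)) A
    = emeasure (density lborel (\<lambda>\<zeta>. ennreal (grushin_density \<gamma> T \<mu> (x, y) \<zeta>))) A" .
qed

end

section \<open>Comparison of the grid approximations with the diffusion\<close>

context
  fixes \<gamma> T :: real and \<mu> :: "(real \<Rightarrow> real ^ 'd) measure"
    and M :: "'w measure" and b :: "real \<Rightarrow> 'w \<Rightarrow> real ^ 'd" and bh :: "real \<Rightarrow> 'w \<Rightarrow> real ^ 'e"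
  assumes \<gamma>: "\<gamma> > 0" and T: "T > 0" and pw: "pinned_wiener_measure T \<mu>"
    and b: "brownian_motion M b" and bh: "brownian_motion M bh" and ind: "indep_processes M b bh"
begin

interpretation M: prob_space M by (rule bm_prob_space[OF b])
interpretation prob_space \<mu> by (rule pinned_prob_space[OF T pw])
interpretation G: prob_space "std_gauss :: (real ^ 'd) measure" by (rule prob_space_std_gauss)
interpretation E: prob_space "std_gauss :: (real ^ 'e) measure" by (rule prob_space_std_gauss)
interpretation G\<mu>: pair_prob_space "std_gauss :: (real ^ 'd) measure" \<mu> ..

abbreviation (input) "full_space \<equiv> base \<mu> \<Otimes>\<^sub>M (std_gauss :: (real ^ 'e) measure)"

interpretation BE: pair_prob_space "base \<mu>" "std_gauss :: (real ^ 'e) measure" ..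

lemma prob_space_full: "prob_space full_space"
  by (intro prob_space_pair prob_space_std_gauss pinned_prob_space[OF T pw])

text \<open>A Brownian path on \<open>[0, T]\<close> rebuilt from a standard Gaussian vector and a
  bridge; for a pinned path its value at \<open>T\<close> is \<open>sqrt T\<close> times the
  Gaussian vector.\<close>

definition free_path :: "(real ^ 'd) \<times> (real \<Rightarrow> real ^ 'd) \<Rightarrow> real \<Rightarrow> real ^ 'd" where
  "free_path p t = snd p t + (t / T) *\<^sub>R sqrt T *\<^sub>R fst p"

text \<open>On the path of \<open>b\<close> this is the conditional variance, given
  \<open>b\<close>, of each component of \<open>grid_ito_sum\<close>.\<close>

definition grid_variance :: "real ^ 'd \<Rightarrow> nat \<Rightarrow> nat \<Rightarrow> (real \<Rightarrow> real ^ 'd) \<Rightarrow> real" where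
  "grid_variance x K m B = (\<Sum>k<m. (min (norm (x + B (T * real k / real m)) powr \<gamma>) (real K))\<^sup>2 *
      (T * real (Suc k) / real m - T * real k / real m))"

definition grid_ito_sum :: "real ^ 'd \<Rightarrow> nat \<Rightarrow> nat \<Rightarrow> 'w \<Rightarrow> real ^ 'e" where
  "grid_ito_sum x K m \<omega> = (\<Sum>k<m. min (norm (x + b (T * real k / real m) \<omega>) powr \<gamma>) (real K) *\<^sub>R
      (bh (T * real (Suc k) / real m) \<omega> - bh (T * real k / real m) \<omega>))"

lemma free_path_measurable: "t \<in> {0..T} \<Longrightarrow> (\<lambda>p. free_path p t) \<in> borel_measurable (base \<mu>)"
proof -
  assume t: "t \<in> {0..T}"
  have 1: "(\<lambda>p. snd p t) \<in> borel_measurable (base \<mu>)"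
    by (rule measurable_compose[OF measurable_snd pinned_coord_measurable[OF T pw t]])
  have 2: "(\<lambda>p. (t / T) *\<^sub>R sqrt T *\<^sub>R fst p) \<in> borel_measurable (base \<mu>)" by measurable
  show ?thesis unfolding free_path_def by (intro borel_measurable_add 1 2)
qed

lemma grid_variance_nonneg: "m > 0 \<Longrightarrow> 0 \<le> grid_variance x K m B"
  unfolding grid_variance_def using T
  by (intro sum_nonneg mult_nonneg_nonneg) (auto intro!: divide_right_mono mult_left_mono)

lemma grid_variance_measurable:
  assumes "m > 0" "\<And>t. t \<in> {0..T} \<Longrightarrow> (\<lambda>q. B q t) \<in> borel_measurable N"
  shows "(\<lambda>q. grid_variance x K m (B q)) \<in> borel_measurable N"
  unfolding grid_variance_def
proof (intro borel_measurable_sum borel_measurable_times borel_measurable_const borel_measurable_power borel_measurable_min)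
  fix k assume k: "k \<in> {..<m}"
  have "T * real k / real m \<in> {0..T}" using k T assms(1) by (auto simp: field_simps)
  from assms(2)[OF this]
  show "(\<lambda>q. norm (x + B q (T * real k / real m)) powr \<gamma>) \<in> borel_measurable N"
    by (rule measurable_compose[where g="\<lambda>z. norm (x + z) powr \<gamma>"]) measurable
qed

text \<open>The integrand sees the path only through its \<open>m + 1\<close> grid values, whose
  laws are identified by \<open>grid_law\<close>.\<close>

lemma grid_functional:
  assumes m: "(m::nat) > 0"
  shows "(\<integral>\<omega>. iexp (p \<bullet> b T \<omega>) * of_real (exp (- (r * grid_variance x K m (\<lambda>t. b t \<omega>)) / 2)) \<partial>M)
    = (\<integral>q. iexp (p \<bullet> free_path q T) * of_real (exp (- (r * grid_variance x K m (free_path q)) / 2)) \<partial>base \<mu>)"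
proof -
  let ?I = "{..m} \<times> (UNIV :: 'd set)"
  let ?Q = "Pi\<^sub>M ?I (\<lambda>_. borel :: real measure)"
  define vec where "vec f k = (\<chi> i. (f (k, i) :: real))" for f :: "nat \<times> 'd \<Rightarrow> real" and k
  have vecm: "(\<lambda>f. vec f k) \<in> borel_measurable ?Q" if "k \<le> m" for k
  proof -
    have "(\<lambda>f. \<Sum>i\<in>UNIV. f (k, i) *\<^sub>R axis i (1::real)) \<in> borel_measurable ?Q"
      using that by (intro borel_measurable_sum borel_measurable_scaleR borel_measurable_const measurable_component_singleton) auto
    moreover have "vec f k = (\<Sum>i\<in>UNIV. f (k, i) *\<^sub>R axis i (1::real))" for f
      by (simp add: vec_def vec_eq_iff axis_def if_distrib cong: if_cong)
    ultimately show ?thesis by simp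
  qed
  define W where "W f = (\<Sum>k<m. (min (norm (x + vec f k) powr \<gamma>) (real K))\<^sup>2 * (T * real (Suc k) / real m - T * real k / real m))" for f
  have Wm: "W \<in> borel_measurable ?Q"
    unfolding W_def[abs_def]
  proof (intro borel_measurable_sum borel_measurable_times borel_measurable_const borel_measurable_power borel_measurable_min)
    fix k assume "k \<in> {..<m}"
    then have "(\<lambda>f. vec f k) \<in> borel_measurable ?Q" by (intro vecm) auto
    then show "(\<lambda>f. norm (x + vec f k) powr \<gamma>) \<in> borel_measurable ?Q"
      by (rule measurable_compose[where g="\<lambda>z. norm (x + z) powr \<gamma>"]) measurable
  qed
  define \<Psi> where "\<Psi> f = iexp (p \<bullet> vec f m) * of_real (exp (- (r * W f) / 2))" for f
  have \<Psi>m: "\<Psi> \<in> borel_measurable ?Q"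
    unfolding \<Psi>_def[abs_def]
  proof (intro borel_measurable_times)
    have "(\<lambda>f. p \<bullet> vec f m) \<in> borel_measurable ?Q" using vecm[of m] by (intro borel_measurable_inner) auto
    then show "(\<lambda>f. iexp (p \<bullet> vec f m)) \<in> borel_measurable ?Q"
      by (rule measurable_compose[where g="\<lambda>z. iexp z"]) measurable
    show "(\<lambda>f. complex_of_real (exp (- (r * W f) / 2))) \<in> borel_measurable ?Q"
      by (rule measurable_compose[OF Wm, where g="\<lambda>z. complex_of_real (exp (- (r * z) / 2))"]) measurable
  qed
  define X where "X \<omega> = (\<lambda>p\<in>?I. b (T * fst p / m) \<omega> $ snd p)" for \<omega>
  define Y where "Y q = (\<lambda>p\<in>?I. (snd q (T * fst p / m) + (fst p / m) *\<^sub>R sqrt T *\<^sub>R fst q) $ snd p)" for q :: "(real ^ 'd) \<times> (real \<Rightarrow> real ^ 'd)"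
  have t: "T * real k / real m \<in> {0..T}" if "k \<le> m" for k using that T m by (auto simp: field_simps)
  have bridk: "free_path q (T * real k / real m) = snd q (T * real k / real m) + (real k / real m) *\<^sub>R sqrt T *\<^sub>R fst q" for q k
    using T by (simp add: free_path_def)
  have Xm: "X \<in> measurable M ?Q"
    unfolding X_def[abs_def]
  proof (rule measurable_restrict)
    fix p assume "p \<in> ?I"
    then show "(\<lambda>\<omega>. b (T * fst p / m) \<omega> $ snd p) \<in> borel_measurable M"
      using t by (intro component_measurable bm_measurable[OF b]) auto
  qed
  have Ym: "Y \<in> measurable (base \<mu>) ?Q"
    unfolding Y_def[abs_def]
  proof (rule measurable_restrict)
    fix p assume "p \<in> ?I"
    then have "(\<lambda>q. free_path q (T * fst p / m)) \<in> borel_measurable (base \<mu>)" using t by (intro free_path_measurable) auto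
    then show "(\<lambda>q. (snd q (T * fst p / m) + (fst p / m) *\<^sub>R sqrt T *\<^sub>R fst q) $ snd p) \<in> borel_measurable (base \<mu>)"
      unfolding bridk by (rule component_measurable)
  qed
  have vX: "vec (X \<omega>) k = b (T * real k / real m) \<omega>" if "k \<le> m" for k \<omega>
    using that by (simp add: vec_def X_def vec_eq_iff)
  have vY: "vec (Y q) k = free_path q (T * real k / real m)" if "k \<le> m" for k q
    unfolding bridk using that by (simp add: vec_def Y_def vec_eq_iff)
  have \<Psi>X: "\<Psi> (X \<omega>) = iexp (p \<bullet> b T \<omega>) * of_real (exp (- (r * grid_variance x K m (\<lambda>t. b t \<omega>)) / 2))" for \<omega>
    using m by (simp add: \<Psi>_def W_def grid_variance_def vX)
  have \<Psi>Y: "\<Psi> (Y q) = iexp (p \<bullet> free_path q T) * of_real (exp (- (r * grid_variance x K m (free_path q)) / 2))" for q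
    using m by (simp add: \<Psi>_def W_def grid_variance_def vY)
  have "(\<integral>\<omega>. \<Psi> (X \<omega>) \<partial>M) = (\<integral>f. \<Psi> f \<partial>distr M ?Q X)" by (rule integral_distr[OF Xm \<Psi>m, symmetric])
  also have "distr M ?Q X = distr (base \<mu>) ?Q Y"
    unfolding X_def[abs_def] Y_def[abs_def] by (rule grid_law[OF T pw m b])
  also have "(\<integral>f. \<Psi> f \<partial>distr (base \<mu>) ?Q Y) = (\<integral>q. \<Psi> (Y q) \<partial>base \<mu>)" by (rule integral_distr[OF Ym \<Psi>m])
  finally show ?thesis unfolding \<Psi>X \<Psi>Y .
qed

text \<open>Conditioning on \<open>b\<close> gives the characteristic function of a Gaussian vector
  with random variance. This functional of \<open>b\<close> is transferred to the bridge side and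
  there read backwards as an integral over an independent Gaussian vector.\<close>

lemma approximate_law:
  assumes m: "(m::nat) > 0"
  shows "distr M borel (\<lambda>\<omega>. (b T \<omega>, grid_ito_sum x K m \<omega>))
    = distr full_space borel (\<lambda>q. (free_path (fst q) T, sqrt (grid_variance x K m (free_path (fst q))) *\<^sub>R snd q))"
proof (rule char_determines_law[OF bm_prob_space[OF b] prob_space_full])
  have t: "T * real k / real m \<in> {0..T}" if "k \<le> m" for k using that T m by (auto simp: field_simps)
  have t0: "0 \<le> T * real k / real m" for k using T by simp
  have hm: "(\<lambda>\<omega>. min (norm (x + b (T * real k / real m) \<omega>) powr \<gamma>) (real K)) \<in> borel_measurable N"
    if "b (T * real k / real m) \<in> borel_measurable N" for N k
    by (rule measurable_compose[OF that, where g="\<lambda>z. min (norm (x + z) powr \<gamma>) (real K)"]) measurable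
  show "(\<lambda>\<omega>. (b T \<omega>, grid_ito_sum x K m \<omega>)) \<in> borel_measurable M"
    unfolding grid_ito_sum_def using T t0
    by (intro borel_measurable_Pair borel_measurable_sum borel_measurable_scaleR hm borel_measurable_diff bm_measurable[OF b] bm_measurable[OF bh]) auto
  have Vm: "(\<lambda>q. grid_variance x K m (free_path q)) \<in> borel_measurable (base \<mu>)" by (rule grid_variance_measurable[OF m free_path_measurable])
  have sVm: "(\<lambda>q. sqrt (grid_variance x K m (free_path q))) \<in> borel_measurable (base \<mu>)" by (rule measurable_compose[OF Vm borel_measurable_sqrt])
  have bT: "(\<lambda>q. free_path q T) \<in> borel_measurable (base \<mu>)" using T by (intro free_path_measurable) auto
  show rm: "(\<lambda>q. (free_path (fst q) T, sqrt (grid_variance x K m (free_path (fst q))) *\<^sub>R snd q)) \<in> borel_measurable full_space"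
    by (intro borel_measurable_Pair borel_measurable_scaleR measurable_compose[OF measurable_fst bT] measurable_compose[OF measurable_fst sVm]) measurable
  fix u :: "(real ^ 'd) \<times> (real ^ 'e)"
  let ?p = "fst u" and ?q = "snd u"
  let ?A = "generated_algebra M b {0..}"
  have inc: "incseq (\<lambda>k. T * real k / real m)" using T by (auto simp: incseq_def intro!: divide_right_mono mult_left_mono)
  have bA: "b s \<in> borel_measurable ?A" if "0 \<le> s" for s using that by (intro measurable_generated_algebra) auto
  have "(\<integral>\<omega>. iexp (u \<bullet> (b T \<omega>, grid_ito_sum x K m \<omega>)) \<partial>M) = (\<integral>\<omega>. iexp (?p \<bullet> b T \<omega> + ?q \<bullet> grid_ito_sum x K m \<omega>) \<partial>M)"
    by (simp add: inner_prod_def)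
  also have "\<dots> = (\<integral>\<omega>. iexp (?p \<bullet> b T \<omega>) * of_real (exp (- ((norm ?q)\<^sup>2 * grid_variance x K m (\<lambda>t. b t \<omega>)) / 2)) \<partial>M)"
    unfolding grid_ito_sum_def grid_variance_def
    using T t0 inc by (intro simple_integral_char[OF b bh ind] hm bA borel_measurable_inner borel_measurable_const) auto
  also have "\<dots> = (\<integral>q. iexp (?p \<bullet> free_path q T) * of_real (exp (- ((norm ?q)\<^sup>2 * grid_variance x K m (free_path q)) / 2)) \<partial>base \<mu>)"
    by (rule grid_functional[OF m])
  also have "\<dots> = (\<integral>q. \<integral>z. iexp (u \<bullet> (free_path q T, sqrt (grid_variance x K m (free_path q)) *\<^sub>R z)) \<partial>std_gauss \<partial>base \<mu>)"
  proof (rule Bochner_Integration.integral_cong[OF refl])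
    fix q
    have "(\<integral>z. iexp (u \<bullet> (free_path q T, sqrt (grid_variance x K m (free_path q)) *\<^sub>R z)) \<partial>std_gauss)
      = (\<integral>z. iexp (?p \<bullet> free_path q T) * iexp ((sqrt (grid_variance x K m (free_path q)) *\<^sub>R ?q) \<bullet> z) \<partial>std_gauss)"
      by (intro Bochner_Integration.integral_cong refl)
        (simp only: inner_prod_def fst_conv snd_conv inner_scaleR_left inner_scaleR_right of_real_add distrib_left exp_add)
    also have "\<dots> = iexp (?p \<bullet> free_path q T) * (\<integral>z. iexp ((sqrt (grid_variance x K m (free_path q)) *\<^sub>R ?q) \<bullet> z) \<partial>std_gauss)"
      by (rule integral_mult_right_zero)
    also have "(\<integral>z. iexp ((sqrt (grid_variance x K m (free_path q)) *\<^sub>R ?q) \<bullet> z) \<partial>std_gauss) = of_real (exp (- ((norm ?q)\<^sup>2 * grid_variance x K m (free_path q)) / 2))"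
      unfolding std_gauss_char using grid_variance_nonneg[OF m] by (simp add: power_mult_distrib mult.commute)
    finally show "iexp (?p \<bullet> free_path q T) * of_real (exp (- ((norm ?q)\<^sup>2 * grid_variance x K m (free_path q)) / 2))
      = (\<integral>z. iexp (u \<bullet> (free_path q T, sqrt (grid_variance x K m (free_path q)) *\<^sub>R z)) \<partial>std_gauss)" ..
  qed
  also have "\<dots> = (\<integral>q. iexp (u \<bullet> (free_path (fst q) T, sqrt (grid_variance x K m (free_path (fst q))) *\<^sub>R snd q)) \<partial>full_space)"
  proof -
    have "integrable full_space (\<lambda>q. iexp (u \<bullet> (free_path (fst q) T, sqrt (grid_variance x K m (free_path (fst q))) *\<^sub>R snd q)))"
      by (rule integrable_iexp_real[OF prob_space_full borel_measurable_inner[OF borel_measurable_const rm]])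
    from BE.integral_fst'[OF this] show ?thesis by (simp only: fst_conv snd_conv)
  qed
  finally show "(\<integral>\<omega>. iexp (u \<bullet> (b T \<omega>, grid_ito_sum x K m \<omega>)) \<partial>M)
     = (\<integral>q. iexp (u \<bullet> (free_path (fst q) T, sqrt (grid_variance x K m (free_path (fst q))) *\<^sub>R snd q)) \<partial>full_space)" .
qed

text \<open>Both sides are limits of the same numbers: on one side the grid sums converge almost
  surely to the Ito integral, on the other the grid variances converge to \<open>grushin_v\<close>
  for every path. Boundedness of \<open>f\<close> takes both limits through the integral.\<close>

theorem diffusion_end_law:
  fixes f :: "(real ^ 'd) \<times> (real ^ 'e) \<Rightarrow> real"
  assumes Z: "grushin_diffusion \<gamma> M b bh x y Z"
    and fc: "continuous_on UNIV f" and fb: "bounded (range f)"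
  shows "(\<integral>\<omega>. f (Z T \<omega>) \<partial>M) = (\<integral>q. f (end_law \<gamma> T x y q) \<partial>full_space)"
proof -
  obtain C where C: "\<And>z. \<bar>f z\<bar> \<le> C" using fb by (auto simp: bounded_iff)
  have fm: "f \<in> borel_measurable borel" using fc by (rule borel_measurable_continuous_onI)
  define I where "I = ito_integral M (joint_filt M b bh) bh (\<lambda>s \<omega>. norm (x + b s \<omega>) powr \<gamma>) T"
  have Zm: "Z T \<in> borel_measurable M" and ZI: "AE \<omega> in M. Z T \<omega> = (x + b T \<omega>, y + I \<omega>)"
    using Z T unfolding grushin_diffusion_def I_def by auto
  obtain K m where K: "\<And>i. K i \<ge> (i::nat)" and m: "\<And>i. m i > (i::nat)"
    and S: "AE \<omega> in M. (\<lambda>i. grid_ito_sum x (K i) (m i) \<omega>) \<longlonglongrightarrow> I \<omega>"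
    by (rule ito_integral_approximation[OF b bh ind \<gamma> T, of x]) (rule that, simp_all only: grid_ito_sum_def I_def)
  have m0: "m i > 0" for i using m[of i] by simp
  have mlim: "filterlim m at_top sequentially"
    by (rule filterlim_at_top_mono[OF filterlim_ident]) (use m in \<open>auto intro: less_imp_le always_eventually\<close>)
  have Klim: "filterlim (\<lambda>i. real (K i)) at_top sequentially"
    by (rule filterlim_compose[OF filterlim_real_sequentially], rule filterlim_at_top_mono[OF filterlim_ident]) (use K in auto)
  \<comment> \<open>The starting point is moved into the test function, since
    \<open>approximate_law\<close> concerns \<open>b T\<close> and the sums alone.\<close>
  define g where "g p = f (x + fst p, y + snd p)" for p
  have gc: "continuous_on UNIV g" unfolding g_def
    by (rule continuous_on_compose2[OF fc]) (auto intro!: continuous_intros)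
  have gm: "g \<in> borel_measurable borel" using gc by (rule borel_measurable_continuous_onI)
  have gC: "\<bar>g z\<bar> \<le> C" for z using C by (simp add: g_def)
  have Sm: "(\<lambda>\<omega>. (b T \<omega>, grid_ito_sum x (K i) (m i) \<omega>)) \<in> borel_measurable M" for i
  proof -
    have hm: "(\<lambda>\<omega>. min (norm (x + b t \<omega>) powr \<gamma>) (real (K i))) \<in> borel_measurable M" if "0 \<le> t" for t
      by (rule measurable_compose[OF bm_measurable[OF b that], where g="\<lambda>z. min (norm (x + z) powr \<gamma>) (real (K i))"]) measurable
    show ?thesis unfolding grid_ito_sum_def using T
      by (intro borel_measurable_Pair borel_measurable_sum borel_measurable_scaleR hm borel_measurable_diff bm_measurable[OF b] bm_measurable[OF bh]) auto
  qed
  have Vm: "(\<lambda>q. sqrt (grid_variance x (K i) (m i) (free_path q))) \<in> borel_measurable (base \<mu>)" for i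
    by (rule measurable_compose[OF grid_variance_measurable[OF m0 free_path_measurable] borel_measurable_sqrt])
  have bT: "(\<lambda>q. free_path q T) \<in> borel_measurable (base \<mu>)" using T by (intro free_path_measurable) auto
  have Rm: "(\<lambda>q. (free_path (fst q) T, sqrt (grid_variance x (K i) (m i) (free_path (fst q))) *\<^sub>R snd q)) \<in> borel_measurable full_space" for i
    by (intro borel_measurable_Pair borel_measurable_scaleR measurable_compose[OF measurable_fst bT] measurable_compose[OF measurable_fst Vm]) measurable
  have eq: "(\<integral>\<omega>. g (b T \<omega>, grid_ito_sum x (K i) (m i) \<omega>) \<partial>M)
     = (\<integral>q. g (free_path (fst q) T, sqrt (grid_variance x (K i) (m i) (free_path (fst q))) *\<^sub>R snd q) \<partial>full_space)" for i
    using integral_distr[OF Sm gm, of i] integral_distr[OF Rm gm, of i] approximate_law[OF m0, of x "K i" i] by simp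
  have l1: "(\<lambda>i. \<integral>\<omega>. g (b T \<omega>, grid_ito_sum x (K i) (m i) \<omega>) \<partial>M) \<longlonglongrightarrow> (\<integral>\<omega>. f (Z T \<omega>) \<partial>M)"
  proof (rule integral_dominated_convergence[where w="\<lambda>_. C"])
    show "(\<lambda>\<omega>. f (Z T \<omega>)) \<in> borel_measurable M" by (rule measurable_compose[OF Zm fm])
    show "(\<lambda>\<omega>. g (b T \<omega>, grid_ito_sum x (K i) (m i) \<omega>)) \<in> borel_measurable M" for i by (rule measurable_compose[OF Sm gm])
    show "AE \<omega> in M. (\<lambda>i. g (b T \<omega>, grid_ito_sum x (K i) (m i) \<omega>)) \<longlonglongrightarrow> f (Z T \<omega>)"
      using S ZI
    proof eventually_elim
      case (elim \<omega>)
      have "(\<lambda>i. (b T \<omega>, grid_ito_sum x (K i) (m i) \<omega>)) \<longlonglongrightarrow> (b T \<omega>, I \<omega>)" by (intro tendsto_intros elim)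
      from continuous_on_tendsto_compose[OF gc this]
      have "(\<lambda>i. g (b T \<omega>, grid_ito_sum x (K i) (m i) \<omega>)) \<longlonglongrightarrow> g (b T \<omega>, I \<omega>)" by simp
      then show ?case using elim by (simp add: g_def)
    qed
  qed (use gC in auto)
  have l2: "(\<lambda>i. \<integral>q. g (free_path (fst q) T, sqrt (grid_variance x (K i) (m i) (free_path (fst q))) *\<^sub>R snd q) \<partial>full_space)
    \<longlonglongrightarrow> (\<integral>q. f (end_law \<gamma> T x y q) \<partial>full_space)"
  proof (rule integral_dominated_convergence[where w="\<lambda>_. C"])
    show "(\<lambda>q. f (end_law \<gamma> T x y q)) \<in> borel_measurable full_space"
      by (rule measurable_compose[OF end_law_measurable[OF \<gamma> T pw] fm])
    show "(\<lambda>q. g (free_path (fst q) T, sqrt (grid_variance x (K i) (m i) (free_path (fst q))) *\<^sub>R snd q)) \<in> borel_measurable full_space" for i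
      by (rule measurable_compose[OF Rm gm])
    show "AE q in full_space. (\<lambda>i. g (free_path (fst q) T, sqrt (grid_variance x (K i) (m i) (free_path (fst q))) *\<^sub>R snd q)) \<longlonglongrightarrow> f (end_law \<gamma> T x y q)"
    proof (rule AE_I2)
      fix q assume "q \<in> space full_space"
      then obtain z w u where q: "q = ((z, w), u)" and w: "w \<in> space \<mu>" by (auto simp: space_pair_measure)
      define h where "h t = norm (x + free_path (z, w) t) powr \<gamma>" for t
      \<comment> \<open>The decisive identity: the free path started at \<open>x\<close> is the
        bridge laid around the line from \<open>x\<close> to the end point
        \<open>x + sqrt T *\<^sub>R z\<close>.\<close>
      have lp: "x + free_path (z, w) t = w t + line_path T x (x + sqrt T *\<^sub>R z) t" for t
        by (simp add: free_path_def line_path_def)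
      have "continuous_on {0..T} (\<lambda>t. w t + line_path T x (x + sqrt T *\<^sub>R z) t)"
        by (intro continuous_intros pinned_path_cont[OF T pw w] line_path_cont[OF T pw])
      from continuous_on_powr'[OF continuous_on_norm[OF this] continuous_on_const[of _ \<gamma>]]
      have hc: "continuous_on {0..T} h" unfolding h_def lp using \<gamma> by auto
      have "(\<lambda>i. grid_variance x (K i) (m i) (free_path (z, w))) \<longlonglongrightarrow> (LBINT s:{0..T}. (h s)\<^sup>2)"
        using grid_square_sum_tendsto[OF T mlim m0 Klim _ hc] unfolding grid_variance_def h_def by simp
      also have "(LBINT s:{0..T}. (h s)\<^sup>2) = grushin_v \<gamma> T x (x + sqrt T *\<^sub>R z) w"
      proof -
        have "(h s)\<^sup>2 = norm (w s + line_path T x (x + sqrt T *\<^sub>R z) s) powr (2 * \<gamma>)" for s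
          unfolding h_def lp power2_eq_square powr_add[symmetric] by simp
        then show ?thesis by (simp add: grushin_v_def)
      qed
      finally have "(\<lambda>i. (free_path (z, w) T, sqrt (grid_variance x (K i) (m i) (free_path (z, w))) *\<^sub>R u))
         \<longlonglongrightarrow> (free_path (z, w) T, sqrt (grushin_v \<gamma> T x (x + sqrt T *\<^sub>R z) w) *\<^sub>R u)"
        by (intro tendsto_intros)
      from continuous_on_tendsto_compose[OF gc this]
      have "(\<lambda>i. g (free_path (z, w) T, sqrt (grid_variance x (K i) (m i) (free_path (z, w))) *\<^sub>R u))
        \<longlonglongrightarrow> g (free_path (z, w) T, sqrt (grushin_v \<gamma> T x (x + sqrt T *\<^sub>R z) w) *\<^sub>R u)" by simp
      moreover have "free_path (z, w) T = sqrt T *\<^sub>R z"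
        using T pinned_path_T[OF T pw w] by (simp add: free_path_def)
      ultimately show "(\<lambda>i. g (free_path (fst q) T, sqrt (grid_variance x (K i) (m i) (free_path (fst q))) *\<^sub>R snd q)) \<longlonglongrightarrow> f (end_law \<gamma> T x y q)"
        by (simp add: q g_def end_law_def)
    qed
  qed (use gC in auto)
  show ?thesis using LIMSEQ_unique[OF l1[unfolded eq] l2] .
qed

theorem transition_density_grushin:
  assumes Z: "\<And>x y. grushin_diffusion \<gamma> M b bh x y (Z (x, y))"
  shows "transition_density M Z T (grushin_density \<gamma> T \<mu>)"
  unfolding transition_density_def
proof (intro conjI allI impI)
  fix z :: "(real ^ 'd) \<times> (real ^ 'e)"
  obtain x y where z: "z = (x, y)" by (cases z)
  have law: "distr full_space borel (end_law \<gamma> T x y) = density lborel (\<lambda>\<zeta>. ennreal (grushin_density \<gamma> T \<mu> z \<zeta>))"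
    unfolding z by (rule end_law_density[OF \<gamma> T pw])
  have em: "end_law \<gamma> T x y \<in> borel_measurable full_space" by (rule end_law_measurable[OF \<gamma> T pw])
  have p0: "0 \<le> grushin_density \<gamma> T \<mu> z \<zeta>" for \<zeta> :: "(real ^ 'd) \<times> (real ^ 'e)"
    using grushin_density_eq[OF \<gamma> T pw, of "(z, \<zeta>)"] T
    by (auto simp: gauss_factor_def intro!: mult_nonneg_nonneg Bochner_Integration.integral_nonneg)
  have pc: "continuous_on UNIV (\<lambda>\<zeta> :: (real ^ 'd) \<times> (real ^ 'e). grushin_density \<gamma> T \<mu> z \<zeta>)"
    using continuous_on_compose2[OF grushin_density_continuous[OF \<gamma> T pw], of UNIV "\<lambda>\<zeta>. (z, \<zeta>)"]
    by (simp add: continuous_on_Pair continuous_on_const continuous_on_id)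
  then have pm: "(\<lambda>\<zeta> :: (real ^ 'd) \<times> (real ^ 'e). grushin_density \<gamma> T \<mu> z \<zeta>) \<in> borel_measurable borel"
    by (rule borel_measurable_continuous_onI)
  show "integrable lborel (grushin_density \<gamma> T \<mu> z :: (real ^ 'd) \<times> (real ^ 'e) \<Rightarrow> real)"
  proof (rule integrableI_bounded)
    \<comment> \<open>Integrability comes from the law itself: the density belongs to a probability
      measure, so its integral is 1.\<close>
    have "prob_space (density lborel (\<lambda>\<zeta> :: (real ^ 'd) \<times> (real ^ 'e). ennreal (grushin_density \<gamma> T \<mu> z \<zeta>)))"
      unfolding law[symmetric] by (rule prob_space.prob_space_distr[OF prob_space_full em])
    from prob_space.emeasure_space_1[OF this]
    have "(\<integral>\<^sup>+\<zeta>. ennreal (grushin_density \<gamma> T \<mu> z (\<zeta> :: (real ^ 'd) \<times> (real ^ 'e))) \<partial>lborel) = 1"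
      using pm by (simp add: emeasure_density)
    then show "(\<integral>\<^sup>+\<zeta>. ennreal (norm (grushin_density \<gamma> T \<mu> z (\<zeta> :: (real ^ 'd) \<times> (real ^ 'e)))) \<partial>lborel) < \<infinity>"
      using p0 by simp
  qed (use pm in simp)
  fix f :: "(real ^ 'd) \<times> (real ^ 'e) \<Rightarrow> real"
  assume f: "continuous_on UNIV f \<and> bounded (range f)"
  then have fm: "f \<in> borel_measurable borel" by (intro borel_measurable_continuous_onI) simp
  have "(\<integral>\<omega>. f (Z z T \<omega>) \<partial>M) = (\<integral>q. f (end_law \<gamma> T x y q) \<partial>full_space)"
    unfolding z using f by (intro diffusion_end_law Z) auto
  also have "\<dots> = (\<integral>\<zeta>. f \<zeta> \<partial>distr full_space borel (end_law \<gamma> T x y))" by (rule integral_distr[OF em fm, symmetric])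
  also have "\<dots> = (\<integral>\<zeta>. f \<zeta> * grushin_density \<gamma> T \<mu> z \<zeta> \<partial>lborel)"
    unfolding law using fm pm p0 by (subst integral_density) (auto simp: mult.commute)
  finally show "(\<integral>\<omega>. f (Z z T \<omega>) \<partial>M) = (\<integral>\<zeta>. f \<zeta> * grushin_density \<gamma> T \<mu> z \<zeta> \<partial>lborel)" .
qed

end

theorem theorem3p1:
  fixes \<gamma> T :: real and \<mu> :: "(real \<Rightarrow> real ^ 'd) measure"
  assumes "\<gamma> > 0" and "T > 0"
    and "pinned_wiener_measure T \<mu>"
  shows
    "(\<forall>x \<xi> :: real ^ 'd.
        (AE w in \<mu>. grushin_v \<gamma> T x \<xi> w > 0) \<and>
        (\<lambda>w. inverse (grushin_v \<gamma> T x \<xi> w)) \<in> L_infty_minus \<mu>) \<and>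
     (\<forall>(M :: 'w measure) (b :: real \<Rightarrow> 'w \<Rightarrow> real ^ 'd) (bh :: real \<Rightarrow> 'w \<Rightarrow> real ^ 'e) Z.
        brownian_motion M b \<and> brownian_motion M bh \<and> indep_processes M b bh \<and>
        (\<forall>x y. grushin_diffusion \<gamma> M b bh x y (Z (x, y))) \<longrightarrow>
        transition_density M Z T (grushin_density \<gamma> T \<mu>)) \<and>
     continuous_on UNIV
       (\<lambda>(z, \<zeta>). grushin_density \<gamma> T \<mu> z (\<zeta> :: (real ^ 'd) \<times> (real ^ 'e)))"
proof (intro conjI allI impI)
  note a = assms
  show "AE w in \<mu>. grushin_v \<gamma> T x \<xi> w > 0" for x \<xi> by (rule grushin_v_pos[OF a(2,3,1)])
  show "(\<lambda>w. inverse (grushin_v \<gamma> T x \<xi> w)) \<in> L_infty_minus \<mu>" for x \<xi> by (rule inverse_grushin_v_L_infty_minus[OF a])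
  show "transition_density M Z T (grushin_density \<gamma> T \<mu>)"
    if "brownian_motion M b \<and> brownian_motion M bh \<and> indep_processes M b bh \<and>
        (\<forall>x y. grushin_diffusion \<gamma> M b bh x y (Z (x, y)))"
    for M :: "'w measure" and b :: "real \<Rightarrow> 'w \<Rightarrow> real ^ 'd" and bh :: "real \<Rightarrow> 'w \<Rightarrow> real ^ 'e" and Z
    using that by (intro transition_density_grushin[OF a]) auto
  show "continuous_on UNIV (\<lambda>(z, \<zeta>). grushin_density \<gamma> T \<mu> z (\<zeta> :: (real ^ 'd) \<times> (real ^ 'e)))"
    by (rule grushin_density_continuous[OF a])
qed

end
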